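(* Let $B=A[[t;\sigma,\delta]]$ be a skew power series ring over a noetherian pseudocompact ring $A$, and let $I$ be an open two-sided ideal of $A$ which is stable under $\sigma$ and $\delta$ and contained in the Jacobson radical of $A$. Let $S$ be the set of elements $b\in B$ such that the complex $B\xrightarrow{\cdot b}B$ is perfect as a complex of $A$-modules. Then $S$ is a left denominator set in $B$, and $\mathbf{SP}^A(B)$ is precisely the subcategory of those complexes in $\mathbf{SP}(B)$ whose cohomology modules are $S$-torsion.
   Context: Rings are associative with identity; $R^{\mathrm{op}}$ is the opposite ring; modules are left unitary. Let $A$ be a topological ring. A topological $A$-module is pro-discrete if it is the limit of a filtered (inverse) system of discrete $A$-modules, and pseudocompact if these discrete modules can moreover be taken of finite length. A topological $A$-$B$-bimodule is pseudocompact if it is pseudocompact both as $A$-module and as $B^{\mathrm{op}}$-module. A topological ring $A$ is left pseudocompact if it is pseudocompact as a left $A$-module, and pseudocompact if it is pseudocompact as an $A$-$A$-bimodule. Skew power series rings. Let $A$ be a pseudocompact ring with a continuous ring automorphism $\sigma$ and a topologically nilpotent $\sigma$-derivation $\delta$, i.e. a continuous map $\delta\colon A\to A$ with $\delta(ab)=\sigma(a)\delta(b)+\delta(a)b$ for all $a,b\in A$ and such that for each open ideal $I$ of $A$ there is a positive integer $n$ with $\delta^n(A)\subset I$. A (left) skew power series ring $B=A[[t;\sigma,\delta]]$ over $A$ is a left pseudocompact ring $B$ with an element $t\in B$ such that: (i) $B$ contains $A$ as a closed subring; (ii) $B$ is pseudocompact as $A^{\mathrm{op}}$-module; (iii) as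 topological $A$-module, $B$ is topologically freely generated by the powers of $t$: $B=\prod_{n=0}^\infty At^n$; (iv) $ta=\sigma(a)t+\delta(a)$ for all $a\in A$. A complex of $R$-modules is strictly perfect if all its terms are finitely generated projective and almost all are zero; it is perfect if it is quasi-isomorphic to a strictly perfect complex. $\mathbf{SP}(B)$ is the category of strictly perfect complexes of $B$-modules, and $\mathbf{SP}^A(B)$ is the subcategory of those complexes in $\mathbf{SP}(B)$ which are perfect as complexes of $A$-modules. A subset $S$ of a ring $B$ is a left denominator set if (1) $S$ is multiplicatively closed; (2) (Ore condition) for each $s\in S$, $b\in B$ there exist $s'\in S$, $b'\in B$ with $b's=s'b$; (3) (annihilator condition) for each $s\in S$, $b\in B$ with $bs=0$ there exists $s'\in S$ with $s'b=0$. For a left denominator set $S$ with left quotient ring $B_S$, a $B$-module $M$ is $S$-torsion if each element of $M$ is annihilated by some element of $S$, equivalently $B_S\otimes_B M=0$. *)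

theory Defs
  imports "HOL-Analysis.Analysis" "HOL-Algebra.QuotRing" "HOL-Algebra.Module"
begin

section \<open>Modules over noncommutative rings\<close>

text \<open>The locale \<^locale>\<open>module\<close> of HOL-Algebra requires a commutative base ring. We keep its record
  type and its axioms, but allow an arbitrary ring. The fields \<open>mult\<close> and \<open>one\<close> of the module record
  play no role. Since only elements of the carrier of the base ring act, restriction of scalars
  along an inclusion of rings does not change the record.\<close>

locale left_module = R?: ring R + M?: abelian_group M
  for R :: "('a, 'r) ring_scheme" (structure) and M :: "('a, 'm) module" (structure) +
  assumes smult_closed:
      "\<lbrakk>a \<in> carrier R; x \<in> carrier M\<rbrakk> \<Longrightarrow> a \<odot>\<^bsub>M\<^esub> x \<in> carrier M"
    and smult_l_distr:
      "\<lbrakk>a \<in> carrier R; b \<in> carrier R; x \<in> carrier M\<rbrakk> \<Longrightarrow>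
       (a \<oplus>\<^bsub>R\<^esub> b) \<odot>\<^bsub>M\<^esub> x = a \<odot>\<^bsub>M\<^esub> x \<oplus>\<^bsub>M\<^esub> b \<odot>\<^bsub>M\<^esub> x"
    and smult_r_distr:
      "\<lbrakk>a \<in> carrier R; x \<in> carrier M; y \<in> carrier M\<rbrakk> \<Longrightarrow>
       a \<odot>\<^bsub>M\<^esub> (x \<oplus>\<^bsub>M\<^esub> y) = a \<odot>\<^bsub>M\<^esub> x \<oplus>\<^bsub>M\<^esub> a \<odot>\<^bsub>M\<^esub> y"
    and smult_assoc1:
      "\<lbrakk>a \<in> carrier R; b \<in> carrier R; x \<in> carrier M\<rbrakk> \<Longrightarrow>
       (a \<otimes>\<^bsub>R\<^esub> b) \<odot>\<^bsub>M\<^esub> x = a \<odot>\<^bsub>M\<^esub> (b \<odot>\<^bsub>M\<^esub> x)"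
    and smult_one:
      "x \<in> carrier M \<Longrightarrow> \<one>\<^bsub>R\<^esub> \<odot>\<^bsub>M\<^esub> x = x"

definition left_module_hom ::
  "('a, 'r) ring_scheme \<Rightarrow> ('a, 'm) module \<Rightarrow> ('a, 'n) module \<Rightarrow> ('m \<Rightarrow> 'n) set" where
  "left_module_hom R M N =
    {h. h \<in> carrier M \<rightarrow> carrier N \<and>
        (\<forall>x \<in> carrier M. \<forall>y \<in> carrier M. h (x \<oplus>\<^bsub>M\<^esub> y) = h x \<oplus>\<^bsub>N\<^esub> h y) \<and>
        (\<forall>a \<in> carrier R. \<forall>x \<in> carrier M. h (a \<odot>\<^bsub>M\<^esub> x) = a \<odot>\<^bsub>N\<^esub> h x)}"

definition left_module_iso ::
  "('a, 'r) ring_scheme \<Rightarrow> ('a, 'm) module \<Rightarrow> ('a, 'n) module \<Rightarrow> ('m \<Rightarrow> 'n) set" where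
  "left_module_iso R M N =
    {h \<in> left_module_hom R M N. bij_betw h (carrier M) (carrier N)}"

definition opposite_ring :: "('a, 'r) ring_scheme \<Rightarrow> 'a ring" where
  "opposite_ring R =
    \<lparr>carrier = carrier R, monoid.mult = (\<lambda>x y. y \<otimes>\<^bsub>R\<^esub> x), one = \<one>\<^bsub>R\<^esub>,
     ring.zero = \<zero>\<^bsub>R\<^esub>, ring.add = (\<lambda>x y. x \<oplus>\<^bsub>R\<^esub> y)\<rparr>"

text \<open>The ring as a left module over itself, hence also over each of its subrings. A right module
  is a left module over \<^const>\<open>opposite_ring\<close>; in particular \<open>regular_module (opposite_ring B)\<close> is
  \<open>B\<close> as a right module.\<close>

definition regular_module :: "('a, 'r) ring_scheme \<Rightarrow> ('a, 'a) module" where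
  "regular_module R =
    \<lparr>carrier = carrier R, monoid.mult = (\<lambda>x y. x \<otimes>\<^bsub>R\<^esub> y), one = \<one>\<^bsub>R\<^esub>,
     ring.zero = \<zero>\<^bsub>R\<^esub>, ring.add = (\<lambda>x y. x \<oplus>\<^bsub>R\<^esub> y), smult = (\<lambda>x y. x \<otimes>\<^bsub>R\<^esub> y)\<rparr>"

definition product_module :: "'i set \<Rightarrow> ('i \<Rightarrow> ('a, 'm) module) \<Rightarrow> ('a, 'i \<Rightarrow> 'm) module" where
  "product_module I M =
    \<lparr>carrier = (\<Pi>\<^sub>E i\<in>I. carrier (M i)), monoid.mult = (\<lambda>_ _. undefined), one = undefined,
     ring.zero = (\<lambda>i\<in>I. \<zero>\<^bsub>M i\<^esub>), ring.add = (\<lambda>x y. \<lambda>i\<in>I. x i \<oplus>\<^bsub>M i\<^esub> y i),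
     smult = (\<lambda>a x. \<lambda>i\<in>I. a \<odot>\<^bsub>M i\<^esub> x i)\<rparr>"

definition quotient_module :: "('a, 'm) module \<Rightarrow> 'm set \<Rightarrow> ('a, 'm set) module" where
  "quotient_module M N =
    \<lparr>carrier = a_rcosets\<^bsub>M\<^esub> N, monoid.mult = (\<lambda>_ _. undefined), one = undefined,
     ring.zero = N, ring.add = (\<lambda>U V. U <+>\<^bsub>M\<^esub> V),
     smult = (\<lambda>a U. N <+>\<^bsub>M\<^esub> ((\<lambda>x. a \<odot>\<^bsub>M\<^esub> x) ` U))\<rparr>"

definition finite_length :: "('a, 'r) ring_scheme \<Rightarrow> ('a, 'm) module \<Rightarrow> bool" where
  "finite_length R M \<longleftrightarrow>
    (\<exists>(n::nat) N. N 0 = {\<zero>\<^bsub>M\<^esub>} \<and> N n = carrier M \<and> (\<forall>i\<le>n. submodule (N i) R M) \<and>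
       (\<forall>i<n. N i \<subset> N (Suc i) \<and>
          \<not> (\<exists>L. submodule L R M \<and> N i \<subset> L \<and> L \<subset> N (Suc i))))"

definition noetherian_module :: "('a, 'r) ring_scheme \<Rightarrow> ('a, 'm) module \<Rightarrow> bool" where
  "noetherian_module R M \<longleftrightarrow>
    (\<forall>N :: nat \<Rightarrow> 'm set. (\<forall>i. submodule (N i) R M) \<and> (\<forall>i. N i \<subseteq> N (Suc i)) \<longrightarrow>
       (\<exists>k. \<forall>i\<ge>k. N i = N k))"

text \<open>Noetherian means left and right noetherian.\<close>

definition two_sided_noetherian :: "('a, 'r) ring_scheme \<Rightarrow> bool" where
  "two_sided_noetherian R \<longleftrightarrow>
    noetherian_module R (regular_module R) \<and>
    noetherian_module (opposite_ring R) (regular_module (opposite_ring R))"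

definition maximal_left_ideal :: "('a, 'r) ring_scheme \<Rightarrow> 'a set \<Rightarrow> bool" where
  "maximal_left_ideal R J \<longleftrightarrow>
    submodule J R (regular_module R) \<and> J \<noteq> carrier R \<and>
    (\<forall>L. submodule L R (regular_module R) \<and> J \<subseteq> L \<longrightarrow> L = J \<or> L = carrier R)"

definition jacobson_radical :: "('a, 'r) ring_scheme \<Rightarrow> 'a set" where
  "jacobson_radical R = {x \<in> carrier R. \<forall>J. maximal_left_ideal R J \<longrightarrow> x \<in> J}"

definition finitely_generated :: "('a, 'r) ring_scheme \<Rightarrow> ('a, 'm) module \<Rightarrow> bool" where
  "finitely_generated R M \<longleftrightarrow>
    (\<exists>F. finite F \<and> F \<subseteq> carrier M \<and>
       (\<forall>N. submodule N R M \<and> F \<subseteq> N \<longrightarrow> N = carrier M))"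

text \<open>The lifting property. A definition cannot quantify over types, so the test modules have
  carriers in fixed types. These are large enough: the condition covers the lifting of the identity
  of \<open>P\<close> along the canonical surjection onto \<open>P\<close> from the free module on the set \<open>carrier P\<close>, which
  lives on the type \<open>'m \<Rightarrow> 'a\<close>. Hence it makes \<open>P\<close> a direct summand of a free module.\<close>

definition projective :: "('a, 'r) ring_scheme \<Rightarrow> ('a, 'm) module \<Rightarrow> bool" where
  "projective R P \<longleftrightarrow> left_module R P \<and>
    (\<forall>(M :: ('a, 'm \<Rightarrow> 'a) module) (N :: ('a, 'm) module) g h.
       left_module R M \<and> left_module R N \<and>
       g \<in> left_module_hom R M N \<and> g ` carrier M = carrier N \<and> h \<in> left_module_hom R P N \<longrightarrow>
       (\<exists>l \<in> left_module_hom R P M. \<forall>x \<in> carrier P. g (l x) = h x))"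


section \<open>Pseudocompact rings and modules\<close>

definition topological_ring :: "('a, 'r) ring_scheme \<Rightarrow> 'a topology \<Rightarrow> bool" where
  "topological_ring R T \<longleftrightarrow> ring R \<and> topspace T = carrier R \<and>
    continuous_map (prod_topology T T) T (\<lambda>(x, y). x \<oplus>\<^bsub>R\<^esub> y) \<and>
    continuous_map T T (\<lambda>x. \<ominus>\<^bsub>R\<^esub> x) \<and>
    continuous_map (prod_topology T T) T (\<lambda>(x, y). x \<otimes>\<^bsub>R\<^esub> y)"

definition topological_module ::
  "('a, 'r) ring_scheme \<Rightarrow> 'a topology \<Rightarrow> ('a, 'm) module \<Rightarrow> 'm topology \<Rightarrow> bool" where
  "topological_module R TR M TM \<longleftrightarrow> topological_ring R TR \<and> left_module R M \<and>
    topspace TM = carrier M \<and>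
    continuous_map (prod_topology TM TM) TM (\<lambda>(x, y). x \<oplus>\<^bsub>M\<^esub> y) \<and>
    continuous_map TM TM (\<lambda>x. \<ominus>\<^bsub>M\<^esub> x) \<and>
    continuous_map (prod_topology TR TM) TM (\<lambda>(a, x). a \<odot>\<^bsub>M\<^esub> x)"

definition topological_module_iso ::
  "('a, 'r) ring_scheme \<Rightarrow> ('a, 'm) module \<Rightarrow> 'm topology \<Rightarrow> ('a, 'n) module \<Rightarrow> 'n topology
    \<Rightarrow> ('m \<Rightarrow> 'n) set" where
  "topological_module_iso R M TM N TN =
    {h \<in> left_module_iso R M N. homeomorphic_map TM TN h}"

definition directed_set :: "'i set \<Rightarrow> ('i \<Rightarrow> 'i \<Rightarrow> bool) \<Rightarrow> bool" where
  "directed_set I leq \<longleftrightarrow> I \<noteq> {} \<and> (\<forall>i\<in>I. leq i i) \<and>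
    (\<forall>i\<in>I. \<forall>j\<in>I. \<forall>k\<in>I. leq i j \<and> leq j k \<longrightarrow> leq i k) \<and>
    (\<forall>i\<in>I. \<forall>j\<in>I. \<exists>k\<in>I. leq i k \<and> leq j k)"

definition inverse_system ::
  "('a, 'r) ring_scheme \<Rightarrow> 'i set \<Rightarrow> ('i \<Rightarrow> 'i \<Rightarrow> bool) \<Rightarrow> ('i \<Rightarrow> ('a, 'm) module)
    \<Rightarrow> ('i \<Rightarrow> 'i \<Rightarrow> 'm \<Rightarrow> 'm) \<Rightarrow> bool" where
  "inverse_system R I leq M f \<longleftrightarrow> directed_set I leq \<and> (\<forall>i\<in>I. left_module R (M i)) \<and>
    (\<forall>i\<in>I. \<forall>j\<in>I. leq i j \<longrightarrow> f i j \<in> left_module_hom R (M j) (M i)) \<and>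
    (\<forall>i\<in>I. \<forall>x \<in> carrier (M i). f i i x = x) \<and>
    (\<forall>i\<in>I. \<forall>j\<in>I. \<forall>k\<in>I. leq i j \<and> leq j k \<longrightarrow>
       (\<forall>x \<in> carrier (M k). f i j (f j k x) = f i k x))"

definition inverse_limit ::
  "'i set \<Rightarrow> ('i \<Rightarrow> 'i \<Rightarrow> bool) \<Rightarrow> ('i \<Rightarrow> ('a, 'm) module) \<Rightarrow> ('i \<Rightarrow> 'i \<Rightarrow> 'm \<Rightarrow> 'm)
    \<Rightarrow> ('a, 'i \<Rightarrow> 'm) module" where
  "inverse_limit I leq M f =
    (product_module I M)\<lparr>carrier :=
       {x \<in> carrier (product_module I M). \<forall>i\<in>I. \<forall>j\<in>I. leq i j \<longrightarrow> f i j (x j) = x i}\<rparr>"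

definition limit_topology_of_discrete ::
  "'i set \<Rightarrow> ('i \<Rightarrow> 'i \<Rightarrow> bool) \<Rightarrow> ('i \<Rightarrow> ('a, 'm) module) \<Rightarrow> ('i \<Rightarrow> 'i \<Rightarrow> 'm \<Rightarrow> 'm)
    \<Rightarrow> ('i \<Rightarrow> 'm) topology" where
  "limit_topology_of_discrete I leq M f =
    subtopology (product_topology (\<lambda>i. discrete_topology (carrier (M i))) I)
      (carrier (inverse_limit I leq M f))"

text \<open>Limits of filtered systems of discrete modules of finite length. As definitions cannot
  quantify over types, indices and elements of the members of the system are subsets of the
  module. This is no restriction: if \<open>M\<close> is the limit of any such system, it is also the limit of the
  quotients of \<open>M\<close> by the kernels of the projections to the members of that system, indexed by
  these kernels.\<close>

definition pseudocompact_module ::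
  "('a, 'r) ring_scheme \<Rightarrow> 'a topology \<Rightarrow> ('a, 'm) module \<Rightarrow> 'm topology \<Rightarrow> bool" where
  "pseudocompact_module R TR M TM \<longleftrightarrow> topological_module R TR M TM \<and>
    (\<exists>(I :: 'm set set) leq (D :: 'm set \<Rightarrow> ('a, 'm set) module) f \<phi>.
       inverse_system R I leq D f \<and>
       (\<forall>i\<in>I. topological_module R TR (D i) (discrete_topology (carrier (D i))) \<and>
              finite_length R (D i)) \<and>
       \<phi> \<in> topological_module_iso R M TM
             (inverse_limit I leq D f) (limit_topology_of_discrete I leq D f))"

definition left_pseudocompact_ring :: "('a, 'r) ring_scheme \<Rightarrow> 'a topology \<Rightarrow> bool" where
  "left_pseudocompact_ring R T \<longleftrightarrow>
    topological_ring R T \<and> pseudocompact_module R T (regular_module R) T"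

definition pseudocompact_ring :: "('a, 'r) ring_scheme \<Rightarrow> 'a topology \<Rightarrow> bool" where
  "pseudocompact_ring R T \<longleftrightarrow> left_pseudocompact_ring R T \<and>
    pseudocompact_module (opposite_ring R) T (regular_module (opposite_ring R)) T"


section \<open>Skew power series rings\<close>

definition continuous_automorphism ::
  "('a, 'r) ring_scheme \<Rightarrow> 'a topology \<Rightarrow> ('a \<Rightarrow> 'a) \<Rightarrow> bool" where
  "continuous_automorphism A T \<sigma> \<longleftrightarrow> \<sigma> \<in> ring_iso A A \<and> continuous_map T T \<sigma>"

definition continuous_skew_derivation ::
  "('a, 'r) ring_scheme \<Rightarrow> 'a topology \<Rightarrow> ('a \<Rightarrow> 'a) \<Rightarrow> ('a \<Rightarrow> 'a) \<Rightarrow> bool" where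
  "continuous_skew_derivation A T \<sigma> \<delta> \<longleftrightarrow> continuous_map T T \<delta> \<and>
    (\<forall>a \<in> carrier A. \<forall>b \<in> carrier A. \<delta> (a \<oplus>\<^bsub>A\<^esub> b) = \<delta> a \<oplus>\<^bsub>A\<^esub> \<delta> b) \<and>
    (\<forall>a \<in> carrier A. \<forall>b \<in> carrier A.
       \<delta> (a \<otimes>\<^bsub>A\<^esub> b) = \<sigma> a \<otimes>\<^bsub>A\<^esub> \<delta> b \<oplus>\<^bsub>A\<^esub> \<delta> a \<otimes>\<^bsub>A\<^esub> b)"

definition topologically_nilpotent ::
  "('a, 'r) ring_scheme \<Rightarrow> 'a topology \<Rightarrow> ('a \<Rightarrow> 'a) \<Rightarrow> bool" where
  "topologically_nilpotent A T \<delta> \<longleftrightarrow>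
    (\<forall>I. ideal I A \<and> openin T I \<longrightarrow> (\<exists>n::nat. n > 0 \<and> (\<delta> ^^ n) ` carrier A \<subseteq> I))"

text \<open>The map \<open>\<phi>\<close> below is the isomorphism of topological left \<open>A\<close>-modules from the product of
  countably many copies of \<open>A\<close> onto \<open>B\<close> that sends the \<open>n\<close>-th unit vector to \<open>t\<^sup>n\<close>; by continuity it
  maps \<open>a\<close> to the convergent series of the \<open>a\<^sub>n t\<^sup>n\<close>.\<close>

definition skew_power_series_ring ::
  "('a, 'r) ring_scheme \<Rightarrow> 'a topology \<Rightarrow> ('a \<Rightarrow> 'a) \<Rightarrow> ('a \<Rightarrow> 'a)
    \<Rightarrow> ('a, 's) ring_scheme \<Rightarrow> 'a topology \<Rightarrow> 'a \<Rightarrow> bool" where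
  "skew_power_series_ring A TA \<sigma> \<delta> B TB t \<longleftrightarrow>
    pseudocompact_ring A TA \<and>
    continuous_automorphism A TA \<sigma> \<and>
    continuous_skew_derivation A TA \<sigma> \<delta> \<and>
    topologically_nilpotent A TA \<delta> \<and>
    left_pseudocompact_ring B TB \<and>
    t \<in> carrier B \<and>
    (carrier A \<subseteq> carrier B \<and> (\<lambda>a. a) \<in> ring_hom A B \<and>
       closedin TB (carrier A) \<and> TA = subtopology TB (carrier A)) \<and>
    pseudocompact_module (opposite_ring A) TA (regular_module (opposite_ring B)) TB \<and>
    (\<exists>\<phi>. \<phi> \<in> topological_module_iso A
               (product_module (UNIV :: nat set) (\<lambda>_. regular_module A))
               (product_topology (\<lambda>_. TA) UNIV)
               (regular_module B) TB \<and>
         (\<forall>n. \<phi> (\<lambda>m. if m = n then \<one>\<^bsub>A\<^esub> else \<zero>\<^bsub>A\<^esub>) = t [^]\<^bsub>B\<^esub> n)) \<and>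
    (\<forall>a \<in> carrier A. t \<otimes>\<^bsub>B\<^esub> a = \<sigma> a \<otimes>\<^bsub>B\<^esub> t \<oplus>\<^bsub>B\<^esub> \<delta> a)"


section \<open>Perfect complexes\<close>

text \<open>Cochain complexes; \<open>diff C n\<close> maps degree \<open>n\<close> to degree \<open>n + 1\<close>.\<close>

record ('a, 'm) cochain =
  obj :: "int \<Rightarrow> ('a, 'm) module"
  diff :: "int \<Rightarrow> 'm \<Rightarrow> 'm"

definition cochain_complex :: "('a, 'r) ring_scheme \<Rightarrow> ('a, 'm) cochain \<Rightarrow> bool" where
  "cochain_complex R C \<longleftrightarrow> (\<forall>n. left_module R (obj C n)) \<and>
    (\<forall>n. diff C n \<in> left_module_hom R (obj C n) (obj C (n + 1))) \<and>
    (\<forall>n. \<forall>x \<in> carrier (obj C n). diff C (n + 1) (diff C n x) = \<zero>\<^bsub>obj C (n + 1 + 1)\<^esub>)"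

definition cocycles :: "('a, 'm) cochain \<Rightarrow> int \<Rightarrow> 'm set" where
  "cocycles C n = {x \<in> carrier (obj C n). diff C n x = \<zero>\<^bsub>obj C (n + 1)\<^esub>}"

definition coboundaries :: "('a, 'm) cochain \<Rightarrow> int \<Rightarrow> 'm set" where
  "coboundaries C n = diff C (n - 1) ` carrier (obj C (n - 1))"

definition cohomology :: "('a, 'm) cochain \<Rightarrow> int \<Rightarrow> ('a, 'm set) module" where
  "cohomology C n = quotient_module ((obj C n)\<lparr>carrier := cocycles C n\<rparr>) (coboundaries C n)"

definition chain_map ::
  "('a, 'r) ring_scheme \<Rightarrow> ('a, 'm) cochain \<Rightarrow> ('a, 'n) cochain \<Rightarrow> (int \<Rightarrow> 'm \<Rightarrow> 'n) \<Rightarrow> bool" where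
  "chain_map R C D f \<longleftrightarrow> (\<forall>n. f n \<in> left_module_hom R (obj C n) (obj D n)) \<and>
    (\<forall>n. \<forall>x \<in> carrier (obj C n). f (n + 1) (diff C n x) = diff D n (f n x))"

definition cohomology_map ::
  "('a, 'n) cochain \<Rightarrow> (int \<Rightarrow> 'm \<Rightarrow> 'n) \<Rightarrow> int \<Rightarrow> 'm set \<Rightarrow> 'n set" where
  "cohomology_map D f n U = coboundaries D n <+>\<^bsub>obj D n\<^esub> (f n ` U)"

definition quasi_isomorphism ::
  "('a, 'r) ring_scheme \<Rightarrow> ('a, 'm) cochain \<Rightarrow> ('a, 'n) cochain \<Rightarrow> (int \<Rightarrow> 'm \<Rightarrow> 'n) \<Rightarrow> bool" where
  "quasi_isomorphism R C D f \<longleftrightarrow> cochain_complex R C \<and> cochain_complex R D \<and> chain_map R C D f \<and>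
    (\<forall>n. cohomology_map D f n \<in> left_module_iso R (cohomology C n) (cohomology D n))"

definition strictly_perfect :: "('a, 'r) ring_scheme \<Rightarrow> ('a, 'm) cochain \<Rightarrow> bool" where
  "strictly_perfect R C \<longleftrightarrow> cochain_complex R C \<and>
    (\<forall>n. finitely_generated R (obj C n) \<and> projective R (obj C n)) \<and>
    finite {n. carrier (obj C n) \<noteq> {\<zero>\<^bsub>obj C n\<^esub>}}"

text \<open>Every isomorphism in the derived category from a strictly perfect complex is represented
  by an actual quasi-isomorphism out of it, so zigzags are not needed. Every finitely generated
  projective module is isomorphic to a submodule of some \<open>R\<^sup>k\<close>, hence to a module with carrier in
  the type \<open>nat \<Rightarrow> 'a\<close>.\<close>

definition perfect :: "('a, 'r) ring_scheme \<Rightarrow> ('a, 'm) cochain \<Rightarrow> bool" where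
  "perfect R C \<longleftrightarrow>
    (\<exists>(P :: ('a, nat \<Rightarrow> 'a) cochain) f. strictly_perfect R P \<and> quasi_isomorphism R P C f)"

text \<open>Both categories of complexes are full subcategories of the category of complexes of
  \<open>B\<close>-modules and are given by their classes of objects. Here \<open>A\<close> is a subring of \<open>B\<close>.\<close>

definition SP :: "('a, 's) ring_scheme \<Rightarrow> ('a, 'm) cochain set" where
  "SP B = {C. strictly_perfect B C}"

definition SP_over :: "('a, 'r) ring_scheme \<Rightarrow> ('a, 's) ring_scheme \<Rightarrow> ('a, 'm) cochain set" where
  "SP_over A B = {C \<in> SP B. perfect A C}"

text \<open>The complex of left modules \<open>B \<rightarrow> B\<close>, \<open>x \<mapsto> x b\<close>, placed in degrees 0 and 1.\<close>

definition right_mult_complex :: "('a, 's) ring_scheme \<Rightarrow> 'a \<Rightarrow> ('a, 'a) cochain" where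
  "right_mult_complex B b =
    \<lparr>obj = (\<lambda>n. if n = 0 \<or> n = 1 then regular_module B
                else (regular_module B)\<lparr>carrier := {\<zero>\<^bsub>B\<^esub>}\<rparr>),
     diff = (\<lambda>n x. if n = 0 then x \<otimes>\<^bsub>B\<^esub> b else \<zero>\<^bsub>B\<^esub>)\<rparr>"

definition perfect_mult_set :: "('a, 'r) ring_scheme \<Rightarrow> ('a, 's) ring_scheme \<Rightarrow> 'a set" where
  "perfect_mult_set A B = {b \<in> carrier B. perfect A (right_mult_complex B b)}"


section \<open>Left denominator sets\<close>

definition left_denominator_set :: "('a, 's) ring_scheme \<Rightarrow> 'a set \<Rightarrow> bool" where
  "left_denominator_set B S \<longleftrightarrow> S \<subseteq> carrier B \<and>
    (\<one>\<^bsub>B\<^esub> \<in> S \<and> (\<forall>s\<in>S. \<forall>s'\<in>S. s \<otimes>\<^bsub>B\<^esub> s' \<in> S)) \<and>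
    (\<forall>s\<in>S. \<forall>b \<in> carrier B. \<exists>s'\<in>S. \<exists>b' \<in> carrier B. b' \<otimes>\<^bsub>B\<^esub> s = s' \<otimes>\<^bsub>B\<^esub> b) \<and>
    (\<forall>s\<in>S. \<forall>b \<in> carrier B. b \<otimes>\<^bsub>B\<^esub> s = \<zero>\<^bsub>B\<^esub> \<longrightarrow> (\<exists>s'\<in>S. s' \<otimes>\<^bsub>B\<^esub> b = \<zero>\<^bsub>B\<^esub>))"

definition torsion_module :: "'a set \<Rightarrow> ('a, 'm) module \<Rightarrow> bool" where
  "torsion_module S M \<longleftrightarrow> (\<forall>x \<in> carrier M. \<exists>s\<in>S. s \<odot>\<^bsub>M\<^esub> x = \<zero>\<^bsub>M\<^esub>)"

end

theory Submission
  imports Defs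
begin

text \<open>Call an element of \<open>B\<close> distinguished if it is congruent to some \<open>t\<^sup>n\<close> modulo the ideal \<open>J\<close> of
  series with coefficients in \<open>I\<close>. The theorem rests on two comparisons: perfectness over \<open>A\<close> with
  finite generation over \<open>A\<close>, and finite generation over \<open>A\<close> with being killed by distinguished
  elements.

  Perfectness. A product of copies of \<open>A\<close> is flat, as \<open>A\<close> is right noetherian; hence so is every
  finitely generated projective \<open>B\<close>-module, being a retract of some \<open>B\<^sup>k\<close> (\<open>flat_over_A\<close>). A bounded
  complex of flat modules with finitely generated cohomology over a left noetherian ring is perfect
  (\<open>perfectI\<close>): a resolution by free modules, built from the top, can be cut off below the complex,
  where its last kernel is flat and finitely generated, hence projective. So a complex in \<open>SP B\<close> is
  perfect over \<open>A\<close> if and only if its cohomology is finitely generated over \<open>A\<close>, and \<open>S\<close> consists of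
  the \<open>b\<close> for which \<open>x \<mapsto> x b\<close> has kernel and cokernel finitely generated over \<open>A\<close> (\<open>mem_S_iff\<close>).

  Distinguished elements. As \<open>I\<close> lies in the Jacobson radical, \<open>A\<close> is complete for the closed powers
  of \<open>I\<close>, and Weierstrass division by a distinguished element \<open>s\<close> is possible: \<open>x \<mapsto> x s\<close> is
  injective, and \<open>B / B s\<close> is generated over \<open>A\<close> by \<open>1, t, \<dots>, t\<^sup>n\<^sup>-\<^sup>1\<close>. So \<open>s\<close> lies in \<open>S\<close>.
  Conversely, every left ideal \<open>L\<close> with \<open>B / L\<close> finitely generated over \<open>A\<close> contains a distinguished
  element (\<open>cofinite_left_ideal_distinguished\<close>). Since \<open>A / I\<close> has finite length, the chain of the
  \<open>B t\<^sup>n + L + J\<close> becomes constant, so \<open>(1 - c t\<^sup>r) t\<^sup>k\<close> lies in \<open>L + J\<close> for some \<open>c\<close>. Here \<open>r\<close> is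
  chosen with \<open>\<delta>\<^sup>r A \<subseteq> I\<close>; then \<open>t\<^sup>r B \<subseteq> B t + J\<close>, which makes the geometric series in \<open>c t\<^sup>r\<close>
  converge modulo \<open>J\<close> and \<open>t\<^sup>k\<close> an element of \<open>L + J\<close>.

  Torsion. It follows that a \<open>B\<close>-module that is finitely generated over \<open>A\<close> is \<open>S\<close>-torsion
  (\<open>torsion_of_fg\<close>). Applied to \<open>B / B s\<close> and to the annihilator of \<open>s\<close>, this gives the two
  conditions on a left denominator set; applied to cohomology, it gives one half of the statement on
  complexes.

  For the other half, a finitely generated \<open>S\<close>-torsion \<open>B\<close>-module is finitely generated over \<open>A\<close>,
  being a quotient of a direct sum of modules \<open>B / B s\<close>. To see that the cocycles of a complex in
  \<open>SP B\<close> with torsion cohomology are finitely generated, one proves by descending induction on the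
  degree that they are pseudo-coherent, that is, have resolutions by finitely generated free
  modules. This uses that submodules \<open>X\<close> of pseudo-coherent modules \<open>M\<close> with \<open>M / X\<close> finitely
  generated over \<open>A\<close> are pseudo-coherent (\<open>cofinite_submodule_pseudo_coherent\<close>), which again comes
  from distinguished elements.\<close>

section \<open>Homomorphisms and submodules\<close>

context left_module
begin

lemma smult_zero_left: "x \<in> carrier M \<Longrightarrow> \<zero> \<odot>\<^bsub>M\<^esub> x = \<zero>\<^bsub>M\<^esub>"
  by (metis M.add.l_cancel_one' R.l_zero R.zero_closed smult_closed smult_l_distr)

lemma smult_zero_right: "a \<in> carrier R \<Longrightarrow> a \<odot>\<^bsub>M\<^esub> \<zero>\<^bsub>M\<^esub> = \<zero>\<^bsub>M\<^esub>"
  by (metis M.add.l_cancel_one' M.l_zero M.zero_closed smult_closed smult_r_distr)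

lemma smult_minus_left:
  assumes "a \<in> carrier R" "x \<in> carrier M"
  shows "(\<ominus> a) \<odot>\<^bsub>M\<^esub> x = \<ominus>\<^bsub>M\<^esub> (a \<odot>\<^bsub>M\<^esub> x)"
proof -
  have "(\<ominus> a) \<odot>\<^bsub>M\<^esub> x \<oplus>\<^bsub>M\<^esub> a \<odot>\<^bsub>M\<^esub> x = \<zero>\<^bsub>M\<^esub>"
    using assms by (simp add: smult_l_distr[symmetric] R.l_neg smult_zero_left)
  then show ?thesis
    using assms M.minus_equality smult_closed R.a_inv_closed by metis
qed

lemma smult_minus_right:
  assumes "a \<in> carrier R" "x \<in> carrier M"
  shows "a \<odot>\<^bsub>M\<^esub> (\<ominus>\<^bsub>M\<^esub> x) = \<ominus>\<^bsub>M\<^esub> (a \<odot>\<^bsub>M\<^esub> x)"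
proof -
  have "a \<odot>\<^bsub>M\<^esub> (\<ominus>\<^bsub>M\<^esub> x) \<oplus>\<^bsub>M\<^esub> a \<odot>\<^bsub>M\<^esub> x = \<zero>\<^bsub>M\<^esub>"
    using assms by (simp add: smult_r_distr[symmetric] M.l_neg smult_zero_right)
  then show ?thesis
    using assms M.minus_equality smult_closed M.a_inv_closed by metis
qed

lemma submoduleI:
  assumes "H \<subseteq> carrier M" "\<zero>\<^bsub>M\<^esub> \<in> H"
    and add: "\<And>x y. x \<in> H \<Longrightarrow> y \<in> H \<Longrightarrow> x \<oplus>\<^bsub>M\<^esub> y \<in> H"
    and smult: "\<And>a x. a \<in> carrier R \<Longrightarrow> x \<in> H \<Longrightarrow> a \<odot>\<^bsub>M\<^esub> x \<in> H"
  shows "submodule H R M"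
proof -
  have "\<ominus>\<^bsub>M\<^esub> x \<in> H" if "x \<in> H" for x
    using smult[OF R.a_inv_closed[OF R.one_closed] that] smult_minus_left[of \<one> x] smult_one that assms(1)
    by auto
  then have "subgroup H (add_monoid M)"
    using assms by (intro M.add.subgroupI) (auto simp: a_inv_def[symmetric])
  then show ?thesis
    using smult by (simp add: submodule_def submodule_axioms_def)
qed

end

lemma submoduleD:
  assumes "submodule N R M"
  shows "N \<subseteq> carrier M" "\<zero>\<^bsub>M\<^esub> \<in> N"
    "\<And>x y. x \<in> N \<Longrightarrow> y \<in> N \<Longrightarrow> x \<oplus>\<^bsub>M\<^esub> y \<in> N"
    "\<And>a x. a \<in> carrier R \<Longrightarrow> x \<in> N \<Longrightarrow> a \<odot>\<^bsub>M\<^esub> x \<in> N"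
    "\<And>x. x \<in> N \<Longrightarrow> \<ominus>\<^bsub>M\<^esub> x \<in> N"
    "\<And>x y. x \<in> N \<Longrightarrow> y \<in> N \<Longrightarrow> x \<ominus>\<^bsub>M\<^esub> y \<in> N"
  using submodule.axioms(1)[OF assms] submodule.smult_closed[OF assms]
    subgroup.subset subgroup.one_closed subgroup.m_closed subgroup.m_inv_closed
  by (fastforce simp: a_inv_def a_minus_def)+

lemma submodule_carrier:
  assumes "left_module R M"
  shows "submodule (carrier M) R M"
proof -
  interpret left_module R M by fact
  show ?thesis by (rule submoduleI) (auto intro: smult_closed)
qed

lemma submodule_zero:
  assumes "left_module R M"
  shows "submodule {\<zero>\<^bsub>M\<^esub>} R M"
proof -
  interpret left_module R M by fact
  show ?thesis by (rule submoduleI) (auto simp: smult_zero_right)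
qed

lemma submodule_left_module:
  assumes "left_module R M" "submodule N R M"
  shows "left_module R (M\<lparr>carrier := N\<rparr>)"
proof -
  interpret left_module R M by fact
  note N = submoduleD[OF assms(2)]
  have "abelian_group (M\<lparr>carrier := N\<rparr>)"
  proof (rule abelian_groupI; simp)
    fix x assume "x \<in> N"
    then show "\<exists>y\<in>N. y \<oplus>\<^bsub>M\<^esub> x = \<zero>\<^bsub>M\<^esub>"
      using N by (intro bexI[of _ "\<ominus>\<^bsub>M\<^esub> x"]) (auto intro: M.l_neg)
  qed (use N in \<open>auto simp: M.a_assoc subset_iff intro: M.a_comm\<close>)
  then show ?thesis
    using N R.ring_axioms
    by (auto simp: left_module_def left_module_axioms_def subset_iff smult_closed smult_l_distr
        smult_r_distr smult_assoc1 smult_one)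
qed

lemma submodule_of_submodule:
  assumes "left_module R M" "submodule N R M" "submodule L R M" "L \<subseteq> N"
  shows "submodule L R (M\<lparr>carrier := N\<rparr>)"
proof -
  interpret left_module R "M\<lparr>carrier := N\<rparr>" using assms submodule_left_module by auto
  show ?thesis
    using submoduleD[OF assms(3)] assms(4) by (intro submoduleI) auto
qed

lemma left_module_homI:
  assumes "\<And>x. x \<in> carrier M \<Longrightarrow> h x \<in> carrier N"
    and "\<And>x y. x \<in> carrier M \<Longrightarrow> y \<in> carrier M \<Longrightarrow> h (x \<oplus>\<^bsub>M\<^esub> y) = h x \<oplus>\<^bsub>N\<^esub> h y"
    and "\<And>a x. a \<in> carrier R \<Longrightarrow> x \<in> carrier M \<Longrightarrow> h (a \<odot>\<^bsub>M\<^esub> x) = a \<odot>\<^bsub>N\<^esub> h x"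
  shows "h \<in> left_module_hom R M N"
  using assms by (auto simp: left_module_hom_def)

lemma hom_closed: "h \<in> left_module_hom R M N \<Longrightarrow> x \<in> carrier M \<Longrightarrow> h x \<in> carrier N"
  and hom_add: "h \<in> left_module_hom R M N \<Longrightarrow> x \<in> carrier M \<Longrightarrow> y \<in> carrier M \<Longrightarrow>
    h (x \<oplus>\<^bsub>M\<^esub> y) = h x \<oplus>\<^bsub>N\<^esub> h y"
  and hom_smult: "h \<in> left_module_hom R M N \<Longrightarrow> a \<in> carrier R \<Longrightarrow> x \<in> carrier M \<Longrightarrow>
    h (a \<odot>\<^bsub>M\<^esub> x) = a \<odot>\<^bsub>N\<^esub> h x"
  by (auto simp: left_module_hom_def)

lemma hom_zero:
  assumes "left_module R M" "left_module R N" "h \<in> left_module_hom R M N"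
  shows "h \<zero>\<^bsub>M\<^esub> = \<zero>\<^bsub>N\<^esub>"
proof -
  interpret M: left_module R M by fact
  interpret N: left_module R N by fact
  show ?thesis
    by (metis M.M.zero_closed M.R.zero_closed M.smult_zero_left N.smult_zero_left assms(3) hom_closed hom_smult)
qed

lemma hom_neg:
  assumes "left_module R M" "left_module R N" "h \<in> left_module_hom R M N" "x \<in> carrier M"
  shows "h (\<ominus>\<^bsub>M\<^esub> x) = \<ominus>\<^bsub>N\<^esub> h x"
proof -
  interpret M: left_module R M by fact
  interpret N: left_module R N by fact
  show ?thesis
    using M.smult_minus_left[of "\<one>\<^bsub>R\<^esub>" x] N.smult_minus_left[of "\<one>\<^bsub>R\<^esub>" "h x"] assms(3,4)
      hom_smult[OF assms(3), of "\<ominus>\<^bsub>R\<^esub> \<one>\<^bsub>R\<^esub>" x] hom_closed[OF assms(3)]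
    by (simp add: M.smult_one N.smult_one)
qed

lemma hom_minus:
  assumes "left_module R M" "left_module R N" "h \<in> left_module_hom R M N"
    "x \<in> carrier M" "y \<in> carrier M"
  shows "h (x \<ominus>\<^bsub>M\<^esub> y) = h x \<ominus>\<^bsub>N\<^esub> h y"
proof -
  interpret M: left_module R M by fact
  show ?thesis
    using assms by (simp add: a_minus_def hom_add hom_neg)
qed

lemma hom_compose:
  assumes "h \<in> left_module_hom R L M" "g \<in> left_module_hom R M N"
  shows "(\<lambda>x. g (h x)) \<in> left_module_hom R L N"
  using assms by (auto simp: left_module_hom_def Pi_iff)

lemma hom_id: "(\<lambda>x. x) \<in> left_module_hom R M M"
  by (auto simp: left_module_hom_def)

lemma hom_sum:
  assumes "left_module R N" "h \<in> left_module_hom R M N" "g \<in> left_module_hom R M N"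
  shows "(\<lambda>x. h x \<oplus>\<^bsub>N\<^esub> g x) \<in> left_module_hom R M N"
proof -
  interpret N: left_module R N by fact
  show ?thesis
    using assms(2,3)
    by (auto simp: left_module_hom_def Pi_iff N.smult_r_distr N.M.a_ac N.smult_closed)
qed

lemma hom_diff:
  assumes "left_module R N" "h \<in> left_module_hom R M N" "g \<in> left_module_hom R M N"
  shows "(\<lambda>x. h x \<ominus>\<^bsub>N\<^esub> g x) \<in> left_module_hom R M N"
proof -
  interpret N: left_module R N by fact
  show ?thesis
    using assms(2,3)
    by (auto simp: left_module_hom_def Pi_iff N.smult_r_distr N.M.a_ac a_minus_def N.smult_minus_right
        N.M.minus_add N.smult_closed)
qed

lemma hom_codomain_submodule:
  assumes "h \<in> left_module_hom R L M" "h ` carrier L \<subseteq> N"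
  shows "h \<in> left_module_hom R L (M\<lparr>carrier := N\<rparr>)"
  using assms by (auto simp: left_module_hom_def)

lemma hom_from_submodule:
  assumes "h \<in> left_module_hom R L M" "N \<subseteq> carrier L"
  shows "h \<in> left_module_hom R (L\<lparr>carrier := N\<rparr>) M"
  using assms by (auto simp: left_module_hom_def subset_iff)

lemma hom_into_submodule:
  assumes "h \<in> left_module_hom R L (M\<lparr>carrier := N\<rparr>)" "N \<subseteq> carrier M"
  shows "h \<in> left_module_hom R L M"
  using assms by (auto simp: left_module_hom_def subset_iff)

lemma submodule_image:
  assumes "left_module R L" "left_module R M" "h \<in> left_module_hom R L M" "submodule N R L"
  shows "submodule (h ` N) R M"
proof -
  interpret M: left_module R M by fact
  note N = submoduleD[OF assms(4)]
  show ?thesis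
  proof (rule M.submoduleI)
    show "h ` N \<subseteq> carrier M" using N(1) hom_closed[OF assms(3)] by auto
    show "\<zero>\<^bsub>M\<^esub> \<in> h ` N" using N(2) hom_zero[OF assms(1-3)] by force
  next
    fix x y assume "x \<in> h ` N" "y \<in> h ` N"
    then obtain u v where "x = h u" "y = h v" "u \<in> N" "v \<in> N" by auto
    then show "x \<oplus>\<^bsub>M\<^esub> y \<in> h ` N"
      using N(1) N(3)[of u v] hom_add[OF assms(3), of u v] by (metis imageI subsetD)
  next
    fix a x assume "a \<in> carrier R" "x \<in> h ` N"
    then obtain u where "x = h u" "u \<in> N" by auto
    with \<open>a \<in> carrier R\<close> show "a \<odot>\<^bsub>M\<^esub> x \<in> h ` N"
      using N(1) N(4)[of a u] hom_smult[OF assms(3), of a u] by (metis imageI subsetD)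
  qed
qed

lemma submodule_preimage:
  assumes "left_module R L" "left_module R M" "h \<in> left_module_hom R L M" "submodule N R M"
  shows "submodule {x \<in> carrier L. h x \<in> N} R L"
proof -
  interpret L: left_module R L by fact
  note N = submoduleD[OF assms(4)]
  show ?thesis
    using N hom_zero[OF assms(1-3)] hom_add[OF assms(3)] hom_smult[OF assms(3)]
    by (intro L.submoduleI) (auto simp: L.smult_closed)
qed

lemma submodule_kernel:
  assumes "left_module R L" "left_module R M" "h \<in> left_module_hom R L M"
  shows "submodule {x \<in> carrier L. h x = \<zero>\<^bsub>M\<^esub>} R L"
  using submodule_preimage[OF assms submodule_zero[OF assms(2)]] by simp

lemma submodule_Int:
  assumes "left_module R M" "submodule N R M" "submodule L R M"
  shows "submodule (N \<inter> L) R M"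
proof -
  interpret M: left_module R M by fact
  show ?thesis
    using submoduleD[OF assms(2)] submoduleD[OF assms(3)] by (intro M.submoduleI) auto
qed

lemma submodule_sum:
  assumes "left_module R M" "submodule N R M" "submodule L R M"
  shows "submodule {x \<oplus>\<^bsub>M\<^esub> y | x y. x \<in> N \<and> y \<in> L} R M"
proof -
  interpret M: left_module R M by fact
  note N = submoduleD[OF assms(2)] and L = submoduleD[OF assms(3)]
  show ?thesis
  proof (rule M.submoduleI)
    show "{x \<oplus>\<^bsub>M\<^esub> y | x y. x \<in> N \<and> y \<in> L} \<subseteq> carrier M" using N(1) L(1) by auto
    show "\<zero>\<^bsub>M\<^esub> \<in> {x \<oplus>\<^bsub>M\<^esub> y | x y. x \<in> N \<and> y \<in> L}" using N(2) L(2) M.M.l_zero by force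
  next
    fix u v assume "u \<in> {x \<oplus>\<^bsub>M\<^esub> y | x y. x \<in> N \<and> y \<in> L}" "v \<in> {x \<oplus>\<^bsub>M\<^esub> y | x y. x \<in> N \<and> y \<in> L}"
    then obtain x y x' y' where *: "u = x \<oplus>\<^bsub>M\<^esub> y" "v = x' \<oplus>\<^bsub>M\<^esub> y'" "x \<in> N" "y \<in> L" "x' \<in> N" "y' \<in> L"
      by auto
    then have "u \<oplus>\<^bsub>M\<^esub> v = (x \<oplus>\<^bsub>M\<^esub> x') \<oplus>\<^bsub>M\<^esub> (y \<oplus>\<^bsub>M\<^esub> y')"
      using N(1) L(1) by (simp add: M.M.a_ac subset_iff)
    then show "u \<oplus>\<^bsub>M\<^esub> v \<in> {x \<oplus>\<^bsub>M\<^esub> y | x y. x \<in> N \<and> y \<in> L}" using * N(3) L(3) by blast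
  next
    fix a u assume a: "a \<in> carrier R" and "u \<in> {x \<oplus>\<^bsub>M\<^esub> y | x y. x \<in> N \<and> y \<in> L}"
    then obtain x y where *: "u = x \<oplus>\<^bsub>M\<^esub> y" "x \<in> N" "y \<in> L" by auto
    then have "a \<odot>\<^bsub>M\<^esub> u = a \<odot>\<^bsub>M\<^esub> x \<oplus>\<^bsub>M\<^esub> a \<odot>\<^bsub>M\<^esub> y"
      using N(1) L(1) a by (simp add: M.smult_r_distr subset_iff)
    then show "a \<odot>\<^bsub>M\<^esub> u \<in> {x \<oplus>\<^bsub>M\<^esub> y | x y. x \<in> N \<and> y \<in> L}" using * a N(4) L(4) by blast
  qed
qed

section \<open>Finite free modules\<close>

text \<open>The free module of rank \<open>k\<close> is realised on sequences that vanish from \<open>k\<close> on, so that the free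
  modules of all ranks have the same element type.\<close>

definition free_module :: "('a, 'r) ring_scheme \<Rightarrow> nat \<Rightarrow> ('a, nat \<Rightarrow> 'a) module" where
  "free_module R k =
    \<lparr>carrier = {x. (\<forall>i. x i \<in> carrier R) \<and> (\<forall>i\<ge>k. x i = \<zero>\<^bsub>R\<^esub>)},
     monoid.mult = (\<lambda>_ _. undefined), one = undefined,
     ring.zero = (\<lambda>i. \<zero>\<^bsub>R\<^esub>), ring.add = (\<lambda>x y i. x i \<oplus>\<^bsub>R\<^esub> y i),
     smult = (\<lambda>a x i. a \<otimes>\<^bsub>R\<^esub> x i)\<rparr>"

definition unit_row :: "('a, 'r) ring_scheme \<Rightarrow> nat \<Rightarrow> nat \<Rightarrow> 'a" where
  "unit_row R i = (\<lambda>j. if j = i then \<one>\<^bsub>R\<^esub> else \<zero>\<^bsub>R\<^esub>)"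

primrec lincomb :: "('a, 'm) module \<Rightarrow> (nat \<Rightarrow> 'm) \<Rightarrow> (nat \<Rightarrow> 'a) \<Rightarrow> nat \<Rightarrow> 'm" where
  "lincomb M g x 0 = \<zero>\<^bsub>M\<^esub>"
| "lincomb M g x (Suc k) = lincomb M g x k \<oplus>\<^bsub>M\<^esub> x k \<odot>\<^bsub>M\<^esub> g k"

lemma free_module_simps:
  "x \<in> carrier (free_module R k) \<longleftrightarrow> (\<forall>i. x i \<in> carrier R) \<and> (\<forall>i\<ge>k. x i = \<zero>\<^bsub>R\<^esub>)"
  "\<zero>\<^bsub>free_module R k\<^esub> = (\<lambda>i. \<zero>\<^bsub>R\<^esub>)"
  "x \<oplus>\<^bsub>free_module R k\<^esub> y = (\<lambda>i. x i \<oplus>\<^bsub>R\<^esub> y i)"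
  "a \<odot>\<^bsub>free_module R k\<^esub> x = (\<lambda>i. a \<otimes>\<^bsub>R\<^esub> x i)"
  by (simp_all add: free_module_def)

lemma free_left_module:
  assumes "ring R"
  shows "left_module R (free_module R k)"
proof -
  interpret ring R by fact
  have "abelian_group (free_module R k)"
  proof (rule abelian_groupI)
    fix x assume "x \<in> carrier (free_module R k)"
    then show "\<exists>y\<in>carrier (free_module R k). y \<oplus>\<^bsub>free_module R k\<^esub> x = \<zero>\<^bsub>free_module R k\<^esub>"
      by (intro bexI[of _ "\<lambda>i. \<ominus>\<^bsub>R\<^esub> x i"]) (auto simp: free_module_simps l_neg)
  qed (auto simp: free_module_simps a_assoc fun_eq_iff intro: a_comm)
  then show ?thesis
    using assms by (auto simp: left_module_def left_module_axioms_def free_module_simps l_distr r_distr m_assoc)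
qed

lemma regular_left_module:
  assumes "ring R"
  shows "left_module R (regular_module R)"
proof -
  interpret ring R by fact
  have "abelian_group (regular_module R)"
  proof (rule abelian_groupI)
    fix x assume "x \<in> carrier (regular_module R)"
    then show "\<exists>y\<in>carrier (regular_module R). y \<oplus>\<^bsub>regular_module R\<^esub> x = \<zero>\<^bsub>regular_module R\<^esub>"
      by (intro bexI[of _ "\<ominus>\<^bsub>R\<^esub> x"]) (auto simp: regular_module_def l_neg)
  qed (auto simp: regular_module_def a_assoc intro: a_comm)
  then show ?thesis
    using assms by (auto simp: left_module_def left_module_axioms_def regular_module_def l_distr r_distr m_assoc)
qed

lemma regular_module_simps:
  "carrier (regular_module R) = carrier R"
  "\<zero>\<^bsub>regular_module R\<^esub> = \<zero>\<^bsub>R\<^esub>"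
  "x \<oplus>\<^bsub>regular_module R\<^esub> y = x \<oplus>\<^bsub>R\<^esub> y"
  "a \<odot>\<^bsub>regular_module R\<^esub> x = a \<otimes>\<^bsub>R\<^esub> x"
  by (simp_all add: regular_module_def)

lemma unit_row_in_free: "ring R \<Longrightarrow> i < k \<Longrightarrow> unit_row R i \<in> carrier (free_module R k)"
  by (auto simp: free_module_simps unit_row_def ring.ring_simprules)

context left_module
begin

lemma lincomb_closed:
  "(\<And>i. i < k \<Longrightarrow> g i \<in> carrier M) \<Longrightarrow> (\<And>i. i < k \<Longrightarrow> x i \<in> carrier R) \<Longrightarrow> lincomb M g x k \<in> carrier M"
  by (induction k) (auto intro: smult_closed)

lemma lincomb_in_submodule:
  assumes "submodule N R M"
  shows "(\<And>i. i < k \<Longrightarrow> g i \<in> N) \<Longrightarrow> (\<And>i. i < k \<Longrightarrow> x i \<in> carrier R) \<Longrightarrow> lincomb M g x k \<in> N"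
  using submoduleD[OF assms] by (induction k) auto

lemma lincomb_hom:
  assumes "\<And>i. i < k \<Longrightarrow> g i \<in> carrier M"
  shows "(\<lambda>x. lincomb M g x k) \<in> left_module_hom R (free_module R k) M"
proof (rule left_module_homI)
  fix x assume "x \<in> carrier (free_module R k)"
  then show "lincomb M g x k \<in> carrier M"
    using assms by (intro lincomb_closed) (auto simp: free_module_simps)
next
  fix x y assume "x \<in> carrier (free_module R k)" "y \<in> carrier (free_module R k)"
  then have xy: "\<And>i. x i \<in> carrier R" "\<And>i. y i \<in> carrier R" by (auto simp: free_module_simps)
  have "lincomb M g (\<lambda>i. x i \<oplus> y i) j = lincomb M g x j \<oplus>\<^bsub>M\<^esub> lincomb M g y j" if "j \<le> k" for j
    using that
  proof (induction j)
    case (Suc j)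
    have "lincomb M g x j \<in> carrier M" "lincomb M g y j \<in> carrier M" "g j \<in> carrier M"
      "x j \<odot>\<^bsub>M\<^esub> g j \<in> carrier M" "y j \<odot>\<^bsub>M\<^esub> g j \<in> carrier M"
      using Suc.prems assms xy by (auto intro!: lincomb_closed smult_closed)
    then show ?case
      using Suc xy by (simp add: smult_l_distr M.a_ac)
  qed simp
  then show "lincomb M g (x \<oplus>\<^bsub>free_module R k\<^esub> y) k = lincomb M g x k \<oplus>\<^bsub>M\<^esub> lincomb M g y k"
    by (simp add: free_module_simps)
next
  fix a x assume a: "a \<in> carrier R" and "x \<in> carrier (free_module R k)"
  then have x: "\<And>i. x i \<in> carrier R" by (auto simp: free_module_simps)
  have "lincomb M g (\<lambda>i. a \<otimes> x i) j = a \<odot>\<^bsub>M\<^esub> lincomb M g x j" if "j \<le> k" for j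
    using that
  proof (induction j)
    case (Suc j)
    have "lincomb M g x j \<in> carrier M" "g j \<in> carrier M" "x j \<odot>\<^bsub>M\<^esub> g j \<in> carrier M"
      using Suc.prems assms x by (auto intro!: lincomb_closed smult_closed)
    then show ?case
      using Suc x a by (simp add: smult_r_distr smult_assoc1)
  qed (simp add: a smult_zero_right)
  then show "lincomb M g (a \<odot>\<^bsub>free_module R k\<^esub> x) k = a \<odot>\<^bsub>M\<^esub> lincomb M g x k"
    by (simp add: free_module_simps)
qed

lemma lincomb_unit_row:
  assumes "\<And>i. i < k \<Longrightarrow> g i \<in> carrier M" "i < k"
  shows "lincomb M g (unit_row R i) k = g i"
proof -
  have "lincomb M g (unit_row R i) j = (if i < j then g i else \<zero>\<^bsub>M\<^esub>)" if "j \<le> k" for j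
    using that
  proof (induction j)
    case (Suc j)
    then show ?case
      using assms by (auto simp: unit_row_def smult_one smult_zero_left less_Suc_eq)
  qed simp
  then show ?thesis using assms(2) by simp
qed

lemma lincomb_cong:
  "(\<And>i. i < k \<Longrightarrow> g i = g' i) \<Longrightarrow> (\<And>i. i < k \<Longrightarrow> x i = x' i) \<Longrightarrow> lincomb M g x k = lincomb M g' x' k"
  by (induction k) auto

end

lemma hom_lincomb:
  assumes "left_module R L" "left_module R M" "h \<in> left_module_hom R L M"
    and "\<And>i. i < k \<Longrightarrow> g i \<in> carrier L" "\<And>i. i < k \<Longrightarrow> x i \<in> carrier R"
  shows "h (lincomb L g x k) = lincomb M (\<lambda>i. h (g i)) x k"
proof -
  interpret L: left_module R L by fact
  show ?thesis
    using assms(4,5)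
  proof (induction k)
    case 0
    then show ?case using hom_zero[OF assms(1-3)] by simp
  next
    case (Suc k)
    then show ?case
      by (simp add: hom_add[OF assms(3)] hom_smult[OF assms(3)] L.lincomb_closed L.smult_closed)
  qed
qed

lemma free_lincomb_unit_rows:
  assumes "ring R" "x \<in> carrier (free_module R k)"
  shows "lincomb (free_module R k) (unit_row R) x k = x"
proof -
  interpret ring R by fact
  let ?z = "\<zero>\<^bsub>R\<^esub>"
  have x: "\<And>i. x i \<in> carrier R" "\<And>i. i \<ge> k \<Longrightarrow> x i = ?z" using assms(2) by (auto simp: free_module_simps)
  have "lincomb (free_module R k) (unit_row R) x j = (\<lambda>i. if i < j then x i else ?z)" for j
  proof (induction j)
    case (Suc j)
    then show ?case
      by (auto simp: free_module_simps unit_row_def fun_eq_iff x(1) less_Suc_eq)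
  qed (simp add: free_module_simps)
  then show ?thesis using x(2) by (auto simp: fun_eq_iff)
qed

lemma free_hom_eq_lincomb:
  assumes "left_module R M" "f \<in> left_module_hom R (free_module R k) M" "x \<in> carrier (free_module R k)"
  shows "f x = lincomb M (\<lambda>i. f (unit_row R i)) x k"
proof -
  interpret M: left_module R M by fact
  have "f (lincomb (free_module R k) (unit_row R) x k) = lincomb M (\<lambda>i. f (unit_row R i)) x k"
    using assms unit_row_in_free[OF M.R.ring_axioms]
    by (intro hom_lincomb[OF free_left_module[OF M.R.ring_axioms]]) (auto simp: free_module_simps(1))
  then show ?thesis using free_lincomb_unit_rows[OF M.R.ring_axioms assms(3)] by simp
qed

lemma free_hom_exists:
  assumes "left_module R M" "\<And>i. i < k \<Longrightarrow> \<exists>y \<in> carrier M. P i y"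
  obtains f where "f \<in> left_module_hom R (free_module R k) M" "\<And>i. i < k \<Longrightarrow> P i (f (unit_row R i))"
proof -
  interpret M: left_module R M by fact
  obtain g where g: "\<And>i. i < k \<Longrightarrow> g i \<in> carrier M" "\<And>i. i < k \<Longrightarrow> P i (g i)"
    using assms(2) by metis
  show ?thesis
    using that[OF M.lincomb_hom[of k g]] g by (simp add: M.lincomb_unit_row)
qed

lemma free_hom_image_subset:
  assumes "left_module R M" "f \<in> left_module_hom R (free_module R k) M" "submodule N R M"
    and "\<And>i. i < k \<Longrightarrow> f (unit_row R i) \<in> N" "x \<in> carrier (free_module R k)"
  shows "f x \<in> N"
proof -
  have "lincomb M (\<lambda>i. f (unit_row R i)) x k \<in> N"
    by (rule left_module.lincomb_in_submodule[OF assms(1,3)])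
      (use assms(4,5) in \<open>simp_all add: free_module_simps\<close>)
  then show ?thesis by (simp only: free_hom_eq_lincomb[OF assms(1,2,5)])
qed

lemma free_hom_eqI:
  assumes "left_module R M" "f \<in> left_module_hom R (free_module R k) M" "g \<in> left_module_hom R (free_module R k) M"
    and "\<And>i. i < k \<Longrightarrow> f (unit_row R i) = g (unit_row R i)" "x \<in> carrier (free_module R k)"
  shows "f x = g x"
  unfolding free_hom_eq_lincomb[OF assms(1,2,5)] free_hom_eq_lincomb[OF assms(1,3,5)]
  by (rule left_module.lincomb_cong[OF assms(1)]) (simp_all add: assms(4))

lemma free_hom_lift:
  assumes "left_module R L" "left_module R M" "p \<in> left_module_hom R L M"
    and "f \<in> left_module_hom R (free_module R k) M" "f ` carrier (free_module R k) \<subseteq> p ` carrier L"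
  obtains g where "g \<in> left_module_hom R (free_module R k) L"
    "\<And>x. x \<in> carrier (free_module R k) \<Longrightarrow> p (g x) = f x"
proof -
  interpret L: left_module R L by fact
  have "\<exists>y \<in> carrier L. p y = f (unit_row R i)" if "i < k" for i
  proof -
    have "f (unit_row R i) \<in> p ` carrier L"
      using assms(5) unit_row_in_free[OF L.R.ring_axioms that] by blast
    then show ?thesis by auto
  qed
  then obtain g where g: "g \<in> left_module_hom R (free_module R k) L"
      "\<And>i. i < k \<Longrightarrow> p (g (unit_row R i)) = f (unit_row R i)"
    using free_hom_exists[OF assms(1), of k "\<lambda>i y. p y = f (unit_row R i)"] by metis
  show ?thesis
    by (rule that[OF g(1)], rule free_hom_eqI[OF assms(2) hom_compose[OF g(1) assms(3)] assms(4) g(2)])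
qed

text \<open>A row of length \<open>r + k\<close> is a pair of rows of lengths \<open>r\<close> and \<open>k\<close>.\<close>

definition row_take :: "('a, 'r) ring_scheme \<Rightarrow> nat \<Rightarrow> (nat \<Rightarrow> 'a) \<Rightarrow> nat \<Rightarrow> 'a" where
  "row_take R r c = (\<lambda>i. if i < r then c i else \<zero>\<^bsub>R\<^esub>)"

definition row_drop :: "nat \<Rightarrow> (nat \<Rightarrow> 'a) \<Rightarrow> nat \<Rightarrow> 'a" where
  "row_drop r c = (\<lambda>i. c (i + r))"

definition row_append :: "nat \<Rightarrow> (nat \<Rightarrow> 'a) \<Rightarrow> (nat \<Rightarrow> 'a) \<Rightarrow> nat \<Rightarrow> 'a" where
  "row_append r x y = (\<lambda>i. if i < r then x i else y (i - r))"

lemma row_take_hom: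
  assumes "ring R"
  shows "row_take R r \<in> left_module_hom R (free_module R (r + k)) (free_module R r)"
proof -
  interpret R: ring R by fact
  show ?thesis
    by (rule left_module_homI) (auto simp: row_take_def free_module_simps fun_eq_iff)
qed

lemma row_drop_hom: "row_drop r \<in> left_module_hom R (free_module R (r + k)) (free_module R k)"
  by (rule left_module_homI) (auto simp: row_drop_def free_module_simps fun_eq_iff)

lemma row_append:
  assumes "x \<in> carrier (free_module R r)" "y \<in> carrier (free_module R k)"
  shows "row_append r x y \<in> carrier (free_module R (r + k))"
    "row_take R r (row_append r x y) = x" "row_drop r (row_append r x y) = y"
  using assms by (auto simp: row_append_def row_take_def row_drop_def free_module_simps fun_eq_iff)

lemma row_append_take_drop:
  "c \<in> carrier (free_module R (r + k)) \<Longrightarrow> row_append r (row_take R r c) (row_drop r c) = c"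
  by (auto simp: row_append_def row_take_def row_drop_def free_module_simps fun_eq_iff)

lemma row_append_hom:
  assumes "f \<in> left_module_hom R L (free_module R r)" "g \<in> left_module_hom R L (free_module R k)"
  shows "(\<lambda>x. row_append r (f x) (g x)) \<in> left_module_hom R L (free_module R (r + k))"
proof (rule left_module_homI)
  fix x assume "x \<in> carrier L"
  then show "row_append r (f x) (g x) \<in> carrier (free_module R (r + k))"
    using row_append(1) assms hom_closed by metis
next
  fix x y assume "x \<in> carrier L" "y \<in> carrier L"
  then show "row_append r (f (x \<oplus>\<^bsub>L\<^esub> y)) (g (x \<oplus>\<^bsub>L\<^esub> y)) =
      row_append r (f x) (g x) \<oplus>\<^bsub>free_module R (r + k)\<^esub> row_append r (f y) (g y)"
    by (simp only: hom_add[OF assms(1)] hom_add[OF assms(2)])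
      (simp add: row_append_def free_module_simps fun_eq_iff)
next
  fix a x assume "a \<in> carrier R" "x \<in> carrier L"
  then show "row_append r (f (a \<odot>\<^bsub>L\<^esub> x)) (g (a \<odot>\<^bsub>L\<^esub> x)) =
      a \<odot>\<^bsub>free_module R (r + k)\<^esub> row_append r (f x) (g x)"
    by (simp only: hom_smult[OF assms(1)] hom_smult[OF assms(2)])
      (simp add: row_append_def free_module_simps fun_eq_iff)
qed

lemma free_hom_append:
  assumes "left_module R M" "f \<in> left_module_hom R (free_module R r) M" "g \<in> left_module_hom R (free_module R k) M"
  shows "(\<lambda>c. f (row_take R r c) \<oplus>\<^bsub>M\<^esub> g (row_drop r c)) \<in> left_module_hom R (free_module R (r + k)) M"
proof -
  interpret M: left_module R M by fact
  show ?thesis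
    by (rule hom_sum[OF assms(1) hom_compose[OF row_take_hom[OF M.R.ring_axioms] assms(2)]
          hom_compose[OF row_drop_hom assms(3)]])
qed

lemma (in abelian_group) add_diff_cancel:
  assumes "x \<in> carrier G" "y \<in> carrier G"
  shows "y \<oplus> (x \<ominus> y) = x"
  using assms by (metis a_minus_def a_inv_closed a_assoc a_comm r_neg r_zero)

lemma (in abelian_group) diff_eq_zero_iff:
  assumes "x \<in> carrier G" "y \<in> carrier G"
  shows "x \<ominus> y = \<zero> \<longleftrightarrow> x = y"
  using assms by (metis add_diff_cancel r_neg a_minus_def r_zero)

section \<open>Finite generation over noetherian rings\<close>

text \<open>Finite generation of the quotient \<open>Y / X\<close>, stated without forming the quotient.\<close>

definition fg_mod :: "('a, 'r) ring_scheme \<Rightarrow> ('a, 'm) module \<Rightarrow> 'm set \<Rightarrow> 'm set \<Rightarrow> bool" where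
  "fg_mod R M Y X \<longleftrightarrow>
    (\<exists>k. \<exists>f \<in> left_module_hom R (free_module R k) M. f ` carrier (free_module R k) \<subseteq> Y \<and>
       (\<forall>y\<in>Y. \<exists>x \<in> carrier (free_module R k). \<exists>z\<in>X. y = f x \<oplus>\<^bsub>M\<^esub> z))"

lemma fg_modI:
  assumes "f \<in> left_module_hom R (free_module R k) M"
    "\<And>x. x \<in> carrier (free_module R k) \<Longrightarrow> f x \<in> Y"
    "\<And>y. y \<in> Y \<Longrightarrow> \<exists>x \<in> carrier (free_module R k). \<exists>z\<in>X. y = f x \<oplus>\<^bsub>M\<^esub> z"
  shows "fg_mod R M Y X"
  unfolding fg_mod_def using assms by (intro exI[of _ k] bexI[OF _ assms(1)] conjI) auto

lemma fg_modE:
  assumes "fg_mod R M Y X"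
  obtains k f where "f \<in> left_module_hom R (free_module R k) M" "f ` carrier (free_module R k) \<subseteq> Y"
    "\<And>y. y \<in> Y \<Longrightarrow> \<exists>x \<in> carrier (free_module R k). \<exists>z\<in>X. y = f x \<oplus>\<^bsub>M\<^esub> z"
  using assms by (auto simp: fg_mod_def)

lemma fg_mod_zero_iff:
  assumes "left_module R M"
  shows "fg_mod R M N {\<zero>\<^bsub>M\<^esub>} \<longleftrightarrow>
    (\<exists>k. \<exists>f \<in> left_module_hom R (free_module R k) M. f ` carrier (free_module R k) = N)"
proof -
  interpret M: left_module R M by fact
  have "(f ` carrier (free_module R k) \<subseteq> N \<and>
       (\<forall>y\<in>N. \<exists>x \<in> carrier (free_module R k). \<exists>z\<in>{\<zero>\<^bsub>M\<^esub>}. y = f x \<oplus>\<^bsub>M\<^esub> z)) \<longleftrightarrow>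
     f ` carrier (free_module R k) = N" if "f \<in> left_module_hom R (free_module R k) M" for f k
    using hom_closed[OF that] by auto
  then show ?thesis unfolding fg_mod_def by (metis (no_types, lifting))
qed

lemma fg_mod_mono:
  assumes "fg_mod R M Y X" "X \<subseteq> X'"
  shows "fg_mod R M Y X'"
  using assms unfolding fg_mod_def by (meson subsetD)

lemma fg_mod_trans:
  assumes "left_module R M" "submodule Y R M" "X \<subseteq> Y" "W \<subseteq> carrier M" "fg_mod R M Y X" "fg_mod R M X W"
  shows "fg_mod R M Y W"
proof -
  interpret M: left_module R M by fact
  obtain r f where f: "f \<in> left_module_hom R (free_module R r) M" "f ` carrier (free_module R r) \<subseteq> Y"
    "\<And>y. y \<in> Y \<Longrightarrow> \<exists>x \<in> carrier (free_module R r). \<exists>z\<in>X. y = f x \<oplus>\<^bsub>M\<^esub> z"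
    using fg_modE[OF assms(5)] by metis
  obtain k g where g: "g \<in> left_module_hom R (free_module R k) M" "g ` carrier (free_module R k) \<subseteq> X"
    "\<And>y. y \<in> X \<Longrightarrow> \<exists>x \<in> carrier (free_module R k). \<exists>z\<in>W. y = g x \<oplus>\<^bsub>M\<^esub> z"
    using fg_modE[OF assms(6)] by metis
  let ?h = "\<lambda>c. f (row_take R r c) \<oplus>\<^bsub>M\<^esub> g (row_drop r c)"
  have "?h c \<in> Y" if "c \<in> carrier (free_module R (r + k))" for c
    using hom_closed[OF row_take_hom[OF M.R.ring_axioms] that] hom_closed[OF row_drop_hom that]
      f(2) g(2) assms(3) submoduleD(3)[OF assms(2)] by blast
  moreover have "\<exists>c \<in> carrier (free_module R (r + k)). \<exists>w\<in>W. y = ?h c \<oplus>\<^bsub>M\<^esub> w" if y: "y \<in> Y" for y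
  proof -
    obtain x z where x: "x \<in> carrier (free_module R r)" "z \<in> X" "y = f x \<oplus>\<^bsub>M\<^esub> z" using f(3)[OF y] by auto
    obtain x' w where x': "x' \<in> carrier (free_module R k)" "w \<in> W" "z = g x' \<oplus>\<^bsub>M\<^esub> w" using g(3)[OF x(2)] by auto
    have "y = ?h (row_append r x x') \<oplus>\<^bsub>M\<^esub> w"
      using x x' assms(4) hom_closed[OF f(1)] hom_closed[OF g(1)]
      by (simp add: row_append(2,3)[OF x(1) x'(1)] M.M.a_assoc subset_iff)
    then show ?thesis using row_append(1)[OF x(1) x'(1)] x'(2) by blast
  qed
  ultimately show ?thesis by (rule fg_modI[OF free_hom_append[OF assms(1) f(1) g(1)]])
qed

lemma fg_mod_image:
  assumes "h \<in> left_module_hom R M N" "fg_mod R M Y X" "X \<subseteq> carrier M"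
  shows "fg_mod R N (h ` Y) (h ` X)"
proof -
  obtain r f where f: "f \<in> left_module_hom R (free_module R r) M" "f ` carrier (free_module R r) \<subseteq> Y"
    "\<And>y. y \<in> Y \<Longrightarrow> \<exists>x \<in> carrier (free_module R r). \<exists>z\<in>X. y = f x \<oplus>\<^bsub>M\<^esub> z"
    using fg_modE[OF assms(2)] by metis
  have "\<exists>x \<in> carrier (free_module R r). \<exists>z\<in>h ` X. y = h (f x) \<oplus>\<^bsub>N\<^esub> z" if y: "y \<in> h ` Y" for y
  proof -
    obtain y' where "y' \<in> Y" "y = h y'" using y by auto
    moreover from f(3)[OF this(1)] obtain x z where "x \<in> carrier (free_module R r)" "z \<in> X" "y' = f x \<oplus>\<^bsub>M\<^esub> z" by auto
    ultimately show ?thesis using hom_add[OF assms(1), of "f x" z] hom_closed[OF f(1)] assms(3) by blast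
  qed
  then show ?thesis
    using f(2) by (intro fg_modI[OF hom_compose[OF f(1) assms(1)]]) auto
qed

lemma finite_span:
  assumes "left_module R M" "finite F" "F \<subseteq> carrier M"
  obtains k f where "f \<in> left_module_hom R (free_module R k) M" "F \<subseteq> f ` carrier (free_module R k)"
    "\<And>L. submodule L R M \<Longrightarrow> F \<subseteq> L \<Longrightarrow> f ` carrier (free_module R k) \<subseteq> L"
proof -
  interpret M: left_module R M by fact
  obtain g where g: "bij_betw g {..<card F} F"
    using ex_bij_betw_nat_finite[OF assms(2)] by (auto simp: atLeast0LessThan)
  have gF: "g i \<in> F" if "i < card F" for i using g that by (auto simp: bij_betw_def)
  then have gM: "g i \<in> carrier M" if "i < card F" for i using that assms(3) by auto
  let ?f = "\<lambda>x. lincomb M g x (card F)"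
  show thesis
  proof (rule that[of ?f "card F"])
    show "?f \<in> left_module_hom R (free_module R (card F)) M" using M.lincomb_hom[of "card F" g] gM by auto
    show "F \<subseteq> ?f ` carrier (free_module R (card F))"
    proof
      fix y assume "y \<in> F"
      then obtain i where "i < card F" "y = g i" using g by (auto simp: bij_betw_def)
      then show "y \<in> ?f ` carrier (free_module R (card F))"
        using M.lincomb_unit_row[of "card F" g i] gM unit_row_in_free[OF M.R.ring_axioms, of i "card F"]
        by (metis image_eqI)
    qed
    show "?f ` carrier (free_module R (card F)) \<subseteq> L" if "submodule L R M" "F \<subseteq> L" for L
    proof
      fix y assume "y \<in> ?f ` carrier (free_module R (card F))"
      then obtain x where "x \<in> carrier (free_module R (card F))" "y = ?f x" by auto
      then show "y \<in> L"
        using M.lincomb_in_submodule[OF that(1), of "card F" g x] gF that(2) by (auto simp: free_module_simps)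
    qed
  qed
qed

lemma finitely_generated_iff:
  assumes "left_module R M"
  shows "finitely_generated R M \<longleftrightarrow>
    (\<exists>k. \<exists>f \<in> left_module_hom R (free_module R k) M. f ` carrier (free_module R k) = carrier M)"
proof
  interpret M: left_module R M by fact
  {
    assume "finitely_generated R M"
    then obtain F where F: "finite F" "F \<subseteq> carrier M" "\<And>N. submodule N R M \<Longrightarrow> F \<subseteq> N \<Longrightarrow> N = carrier M"
      by (auto simp: finitely_generated_def)
    obtain k f where f: "f \<in> left_module_hom R (free_module R k) M" "F \<subseteq> f ` carrier (free_module R k)"
      using finite_span[OF assms F(1,2)] by metis
    have "submodule (f ` carrier (free_module R k)) R M"
      using submodule_image[OF free_left_module[OF M.R.ring_axioms] assms f(1)
          submodule_carrier[OF free_left_module[OF M.R.ring_axioms]]] .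
    then show "\<exists>k. \<exists>f \<in> left_module_hom R (free_module R k) M. f ` carrier (free_module R k) = carrier M"
      using F(3) f by blast
  }
  assume "\<exists>k. \<exists>f \<in> left_module_hom R (free_module R k) M. f ` carrier (free_module R k) = carrier M"
  then obtain k f where f: "f \<in> left_module_hom R (free_module R k) M" "f ` carrier (free_module R k) = carrier M"
    by auto
  let ?F = "(\<lambda>i. f (unit_row R i)) ` {..<k}"
  have "?F \<subseteq> carrier M" using hom_closed[OF f(1)] unit_row_in_free[OF M.R.ring_axioms] by auto
  moreover have "N = carrier M" if N: "submodule N R M" "?F \<subseteq> N" for N
  proof
    show "N \<subseteq> carrier M" using submoduleD(1)[OF N(1)] .
    have "f x \<in> N" if "x \<in> carrier (free_module R k)" for x
      by (rule free_hom_image_subset[OF assms f(1) N(1) _ that]) (use N(2) in auto)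
    then show "carrier M \<subseteq> N" unfolding f(2)[symmetric] by blast
  qed
  ultimately show "finitely_generated R M"
    unfolding finitely_generated_def by (intro exI[of _ ?F]) auto
qed

lemma submodule_Inter:
  assumes "left_module R M" "\<And>N. N \<in> \<N> \<Longrightarrow> submodule N R M" "\<N> \<noteq> {}"
  shows "submodule (\<Inter>\<N>) R M"
proof -
  interpret M: left_module R M by fact
  show ?thesis
  proof (rule M.submoduleI)
    show "\<Inter>\<N> \<subseteq> carrier M" using submoduleD(1)[OF assms(2)] assms(3) by blast
  qed (use submoduleD(2-4)[OF assms(2)] in auto)
qed

text \<open>Otherwise, adjoining again and again an element of \<open>N\<close> outside the span of the previous ones
  gives an ascending chain that never stops.\<close>

lemma noetherian_submodule_fg:
  assumes "left_module R M" "noetherian_module R M" "submodule N R M"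
  shows "fg_mod R M N {\<zero>\<^bsub>M\<^esub>}"
proof (rule ccontr)
  assume nfg: "\<not> fg_mod R M N {\<zero>\<^bsub>M\<^esub>}"
  interpret M: left_module R M by fact
  define sp where "sp F = \<Inter>{L. submodule L R M \<and> F \<subseteq> L}" for F
  have sp: "submodule (sp F) R M" "F \<subseteq> sp F" if "F \<subseteq> N" for F
    unfolding sp_def using submodule_Inter[OF assms(1), of "{L. submodule L R M \<and> F \<subseteq> L}"] that assms(3) by auto
  have spN: "sp F \<subseteq> N" if "F \<subseteq> N" for F using that assms(3) by (auto simp: sp_def)
  have "\<exists>y\<in>N. y \<notin> sp F" if F: "finite F" "F \<subseteq> N" for F
  proof (rule ccontr)
    assume "\<not> (\<exists>y\<in>N. y \<notin> sp F)"
    then have eq: "sp F = N" using spN[OF F(2)] by auto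
    obtain k f where f: "f \<in> left_module_hom R (free_module R k) M" "F \<subseteq> f ` carrier (free_module R k)"
      "\<And>L. submodule L R M \<Longrightarrow> F \<subseteq> L \<Longrightarrow> f ` carrier (free_module R k) \<subseteq> L"
      using finite_span[OF assms(1) F(1) subset_trans[OF F(2) submoduleD(1)[OF assms(3)]], of thesis] by blast
    have "submodule (f ` carrier (free_module R k)) R M"
      using submodule_image[OF free_left_module[OF M.R.ring_axioms] assms(1) f(1)
          submodule_carrier[OF free_left_module[OF M.R.ring_axioms]]] .
    then have "sp F \<subseteq> f ` carrier (free_module R k)" using f(2) by (auto simp: sp_def)
    then have "f ` carrier (free_module R k) = N" using f(3)[OF assms(3) F(2)] eq by auto
    then show False using nfg fg_mod_zero_iff[OF assms(1)] f(1) by blast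
  qed
  then obtain c where c: "\<And>F. finite F \<Longrightarrow> F \<subseteq> N \<Longrightarrow> c F \<in> N \<and> c F \<notin> sp F" by metis
  define G where "G = rec_nat {} (\<lambda>_ F. insert (c F) F)"
  have G: "finite (G n) \<and> G n \<subseteq> N" for n by (induction n) (auto simp: G_def c)
  have GS: "G (Suc n) = insert (c (G n)) (G n)" for n by (simp add: G_def)
  have "sp (G n) \<subseteq> sp (G (Suc n))" for n unfolding GS sp_def by blast
  then obtain k where k: "\<And>i. i \<ge> k \<Longrightarrow> sp (G i) = sp (G k)"
    using assms(2)[unfolded noetherian_module_def, rule_format, of "\<lambda>n. sp (G n)"] sp(1) G by blast
  have "c (G k) \<in> sp (G (Suc k))" using sp(2)[of "G (Suc k)"] G GS by auto
  then show False using k[of "Suc k"] c G by auto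
qed

text \<open>Induction on the rank: the last coordinates of the elements of \<open>N\<close> form a left ideal, and the
  elements with last coordinate zero form a submodule of the free module of rank one less.\<close>

lemma noetherian_free_submodule_fg:
  assumes "ring R" "noetherian_module R (regular_module R)"
  shows "submodule N R (free_module R k) \<Longrightarrow> fg_mod R (free_module R k) N {\<zero>\<^bsub>free_module R k\<^esub>}"
proof (induction k arbitrary: N)
  interpret R: ring R by fact
  note fr = free_left_module[OF assms(1)]
  {
    case 0
    have z: "x = \<zero>\<^bsub>free_module R 0\<^esub>" if "x \<in> carrier (free_module R 0)" for x
      using that by (simp add: free_module_simps fun_eq_iff)
    have "N = carrier (free_module R 0)"
    proof
      show "N \<subseteq> carrier (free_module R 0)" by (rule submoduleD(1)[OF 0])
      show "carrier (free_module R 0) \<subseteq> N" using z submoduleD(2)[OF 0] by blast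
    qed
    then show ?case
      unfolding fg_mod_zero_iff[OF fr] by (intro exI[of _ 0] bexI[OF _ hom_id]) simp
  next
    case (Suc k)
    let ?F = "free_module R (Suc k)" and ?Rg = "regular_module R"
    have ev: "(\<lambda>x. x k) \<in> left_module_hom R ?F ?Rg"
      by (rule left_module_homI) (auto simp: free_module_simps regular_module_simps)
    note Rg = regular_left_module[OF assms(1)]
    obtain p f1 where f1: "f1 \<in> left_module_hom R (free_module R p) ?Rg"
      "f1 ` carrier (free_module R p) = (\<lambda>x. x k) ` N"
      using noetherian_submodule_fg[OF Rg assms(2) submodule_image[OF fr Rg ev Suc.prems]]
      unfolding fg_mod_zero_iff[OF Rg] by auto
    note NF = submodule_left_module[OF fr Suc.prems]
    obtain g1 where g1: "g1 \<in> left_module_hom R (free_module R p) (?F\<lparr>carrier := N\<rparr>)"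
      "\<And>x. x \<in> carrier (free_module R p) \<Longrightarrow> g1 x k = f1 x"
      using free_hom_lift[OF NF Rg hom_from_submodule[OF ev submoduleD(1)[OF Suc.prems]] f1(1)] f1(2) by auto
    note g1' = hom_into_submodule[OF g1(1) submoduleD(1)[OF Suc.prems]]
    define N0 where "N0 = {x \<in> N. x k = \<zero>\<^bsub>R\<^esub>}"
    have carr: "x \<in> carrier (free_module R k) \<longleftrightarrow> x \<in> carrier ?F \<and> x k = \<zero>\<^bsub>R\<^esub>" for x
      unfolding free_module_simps by (metis Suc_leD Suc_le_eq le_neq_implies_less order_refl)
    have "submodule N0 R (free_module R k)"
    proof (rule left_module.submoduleI[OF fr])
      show "N0 \<subseteq> carrier (free_module R k)"
        using submoduleD(1)[OF Suc.prems] by (auto simp: N0_def carr)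
    qed (use submoduleD(1-4)[OF Suc.prems] in \<open>auto simp: N0_def free_module_simps\<close>)
    then obtain q f2 where f2: "f2 \<in> left_module_hom R (free_module R q) (free_module R k)"
      "f2 ` carrier (free_module R q) = N0"
      using Suc.IH unfolding fg_mod_zero_iff[OF fr] by blast
    have f2': "f2 \<in> left_module_hom R (free_module R q) ?F"
      using f2(1) by (auto simp: left_module_hom_def Pi_iff carr free_module_simps(2-4))
    let ?h = "\<lambda>c. g1 (row_take R p c) \<oplus>\<^bsub>?F\<^esub> f2 (row_drop p c)"
    have h: "?h \<in> left_module_hom R (free_module R (p + q)) ?F"
      by (rule free_hom_append[OF fr g1' f2'])
    have "?h ` carrier (free_module R (p + q)) = N"
    proof (intro equalityI subsetI)
      fix y assume "y \<in> ?h ` carrier (free_module R (p + q))"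
      then obtain c where c: "c \<in> carrier (free_module R (p + q))" "y = ?h c" by auto
      have "g1 (row_take R p c) \<in> N" using hom_closed[OF g1(1) hom_closed[OF row_take_hom[OF assms(1)] c(1)]] by simp
      moreover have "f2 (row_drop p c) \<in> N"
        using f2(2) hom_closed[OF row_drop_hom c(1)] by (auto simp: N0_def)
      ultimately show "y \<in> N" using c(2) submoduleD(3)[OF Suc.prems] by blast
    next
      fix y assume y: "y \<in> N"
      then obtain x where x: "x \<in> carrier (free_module R p)" "f1 x = y k" using f1(2) by (metis (mono_tags, lifting) imageE image_eqI)
      interpret F: left_module R ?F by (rule fr)
      have gx: "g1 x \<in> N" using hom_closed[OF g1(1) x(1)] by simp
      have yF: "y \<in> carrier ?F" and gF: "g1 x \<in> carrier ?F" using y gx submoduleD(1)[OF Suc.prems] by auto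
      have "(y \<ominus>\<^bsub>?F\<^esub> g1 x) k = \<zero>\<^bsub>R\<^esub>"
        using hom_minus[OF fr Rg ev yF gF] x(2) g1(2)[OF x(1)] hom_closed[OF ev yF]
          abelian_group.r_neg[OF left_module.axioms(2)[OF Rg], of "y k"]
        by (simp add: a_minus_def regular_module_simps)
      then have "y \<ominus>\<^bsub>?F\<^esub> g1 x \<in> N0" using submoduleD(6)[OF Suc.prems y gx] by (simp add: N0_def)
      then obtain z where z: "z \<in> carrier (free_module R q)" "f2 z = y \<ominus>\<^bsub>?F\<^esub> g1 x" using f2(2) by (metis imageE)
      have "?h (row_append p x z) = g1 x \<oplus>\<^bsub>?F\<^esub> (y \<ominus>\<^bsub>?F\<^esub> g1 x)"
        by (simp only: row_append(2,3)[OF x(1) z(1)] z(2))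
      also have "\<dots> = y" by (rule F.M.add_diff_cancel[OF yF gF])
      finally show "y \<in> ?h ` carrier (free_module R (p + q))" using row_append(1)[OF x(1) z(1)] by force
    qed
    then show ?case unfolding fg_mod_zero_iff[OF fr] using h by blast
  }
qed

text \<open>The basic use of noetherianness: \<open>h\<close> embeds \<open>Y' / h\<^sup>-\<^sup>1 X\<close> into the finitely generated module
  \<open>Y / X\<close>.\<close>

lemma fg_mod_embed:
  assumes "noetherian_module R (regular_module R)" "left_module R M'" "left_module R M"
    and h: "h \<in> left_module_hom R M' M" and Y': "submodule Y' R M'" and X: "submodule X R M"
    and fg: "fg_mod R M Y X" and "h ` Y' \<subseteq> Y"
  shows "fg_mod R M' Y' {y \<in> Y'. h y \<in> X}"
proof -
  interpret M': left_module R M' by fact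
  interpret M: left_module R M by fact
  note fr = free_left_module[OF M'.R.ring_axioms]
  note Xd = submoduleD[OF X] and Y'd = submoduleD[OF Y']
  obtain k f where f: "f \<in> left_module_hom R (free_module R k) M" "f ` carrier (free_module R k) \<subseteq> Y"
    "\<And>y. y \<in> Y \<Longrightarrow> \<exists>x \<in> carrier (free_module R k). \<exists>z\<in>X. y = f x \<oplus>\<^bsub>M\<^esub> z"
    using fg_modE[OF fg] by metis
  \<comment> \<open>The submodule \<open>(h Y' + X) / X\<close> of \<open>Y / X\<close>, seen in the free module that covers \<open>Y / X\<close>. Its
    finitely many generators are lifted to \<open>Y'\<close>.\<close>
  define D where "D = {x \<in> carrier (free_module R k). f x \<in> {a \<oplus>\<^bsub>M\<^esub> z | a z. a \<in> h ` Y' \<and> z \<in> X}}"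
  have "submodule D R (free_module R k)"
    unfolding D_def
    by (rule submodule_preimage[OF fr assms(3) f(1) submodule_sum[OF assms(3) submodule_image[OF assms(2,3) h Y'] X]])
  then obtain m q where q: "q \<in> left_module_hom R (free_module R m) (free_module R k)"
      "q ` carrier (free_module R m) = D"
    using noetherian_free_submodule_fg[OF M'.R.ring_axioms assms(1)] unfolding fg_mod_zero_iff[OF fr] by blast
  have fq: "(\<lambda>x. f (q x)) \<in> left_module_hom R (free_module R m) M" by (rule hom_compose[OF q(1) f(1)])
  have "\<exists>y \<in> carrier M'. y \<in> Y' \<and> h y \<ominus>\<^bsub>M\<^esub> f (q (unit_row R i)) \<in> X" if "i < m" for i
  proof -
    have "q (unit_row R i) \<in> D" using q(2) unit_row_in_free[OF M'.R.ring_axioms that] by auto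
    then obtain y z where y: "y \<in> Y'" "z \<in> X" "f (q (unit_row R i)) = h y \<oplus>\<^bsub>M\<^esub> z" by (auto simp: D_def)
    have "h y \<in> carrier M" "z \<in> carrier M" using y Xd(1) Y'd(1) hom_closed[OF h] by auto
    then have "h y \<ominus>\<^bsub>M\<^esub> f (q (unit_row R i)) = \<ominus>\<^bsub>M\<^esub> z"
      by (simp add: y(3) a_minus_def M.M.minus_add M.M.r_neg2)
    then show ?thesis using y Y'd(1) Xd(5) by auto
  qed
  then obtain g where g: "g \<in> left_module_hom R (free_module R m) M'"
    "\<And>i. i < m \<Longrightarrow> g (unit_row R i) \<in> Y' \<and> h (g (unit_row R i)) \<ominus>\<^bsub>M\<^esub> f (q (unit_row R i)) \<in> X"
    using free_hom_exists[OF assms(2), of m "\<lambda>i y. y \<in> Y' \<and> h y \<ominus>\<^bsub>M\<^esub> f (q (unit_row R i)) \<in> X"] by metis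
  have gY: "g x \<in> Y'" if "x \<in> carrier (free_module R m)" for x
    using free_hom_image_subset[OF assms(2) g(1) Y' _ that] g(2) by blast
  have gX: "h (g x) \<ominus>\<^bsub>M\<^esub> f (q x) \<in> X" if "x \<in> carrier (free_module R m)" for x
    using free_hom_image_subset[OF assms(3) hom_diff[OF assms(3) hom_compose[OF g(1) h] fq] X _ that] g(2) by blast
  have "\<exists>u \<in> carrier (free_module R m). \<exists>z\<in>{y \<in> Y'. h y \<in> X}. y = g u \<oplus>\<^bsub>M'\<^esub> z" if y: "y \<in> Y'" for y
  proof -
    obtain x z where x: "x \<in> carrier (free_module R k)" "z \<in> X" "h y = f x \<oplus>\<^bsub>M\<^esub> z"
      using f(3)[of "h y"] y assms(8) by auto
    have c: "z \<in> carrier M" "f x \<in> carrier M" "h y \<in> carrier M" "y \<in> carrier M'"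
      using x Xd(1) hom_closed[OF f(1)] y Y'd(1) hom_closed[OF h] by auto
    have "f x = h y \<oplus>\<^bsub>M\<^esub> (\<ominus>\<^bsub>M\<^esub> z)" using c x(3) by (simp add: M.M.a_assoc M.M.r_neg)
    then have "x \<in> D" using x(1,2) y Xd(5) by (auto simp: D_def)
    then obtain u where u: "u \<in> carrier (free_module R m)" "q u = x" using q(2) by auto
    have gu: "g u \<in> carrier M'" "h (g u) \<in> carrier M" using gY[OF u(1)] Y'd(1) hom_closed[OF h] by auto
    have "h (y \<ominus>\<^bsub>M'\<^esub> g u) = z \<ominus>\<^bsub>M\<^esub> (h (g u) \<ominus>\<^bsub>M\<^esub> f x)"
      unfolding hom_minus[OF assms(2,3) h c(4) gu(1)] x(3) using c gu
      by (simp add: a_minus_def M.M.minus_add M.M.a_ac)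
    then have "h (y \<ominus>\<^bsub>M'\<^esub> g u) \<in> X" using Xd(6)[OF x(2) gX[OF u(1)]] u(2) by simp
    moreover have "y \<ominus>\<^bsub>M'\<^esub> g u \<in> Y'" using Y'd(6)[OF y gY[OF u(1)]] .
    moreover have "y = g u \<oplus>\<^bsub>M'\<^esub> (y \<ominus>\<^bsub>M'\<^esub> g u)" using M'.M.add_diff_cancel[OF c(4) gu(1)] by simp
    ultimately show ?thesis using u(1) by blast
  qed
  with gY show ?thesis by (rule fg_modI[OF g(1)])
qed

lemma fg_mod_submodule:
  assumes "noetherian_module R (regular_module R)" "left_module R M"
    and "submodule N R M" "submodule X R M" "fg_mod R M Y X" "X \<subseteq> N" "N \<subseteq> Y"
  shows "fg_mod R M N X"
proof -
  have "fg_mod R M N {y \<in> N. y \<in> X}"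
    by (rule fg_mod_embed[OF assms(1,2,2) hom_id assms(3,4,5)]) (use assms(7) in auto)
  moreover have "{y \<in> N. y \<in> X} = X" using assms(6) by auto
  ultimately show ?thesis by simp
qed

section \<open>Flatness\<close>

text \<open>The equational criterion: every homomorphism from a finite free module to \<open>M\<close> factors through
  a homomorphism of finite free modules that kills its whole kernel. Over a left noetherian ring
  this is flatness; in general it is slightly stronger.\<close>

definition flat_module :: "('a, 'r) ring_scheme \<Rightarrow> ('a, 'm) module \<Rightarrow> bool" where
  "flat_module R M \<longleftrightarrow>
    (\<forall>k. \<forall>f \<in> left_module_hom R (free_module R k) M.
       \<exists>q. \<exists>\<gamma> \<in> left_module_hom R (free_module R k) (free_module R q).
       \<exists>f' \<in> left_module_hom R (free_module R q) M.
         \<forall>x \<in> carrier (free_module R k). f x = f' (\<gamma> x) \<and> (f x = \<zero>\<^bsub>M\<^esub> \<longrightarrow> \<gamma> x = \<zero>\<^bsub>free_module R q\<^esub>))"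

lemma flat_moduleI:
  assumes "\<And>k f. f \<in> left_module_hom R (free_module R k) M \<Longrightarrow>
       \<exists>q \<gamma> f'. \<gamma> \<in> left_module_hom R (free_module R k) (free_module R q) \<and>
       f' \<in> left_module_hom R (free_module R q) M \<and>
         (\<forall>x \<in> carrier (free_module R k). f x = f' (\<gamma> x) \<and> (f x = \<zero>\<^bsub>M\<^esub> \<longrightarrow> \<gamma> x = \<zero>\<^bsub>free_module R q\<^esub>))"
  shows "flat_module R M"
  unfolding flat_module_def using assms by blast

lemma flat_moduleE:
  assumes "flat_module R M" "f \<in> left_module_hom R (free_module R k) M"
  obtains q \<gamma> f' where "\<gamma> \<in> left_module_hom R (free_module R k) (free_module R q)"
    "f' \<in> left_module_hom R (free_module R q) M"
    "\<And>x. x \<in> carrier (free_module R k) \<Longrightarrow> f x = f' (\<gamma> x)"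
    "\<And>x. x \<in> carrier (free_module R k) \<Longrightarrow> f x = \<zero>\<^bsub>M\<^esub> \<Longrightarrow> \<gamma> x = \<zero>\<^bsub>free_module R q\<^esub>"
proof -
  obtain q \<gamma> f' where *: "\<gamma> \<in> left_module_hom R (free_module R k) (free_module R q)"
    "f' \<in> left_module_hom R (free_module R q) M"
    "\<forall>x \<in> carrier (free_module R k). f x = f' (\<gamma> x) \<and> (f x = \<zero>\<^bsub>M\<^esub> \<longrightarrow> \<gamma> x = \<zero>\<^bsub>free_module R q\<^esub>)"
    using assms unfolding flat_module_def by blast
  show thesis by (rule that[OF *(1,2)]) (use *(3) in auto)
qed

text \<open>Let \<open>f\<close> map into the kernel and factor it as \<open>f' \<circ> \<gamma>\<close> through a map \<open>f'\<close> to \<open>Y\<close>. The map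
  \<open>p \<circ> f'\<close> in turn factors through some \<open>\<eta>\<close> that kills the image of \<open>\<gamma>\<close>. Subtracting from \<open>f'\<close> a
  lift of \<open>p \<circ> f'\<close> to \<open>Y\<close> along this factorisation moves it into the kernel without changing its
  composite with \<open>\<gamma>\<close>.\<close>

lemma flat_kernel:
  assumes Y: "left_module R Y" and W: "left_module R W" and p: "p \<in> left_module_hom R Y W"
    and surj: "p ` carrier Y = carrier W" and fl: "flat_module R Y" "flat_module R W"
  shows "flat_module R (Y\<lparr>carrier := {y \<in> carrier Y. p y = \<zero>\<^bsub>W\<^esub>}\<rparr>)"
proof (rule flat_moduleI)
  interpret Y: left_module R Y by fact
  interpret W: left_module R W by fact
  note fr = free_left_module[OF Y.R.ring_axioms]
  let ?X = "{y \<in> carrier Y. p y = \<zero>\<^bsub>W\<^esub>}"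
  fix k f assume f: "f \<in> left_module_hom R (free_module R k) (Y\<lparr>carrier := ?X\<rparr>)"
  have fY: "f \<in> left_module_hom R (free_module R k) Y" by (rule hom_into_submodule[OF f]) auto
  obtain q \<gamma> f' where 1: "\<gamma> \<in> left_module_hom R (free_module R k) (free_module R q)"
    "f' \<in> left_module_hom R (free_module R q) Y"
    "\<And>x. x \<in> carrier (free_module R k) \<Longrightarrow> f x = f' (\<gamma> x)"
    "\<And>x. x \<in> carrier (free_module R k) \<Longrightarrow> f x = \<zero>\<^bsub>Y\<^esub> \<Longrightarrow> \<gamma> x = \<zero>\<^bsub>free_module R q\<^esub>"
    by (rule flat_moduleE[OF fl(1) fY]) blast
  have pf: "(\<lambda>x. p (f' x)) \<in> left_module_hom R (free_module R q) W" by (rule hom_compose[OF 1(2) p])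
  obtain n \<eta> g' where 2: "\<eta> \<in> left_module_hom R (free_module R q) (free_module R n)"
    "g' \<in> left_module_hom R (free_module R n) W"
    "\<And>x. x \<in> carrier (free_module R q) \<Longrightarrow> p (f' x) = g' (\<eta> x)"
    "\<And>x. x \<in> carrier (free_module R q) \<Longrightarrow> p (f' x) = \<zero>\<^bsub>W\<^esub> \<Longrightarrow> \<eta> x = \<zero>\<^bsub>free_module R n\<^esub>"
    by (rule flat_moduleE[OF fl(2) pf]) blast
  obtain g where g: "g \<in> left_module_hom R (free_module R n) Y"
    "\<And>x. x \<in> carrier (free_module R n) \<Longrightarrow> p (g x) = g' x"
    by (rule free_hom_lift[OF Y W p 2(2)]) (use surj hom_closed[OF 2(2)] in auto)
  let ?f'' = "\<lambda>x. f' x \<ominus>\<^bsub>Y\<^esub> g (\<eta> x)"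
  have h: "?f'' \<in> left_module_hom R (free_module R q) Y"
    by (rule hom_diff[OF Y 1(2) hom_compose[OF 2(1) g(1)]])
  have "?f'' x \<in> ?X" if x: "x \<in> carrier (free_module R q)" for x
  proof -
    have c: "f' x \<in> carrier Y" "\<eta> x \<in> carrier (free_module R n)" "g (\<eta> x) \<in> carrier Y"
      using hom_closed 1(2) 2(1) g(1) x by metis+
    have "p (?f'' x) = g' (\<eta> x) \<ominus>\<^bsub>W\<^esub> g' (\<eta> x)"
      using hom_minus[OF Y W p c(1,3)] 2(3)[OF x] g(2)[OF c(2)] by simp
    also have "\<dots> = \<zero>\<^bsub>W\<^esub>" using W.M.diff_eq_zero_iff hom_closed[OF 2(2) c(2)] by blast
    finally show ?thesis using hom_closed[OF h x] by simp
  qed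
  then have h': "?f'' \<in> left_module_hom R (free_module R q) (Y\<lparr>carrier := ?X\<rparr>)"
    by (intro hom_codomain_submodule[OF h]) auto
  have "f x = ?f'' (\<gamma> x)" if x: "x \<in> carrier (free_module R k)" for x
  proof -
    have \<gamma>x: "\<gamma> x \<in> carrier (free_module R q)" using hom_closed[OF 1(1) x] .
    have fx: "f x \<in> carrier Y" "p (f x) = \<zero>\<^bsub>W\<^esub>" using hom_closed[OF f x] by auto
    then have "\<eta> (\<gamma> x) = \<zero>\<^bsub>free_module R n\<^esub>" using 2(4)[OF \<gamma>x] 1(3)[OF x] by simp
    then have "g (\<eta> (\<gamma> x)) = \<zero>\<^bsub>Y\<^esub>" using hom_zero[OF fr Y g(1)] by simp
    then show ?thesis using 1(3)[OF x] fx by (simp add: a_minus_def)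
  qed
  moreover have "\<gamma> x = \<zero>\<^bsub>free_module R q\<^esub>" if "x \<in> carrier (free_module R k)" "f x = \<zero>\<^bsub>Y\<lparr>carrier := ?X\<rparr>\<^esub>" for x
    using 1(4) that by simp
  ultimately show "\<exists>q \<gamma> f'. \<gamma> \<in> left_module_hom R (free_module R k) (free_module R q) \<and>
       f' \<in> left_module_hom R (free_module R q) (Y\<lparr>carrier := ?X\<rparr>) \<and>
         (\<forall>x \<in> carrier (free_module R k). f x = f' (\<gamma> x) \<and>
           (f x = \<zero>\<^bsub>Y\<lparr>carrier := ?X\<rparr>\<^esub> \<longrightarrow> \<gamma> x = \<zero>\<^bsub>free_module R q\<^esub>))"
    using 1(1) h' by blast
qed

definition pair_module :: "('a, 'm) module \<Rightarrow> ('a, 'n) module \<Rightarrow> ('a, 'm \<times> 'n) module" where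
  "pair_module M N =
    \<lparr>carrier = carrier M \<times> carrier N, monoid.mult = (\<lambda>_ _. undefined), one = undefined,
     ring.zero = (\<zero>\<^bsub>M\<^esub>, \<zero>\<^bsub>N\<^esub>), ring.add = (\<lambda>x y. (fst x \<oplus>\<^bsub>M\<^esub> fst y, snd x \<oplus>\<^bsub>N\<^esub> snd y)),
     smult = (\<lambda>a x. (a \<odot>\<^bsub>M\<^esub> fst x, a \<odot>\<^bsub>N\<^esub> snd x))\<rparr>"

lemma pair_module_simps:
  "carrier (pair_module M N) = carrier M \<times> carrier N"
  "\<zero>\<^bsub>pair_module M N\<^esub> = (\<zero>\<^bsub>M\<^esub>, \<zero>\<^bsub>N\<^esub>)"
  "x \<oplus>\<^bsub>pair_module M N\<^esub> y = (fst x \<oplus>\<^bsub>M\<^esub> fst y, snd x \<oplus>\<^bsub>N\<^esub> snd y)"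
  "a \<odot>\<^bsub>pair_module M N\<^esub> x = (a \<odot>\<^bsub>M\<^esub> fst x, a \<odot>\<^bsub>N\<^esub> snd x)"
  by (simp_all add: pair_module_def)

lemma pair_left_module:
  assumes "left_module R M" "left_module R N"
  shows "left_module R (pair_module M N)"
proof -
  interpret M: left_module R M by fact
  interpret N: left_module R N by fact
  have "abelian_group (pair_module M N)"
  proof (rule abelian_groupI)
    fix x assume "x \<in> carrier (pair_module M N)"
    then show "\<exists>y\<in>carrier (pair_module M N). y \<oplus>\<^bsub>pair_module M N\<^esub> x = \<zero>\<^bsub>pair_module M N\<^esub>"
      by (intro bexI[of _ "(\<ominus>\<^bsub>M\<^esub> fst x, \<ominus>\<^bsub>N\<^esub> snd x)"]) (auto simp: pair_module_simps M.M.l_neg N.M.l_neg)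
  qed (auto simp: pair_module_simps M.M.a_assoc N.M.a_assoc intro: M.M.a_comm N.M.a_comm)
  then show ?thesis
    using M.R.ring_axioms
    by (auto simp: left_module_def left_module_axioms_def pair_module_simps M.smult_closed N.smult_closed
        M.smult_l_distr N.smult_l_distr M.smult_r_distr N.smult_r_distr M.smult_assoc1 N.smult_assoc1
        M.smult_one N.smult_one)
qed

lemma fst_hom: "fst \<in> left_module_hom R (pair_module M N) M"
  and snd_hom: "snd \<in> left_module_hom R (pair_module M N) N"
  by (auto simp: left_module_hom_def pair_module_simps)

lemma pair_hom:
  assumes "f \<in> left_module_hom R L M" "g \<in> left_module_hom R L N"
  shows "(\<lambda>x. (f x, g x)) \<in> left_module_hom R L (pair_module M N)"
  using assms by (auto simp: left_module_hom_def pair_module_simps)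

lemma flat_pair_free:
  assumes C: "left_module R C" and fl: "flat_module R C"
  shows "flat_module R (pair_module (free_module R m) C)"
proof (rule flat_moduleI)
  interpret C: left_module R C by fact
  note fr = free_left_module[OF C.R.ring_axioms]
  fix k f assume f: "f \<in> left_module_hom R (free_module R k) (pair_module (free_module R m) C)"
  have f1: "(\<lambda>x. fst (f x)) \<in> left_module_hom R (free_module R k) (free_module R m)" by (rule hom_compose[OF f fst_hom])
  have f2: "(\<lambda>x. snd (f x)) \<in> left_module_hom R (free_module R k) C" by (rule hom_compose[OF f snd_hom])
  obtain q \<gamma> f' where 1: "\<gamma> \<in> left_module_hom R (free_module R k) (free_module R q)"
    "f' \<in> left_module_hom R (free_module R q) C"
    "\<And>x. x \<in> carrier (free_module R k) \<Longrightarrow> snd (f x) = f' (\<gamma> x)"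
    "\<And>x. x \<in> carrier (free_module R k) \<Longrightarrow> snd (f x) = \<zero>\<^bsub>C\<^esub> \<Longrightarrow> \<gamma> x = \<zero>\<^bsub>free_module R q\<^esub>"
    by (rule flat_moduleE[OF fl f2]) blast
  let ?\<gamma> = "\<lambda>x. row_append m (fst (f x)) (\<gamma> x)"
  let ?f = "\<lambda>c. (row_take R m c, f' (row_drop m c))"
  have g: "?\<gamma> \<in> left_module_hom R (free_module R k) (free_module R (m + q))" by (rule row_append_hom[OF f1 1(1)])
  have h: "?f \<in> left_module_hom R (free_module R (m + q)) (pair_module (free_module R m) C)"
    by (rule pair_hom[OF row_take_hom[OF C.R.ring_axioms] hom_compose[OF row_drop_hom 1(2)]])
  have "f x = ?f (?\<gamma> x)" if x: "x \<in> carrier (free_module R k)" for x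
    using row_append(2,3)[OF hom_closed[OF f1 x] hom_closed[OF 1(1) x]] 1(3)[OF x] by (simp add: prod_eq_iff)
  moreover have "?\<gamma> x = \<zero>\<^bsub>free_module R (m + q)\<^esub>"
    if x: "x \<in> carrier (free_module R k)" "f x = \<zero>\<^bsub>pair_module (free_module R m) C\<^esub>" for x
  proof -
    have "fst (f x) = (\<lambda>i. \<zero>\<^bsub>R\<^esub>)" "\<gamma> x = (\<lambda>i. \<zero>\<^bsub>R\<^esub>)"
      using x(2) 1(4)[OF x(1)] by (auto simp: pair_module_simps free_module_simps)
    then show ?thesis by (simp add: row_append_def free_module_simps fun_eq_iff)
  qed
  ultimately show "\<exists>q \<gamma> f'. \<gamma> \<in> left_module_hom R (free_module R k) (free_module R q) \<and>
       f' \<in> left_module_hom R (free_module R q) (pair_module (free_module R m) C) \<and>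
         (\<forall>x \<in> carrier (free_module R k). f x = f' (\<gamma> x) \<and>
           (f x = \<zero>\<^bsub>pair_module (free_module R m) C\<^esub> \<longrightarrow> \<gamma> x = \<zero>\<^bsub>free_module R q\<^esub>))"
    using g h by blast
qed

lemma flat_zero:
  assumes M: "left_module R M" and "carrier M = {\<zero>\<^bsub>M\<^esub>}"
  shows "flat_module R M"
proof (rule flat_moduleI)
  interpret M: left_module R M by fact
  note fr = free_left_module[OF M.R.ring_axioms]
  fix k f assume f: "f \<in> left_module_hom R (free_module R k) M"
  have "(\<lambda>_. \<zero>\<^bsub>free_module R 0\<^esub>) \<in> left_module_hom R (free_module R k) (free_module R 0)"
    by (rule left_module_homI) (auto simp: free_module_simps)
  moreover have "(\<lambda>_. \<zero>\<^bsub>M\<^esub>) \<in> left_module_hom R (free_module R 0) M"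
    by (rule left_module_homI) (auto simp: M.smult_zero_right)
  moreover have "f x = \<zero>\<^bsub>M\<^esub>" if "x \<in> carrier (free_module R k)" for x
    using hom_closed[OF f that] assms(2) by auto
  ultimately show "\<exists>q \<gamma> f'. \<gamma> \<in> left_module_hom R (free_module R k) (free_module R q) \<and>
       f' \<in> left_module_hom R (free_module R q) M \<and>
         (\<forall>x \<in> carrier (free_module R k). f x = f' (\<gamma> x) \<and> (f x = \<zero>\<^bsub>M\<^esub> \<longrightarrow> \<gamma> x = \<zero>\<^bsub>free_module R q\<^esub>))"
    by blast
qed

text \<open>The finitely generated projective modules, as retracts of finite free modules.\<close>

definition retract_of_free :: "('a, 'r) ring_scheme \<Rightarrow> ('a, 'm) module \<Rightarrow> bool" where
  "retract_of_free R M \<longleftrightarrow> (\<exists>k. \<exists>i \<in> left_module_hom R M (free_module R k).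
     \<exists>r \<in> left_module_hom R (free_module R k) M. \<forall>x \<in> carrier M. r (i x) = x)"

text \<open>If \<open>f\<close> is onto, then \<open>\<gamma>\<close>, which kills the kernel of \<open>f\<close>, descends to a section of \<open>f'\<close>.\<close>

lemma flat_fg_retract:
  assumes M: "left_module R M" and fl: "flat_module R M"
    and f: "f \<in> left_module_hom R (free_module R k) M" "f ` carrier (free_module R k) = carrier M"
  shows "retract_of_free R M"
proof -
  interpret M: left_module R M by fact
  note fr = free_left_module[OF M.R.ring_axioms]
  obtain q \<gamma> f' where 1: "\<gamma> \<in> left_module_hom R (free_module R k) (free_module R q)"
    "f' \<in> left_module_hom R (free_module R q) M"
    "\<And>x. x \<in> carrier (free_module R k) \<Longrightarrow> f x = f' (\<gamma> x)"
    "\<And>x. x \<in> carrier (free_module R k) \<Longrightarrow> f x = \<zero>\<^bsub>M\<^esub> \<Longrightarrow> \<gamma> x = \<zero>\<^bsub>free_module R q\<^esub>"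
    by (rule flat_moduleE[OF fl f(1)]) blast
  interpret F: left_module R "free_module R k" by (rule fr)
  interpret G: left_module R "free_module R q" by (rule fr)
  have wd: "\<gamma> x = \<gamma> y" if "x \<in> carrier (free_module R k)" "y \<in> carrier (free_module R k)" "f x = f y" for x y
  proof -
    have "f (x \<ominus>\<^bsub>free_module R k\<^esub> y) = \<zero>\<^bsub>M\<^esub>"
      using hom_minus[OF fr M f(1) that(1,2)] that M.M.diff_eq_zero_iff hom_closed[OF f(1)] by metis
    then have "\<gamma> x \<ominus>\<^bsub>free_module R q\<^esub> \<gamma> y = \<zero>\<^bsub>free_module R q\<^esub>"
      using 1(4)[of "x \<ominus>\<^bsub>free_module R k\<^esub> y"] hom_minus[OF fr fr 1(1) that(1,2)] that(1,2) by simp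
    then show ?thesis using G.M.diff_eq_zero_iff hom_closed[OF 1(1)] that(1,2) by blast
  qed
  define s where "s m = (SOME x. x \<in> carrier (free_module R k) \<and> f x = m)" for m
  have s: "s m \<in> carrier (free_module R k)" "f (s m) = m" if "m \<in> carrier M" for m
  proof -
    have "\<exists>x. x \<in> carrier (free_module R k) \<and> f x = m" using that f(2) by (metis imageE)
    then show "s m \<in> carrier (free_module R k)" "f (s m) = m" unfolding s_def by (rule someI2_ex; simp)+
  qed
  have "(\<lambda>m. \<gamma> (s m)) \<in> left_module_hom R M (free_module R q)"
  proof (rule left_module_homI)
    fix m assume "m \<in> carrier M"
    then show "\<gamma> (s m) \<in> carrier (free_module R q)" using hom_closed[OF 1(1)] s by auto
  next
    fix m n assume mn: "m \<in> carrier M" "n \<in> carrier M"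
    then have "\<gamma> (s (m \<oplus>\<^bsub>M\<^esub> n)) = \<gamma> (s m \<oplus>\<^bsub>free_module R k\<^esub> s n)"
      using s by (intro wd) (auto simp: hom_add[OF f(1)])
    then show "\<gamma> (s (m \<oplus>\<^bsub>M\<^esub> n)) = \<gamma> (s m) \<oplus>\<^bsub>free_module R q\<^esub> \<gamma> (s n)"
      using hom_add[OF 1(1)] s mn by simp
  next
    fix a m assume mn: "a \<in> carrier R" "m \<in> carrier M"
    then have "\<gamma> (s (a \<odot>\<^bsub>M\<^esub> m)) = \<gamma> (a \<odot>\<^bsub>free_module R k\<^esub> s m)"
      using s by (intro wd) (auto simp: hom_smult[OF f(1)] M.smult_closed F.smult_closed)
    then show "\<gamma> (s (a \<odot>\<^bsub>M\<^esub> m)) = a \<odot>\<^bsub>free_module R q\<^esub> \<gamma> (s m)"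
      using hom_smult[OF 1(1)] s mn by simp
  qed
  moreover have "f' (\<gamma> (s m)) = m" if "m \<in> carrier M" for m using 1(3) s that by metis
  ultimately show ?thesis
    unfolding retract_of_free_def by (intro exI[of _ q] bexI[of _ "\<lambda>m. \<gamma> (s m)"] bexI[OF _ 1(2)]) auto
qed

lemma retract_of_free_projective:
  fixes P :: "('a, 'm) module"
  assumes M: "left_module R P" and "retract_of_free R P"
  shows "projective R P" "finitely_generated R P"
proof -
  obtain k i r where ir: "i \<in> left_module_hom R P (free_module R k)" "r \<in> left_module_hom R (free_module R k) P"
    "\<And>x. x \<in> carrier P \<Longrightarrow> r (i x) = x"
    using assms(2) by (auto simp: retract_of_free_def)
  show "projective R P"
    unfolding projective_def
  proof (intro conjI allI impI M; elim conjE)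
    fix M :: "('a, 'm \<Rightarrow> 'a) module" and N :: "('a, 'm) module" and g h
    assume *: "left_module R M" "left_module R N" "g \<in> left_module_hom R M N" "g ` carrier M = carrier N"
      "h \<in> left_module_hom R P N"
    obtain l where l: "l \<in> left_module_hom R (free_module R k) M"
      "\<And>x. x \<in> carrier (free_module R k) \<Longrightarrow> g (l x) = h (r x)"
      by (rule free_hom_lift[OF *(1-3) hom_compose[OF ir(2) *(5)]])
        (use *(4) hom_closed[OF *(5) hom_closed[OF ir(2)]] in auto)
    have "(\<lambda>x. l (i x)) \<in> left_module_hom R P M" by (rule hom_compose[OF ir(1) l(1)])
    moreover have "\<forall>x\<in>carrier P. g (l (i x)) = h x" using l(2) hom_closed[OF ir(1)] ir(3) by auto
    ultimately show "\<exists>l\<in>left_module_hom R P M. \<forall>x\<in>carrier P. g (l x) = h x"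
      by (intro bexI[of _ "\<lambda>x. l (i x)"])
  qed
  have "r ` carrier (free_module R k) = carrier P"
    using hom_closed[OF ir(2)] hom_closed[OF ir(1)] ir(3) by force
  then show "finitely_generated R P" unfolding finitely_generated_iff[OF M] using ir(2) by blast
qed

text \<open>The definition of projectivity only tests modules on \<open>'m \<Rightarrow> 'a\<close>. The free cover of \<open>P\<close> by a
  finite generating set \<open>F\<close>, realised on functions supported on \<open>F\<close>, is such a test module.\<close>

definition free_on :: "('a, 'r) ring_scheme \<Rightarrow> 'i set \<Rightarrow> ('a, 'i \<Rightarrow> 'a) module" where
  "free_on R F =
    \<lparr>carrier = {x. (\<forall>i. x i \<in> carrier R) \<and> (\<forall>i. i \<notin> F \<longrightarrow> x i = \<zero>\<^bsub>R\<^esub>)},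
     monoid.mult = (\<lambda>_ _. undefined), one = undefined,
     ring.zero = (\<lambda>i. \<zero>\<^bsub>R\<^esub>), ring.add = (\<lambda>x y i. x i \<oplus>\<^bsub>R\<^esub> y i),
     smult = (\<lambda>a x i. a \<otimes>\<^bsub>R\<^esub> x i)\<rparr>"

lemma free_on_left_module:
  assumes "ring R"
  shows "left_module R (free_on R F)"
proof -
  interpret ring R by fact
  have "abelian_group (free_on R F)"
  proof (rule abelian_groupI)
    fix x assume "x \<in> carrier (free_on R F)"
    then show "\<exists>y\<in>carrier (free_on R F). y \<oplus>\<^bsub>free_on R F\<^esub> x = \<zero>\<^bsub>free_on R F\<^esub>"
      by (intro bexI[of _ "\<lambda>i. \<ominus>\<^bsub>R\<^esub> x i"]) (auto simp: free_on_def l_neg)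
  qed (auto simp: free_on_def a_assoc fun_eq_iff intro: a_comm)
  then show ?thesis
    using assms by (auto simp: left_module_def left_module_axioms_def free_on_def l_distr r_distr m_assoc)
qed

lemma projective_retract_of_free:
  assumes "projective R P" "finitely_generated R P"
  shows "retract_of_free R P"
proof -
  have P: "left_module R P" using assms(1) by (simp add: projective_def)
  interpret P: left_module R P by fact
  obtain F where F: "finite F" "F \<subseteq> carrier P" "\<And>N. submodule N R P \<Longrightarrow> F \<subseteq> N \<Longrightarrow> N = carrier P"
    using assms(2) by (auto simp: finitely_generated_def)
  let ?k = "card F"
  obtain g where g: "bij_betw g {..<?k} F"
    using ex_bij_betw_nat_finite[OF F(1)] by (auto simp: atLeast0LessThan)
  have gF: "g i \<in> F" if "i < ?k" for i using g that by (auto simp: bij_betw_def)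
  then have gP: "g i \<in> carrier P" if "i < ?k" for i using that F(2) by auto
  note fr = free_left_module[OF P.R.ring_axioms]
  let ?r = "\<lambda>x. lincomb P g x ?k"
  let ?T = "\<lambda>x i. if i < ?k then x (g i) else \<zero>\<^bsub>R\<^esub>"
  have r: "?r \<in> left_module_hom R (free_module R ?k) P" by (rule P.lincomb_hom[OF gP])
  have T: "?T \<in> left_module_hom R (free_on R F) (free_module R ?k)"
    by (rule left_module_homI) (auto simp: free_on_def free_module_simps)
  have T_surj: "?T ` carrier (free_on R F) = carrier (free_module R ?k)"
  proof
    show "?T ` carrier (free_on R F) \<subseteq> carrier (free_module R ?k)" using hom_closed[OF T] by blast
    show "carrier (free_module R ?k) \<subseteq> ?T ` carrier (free_on R F)"
    proof
      fix y assume y: "y \<in> carrier (free_module R ?k)"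
      let ?x = "\<lambda>p. if p \<in> F then y (the_inv_into {..<?k} g p) else \<zero>\<^bsub>R\<^esub>"
      have x: "?x \<in> carrier (free_on R F)" using y by (auto simp: free_on_def free_module_simps)
      have "?T ?x = y"
        using y gF g by (auto simp: free_module_simps fun_eq_iff bij_betw_def the_inv_into_f_f)
      then show "y \<in> ?T ` carrier (free_on R F)" by (rule image_eqI[OF sym x])
    qed
  qed
  have "submodule (?r ` carrier (free_module R ?k)) R P"
    by (rule submodule_image[OF fr P r submodule_carrier[OF fr]])
  moreover have "F \<subseteq> ?r ` carrier (free_module R ?k)"
  proof
    fix p assume "p \<in> F"
    then obtain i where "i < ?k" "p = g i" using g by (auto simp: bij_betw_def)
    then show "p \<in> ?r ` carrier (free_module R ?k)"
      by (intro image_eqI[of _ _ "unit_row R i"])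
        (simp_all add: P.lincomb_unit_row[OF gP] unit_row_in_free[OF P.R.ring_axioms])
  qed
  ultimately have r_surj: "?r ` carrier (free_module R ?k) = carrier P" using F(3) by blast
  have rT: "(\<lambda>x. ?r (?T x)) \<in> left_module_hom R (free_on R F) P" by (rule hom_compose[OF T r])
  have "(\<lambda>x. ?r (?T x)) ` carrier (free_on R F) = carrier P"
    unfolding r_surj[symmetric] T_surj[symmetric] by (simp add: image_image)
  then have "\<exists>l\<in>left_module_hom R P (free_on R F). \<forall>x\<in>carrier P. ?r (?T (l x)) = x"
    using assms(1)[unfolded projective_def, THEN conjunct2, rule_format, of "free_on R F" P "\<lambda>x. ?r (?T x)" "\<lambda>x. x"]
      free_on_left_module[OF P.R.ring_axioms, of F] rT hom_id[of R P] P by simp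
  then obtain l where l: "l \<in> left_module_hom R P (free_on R F)" "\<And>x. x \<in> carrier P \<Longrightarrow> ?r (?T (l x)) = x"
    by metis
  show ?thesis
    unfolding retract_of_free_def
    by (intro exI[of _ ?k] bexI[OF _ hom_compose[OF l(1) T]] bexI[OF _ r] ballI) (rule l(2))
qed

lemma opposite_ring_simps:
  "carrier (opposite_ring R) = carrier R" "\<zero>\<^bsub>opposite_ring R\<^esub> = \<zero>\<^bsub>R\<^esub>" "\<one>\<^bsub>opposite_ring R\<^esub> = \<one>\<^bsub>R\<^esub>"
  "x \<oplus>\<^bsub>opposite_ring R\<^esub> y = x \<oplus>\<^bsub>R\<^esub> y" "x \<otimes>\<^bsub>opposite_ring R\<^esub> y = y \<otimes>\<^bsub>R\<^esub> x"
  by (simp_all add: opposite_ring_def)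

lemma opposite_ring:
  assumes "ring R"
  shows "ring (opposite_ring R)"
proof -
  interpret ring R by fact
  show ?thesis
  proof (rule ringI)
    show "abelian_group (opposite_ring R)"
    proof (rule abelian_groupI)
      fix x assume "x \<in> carrier (opposite_ring R)"
      then show "\<exists>y\<in>carrier (opposite_ring R). y \<oplus>\<^bsub>opposite_ring R\<^esub> x = \<zero>\<^bsub>opposite_ring R\<^esub>"
        by (intro bexI[of _ "\<ominus>\<^bsub>R\<^esub> x"]) (auto simp: opposite_ring_simps l_neg)
    qed (auto simp: opposite_ring_simps a_assoc intro: a_comm)
    show "Group.monoid (opposite_ring R)"
      by (rule Group.monoid.intro) (auto simp: opposite_ring_simps m_assoc)
  qed (auto simp: opposite_ring_simps l_distr r_distr)
qed

lemma lincomb_opposite: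
  "lincomb (regular_module (opposite_ring R)) x v k = lincomb (regular_module R) v x k"
  by (induction k) (auto simp: regular_module_simps opposite_ring_simps)

lemma lincomb_free_apply:
  "lincomb (free_module R q) g x k j = lincomb (regular_module R) (\<lambda>i. g i j) x k"
  by (induction k) (auto simp: regular_module_simps free_module_simps)

lemma product_module_simps:
  "carrier (product_module X N) = (\<Pi>\<^sub>E i\<in>X. carrier (N i))"
  "\<zero>\<^bsub>product_module X N\<^esub> = (\<lambda>i\<in>X. \<zero>\<^bsub>N i\<^esub>)"
  "x \<oplus>\<^bsub>product_module X N\<^esub> y = (\<lambda>i\<in>X. x i \<oplus>\<^bsub>N i\<^esub> y i)"
  "a \<odot>\<^bsub>product_module X N\<^esub> x = (\<lambda>i\<in>X. a \<odot>\<^bsub>N i\<^esub> x i)"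
  by (simp_all add: product_module_def)

lemma lincomb_product_apply:
  "\<xi> \<in> X \<Longrightarrow> lincomb (product_module X N) g x k \<xi> = lincomb (N \<xi>) (\<lambda>i. g i \<xi>) x k"
  by (induction k) (auto simp: product_module_simps)

lemma product_left_module:
  assumes "ring R" "\<And>i. i \<in> X \<Longrightarrow> left_module R (N i)"
  shows "left_module R (product_module X N)"
proof -
  interpret R: ring R by fact
  note ab = left_module.axioms(2)[OF assms(2)]
  note mo = left_module.smult_closed[OF assms(2)] left_module.smult_l_distr[OF assms(2)]
    left_module.smult_r_distr[OF assms(2)] left_module.smult_assoc1[OF assms(2)] left_module.smult_one[OF assms(2)]
  have closed: "\<And>i x y. i \<in> X \<Longrightarrow> x \<in> carrier (N i) \<Longrightarrow> y \<in> carrier (N i) \<Longrightarrow> x \<oplus>\<^bsub>N i\<^esub> y \<in> carrier (N i)"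
    "\<And>i. i \<in> X \<Longrightarrow> \<zero>\<^bsub>N i\<^esub> \<in> carrier (N i)"
    using ab by (auto simp: abelian_group_def intro: abelian_monoid.a_closed abelian_monoid.zero_closed)
  have "abelian_group (product_module X N)"
  proof (rule abelian_groupI)
    fix x assume x: "x \<in> carrier (product_module X N)"
    show "\<exists>y\<in>carrier (product_module X N). y \<oplus>\<^bsub>product_module X N\<^esub> x = \<zero>\<^bsub>product_module X N\<^esub>"
      by (rule bexI[of _ "\<lambda>i\<in>X. \<ominus>\<^bsub>N i\<^esub> x i"])
        (use x in \<open>auto simp: product_module_simps PiE_iff abelian_group.l_neg[OF ab] abelian_group.a_inv_closed[OF ab]\<close>)
    show "\<zero>\<^bsub>product_module X N\<^esub> \<oplus>\<^bsub>product_module X N\<^esub> x = x"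
      by (rule extensionalityI[of _ X])
        (use x in \<open>auto simp: product_module_simps PiE_iff abelian_monoid.l_zero[OF abelian_group.axioms(1)[OF ab]]\<close>)
  next
    fix x y assume x: "x \<in> carrier (product_module X N)" and y: "y \<in> carrier (product_module X N)"
    show "x \<oplus>\<^bsub>product_module X N\<^esub> y = y \<oplus>\<^bsub>product_module X N\<^esub> x"
      unfolding product_module_simps
      by (rule restrict_ext) (use x y in \<open>auto simp: product_module_simps PiE_iff
          intro: abelian_monoid.a_comm[OF abelian_group.axioms(1)[OF ab]]\<close>)
    fix z assume z: "z \<in> carrier (product_module X N)"
    show "x \<oplus>\<^bsub>product_module X N\<^esub> y \<oplus>\<^bsub>product_module X N\<^esub> z = x \<oplus>\<^bsub>product_module X N\<^esub> (y \<oplus>\<^bsub>product_module X N\<^esub> z)"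
      unfolding product_module_simps
      by (rule restrict_ext) (use x y z in \<open>auto simp: product_module_simps PiE_iff
          intro: abelian_monoid.a_assoc[OF abelian_group.axioms(1)[OF ab]]\<close>)
  qed (auto simp: product_module_simps closed PiE_iff)
  moreover have "left_module_axioms R (product_module X N)"
  proof
    show "a \<odot>\<^bsub>product_module X N\<^esub> x \<in> carrier (product_module X N)" if "a \<in> carrier R" "x \<in> carrier (product_module X N)" for a x
      using that by (auto simp: product_module_simps PiE_iff mo)
    show "(a \<oplus>\<^bsub>R\<^esub> b) \<odot>\<^bsub>product_module X N\<^esub> x = a \<odot>\<^bsub>product_module X N\<^esub> x \<oplus>\<^bsub>product_module X N\<^esub> b \<odot>\<^bsub>product_module X N\<^esub> x"
      if "a \<in> carrier R" "b \<in> carrier R" "x \<in> carrier (product_module X N)" for a b x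
      using that by (auto simp: product_module_simps PiE_iff mo fun_eq_iff restrict_def)
    show "a \<odot>\<^bsub>product_module X N\<^esub> (x \<oplus>\<^bsub>product_module X N\<^esub> y) = a \<odot>\<^bsub>product_module X N\<^esub> x \<oplus>\<^bsub>product_module X N\<^esub> a \<odot>\<^bsub>product_module X N\<^esub> y"
      if "a \<in> carrier R" "x \<in> carrier (product_module X N)" "y \<in> carrier (product_module X N)" for a x y
      using that by (auto simp: product_module_simps PiE_iff mo fun_eq_iff restrict_def)
    show "(a \<otimes>\<^bsub>R\<^esub> b) \<odot>\<^bsub>product_module X N\<^esub> x = a \<odot>\<^bsub>product_module X N\<^esub> (b \<odot>\<^bsub>product_module X N\<^esub> x)"
      if "a \<in> carrier R" "b \<in> carrier R" "x \<in> carrier (product_module X N)" for a b x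
      using that by (auto simp: product_module_simps PiE_iff mo fun_eq_iff restrict_def)
    show "\<one>\<^bsub>R\<^esub> \<odot>\<^bsub>product_module X N\<^esub> x = x" if "x \<in> carrier (product_module X N)" for x
      by (rule extensionalityI[of _ X]) (use that in \<open>auto simp: product_module_simps PiE_iff mo\<close>)
  qed
  ultimately show ?thesis using assms(1) by (simp add: left_module_def)
qed

text \<open>Products of copies of a right noetherian ring are flat. A homomorphism from \<open>R\<^sup>k\<close> into such a
  product is a family of columns of length \<open>k\<close>, all of which lie in the right module \<open>V\<close> of columns
  that are annihilated by the rows in its kernel. A finite generating set of \<open>V\<close> gives the matrix
  through which the homomorphism factors.\<close>

lemma flat_retract_of_product:
  fixes X :: "'i set"
  assumes M: "left_module R M"
    and noeth: "noetherian_module (opposite_ring R) (regular_module (opposite_ring R))"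
    and l: "l \<in> left_module_hom R M (product_module X (\<lambda>_. regular_module R))"
    and r: "r \<in> left_module_hom R (product_module X (\<lambda>_. regular_module R)) M"
    and rl: "\<And>x. x \<in> carrier M \<Longrightarrow> r (l x) = x"
  shows "flat_module R M"
proof (rule flat_moduleI)
  interpret M: left_module R M by fact
  note Rr = M.R.ring_axioms
  note fr = free_left_module[OF Rr] and Rg = regular_left_module[OF Rr]
  let ?O = "opposite_ring R" and ?Pr = "product_module X (\<lambda>_. regular_module R)"
  note Or = opposite_ring[OF Rr]
  note fro = free_left_module[OF Or]
  have Pr: "left_module R ?Pr" by (rule product_left_module[OF Rr Rg])
  interpret Fo: left_module ?O "free_module ?O k" for k by (rule fro)
  fix k f assume f: "f \<in> left_module_hom R (free_module R k) M"
  let ?K = "{x \<in> carrier (free_module R k). f x = \<zero>\<^bsub>M\<^esub>}"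
  define V where "V = {v \<in> carrier (free_module ?O k). \<forall>x\<in>?K. lincomb (regular_module R) v x k = \<zero>\<^bsub>R\<^esub>}"
  have row: "(\<lambda>v. lincomb (regular_module R) v x k) \<in> left_module_hom ?O (free_module ?O k) (regular_module ?O)"
    if "x \<in> ?K" for x
    using left_module.lincomb_hom[OF regular_left_module[OF Or], of k x] that
    by (simp add: lincomb_opposite) (simp add: free_module_simps regular_module_simps opposite_ring_simps)
  have "submodule V ?O (free_module ?O k)"
  proof (rule Fo.submoduleI)
    show "V \<subseteq> carrier (free_module ?O k)" by (auto simp: V_def)
    show "\<zero>\<^bsub>free_module ?O k\<^esub> \<in> V"
      using hom_zero[OF fro regular_left_module[OF Or] row] unfolding V_def
      by (simp add: regular_module_simps opposite_ring_simps)
  next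
    fix v w assume "v \<in> V" "w \<in> V"
    then show "v \<oplus>\<^bsub>free_module ?O k\<^esub> w \<in> V"
      unfolding V_def by (simp add: hom_add[OF row] regular_module_simps opposite_ring_simps)
  next
    fix a v assume "a \<in> carrier ?O" "v \<in> V"
    then show "a \<odot>\<^bsub>free_module ?O k\<^esub> v \<in> V"
      unfolding V_def by (simp add: hom_smult[OF row] Fo.smult_closed) (simp add: regular_module_simps opposite_ring_simps)
  qed
  then obtain q u where u: "u \<in> left_module_hom ?O (free_module ?O q) (free_module ?O k)"
      "u ` carrier (free_module ?O q) = V"
    using noetherian_free_submodule_fg[OF Or noeth] unfolding fg_mod_zero_iff[OF fro] by blast
  define v where "v j = u (unit_row ?O j)" for j
  have vV: "v j \<in> V" if "j < q" for j using u(2) unit_row_in_free[OF Or that] by (auto simp: v_def)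
  have vR: "v j i \<in> carrier R" if "j < q" for i j using vV[OF that] by (auto simp: V_def free_module_simps opposite_ring_simps)
  have u_apply: "u c i = lincomb (regular_module R) c (\<lambda>j. v j i) q" if "c \<in> carrier (free_module ?O q)" for c i
    using free_hom_eq_lincomb[OF fro u(1) that] by (simp add: v_def lincomb_free_apply lincomb_opposite)
  let ?g = "\<lambda>i j. if j < q then v j i else \<zero>\<^bsub>R\<^esub>"
  let ?\<gamma> = "\<lambda>x. lincomb (free_module R q) ?g x k"
  have g: "?g i \<in> carrier (free_module R q)" for i using vR by (auto simp: free_module_simps)
  interpret F: left_module R "free_module R q" by (rule fr)
  have \<gamma>: "?\<gamma> \<in> left_module_hom R (free_module R k) (free_module R q)" by (rule F.lincomb_hom[OF g])
  have \<gamma>K: "?\<gamma> x = \<zero>\<^bsub>free_module R q\<^esub>" if x: "x \<in> ?K" for x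
  proof
    fix j
    show "?\<gamma> x j = \<zero>\<^bsub>free_module R q\<^esub> j"
    proof (cases "j < q")
      case True
      then show ?thesis
        using vV[OF True] x by (simp add: lincomb_free_apply V_def) (simp add: free_module_simps)
    next
      case False
      then show ?thesis
        using hom_closed[OF \<gamma>, of x] x by (simp add: free_module_simps)
    qed
  qed
  let ?e = "\<lambda>i. f (unit_row R i)"
  have e: "?e i \<in> carrier M" if "i < k" for i using hom_closed[OF f unit_row_in_free[OF Rr that]] .
  \<comment> \<open>The components of \<open>l \<circ> f\<close>. They lie in \<open>V\<close>, hence are combinations, with coefficients \<open>c \<xi>\<close>, of
    the columns \<open>v j\<close>.\<close>
  define col where "col \<xi> = (\<lambda>i. if i < k then l (?e i) \<xi> else \<zero>\<^bsub>R\<^esub>)" for \<xi>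
  have colV: "col \<xi> \<in> V" if \<xi>: "\<xi> \<in> X" for \<xi>
  proof -
    have "col \<xi> \<in> carrier (free_module ?O k)"
      using hom_closed[OF l e] \<xi>
      by (fastforce simp: col_def free_module_simps opposite_ring_simps product_module_simps PiE_iff regular_module_simps)
    moreover have "lincomb (regular_module R) (col \<xi>) x k = \<zero>\<^bsub>R\<^esub>" if x: "x \<in> ?K" for x
    proof -
      have "lincomb (regular_module R) (col \<xi>) x k = lincomb (regular_module R) (\<lambda>i. l (?e i) \<xi>) x k"
        by (rule left_module.lincomb_cong[OF Rg]) (auto simp: col_def)
      also have "\<dots> = lincomb ?Pr (\<lambda>i. l (?e i)) x k \<xi>" using \<xi> by (simp add: lincomb_product_apply)
      also have "lincomb ?Pr (\<lambda>i. l (?e i)) x k = l (f x)"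
        by (rule free_hom_eq_lincomb[OF Pr hom_compose[OF f l], symmetric]) (use x in simp)
      also have "\<dots> \<xi> = \<zero>\<^bsub>R\<^esub>" using x \<xi> hom_zero[OF M Pr l] by (simp add: product_module_simps regular_module_simps)
      finally show ?thesis .
    qed
    ultimately show ?thesis by (simp add: V_def)
  qed
  then have "\<exists>c. c \<in> carrier (free_module ?O q) \<and> u c = col \<xi>" if "\<xi> \<in> X" for \<xi> using u(2) that by (metis imageE)
  then obtain c where c: "\<And>\<xi>. \<xi> \<in> X \<Longrightarrow> c \<xi> \<in> carrier (free_module ?O q)" "\<And>\<xi>. \<xi> \<in> X \<Longrightarrow> u (c \<xi>) = col \<xi>" by metis
  let ?y = "\<lambda>j. (\<lambda>\<xi>\<in>X. c \<xi> j)"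
  have y: "?y j \<in> carrier ?Pr" for j
    using c(1) by (auto simp: product_module_simps regular_module_simps free_module_simps opposite_ring_simps)
  let ?f' = "\<lambda>z. lincomb M (\<lambda>j. r (?y j)) z q"
  have f': "?f' \<in> left_module_hom R (free_module R q) M" by (rule M.lincomb_hom) (rule hom_closed[OF r y])
  have "f x = ?f' (?\<gamma> x)" if x: "x \<in> carrier (free_module R k)" for x
  proof (rule free_hom_eqI[OF M f hom_compose[OF \<gamma> f'] _ x])
    fix i assume i: "i < k"
    have "?f' (?\<gamma> (unit_row R i)) = ?f' (?g i)" by (simp add: F.lincomb_unit_row[OF g i])
    also have "\<dots> = lincomb M (\<lambda>j. r (?y j)) (\<lambda>j. v j i) q" by (rule M.lincomb_cong) auto
    also have "\<dots> = r (lincomb ?Pr ?y (\<lambda>j. v j i) q)"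
      by (rule hom_lincomb[OF Pr M r, symmetric]) (use y vR in auto)
    also have "lincomb ?Pr ?y (\<lambda>j. v j i) q = l (?e i)"
    proof (rule extensionalityI[of _ X])
      show "lincomb ?Pr ?y (\<lambda>j. v j i) q \<in> extensional X"
        using left_module.lincomb_closed[OF Pr, of q ?y "\<lambda>j. v j i"] y vR by (auto simp: product_module_simps PiE_def)
      show "l (?e i) \<in> extensional X" using hom_closed[OF l e[OF i]] by (auto simp: product_module_simps PiE_def)
      fix \<xi> assume \<xi>: "\<xi> \<in> X"
      have "lincomb ?Pr ?y (\<lambda>j. v j i) q \<xi> = lincomb (regular_module R) (c \<xi>) (\<lambda>j. v j i) q"
        using \<xi> by (simp add: lincomb_product_apply)
      also have "\<dots> = col \<xi> i" using u_apply[OF c(1)[OF \<xi>], of i] c(2)[OF \<xi>] by simp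
      also have "\<dots> = l (?e i) \<xi>" using i by (simp add: col_def)
      finally show "lincomb ?Pr ?y (\<lambda>j. v j i) q \<xi> = l (?e i) \<xi>" .
    qed
    finally have "?f' (?\<gamma> (unit_row R i)) = r (l (?e i))" .
    then show "f (unit_row R i) = ?f' (?\<gamma> (unit_row R i))" by (simp only: rl[OF e[OF i]])
  qed
  then show "\<exists>q \<gamma> f'. \<gamma> \<in> left_module_hom R (free_module R k) (free_module R q) \<and>
       f' \<in> left_module_hom R (free_module R q) M \<and>
         (\<forall>x \<in> carrier (free_module R k). f x = f' (\<gamma> x) \<and> (f x = \<zero>\<^bsub>M\<^esub> \<longrightarrow> \<gamma> x = \<zero>\<^bsub>free_module R q\<^esub>))"
    using \<gamma> f' \<gamma>K by (intro exI[of _ q] exI[of _ ?\<gamma>] exI[of _ ?f']) auto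
qed

section \<open>Cohomology in terms of elements\<close>

lemma cochain_complexD:
  assumes "cochain_complex R C"
  shows "left_module R (obj C n)" "diff C n \<in> left_module_hom R (obj C n) (obj C (n + 1))"
    "diff C (n - 1) \<in> left_module_hom R (obj C (n - 1)) (obj C n)"
    "x \<in> carrier (obj C n) \<Longrightarrow> diff C (n + 1) (diff C n x) = \<zero>\<^bsub>obj C (n + 1 + 1)\<^esub>"
    "y \<in> carrier (obj C (n - 1)) \<Longrightarrow> diff C n (diff C (n - 1) y) = \<zero>\<^bsub>obj C (n + 1)\<^esub>"
proof -
  show "left_module R (obj C n)" "diff C n \<in> left_module_hom R (obj C n) (obj C (n + 1))"
    "x \<in> carrier (obj C n) \<Longrightarrow> diff C (n + 1) (diff C n x) = \<zero>\<^bsub>obj C (n + 1 + 1)\<^esub>"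
    using assms by (auto simp: cochain_complex_def)
  have "diff C (n - 1) \<in> left_module_hom R (obj C (n - 1)) (obj C (n - 1 + 1))"
    "y \<in> carrier (obj C (n - 1)) \<Longrightarrow> diff C (n - 1 + 1) (diff C (n - 1) y) = \<zero>\<^bsub>obj C (n - 1 + 1 + 1)\<^esub>"
    using assms unfolding cochain_complex_def by blast+
  then show "diff C (n - 1) \<in> left_module_hom R (obj C (n - 1)) (obj C n)"
    "y \<in> carrier (obj C (n - 1)) \<Longrightarrow> diff C n (diff C (n - 1) y) = \<zero>\<^bsub>obj C (n + 1)\<^esub>"
    by simp_all
qed

lemma cocycles_submodule:
  assumes "cochain_complex R C"
  shows "submodule (cocycles C n) R (obj C n)"
  unfolding cocycles_def
  by (rule submodule_kernel[OF cochain_complexD(1)[OF assms] cochain_complexD(1)[OF assms] cochain_complexD(2)[OF assms]])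

lemma coboundaries_submodule:
  assumes "cochain_complex R C"
  shows "submodule (coboundaries C n) R (obj C n)"
  unfolding coboundaries_def
  by (rule submodule_image[OF cochain_complexD(1)[OF assms] cochain_complexD(1)[OF assms] cochain_complexD(3)[OF assms]
        submodule_carrier[OF cochain_complexD(1)[OF assms]]])

lemma coboundaries_subset_cocycles:
  assumes "cochain_complex R C"
  shows "coboundaries C n \<subseteq> cocycles C n"
  using cochain_complexD(5)[OF assms] hom_closed[OF cochain_complexD(3)[OF assms]]
  by (auto simp: coboundaries_def cocycles_def)

definition coset :: "('a, 'm) module \<Rightarrow> 'm set \<Rightarrow> 'm \<Rightarrow> 'm set" where
  "coset M N z = {b \<oplus>\<^bsub>M\<^esub> z | b. b \<in> N}"

lemma coset_eq_iff:
  assumes "left_module R M" "submodule N R M" "z \<in> carrier M" "w \<in> carrier M"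
  shows "coset M N z = coset M N w \<longleftrightarrow> (\<exists>b\<in>N. z = b \<oplus>\<^bsub>M\<^esub> w)"
proof
  interpret M: left_module R M by fact
  note N = submoduleD[OF assms(2)]
  have "z = \<zero>\<^bsub>M\<^esub> \<oplus>\<^bsub>M\<^esub> z" using assms(3) by simp
  then have z: "z \<in> coset M N z" using N(2) by (auto simp: coset_def)
  show "coset M N z = coset M N w \<Longrightarrow> \<exists>b\<in>N. z = b \<oplus>\<^bsub>M\<^esub> w"
    using z by (auto simp: coset_def)
  assume "\<exists>b\<in>N. z = b \<oplus>\<^bsub>M\<^esub> w"
  then obtain b where b: "b \<in> N" "z = b \<oplus>\<^bsub>M\<^esub> w" by blast
  then have w: "w = (\<ominus>\<^bsub>M\<^esub> b) \<oplus>\<^bsub>M\<^esub> z" using assms(4) N(1) by (simp add: M.M.r_neg1 subset_iff)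
  have "c \<oplus>\<^bsub>M\<^esub> z \<in> coset M N w" if c: "c \<in> N" for c
    using c N(1) b N(3)[OF c b(1)] assms(4) by (auto simp: coset_def M.M.a_assoc subset_iff intro!: exI[of _ "c \<oplus>\<^bsub>M\<^esub> b"])
  moreover have "c \<oplus>\<^bsub>M\<^esub> w \<in> coset M N z" if c: "c \<in> N" for c
  proof -
    have "c \<oplus>\<^bsub>M\<^esub> w = (c \<oplus>\<^bsub>M\<^esub> (\<ominus>\<^bsub>M\<^esub> b)) \<oplus>\<^bsub>M\<^esub> z"
      by (subst w) (use c b N(1) assms(3) in \<open>simp add: M.M.a_assoc subset_iff\<close>)
    then show ?thesis using N(3)[OF c N(5)[OF b(1)]] by (auto simp: coset_def)
  qed
  ultimately show "coset M N z = coset M N w" unfolding coset_def[of M N z] coset_def[of M N w]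
    by (auto simp: coset_def)
qed

lemma coset_zero_iff:
  assumes "left_module R M" "submodule N R M" "z \<in> carrier M"
  shows "coset M N z = N \<longleftrightarrow> z \<in> N"
proof -
  interpret M: left_module R M by fact
  note N = submoduleD[OF assms(2)]
  have "coset M N \<zero>\<^bsub>M\<^esub> = N" using N(1) by (force simp: coset_def)
  then have "coset M N z = N \<longleftrightarrow> coset M N z = coset M N \<zero>\<^bsub>M\<^esub>" by simp
  also have "\<dots> \<longleftrightarrow> (\<exists>b\<in>N. z = b \<oplus>\<^bsub>M\<^esub> \<zero>\<^bsub>M\<^esub>)" by (rule coset_eq_iff[OF assms M.M.zero_closed])
  also have "\<dots> \<longleftrightarrow> z \<in> N" using N(1) by (auto simp: subset_iff)
  finally show ?thesis .
qed

lemma coset_add: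
  assumes "left_module R M" "submodule N R M" "z \<in> carrier M" "w \<in> carrier M"
  shows "coset M N z <+>\<^bsub>M\<^esub> coset M N w = coset M N (z \<oplus>\<^bsub>M\<^esub> w)"
proof -
  interpret M: left_module R M by fact
  note N = submoduleD[OF assms(2)]
  have "(b \<oplus>\<^bsub>M\<^esub> z) \<oplus>\<^bsub>M\<^esub> (c \<oplus>\<^bsub>M\<^esub> w) = (b \<oplus>\<^bsub>M\<^esub> c) \<oplus>\<^bsub>M\<^esub> (z \<oplus>\<^bsub>M\<^esub> w)" if "b \<in> N" "c \<in> N" for b c
    using that N(1) assms(3,4) by (simp add: M.M.a_ac subset_iff)
  moreover have "b \<oplus>\<^bsub>M\<^esub> (z \<oplus>\<^bsub>M\<^esub> w) = (b \<oplus>\<^bsub>M\<^esub> z) \<oplus>\<^bsub>M\<^esub> (\<zero>\<^bsub>M\<^esub> \<oplus>\<^bsub>M\<^esub> w)" if "b \<in> N" for b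
    using that N(1) assms(3,4) by (simp add: M.M.a_ac subset_iff)
  ultimately have 2: "\<And>b c. b \<in> N \<Longrightarrow> c \<in> N \<Longrightarrow> (b \<oplus>\<^bsub>M\<^esub> z) \<oplus>\<^bsub>M\<^esub> (c \<oplus>\<^bsub>M\<^esub> w) = (b \<oplus>\<^bsub>M\<^esub> c) \<oplus>\<^bsub>M\<^esub> (z \<oplus>\<^bsub>M\<^esub> w)"
    "\<And>b. b \<in> N \<Longrightarrow> b \<oplus>\<^bsub>M\<^esub> (z \<oplus>\<^bsub>M\<^esub> w) = (b \<oplus>\<^bsub>M\<^esub> z) \<oplus>\<^bsub>M\<^esub> (\<zero>\<^bsub>M\<^esub> \<oplus>\<^bsub>M\<^esub> w)" by simp_all
  show ?thesis
  proof (intro equalityI subsetI)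
    fix u assume "u \<in> coset M N z <+>\<^bsub>M\<^esub> coset M N w"
    then obtain b c where b: "b \<in> N" "c \<in> N" "u = (b \<oplus>\<^bsub>M\<^esub> z) \<oplus>\<^bsub>M\<^esub> (c \<oplus>\<^bsub>M\<^esub> w)"
      unfolding set_add_def' coset_def by blast
    then show "u \<in> coset M N (z \<oplus>\<^bsub>M\<^esub> w)"
      unfolding coset_def using 2(1)[OF b(1,2)] N(3)[OF b(1,2)] by blast
  next
    fix u assume "u \<in> coset M N (z \<oplus>\<^bsub>M\<^esub> w)"
    then obtain b where b: "b \<in> N" "u = b \<oplus>\<^bsub>M\<^esub> (z \<oplus>\<^bsub>M\<^esub> w)" unfolding coset_def by blast
    then show "u \<in> coset M N z <+>\<^bsub>M\<^esub> coset M N w"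
      unfolding set_add_def' coset_def using 2(2)[OF b(1)] N(2) by blast
  qed
qed

lemma coset_of_image:
  assumes "left_module R M" "left_module R M'" "submodule N R M" "submodule N' R M'" "Z \<subseteq> carrier M" "N \<subseteq> Z"
    and h: "\<And>x. x \<in> Z \<Longrightarrow> h x \<in> carrier M'" "\<And>x y. x \<in> Z \<Longrightarrow> y \<in> Z \<Longrightarrow> h (x \<oplus>\<^bsub>M\<^esub> y) = h x \<oplus>\<^bsub>M'\<^esub> h y"
    and "h ` N \<subseteq> N'" "z \<in> Z"
  shows "N' <+>\<^bsub>M'\<^esub> (h ` coset M N z) = coset M' N' (h z)"
proof -
  interpret M: left_module R M by fact
  interpret M': left_module R M' by fact
  note N = submoduleD[OF assms(3)] and N' = submoduleD[OF assms(4)]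
  have hN: "h b \<in> N'" if "b \<in> N" for b using assms(9) that by blast
  have "c \<oplus>\<^bsub>M'\<^esub> h (b \<oplus>\<^bsub>M\<^esub> z) = (c \<oplus>\<^bsub>M'\<^esub> h b) \<oplus>\<^bsub>M'\<^esub> h z" if "b \<in> N" "c \<in> N'" for b c
  proof -
    have "h (b \<oplus>\<^bsub>M\<^esub> z) = h b \<oplus>\<^bsub>M'\<^esub> h z" using h(2) that(1) assms(6,10) by blast
    then show ?thesis using hN[OF that(1)] that(2) N'(1) h(1)[OF assms(10)] by (simp add: M'.M.a_assoc subset_iff)
  qed
  moreover have "c \<oplus>\<^bsub>M'\<^esub> h z = c \<oplus>\<^bsub>M'\<^esub> h (\<zero>\<^bsub>M\<^esub> \<oplus>\<^bsub>M\<^esub> z)" for c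
    using assms(5,10) by (simp add: subset_iff)
  ultimately have 2: "\<And>b c. b \<in> N \<Longrightarrow> c \<in> N' \<Longrightarrow> c \<oplus>\<^bsub>M'\<^esub> h (b \<oplus>\<^bsub>M\<^esub> z) = (c \<oplus>\<^bsub>M'\<^esub> h b) \<oplus>\<^bsub>M'\<^esub> h z"
    "\<And>c. c \<oplus>\<^bsub>M'\<^esub> h z = c \<oplus>\<^bsub>M'\<^esub> h (\<zero>\<^bsub>M\<^esub> \<oplus>\<^bsub>M\<^esub> z)" by simp_all
  show ?thesis
  proof (intro equalityI subsetI)
    fix u assume "u \<in> N' <+>\<^bsub>M'\<^esub> (h ` coset M N z)"
    then obtain b c where b: "b \<in> N" "c \<in> N'" "u = c \<oplus>\<^bsub>M'\<^esub> h (b \<oplus>\<^bsub>M\<^esub> z)"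
      unfolding set_add_def' coset_def by blast
    then show "u \<in> coset M' N' (h z)"
      unfolding coset_def using 2(1)[OF b(1,2)] N'(3)[OF b(2) hN[OF b(1)]] by blast
  next
    fix u assume "u \<in> coset M' N' (h z)"
    then obtain c where c: "c \<in> N'" "u = c \<oplus>\<^bsub>M'\<^esub> h z" unfolding coset_def by blast
    then show "u \<in> N' <+>\<^bsub>M'\<^esub> (h ` coset M N z)"
      unfolding set_add_def' coset_def using 2(2)[of c] N(2) by blast
  qed
qed

lemma cohomology_simps:
  "carrier (cohomology C n) = coset (obj C n) (coboundaries C n) ` cocycles C n"
  "\<zero>\<^bsub>cohomology C n\<^esub> = coboundaries C n"
  "U \<oplus>\<^bsub>cohomology C n\<^esub> V = U <+>\<^bsub>obj C n\<^esub> V"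
  "a \<odot>\<^bsub>cohomology C n\<^esub> U = coboundaries C n <+>\<^bsub>obj C n\<^esub> ((\<lambda>x. a \<odot>\<^bsub>obj C n\<^esub> x) ` U)"
  by (auto simp: cohomology_def quotient_module_def A_RCOSETS_def' a_r_coset_def' set_add_def' coset_def)

lemma cohomology_smult_coset:
  assumes "cochain_complex R C" "a \<in> carrier R" "z \<in> cocycles C n"
  shows "a \<odot>\<^bsub>cohomology C n\<^esub> coset (obj C n) (coboundaries C n) z =
    coset (obj C n) (coboundaries C n) (a \<odot>\<^bsub>obj C n\<^esub> z)"
proof -
  interpret M: left_module R "obj C n" using cochain_complexD(1)[OF assms(1)] .
  note B = submoduleD[OF coboundaries_submodule[OF assms(1)]] and Z = submoduleD(1)[OF cocycles_submodule[OF assms(1)]]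
  show ?thesis
    unfolding cohomology_simps
  proof (rule coset_of_image[OF M.left_module_axioms M.left_module_axioms coboundaries_submodule[OF assms(1)]
        coboundaries_submodule[OF assms(1)] Z coboundaries_subset_cocycles[OF assms(1)]])
    show "(\<odot>\<^bsub>obj C n\<^esub>) a ` coboundaries C n \<subseteq> coboundaries C n" using B(4) assms(2) by blast
  qed (use assms Z in \<open>auto simp: M.smult_closed M.smult_r_distr subset_iff\<close>)
qed

lemma torsion_cohomology_iff:
  assumes "cochain_complex R C" "S \<subseteq> carrier R"
  shows "torsion_module S (cohomology C n) \<longleftrightarrow>
    (\<forall>z \<in> cocycles C n. \<exists>s\<in>S. s \<odot>\<^bsub>obj C n\<^esub> z \<in> coboundaries C n)"
proof -
  interpret M: left_module R "obj C n" using cochain_complexD(1)[OF assms(1)] .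
  note Z = submoduleD[OF cocycles_submodule[OF assms(1)]]
  have "s \<odot>\<^bsub>cohomology C n\<^esub> coset (obj C n) (coboundaries C n) z = \<zero>\<^bsub>cohomology C n\<^esub> \<longleftrightarrow>
      s \<odot>\<^bsub>obj C n\<^esub> z \<in> coboundaries C n" if "s \<in> S" "z \<in> cocycles C n" for s z
  proof -
    have s: "s \<in> carrier R" using that(1) assms(2) by blast
    have "s \<odot>\<^bsub>obj C n\<^esub> z \<in> carrier (obj C n)" using s that(2) Z(1) by (auto intro: M.smult_closed)
    then show ?thesis
      unfolding cohomology_smult_coset[OF assms(1) s that(2)] cohomology_simps(2)
      using coset_zero_iff[OF M.left_module_axioms coboundaries_submodule[OF assms(1)]] by blast
  qed
  then show ?thesis by (auto simp: torsion_module_def cohomology_simps(1))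
qed

lemma chain_mapD:
  assumes "chain_map R C D f"
  shows "f n \<in> left_module_hom R (obj C n) (obj D n)"
    "x \<in> carrier (obj C n) \<Longrightarrow> f (n + 1) (diff C n x) = diff D n (f n x)"
    "y \<in> carrier (obj C (n - 1)) \<Longrightarrow> f n (diff C (n - 1) y) = diff D (n - 1) (f (n - 1) y)"
proof -
  show "f n \<in> left_module_hom R (obj C n) (obj D n)"
    "x \<in> carrier (obj C n) \<Longrightarrow> f (n + 1) (diff C n x) = diff D n (f n x)"
    using assms by (auto simp: chain_map_def)
  have "y \<in> carrier (obj C (n - 1)) \<Longrightarrow> f (n - 1 + 1) (diff C (n - 1) y) = diff D (n - 1) (f (n - 1) y)"
    using assms unfolding chain_map_def by blast
  then show "y \<in> carrier (obj C (n - 1)) \<Longrightarrow> f n (diff C (n - 1) y) = diff D (n - 1) (f (n - 1) y)" by simp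
qed

lemma chain_map_cocycles:
  assumes "cochain_complex R C" "cochain_complex R D" "chain_map R C D f" "z \<in> cocycles C n"
  shows "f n z \<in> cocycles D n"
proof -
  have z: "z \<in> carrier (obj C n)" "diff C n z = \<zero>\<^bsub>obj C (n + 1)\<^esub>" using assms(4) by (auto simp: cocycles_def)
  have "diff D n (f n z) = f (n + 1) \<zero>\<^bsub>obj C (n + 1)\<^esub>" using chain_mapD(2)[OF assms(3) z(1)] z(2) by simp
  then show ?thesis
    using hom_closed[OF chain_mapD(1)[OF assms(3)] z(1)]
      hom_zero[OF cochain_complexD(1)[OF assms(1)] cochain_complexD(1)[OF assms(2)] chain_mapD(1)[OF assms(3)]]
    by (simp add: cocycles_def)
qed

lemma chain_map_coboundaries:
  assumes "chain_map R C D f"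
  shows "f n ` coboundaries C n \<subseteq> coboundaries D n"
proof
  fix y assume "y \<in> f n ` coboundaries C n"
  then obtain x where x: "x \<in> carrier (obj C (n - 1))" "y = f n (diff C (n - 1) x)" by (auto simp: coboundaries_def)
  then have "y = diff D (n - 1) (f (n - 1) x)" using chain_mapD(3)[OF assms] by simp
  then show "y \<in> coboundaries D n"
    unfolding coboundaries_def by (rule image_eqI) (rule hom_closed[OF chain_mapD(1)[OF assms] x(1)])
qed

lemma cohomology_map_coset:
  assumes "cochain_complex R C" "cochain_complex R D" "chain_map R C D f" "z \<in> cocycles C n"
  shows "cohomology_map D f n (coset (obj C n) (coboundaries C n) z) =
    coset (obj D n) (coboundaries D n) (f n z)"
  unfolding cohomology_map_def
proof (rule coset_of_image[OF cochain_complexD(1)[OF assms(1)] cochain_complexD(1)[OF assms(2)]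
      coboundaries_submodule[OF assms(1)] coboundaries_submodule[OF assms(2)] submoduleD(1)[OF cocycles_submodule[OF assms(1)]]
      coboundaries_subset_cocycles[OF assms(1)]])
  show "f n ` coboundaries C n \<subseteq> coboundaries D n" by (rule chain_map_coboundaries[OF assms(3)])
qed (use assms(4) submoduleD(1)[OF cocycles_submodule[OF assms(1)], of n] hom_closed[OF chain_mapD(1)[OF assms(3)]]
    hom_add[OF chain_mapD(1)[OF assms(3)]] in \<open>auto simp: subset_iff\<close>)

lemma quasi_isomorphismI:
  assumes C: "cochain_complex R C" and D: "cochain_complex R D" and f: "chain_map R C D f"
    and inj: "\<And>n z. z \<in> cocycles C n \<Longrightarrow> f n z \<in> coboundaries D n \<Longrightarrow> z \<in> coboundaries C n"
    and surj: "\<And>n w. w \<in> cocycles D n \<Longrightarrow> \<exists>z\<in>cocycles C n. \<exists>b\<in>coboundaries D n. w = b \<oplus>\<^bsub>obj D n\<^esub> f n z"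
  shows "quasi_isomorphism R C D f"
proof -
  have "cohomology_map D f n \<in> left_module_iso R (cohomology C n) (cohomology D n)" for n
  proof -
    interpret M: left_module R "obj C n" using cochain_complexD(1)[OF C] .
    interpret N: left_module R "obj D n" using cochain_complexD(1)[OF D] .
    note ZC = submoduleD[OF cocycles_submodule[OF C, of n]] and ZD = submoduleD[OF cocycles_submodule[OF D, of n]]
    note BC = coboundaries_submodule[OF C, of n] and BD = coboundaries_submodule[OF D, of n]
    note fn = chain_mapD(1)[OF f, where n = n]
    let ?H = "cohomology_map D f n"
    let ?c = "coset (obj C n) (coboundaries C n)" and ?d = "coset (obj D n) (coboundaries D n)"
    note map = cohomology_map_coset[OF C D f]
    have ZCc: "z \<in> carrier (obj C n)" if "z \<in> cocycles C n" for z using that ZC(1) by blast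
    have ZDc: "z \<in> carrier (obj D n)" if "z \<in> cocycles D n" for z using that ZD(1) by blast
    have fZ: "f n z \<in> cocycles D n" if "z \<in> cocycles C n" for z using chain_map_cocycles[OF C D f that] .
    have "?H \<in> left_module_hom R (cohomology C n) (cohomology D n)"
    proof (rule left_module_homI)
      fix U assume "U \<in> carrier (cohomology C n)"
      then show "?H U \<in> carrier (cohomology D n)" using map fZ by (auto simp: cohomology_simps(1))
    next
      fix U V assume "U \<in> carrier (cohomology C n)" "V \<in> carrier (cohomology C n)"
      then obtain z w where zw: "z \<in> cocycles C n" "U = ?c z" "w \<in> cocycles C n" "V = ?c w"
        by (auto simp: cohomology_simps(1))
      have "?H (U \<oplus>\<^bsub>cohomology C n\<^esub> V) = ?H (?c (z \<oplus>\<^bsub>obj C n\<^esub> w))"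
        using zw coset_add[OF M.left_module_axioms BC ZCc ZCc] by (simp add: cohomology_simps(3))
      also have "\<dots> = ?d (f n z \<oplus>\<^bsub>obj D n\<^esub> f n w)"
        using map[OF ZC(3)[OF zw(1,3)]] hom_add[OF fn ZCc ZCc] zw(1,3) by simp
      also have "\<dots> = ?H U \<oplus>\<^bsub>cohomology D n\<^esub> ?H V"
        using coset_add[OF N.left_module_axioms BD ZDc[OF fZ] ZDc[OF fZ]] zw map by (simp add: cohomology_simps(3))
      finally show "?H (U \<oplus>\<^bsub>cohomology C n\<^esub> V) = ?H U \<oplus>\<^bsub>cohomology D n\<^esub> ?H V" .
    next
      fix a U assume a: "a \<in> carrier R" and "U \<in> carrier (cohomology C n)"
      then obtain z where z: "z \<in> cocycles C n" "U = ?c z" by (auto simp: cohomology_simps(1))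
      show "?H (a \<odot>\<^bsub>cohomology C n\<^esub> U) = a \<odot>\<^bsub>cohomology D n\<^esub> ?H U"
        using cohomology_smult_coset[OF C a z(1)] map[OF ZC(4)[OF a z(1)]] hom_smult[OF fn a ZCc[OF z(1)]]
          cohomology_smult_coset[OF D a fZ[OF z(1)]] map[OF z(1)] z(2) by simp
    qed
    moreover have "inj_on ?H (carrier (cohomology C n))"
    proof (rule inj_onI)
      fix U V assume "U \<in> carrier (cohomology C n)" "V \<in> carrier (cohomology C n)" and eq: "?H U = ?H V"
      then obtain z w where zw: "z \<in> cocycles C n" "U = ?c z" "w \<in> cocycles C n" "V = ?c w"
        by (auto simp: cohomology_simps(1))
      then have "?d (f n z) = ?d (f n w)" using eq map by simp
      then obtain b where b: "b \<in> coboundaries D n" "f n z = b \<oplus>\<^bsub>obj D n\<^esub> f n w"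
        using coset_eq_iff[OF N.left_module_axioms BD ZDc[OF fZ[OF zw(1)]] ZDc[OF fZ[OF zw(3)]]] by blast
      have bc: "b \<in> carrier (obj D n)" using b(1) submoduleD(1)[OF BD] by blast
      have "f n (z \<ominus>\<^bsub>obj C n\<^esub> w) = f n z \<ominus>\<^bsub>obj D n\<^esub> f n w"
        by (rule hom_minus[OF M.left_module_axioms N.left_module_axioms fn ZCc[OF zw(1)] ZCc[OF zw(3)]])
      also have "\<dots> = b" using bc ZDc[OF fZ[OF zw(3)]] by (simp add: b(2) a_minus_def N.M.a_assoc N.M.r_neg)
      finally have "z \<ominus>\<^bsub>obj C n\<^esub> w \<in> coboundaries C n"
        using inj[OF ZC(6)[OF zw(1,3)]] b(1) by simp
      moreover have "z = (z \<ominus>\<^bsub>obj C n\<^esub> w) \<oplus>\<^bsub>obj C n\<^esub> w"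
        using ZCc[OF zw(1)] ZCc[OF zw(3)] by (simp add: a_minus_def M.M.a_assoc M.M.l_neg)
      ultimately show "U = V"
        using coset_eq_iff[OF M.left_module_axioms BC ZCc[OF zw(1)] ZCc[OF zw(3)]] zw(2,4) by blast
    qed
    moreover have "?H ` carrier (cohomology C n) = carrier (cohomology D n)"
    proof
      show "?H ` carrier (cohomology C n) \<subseteq> carrier (cohomology D n)"
        using map fZ by (auto simp: cohomology_simps(1))
      show "carrier (cohomology D n) \<subseteq> ?H ` carrier (cohomology C n)"
      proof
        fix U assume "U \<in> carrier (cohomology D n)"
        then obtain w where w: "w \<in> cocycles D n" "U = ?d w" by (auto simp: cohomology_simps(1))
        obtain z b where z: "z \<in> cocycles C n" "b \<in> coboundaries D n" "w = b \<oplus>\<^bsub>obj D n\<^esub> f n z" using surj[OF w(1)] by blast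
        have "U = ?d (f n z)"
          using coset_eq_iff[OF N.left_module_axioms BD ZDc[OF w(1)] ZDc[OF fZ[OF z(1)]]] z(2,3) w(2) by blast
        then have "U = ?H (?c z)" using map[OF z(1)] by simp
        then show "U \<in> ?H ` carrier (cohomology C n)" using z(1) by (auto simp: cohomology_simps(1))
      qed
    qed
    ultimately show ?thesis by (simp add: left_module_iso_def bij_betw_def)
  qed
  then show ?thesis using C D f by (simp add: quasi_isomorphism_def)
qed

lemma quasi_isomorphism_surj:
  assumes "quasi_isomorphism R C D f" "w \<in> cocycles D n"
  shows "\<exists>z\<in>cocycles C n. \<exists>b\<in>coboundaries D n. w = b \<oplus>\<^bsub>obj D n\<^esub> f n z"
proof -
  have C: "cochain_complex R C" and D: "cochain_complex R D" and f: "chain_map R C D f"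
    and iso: "cohomology_map D f n \<in> left_module_iso R (cohomology C n) (cohomology D n)"
    using assms(1) by (auto simp: quasi_isomorphism_def)
  have "coset (obj D n) (coboundaries D n) w \<in> cohomology_map D f n ` carrier (cohomology C n)"
    using iso assms(2) by (auto simp: left_module_iso_def bij_betw_def cohomology_simps(1))
  then obtain z where z: "z \<in> cocycles C n"
    "coset (obj D n) (coboundaries D n) w = cohomology_map D f n (coset (obj C n) (coboundaries C n) z)"
    by (auto simp: cohomology_simps(1))
  have c: "w \<in> carrier (obj D n)" "f n z \<in> carrier (obj D n)"
    using assms(2) chain_map_cocycles[OF C D f z(1)] by (auto simp: cocycles_def)
  show ?thesis
    using z coset_eq_iff[OF cochain_complexD(1)[OF D] coboundaries_submodule[OF D] c]
      cohomology_map_coset[OF C D f z(1)] by auto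
qed

lemma perfect_cohomology_fg:
  assumes "noetherian_module R (regular_module R)" "perfect R C"
  shows "fg_mod R (obj C n) (cocycles C n) (coboundaries C n)"
proof -
  obtain P :: "('a, nat \<Rightarrow> 'a) cochain" and f where P: "strictly_perfect R P" "quasi_isomorphism R P C f"
    using assms(2) by (auto simp: perfect_def)
  have PC: "cochain_complex R P" "cochain_complex R C" "chain_map R P C f"
    using P(2) by (auto simp: quasi_isomorphism_def)
  note m = cochain_complexD(1)[OF PC(1), of n]
  interpret N: left_module R "obj C n" using cochain_complexD(1)[OF PC(2)] .
  interpret M: left_module R "obj P n" by (rule m)
  have "finitely_generated R (obj P n)" using P(1) by (simp add: strictly_perfect_def)
  then have "fg_mod R (obj P n) (carrier (obj P n)) {\<zero>\<^bsub>obj P n\<^esub>}"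
    unfolding fg_mod_zero_iff[OF m] finitely_generated_iff[OF m] .
  then have "fg_mod R (obj P n) (cocycles P n) {\<zero>\<^bsub>obj P n\<^esub>}"
    using submoduleD(1,2)[OF cocycles_submodule[OF PC(1)], of n]
    by (intro fg_mod_submodule[OF assms(1) m cocycles_submodule[OF PC(1)] submodule_zero[OF m]]) auto
  then obtain k g where g: "g \<in> left_module_hom R (free_module R k) (obj P n)" "g ` carrier (free_module R k) = cocycles P n"
    unfolding fg_mod_zero_iff[OF m] by auto
  show ?thesis
  proof (rule fg_modI[OF hom_compose[OF g(1) chain_mapD(1)[OF PC(3)]]])
    fix x assume "x \<in> carrier (free_module R k)"
    then show "f n (g x) \<in> cocycles C n" using g(2) by (intro chain_map_cocycles[OF PC]) auto
  next
    fix w assume w: "w \<in> cocycles C n"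
    obtain z b where z: "z \<in> cocycles P n" "b \<in> coboundaries C n" "w = b \<oplus>\<^bsub>obj C n\<^esub> f n z"
      using quasi_isomorphism_surj[OF P(2) w] by blast
    have "z \<in> g ` carrier (free_module R k)" using z(1) g(2) by simp
    then obtain x where x: "x \<in> carrier (free_module R k)" "z = g x" by auto
    have "b \<in> carrier (obj C n)" "f n z \<in> carrier (obj C n)"
      using z(2) submoduleD(1)[OF coboundaries_submodule[OF PC(2)], of n] chain_map_cocycles[OF PC z(1)]
      by (auto simp: cocycles_def)
    then have "w = f n (g x) \<oplus>\<^bsub>obj C n\<^esub> b" using z(3) x(2) by (simp add: N.M.a_comm)
    then show "\<exists>x\<in>carrier (free_module R k). \<exists>z\<in>coboundaries C n. w = f n (g x) \<oplus>\<^bsub>obj C n\<^esub> z"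
      using x(1) z(2) by blast
  qed
qed

section \<open>A criterion for perfectness\<close>

lemma flat_retract:
  assumes M: "left_module R M" and N: "left_module R N" and fl: "flat_module R M"
    and i: "i \<in> left_module_hom R N M" and r: "r \<in> left_module_hom R M N" and ri: "\<And>x. x \<in> carrier N \<Longrightarrow> r (i x) = x"
  shows "flat_module R N"
proof (rule flat_moduleI)
  fix k f assume f: "f \<in> left_module_hom R (free_module R k) N"
  obtain q \<gamma> f' where 1: "\<gamma> \<in> left_module_hom R (free_module R k) (free_module R q)"
    "f' \<in> left_module_hom R (free_module R q) M"
    "\<And>x. x \<in> carrier (free_module R k) \<Longrightarrow> i (f x) = f' (\<gamma> x)"
    "\<And>x. x \<in> carrier (free_module R k) \<Longrightarrow> i (f x) = \<zero>\<^bsub>M\<^esub> \<Longrightarrow> \<gamma> x = \<zero>\<^bsub>free_module R q\<^esub>"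
    by (rule flat_moduleE[OF fl hom_compose[OF f i]]) blast
  have "f x = r (f' (\<gamma> x))" if "x \<in> carrier (free_module R k)" for x
    using 1(3)[OF that] ri[OF hom_closed[OF f that]] by simp
  moreover have "\<gamma> x = \<zero>\<^bsub>free_module R q\<^esub>" if "x \<in> carrier (free_module R k)" "f x = \<zero>\<^bsub>N\<^esub>" for x
    using 1(4)[OF that(1)] that(2) hom_zero[OF N M i] by simp
  ultimately show "\<exists>q \<gamma> f'. \<gamma> \<in> left_module_hom R (free_module R k) (free_module R q) \<and>
       f' \<in> left_module_hom R (free_module R q) N \<and>
         (\<forall>x \<in> carrier (free_module R k). f x = f' (\<gamma> x) \<and> (f x = \<zero>\<^bsub>N\<^esub> \<longrightarrow> \<gamma> x = \<zero>\<^bsub>free_module R q\<^esub>))"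
    using 1(1) hom_compose[OF 1(2) r]
    by (intro exI[of _ q] exI[of _ \<gamma>] exI[of _ "\<lambda>x. r (f' x)"] conjI ballI impI) auto
qed

text \<open>The cocycles in degree \<open>n - 1\<close> of the mapping cone of \<open>f\<close>.\<close>

definition cone_cocycles ::
  "('a, 'n) cochain \<Rightarrow> ('a, 'm) cochain \<Rightarrow> (int \<Rightarrow> 'n \<Rightarrow> 'm) \<Rightarrow> int \<Rightarrow> ('n \<times> 'm) set" where
  "cone_cocycles P C f n = {(x, c). x \<in> carrier (obj P n) \<and> c \<in> carrier (obj C (n - 1)) \<and>
     diff P n x = \<zero>\<^bsub>obj P (n + 1)\<^esub> \<and> f n x = diff C (n - 1) c}"

text \<open>A complex \<open>P\<close> of finitely generated projective modules that vanishes below \<open>n\<close>, with a map to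
  \<open>C\<close> whose mapping cone is exact in all degrees from \<open>n\<close> on.\<close>

definition approximation ::
  "('a, 'r) ring_scheme \<Rightarrow> ('a, 'm) cochain \<Rightarrow> int \<Rightarrow> int \<Rightarrow> ('a, nat \<Rightarrow> 'a) cochain \<Rightarrow> (int \<Rightarrow> (nat \<Rightarrow> 'a) \<Rightarrow> 'm) \<Rightarrow> bool" where
  "approximation R C m n P f \<longleftrightarrow> cochain_complex R P \<and> chain_map R P C f \<and>
     (\<forall>i. retract_of_free R (obj P i)) \<and>
     (\<forall>i. i < n \<or> i > m \<longrightarrow> carrier (obj P i) = {\<zero>\<^bsub>obj P i\<^esub>}) \<and>
     (\<forall>i\<ge>n. \<forall>(x, c) \<in> cone_cocycles P C f (i + 1).
        \<exists>y \<in> carrier (obj P i). \<exists>e \<in> carrier (obj C (i - 1)).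
          x = diff P i y \<and> c = f i y \<oplus>\<^bsub>obj C i\<^esub> diff C (i - 1) e)"

lemma approximationD:
  assumes "approximation R C m n P f"
  shows "cochain_complex R P" "chain_map R P C f" "retract_of_free R (obj P i)"
    "i < n \<or> i > m \<Longrightarrow> carrier (obj P i) = {\<zero>\<^bsub>obj P i\<^esub>}"
    "i \<ge> n \<Longrightarrow> (x, c) \<in> cone_cocycles P C f (i + 1) \<Longrightarrow>
        \<exists>y \<in> carrier (obj P i). \<exists>e \<in> carrier (obj C (i - 1)).
          x = diff P i y \<and> c = f i y \<oplus>\<^bsub>obj C i\<^esub> diff C (i - 1) e"
  using assms unfolding approximation_def by blast+

lemma cone_cocycles_submodule:
  assumes P: "cochain_complex R P" and C: "cochain_complex R C" and f: "chain_map R P C f"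
  shows "submodule (cone_cocycles P C f n) R (pair_module (obj P n) (obj C (n - 1)))"
proof -
  interpret P: left_module R "obj P n" using cochain_complexD(1)[OF P] .
  interpret P1: left_module R "obj P (n + 1)" using cochain_complexD(1)[OF P] .
  interpret C: left_module R "obj C n" using cochain_complexD(1)[OF C] .
  interpret C1: left_module R "obj C (n - 1)" using cochain_complexD(1)[OF C] .
  note h = cochain_complexD(2)[OF P, of n] chain_mapD(1)[OF f, of n] cochain_complexD(3)[OF C, of n]
  interpret PC: left_module R "pair_module (obj P n) (obj C (n - 1))"
    by (rule pair_left_module[OF P.left_module_axioms C1.left_module_axioms])
  show ?thesis
  proof (rule PC.submoduleI)
    show "\<zero>\<^bsub>pair_module (obj P n) (obj C (n - 1))\<^esub> \<in> cone_cocycles P C f n"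
      using hom_zero[OF P.left_module_axioms P1.left_module_axioms h(1)] hom_zero[OF P.left_module_axioms C.left_module_axioms h(2)]
        hom_zero[OF C1.left_module_axioms C.left_module_axioms h(3)]
      by (simp add: cone_cocycles_def pair_module_simps)
  qed (auto simp: cone_cocycles_def pair_module_simps hom_add[OF h(1)] hom_add[OF h(2)] hom_add[OF h(3)]
      hom_smult[OF h(1)] hom_smult[OF h(2)] hom_smult[OF h(3)] P.smult_closed C1.smult_closed P1.smult_zero_right)
qed

text \<open>Attaching \<open>Q\<close> in degree \<open>n - 1\<close>, with the two components of \<open>\<alpha>\<close> as differential and as map to
  \<open>C\<close>, makes the mapping cone exact in that degree.\<close>

lemma approximation_extend:
  assumes C: "cochain_complex R C" and appr: "approximation R C m n P f" and nm: "n - 1 \<le> m"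
    and Q: "left_module R Q" "retract_of_free R Q"
    and \<alpha>: "\<alpha> \<in> left_module_hom R Q (pair_module (obj P n) (obj C (n - 1)))"
    and \<alpha>_into: "\<And>x. x \<in> carrier Q \<Longrightarrow> \<alpha> x \<in> cone_cocycles P C f n"
    and \<alpha>_onto: "\<And>x c. (x, c) \<in> cone_cocycles P C f n \<Longrightarrow>
      \<exists>y \<in> carrier Q. \<exists>e \<in> carrier (obj C (n - 1 - 1)). x = fst (\<alpha> y) \<and>
        c = snd (\<alpha> y) \<oplus>\<^bsub>obj C (n - 1)\<^esub> diff C (n - 1 - 1) e"
  obtains P' f' where "approximation R C m (n - 1) P' f'" "obj P' (n - 1) = Q" "obj P' n = obj P n"
    "\<And>x. diff P' (n - 1) x = fst (\<alpha> x)" "\<And>x. f' (n - 1) x = snd (\<alpha> x)"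
proof -
  note P = approximationD(1)[OF appr] and f = approximationD(2)[OF appr]
  define P' where "P' = \<lparr>obj = (obj P)(n - 1 := Q),
    diff = (diff P)(n - 1 := (\<lambda>x. fst (\<alpha> x)), n - 1 - 1 := (\<lambda>_. \<zero>\<^bsub>Q\<^esub>))\<rparr>"
  define f' where "f' = f(n - 1 := (\<lambda>x. snd (\<alpha> x)))"
  have o[simp]: "obj P' i = (if i = n - 1 then Q else obj P i)"
    "diff P' i = (if i = n - 1 then (\<lambda>x. fst (\<alpha> x)) else if i = n - 1 - 1 then (\<lambda>_. \<zero>\<^bsub>Q\<^esub>) else diff P i)"
    "f' i = (if i = n - 1 then (\<lambda>x. snd (\<alpha> x)) else f i)" for i
    by (auto simp: P'_def f'_def)
  interpret Q: left_module R Q by (rule Q(1))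
  note mP = cochain_complexD(1)[OF P] and mC = cochain_complexD(1)[OF C]
  have a1: "(\<lambda>x. fst (\<alpha> x)) \<in> left_module_hom R Q (obj P n)" by (rule hom_compose[OF \<alpha> fst_hom])
  have a2: "(\<lambda>x. snd (\<alpha> x)) \<in> left_module_hom R Q (obj C (n - 1))" by (rule hom_compose[OF \<alpha> snd_hom])
  have a: "diff P n (fst (\<alpha> x)) = \<zero>\<^bsub>obj P (n + 1)\<^esub>" "f n (fst (\<alpha> x)) = diff C (n - 1) (snd (\<alpha> x))" if "x \<in> carrier Q" for x
    using \<alpha>_into[OF that] by (auto simp: cone_cocycles_def)
  have zh: "(\<lambda>_. \<zero>\<^bsub>Q\<^esub>) \<in> left_module_hom R (obj P (n - 1 - 1)) Q"
    by (rule left_module_homI) (auto simp: Q.smult_zero_right)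
  have P': "cochain_complex R P'"
    unfolding cochain_complex_def
  proof (intro conjI allI ballI)
    fix i
    show "left_module R (obj P' i)" using Q(1) mP by simp
    show "diff P' i \<in> left_module_hom R (obj P' i) (obj P' (i + 1))"
      using a1 zh cochain_complexD(2)[OF P, of i] by auto
    fix x assume x: "x \<in> carrier (obj P' i)"
    consider "i = n - 1" | "i = n - 1 - 1" | "i = n - 1 - 1 - 1" | "i \<noteq> n - 1" "i \<noteq> n - 1 - 1" "i \<noteq> n - 1 - 1 - 1" by blast
    then show "diff P' (i + 1) (diff P' i x) = \<zero>\<^bsub>obj P' (i + 1 + 1)\<^esub>"
    proof cases
      case 1 then show ?thesis using x a(1) by simp
    next
      case 2 then show ?thesis using hom_zero[OF Q(1) mP a1] by simp
    next
      case 3 then show ?thesis by simp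
    next
      case 4 then show ?thesis using x cochain_complexD(4)[OF P, of x i] by simp
    qed
  qed
  have f': "chain_map R P' C f'"
    unfolding chain_map_def
  proof (intro conjI allI ballI)
    fix i
    show "f' i \<in> left_module_hom R (obj P' i) (obj C i)"
      using a2 chain_mapD(1)[OF f] by simp
    fix x assume x: "x \<in> carrier (obj P' i)"
    consider "i = n - 1" | "i = n - 1 - 1" | "i \<noteq> n - 1" "i \<noteq> n - 1 - 1" by blast
    then show "f' (i + 1) (diff P' i x) = diff C i (f' i x)"
    proof cases
      case 1 then show ?thesis using x a(2) by simp
    next
      case 2
      have "x = \<zero>\<^bsub>obj P i\<^esub>" using x 2 approximationD(4)[OF appr, of i] by auto
      then have "diff C i (f i x) = \<zero>\<^bsub>obj C (i + 1)\<^esub>"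
        using hom_zero[OF mP mC chain_mapD(1)[OF f]] hom_zero[OF mC mC cochain_complexD(2)[OF C]] by simp
      then show ?thesis using 2 hom_zero[OF Q(1) mC a2] by simp
    next
      case 3 then show ?thesis using x chain_mapD(2)[OF f, of x i] by simp
    qed
  qed
  have exact: "\<exists>y \<in> carrier (obj P' i). \<exists>e \<in> carrier (obj C (i - 1)).
          x = diff P' i y \<and> c = f' i y \<oplus>\<^bsub>obj C i\<^esub> diff C (i - 1) e"
    if i: "i \<ge> n - 1" and xc: "(x, c) \<in> cone_cocycles P' C f' (i + 1)" for i x c
  proof (cases "i = n - 1")
    case True
    then have "(x, c) \<in> cone_cocycles P C f n" using xc by (simp add: cone_cocycles_def)
    from \<alpha>_onto[OF this] show ?thesis using True by simp
  next
    case False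
    then have "i \<ge> n" using i by simp
    moreover have "(x, c) \<in> cone_cocycles P C f (i + 1)" using xc i by (auto simp: cone_cocycles_def)
    ultimately show ?thesis using approximationD(5)[OF appr, of i x c] False i by simp
  qed
  have "approximation R C m (n - 1) P' f'"
    unfolding approximation_def
  proof (intro conjI P' f' allI impI)
    fix i
    show "retract_of_free R (obj P' i)" using Q(2) approximationD(3)[OF appr] by simp
    show "carrier (obj P' i) = {\<zero>\<^bsub>obj P' i\<^esub>}" if "i < n - 1 \<or> m < i"
      using that nm approximationD(4)[OF appr, of i] by auto
    show "\<forall>(x, c) \<in> cone_cocycles P' C f' (i + 1). \<exists>y \<in> carrier (obj P' i). \<exists>e \<in> carrier (obj C (i - 1)).
          x = diff P' i y \<and> c = f' i y \<oplus>\<^bsub>obj C i\<^esub> diff C (i - 1) e" if "i \<ge> n - 1"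
      using exact[OF that] by (intro ballI) (auto simp del: o)
  qed
  then show thesis by (rule that) simp_all
qed

text \<open>The cone cocycles are finitely generated modulo the coboundaries of \<open>C\<close>: their projections to
  \<open>P\<^sup>n\<close> form a submodule of a finitely generated module, and those with projection \<open>0\<close> are the
  cocycles of \<open>C\<close>.\<close>

lemma cone_cocycles_fg:
  assumes noeth: "noetherian_module R (regular_module R)" and C: "cochain_complex R C"
    and fg: "fg_mod R (obj C (n - 1)) (cocycles C (n - 1)) (coboundaries C (n - 1))"
    and appr: "approximation R C m n P f"
  shows "fg_mod R (pair_module (obj P n) (obj C (n - 1))) (cone_cocycles P C f n)
     ((\<lambda>c. (\<zero>\<^bsub>obj P n\<^esub>, c)) ` coboundaries C (n - 1))"
proof -
  note P = approximationD(1)[OF appr] and f = approximationD(2)[OF appr]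
  note mP = cochain_complexD(1)[OF P, of n] and mC = cochain_complexD(1)[OF C]
  let ?E = "pair_module (obj P n) (obj C (n - 1))" and ?W = "cone_cocycles P C f n"
  interpret P: left_module R "obj P n" by (rule mP)
  interpret C1: left_module R "obj C (n - 1)" by (rule mC)
  note E = pair_left_module[OF mP mC[of "n - 1"]]
  note W = cone_cocycles_submodule[OF P C f, of n]
  have "fg_mod R (obj P n) (carrier (obj P n)) {\<zero>\<^bsub>obj P n\<^esub>}"
    using retract_of_free_projective(2)[OF mP approximationD(3)[OF appr]]
    unfolding fg_mod_zero_iff[OF mP] finitely_generated_iff[OF mP] .
  then have 1: "fg_mod R ?E ?W {w \<in> ?W. fst w \<in> {\<zero>\<^bsub>obj P n\<^esub>}}"
    by (rule fg_mod_embed[OF noeth E mP fst_hom W submodule_zero[OF mP]])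
      (auto simp: cone_cocycles_def)
  have inc: "(\<lambda>c. (\<zero>\<^bsub>obj P n\<^esub>, c)) \<in> left_module_hom R (obj C (n - 1)) ?E"
    by (rule left_module_homI) (auto simp: pair_module_simps P.smult_zero_right)
  have "f n \<zero>\<^bsub>obj P n\<^esub> = \<zero>\<^bsub>obj C n\<^esub>" by (rule hom_zero[OF mP mC chain_mapD(1)[OF f]])
  moreover have "diff P n \<zero>\<^bsub>obj P n\<^esub> = \<zero>\<^bsub>obj P (n + 1)\<^esub>"
    by (rule hom_zero[OF mP cochain_complexD(1,2)[OF P]])
  ultimately have "{w \<in> ?W. fst w \<in> {\<zero>\<^bsub>obj P n\<^esub>}} = (\<lambda>c. (\<zero>\<^bsub>obj P n\<^esub>, c)) ` cocycles C (n - 1)"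
    by (auto simp: cone_cocycles_def cocycles_def image_iff)
  moreover have "fg_mod R ?E ((\<lambda>c. (\<zero>\<^bsub>obj P n\<^esub>, c)) ` cocycles C (n - 1)) ((\<lambda>c. (\<zero>\<^bsub>obj P n\<^esub>, c)) ` coboundaries C (n - 1))"
    by (rule fg_mod_image[OF inc fg submoduleD(1)[OF coboundaries_submodule[OF C]]])
  moreover have "(\<lambda>c. (\<zero>\<^bsub>obj P n\<^esub>, c)) ` coboundaries C (n - 1) \<subseteq> carrier ?E"
    using submoduleD(1)[OF coboundaries_submodule[OF C], of "n - 1"] by (auto simp: pair_module_simps)
  ultimately show ?thesis
    using fg_mod_trans[OF E W _ _ 1] by (metis (no_types, lifting) mem_Collect_eq subsetI)
qed

text \<open>The new term is a free module \<open>R\<^sup>k\<close> that generates the cone cocycles \<open>W\<close> modulo the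
  coboundaries of \<open>C\<close>. The next module of cone cocycles is the kernel of the resulting surjection
  from \<open>R\<^sup>k \<oplus> C\<^sup>n\<^sup>-\<^sup>2\<close> onto \<open>W\<close>; since \<open>W\<close> and the source are flat, so is the kernel.\<close>

lemma approximation_step:
  assumes noeth: "noetherian_module R (regular_module R)" and C: "cochain_complex R C"
    and fl: "flat_module R (obj C (n - 1 - 1))"
    and fg: "fg_mod R (obj C (n - 1)) (cocycles C (n - 1)) (coboundaries C (n - 1))"
    and nm: "n - 1 \<le> m" and appr: "approximation R C m n P f"
    and flW: "flat_module R ((pair_module (obj P n) (obj C (n - 1)))\<lparr>carrier := cone_cocycles P C f n\<rparr>)"
  obtains P' f' where "approximation R C m (n - 1) P' f'"
    "flat_module R ((pair_module (obj P' (n - 1)) (obj C (n - 1 - 1)))\<lparr>carrier := cone_cocycles P' C f' (n - 1)\<rparr>)"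
proof -
  note P = approximationD(1)[OF appr] and f = approximationD(2)[OF appr]
  note mP = cochain_complexD(1)[OF P] and mC = cochain_complexD(1)[OF C]
  let ?E = "pair_module (obj P n) (obj C (n - 1))" and ?W = "cone_cocycles P C f n"
  interpret P: left_module R "obj P n" by (rule mP)
  interpret C1: left_module R "obj C (n - 1)" by (rule mC)
  note E = pair_left_module[OF mP[of n] mC[of "n - 1"]]
  note W = cone_cocycles_submodule[OF P C f, of n]
  note EW = submodule_left_module[OF E W]
  note fr = free_left_module[OF P.R.ring_axioms]
  interpret E: left_module R ?E by (rule E)
  obtain k \<alpha> where \<alpha>: "\<alpha> \<in> left_module_hom R (free_module R k) ?E" "\<alpha> ` carrier (free_module R k) \<subseteq> ?W"
    "\<And>y. y \<in> ?W \<Longrightarrow> \<exists>x\<in>carrier (free_module R k). \<exists>z\<in>(\<lambda>c. (\<zero>\<^bsub>obj P n\<^esub>, c)) ` coboundaries C (n - 1). y = \<alpha> x \<oplus>\<^bsub>?E\<^esub> z"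
    using fg_modE[OF cone_cocycles_fg[OF noeth C fg appr]] by metis
  have ret: "retract_of_free R (free_module R k)"
    unfolding retract_of_free_def by (intro exI[of _ k] bexI[OF _ hom_id]) simp
  have onto: "\<exists>y \<in> carrier (free_module R k). \<exists>e \<in> carrier (obj C (n - 1 - 1)). x = fst (\<alpha> y) \<and>
        c = snd (\<alpha> y) \<oplus>\<^bsub>obj C (n - 1)\<^esub> diff C (n - 1 - 1) e" if xc: "(x, c) \<in> ?W" for x c
  proof -
    obtain y e where ye: "y \<in> carrier (free_module R k)" "e \<in> carrier (obj C (n - 1 - 1))"
      "(x, c) = \<alpha> y \<oplus>\<^bsub>?E\<^esub> (\<zero>\<^bsub>obj P n\<^esub>, diff C (n - 1 - 1) e)"
      using \<alpha>(3)[OF xc] by (auto simp: coboundaries_def)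
    have "fst (\<alpha> y) \<in> carrier (obj P n)" using hom_closed[OF \<alpha>(1) ye(1)] by (auto simp: pair_module_simps)
    then show ?thesis using ye by (auto simp: pair_module_simps)
  qed
  obtain P' f' where P': "approximation R C m (n - 1) P' f'" "obj P' (n - 1) = free_module R k" "obj P' n = obj P n"
    "\<And>x. diff P' (n - 1) x = fst (\<alpha> x)" "\<And>x. f' (n - 1) x = snd (\<alpha> x)"
    by (rule approximation_extend[OF C appr nm fr ret \<alpha>(1) _ onto]) (use \<alpha>(2) in auto)
  let ?C2 = "obj C (n - 1 - 1)" and ?D = "pair_module (free_module R k) (obj C (n - 1 - 1))"
  note D = pair_left_module[OF fr mC[of "n - 1 - 1"]]
  have inc: "(\<lambda>c. (\<zero>\<^bsub>obj P n\<^esub>, c)) \<in> left_module_hom R (obj C (n - 1)) ?E"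
    by (rule left_module_homI) (auto simp: pair_module_simps P.smult_zero_right)
  have h1: "(\<lambda>w. \<alpha> (fst w)) \<in> left_module_hom R ?D ?E" by (rule hom_compose[OF fst_hom \<alpha>(1)])
  have h2: "(\<lambda>w. (\<zero>\<^bsub>obj P n\<^esub>, diff C (n - 1 - 1) (snd w))) \<in> left_module_hom R ?D ?E"
    by (rule hom_compose[OF hom_compose[OF snd_hom cochain_complexD(3)[OF C]] inc])
  let ?p = "\<lambda>w. \<alpha> (fst w) \<ominus>\<^bsub>?E\<^esub> (\<zero>\<^bsub>obj P n\<^esub>, diff C (n - 1 - 1) (snd w))"
  have p: "?p \<in> left_module_hom R ?D ?E" by (rule hom_diff[OF E h1 h2])
  have bW: "(\<zero>\<^bsub>obj P n\<^esub>, diff C (n - 1 - 1) e) \<in> ?W" if e: "e \<in> carrier ?C2" for e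
    using cochain_complexD(5)[OF C e] hom_zero[OF mP mC chain_mapD(1)[OF f]]
      hom_zero[OF mP mP cochain_complexD(2)[OF P]] hom_closed[OF cochain_complexD(3)[OF C] e]
    by (simp add: cone_cocycles_def)
  have pW: "?p w \<in> ?W" if w: "w \<in> carrier ?D" for w
    using w \<alpha>(2) bW by (intro submoduleD(6)[OF W]) (auto simp: pair_module_simps)
  have p': "?p \<in> left_module_hom R ?D (?E\<lparr>carrier := ?W\<rparr>)"
    by (rule hom_codomain_submodule[OF p]) (use pW in blast)
  have "?p ` carrier ?D = ?W"
  proof
    show "?p ` carrier ?D \<subseteq> ?W" using pW by blast
    show "?W \<subseteq> ?p ` carrier ?D"
    proof
      fix w assume w: "w \<in> ?W"
      obtain x c where xc: "w = (x, c)" by fastforce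
      obtain y e where ye: "y \<in> carrier (free_module R k)" "e \<in> carrier ?C2" "x = fst (\<alpha> y)"
        "c = snd (\<alpha> y) \<oplus>\<^bsub>obj C (n - 1)\<^esub> diff C (n - 1 - 1) e" using onto w xc by blast
      interpret C2: left_module R ?C2 by (rule mC)
      have e': "\<ominus>\<^bsub>?C2\<^esub> e \<in> carrier ?C2" by (rule C2.M.a_inv_closed[OF ye(2)])
      have ay: "\<alpha> y \<in> carrier ?E" using hom_closed[OF \<alpha>(1) ye(1)] .
      have be: "(\<zero>\<^bsub>obj P n\<^esub>, diff C (n - 1 - 1) e) \<in> carrier ?E"
        using bW[OF ye(2)] submoduleD(1)[OF W] by blast
      have "(\<zero>\<^bsub>obj P n\<^esub>, diff C (n - 1 - 1) (\<ominus>\<^bsub>?C2\<^esub> e)) = \<ominus>\<^bsub>?E\<^esub> (\<zero>\<^bsub>obj P n\<^esub>, diff C (n - 1 - 1) e)"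
        using hom_neg[OF mC E hom_compose[OF cochain_complexD(3)[OF C] inc] ye(2)] .
      then have "?p (y, \<ominus>\<^bsub>?C2\<^esub> e) = \<alpha> y \<oplus>\<^bsub>?E\<^esub> (\<zero>\<^bsub>obj P n\<^esub>, diff C (n - 1 - 1) e)"
        using be by (simp add: a_minus_def)
      also have "\<dots> = w" using ay ye(3,4) xc by (auto simp: pair_module_simps)
      finally show "w \<in> ?p ` carrier ?D"
        using ye(1) e' by (intro image_eqI[of _ _ "(y, \<ominus>\<^bsub>?C2\<^esub> e)"]) (auto simp: pair_module_simps)
    qed
  qed
  then have "flat_module R (?D\<lparr>carrier := {w \<in> carrier ?D. ?p w = \<zero>\<^bsub>?E\<lparr>carrier := ?W\<rparr>\<^esub>}\<rparr>)"
    by (intro flat_kernel[OF D EW p' _ flat_pair_free[OF mC fl] flW]) simp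
  moreover have "{w \<in> carrier ?D. ?p w = \<zero>\<^bsub>?E\<lparr>carrier := ?W\<rparr>\<^esub>} = cone_cocycles P' C f' (n - 1)"
  proof -
    have 1: "?p w = \<zero>\<^bsub>?E\<^esub> \<longleftrightarrow> \<alpha> (fst w) = (\<zero>\<^bsub>obj P n\<^esub>, diff C (n - 1 - 1) (snd w))" if "w \<in> carrier ?D" for w
      by (rule E.M.diff_eq_zero_iff[OF hom_closed[OF h1 that] hom_closed[OF h2 that]])
    have 2: "w \<in> cone_cocycles P' C f' (n - 1) \<longleftrightarrow>
        w \<in> carrier ?D \<and> \<alpha> (fst w) = (\<zero>\<^bsub>obj P n\<^esub>, diff C (n - 1 - 1) (snd w))" for w
      using P'(2-5) by (cases w) (auto simp: cone_cocycles_def pair_module_simps prod_eq_iff)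
    have 3: "\<zero>\<^bsub>?E\<lparr>carrier := ?W\<rparr>\<^esub> = \<zero>\<^bsub>?E\<^esub>" by simp
    show ?thesis unfolding 3 set_eq_iff mem_Collect_eq 2 by (intro allI conj_cong refl 1)
  qed
  ultimately show thesis using that[OF P'(1)] P'(2) by simp
qed

text \<open>Starting above the top degree, \<open>C\<close> is approximated by free modules, one degree at a time. In
  degree \<open>a\<close> the term \<open>C\<^sup>a\<^sup>-\<^sup>1\<close> vanishes, so the cone cocycles are a submodule \<open>K\<close> of the finitely
  generated module \<open>P\<^sup>a\<close>. They are flat and finitely generated, hence projective, and attaching \<open>K\<close>
  in degree \<open>a - 1\<close> completes the resolution.\<close>

theorem perfectI:
  fixes C :: "('a, 'm) cochain"
  assumes R: "ring R" and noeth: "noetherian_module R (regular_module R)" and C: "cochain_complex R C"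
    and fl: "\<And>n. flat_module R (obj C n)"
    and fg: "\<And>n. fg_mod R (obj C n) (cocycles C n) (coboundaries C n)"
    and bounded: "\<And>n. n < a \<or> b < n \<Longrightarrow> carrier (obj C n) = {\<zero>\<^bsub>obj C n\<^esub>}"
  shows "perfect R C"
proof -
  note mC = cochain_complexD(1)[OF C]
  note fr = free_left_module[OF R]
  \<comment> \<open>\<open>C\<close> vanishes from degree \<open>m\<close> on. The bound \<open>a + 1\<close> puts \<open>m\<close> above \<open>a\<close> even if \<open>b < a\<close>.\<close>
  define m where "m = max (b + 1) (a + 1)"
  have start: "\<exists>(P :: ('a, nat \<Rightarrow> 'a) cochain) f. approximation R C m (m + 1) P f \<and>
      flat_module R ((pair_module (obj P (m + 1)) (obj C (m + 1 - 1)))\<lparr>carrier := cone_cocycles P C f (m + 1)\<rparr>)"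
  proof -
    let ?Z = "free_module R 0" and ?z = "\<zero>\<^bsub>free_module R 0\<^esub>"
    define P :: "('a, nat \<Rightarrow> 'a) cochain" where "P = \<lparr>obj = \<lambda>_. ?Z, diff = \<lambda>_ _. ?z\<rparr>"
    define f where "f = (\<lambda>i (_ :: nat \<Rightarrow> 'a). \<zero>\<^bsub>obj C i\<^esub>)"
    interpret Z: left_module R ?Z by (rule fr)
    have Zc: "carrier ?Z = {?z}" by (auto simp: free_module_simps fun_eq_iff)
    have P: "cochain_complex R P"
      unfolding cochain_complex_def P_def
      by (auto intro!: left_module_homI simp: fr Z.smult_zero_right)
    have f: "chain_map R P C f"
      unfolding chain_map_def
    proof (intro conjI allI ballI)
      fix i
      interpret Ci: left_module R "obj C i" by (rule mC)
      show "f i \<in> left_module_hom R (obj P i) (obj C i)"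
        unfolding f_def by (rule left_module_homI) (auto simp: Ci.smult_zero_right)
      show "f (i + 1) (diff P i x) = diff C i (f i x)" for x
        using hom_zero[OF mC mC cochain_complexD(2)[OF C]] by (simp add: f_def)
    qed
    have zero: "c = \<zero>\<^bsub>obj C i\<^esub>" if "i \<ge> m" "c \<in> carrier (obj C i)" for i c
      using bounded[of i] that by (auto simp: m_def)
    have "approximation R C m (m + 1) P f"
      unfolding approximation_def
    proof (intro conjI P f allI impI)
      fix i
      have "retract_of_free R (free_module R 0)"
        unfolding retract_of_free_def by (intro exI[of _ 0] bexI[OF _ hom_id]) simp
      then show "retract_of_free R (obj P i)" by (simp add: P_def)
      show "carrier (obj P i) = {\<zero>\<^bsub>obj P i\<^esub>}" by (simp add: P_def Zc)
      assume i: "m + 1 \<le> i"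
      interpret Ci: left_module R "obj C i" by (rule mC)
      interpret Ci1: left_module R "obj C (i - 1)" by (rule mC)
      have "x = ?z" "c = \<zero>\<^bsub>obj C i\<^esub>" if "(x, c) \<in> cone_cocycles P C f (i + 1)" for x c
        using that Zc zero[of i c] i by (auto simp: cone_cocycles_def P_def)
      moreover have "\<zero>\<^bsub>obj C i\<^esub> = f i ?z \<oplus>\<^bsub>obj C i\<^esub> diff C (i - 1) \<zero>\<^bsub>obj C (i - 1)\<^esub>"
        using hom_zero[OF mC mC cochain_complexD(3)[OF C, of i]] by (simp add: f_def)
      ultimately show "\<forall>(x, c) \<in> cone_cocycles P C f (i + 1). \<exists>y \<in> carrier (obj P i). \<exists>e \<in> carrier (obj C (i - 1)).
          x = diff P i y \<and> c = f i y \<oplus>\<^bsub>obj C i\<^esub> diff C (i - 1) e"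
        using Ci1.M.zero_closed Zc by (fastforce simp: P_def)
    qed
    moreover have "flat_module R ((pair_module (obj P (m + 1)) (obj C (m + 1 - 1)))\<lparr>carrier := cone_cocycles P C f (m + 1)\<rparr>)"
    proof (rule flat_zero)
      note E = pair_left_module[OF cochain_complexD(1)[OF P, of "m + 1"] mC[of "m + 1 - 1"]]
      note W = cone_cocycles_submodule[OF P C f, of "m + 1"]
      show "left_module R ((pair_module (obj P (m + 1)) (obj C (m + 1 - 1)))\<lparr>carrier := cone_cocycles P C f (m + 1)\<rparr>)"
        by (rule submodule_left_module[OF E W])
      have "w = \<zero>\<^bsub>pair_module (obj P (m + 1)) (obj C (m + 1 - 1))\<^esub>" if "w \<in> cone_cocycles P C f (m + 1)" for w
        using that zero[of m] Zc by (auto simp: cone_cocycles_def pair_module_simps P_def)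
      then have "cone_cocycles P C f (m + 1) = {\<zero>\<^bsub>pair_module (obj P (m + 1)) (obj C (m + 1 - 1))\<^esub>}"
        using submoduleD(2)[OF W] by blast
      then show "carrier ((pair_module (obj P (m + 1)) (obj C (m + 1 - 1)))\<lparr>carrier := cone_cocycles P C f (m + 1)\<rparr>) =
        {\<zero>\<^bsub>(pair_module (obj P (m + 1)) (obj C (m + 1 - 1)))\<lparr>carrier := cone_cocycles P C f (m + 1)\<rparr>\<^esub>}"
        by simp
    qed
    ultimately show ?thesis by blast
  qed
  have steps: "\<exists>(P :: ('a, nat \<Rightarrow> 'a) cochain) f. approximation R C m (m + 1 - int k) P f \<and>
      flat_module R ((pair_module (obj P (m + 1 - int k)) (obj C (m + 1 - int k - 1)))\<lparr>carrier := cone_cocycles P C f (m + 1 - int k)\<rparr>)" for k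
  proof (induction k)
    case 0 then show ?case using start by simp
  next
    case (Suc k)
    then obtain P :: "('a, nat \<Rightarrow> 'a) cochain" and f where Pf: "approximation R C m (m + 1 - int k) P f"
      "flat_module R ((pair_module (obj P (m + 1 - int k)) (obj C (m + 1 - int k - 1)))\<lparr>carrier := cone_cocycles P C f (m + 1 - int k)\<rparr>)"
      by blast
    have eq: "m + 1 - int (Suc k) = m + 1 - int k - 1" by simp
    obtain P' f' where "approximation R C m (m + 1 - int k - 1) P' f'"
      "flat_module R ((pair_module (obj P' (m + 1 - int k - 1)) (obj C (m + 1 - int k - 1 - 1)))\<lparr>carrier := cone_cocycles P' C f' (m + 1 - int k - 1)\<rparr>)"
      by (rule approximation_step[OF noeth C fl fg _ Pf]) auto
    then show ?case unfolding eq by blast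
  qed
  have "a + 1 \<le> m" unfolding m_def by (rule max.cobounded2)
  then have ma: "m + 1 - int (nat (m + 1 - a)) = a" by simp
  obtain P :: "('a, nat \<Rightarrow> 'a) cochain" and f where appr: "approximation R C m a P f"
    and flW: "flat_module R ((pair_module (obj P a) (obj C (a - 1)))\<lparr>carrier := cone_cocycles P C f a\<rparr>)"
    using steps[of "nat (m + 1 - a)"] unfolding ma by blast
  note P = approximationD(1)[OF appr] and f = approximationD(2)[OF appr]
  note mP = cochain_complexD(1)[OF P]
  have C0: "carrier (obj C (a - 1)) = {\<zero>\<^bsub>obj C (a - 1)\<^esub>}" using bounded[of "a - 1"] by simp
  interpret C1: left_module R "obj C (a - 1)" by (rule mC)
  interpret C2: left_module R "obj C (a - 1 - 1)" by (rule mC)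
  let ?W = "cone_cocycles P C f a" and ?E = "pair_module (obj P a) (obj C (a - 1))"
  note E = pair_left_module[OF mP[of a] mC[of "a - 1"]]
  note W = cone_cocycles_submodule[OF P C f, of a]
  note EW = submodule_left_module[OF E W]
  define K where "K = fst ` ?W"
  have K: "submodule K R (obj P a)" unfolding K_def by (rule submodule_image[OF E mP fst_hom W])
  have KW: "x \<in> K \<longleftrightarrow> (x, \<zero>\<^bsub>obj C (a - 1)\<^esub>) \<in> ?W" for x
    using C0 by (force simp: K_def cone_cocycles_def)
  let ?Q = "(obj P a)\<lparr>carrier := K\<rparr>"
  note Q = submodule_left_module[OF mP K]
  let ?\<alpha> = "\<lambda>x. (x, \<zero>\<^bsub>obj C (a - 1)\<^esub>)"
  have \<alpha>: "?\<alpha> \<in> left_module_hom R ?Q ?E"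
    by (rule left_module_homI) (use submoduleD(1)[OF K] in \<open>auto simp: pair_module_simps C1.smult_zero_right\<close>)
  have "flat_module R ?Q"
  proof (rule flat_retract[OF EW Q flW])
    show "?\<alpha> \<in> left_module_hom R ?Q (?E\<lparr>carrier := ?W\<rparr>)"
      by (rule hom_codomain_submodule[OF \<alpha>]) (auto simp: KW)
    show "fst \<in> left_module_hom R (?E\<lparr>carrier := ?W\<rparr>) ?Q"
      by (rule hom_codomain_submodule[OF hom_from_submodule[OF fst_hom submoduleD(1)[OF W]]]) (auto simp: K_def)
  qed simp
  moreover have "\<exists>k. \<exists>g \<in> left_module_hom R (free_module R k) ?Q. g ` carrier (free_module R k) = carrier ?Q"
  proof -
    have "fg_mod R (obj P a) (carrier (obj P a)) {\<zero>\<^bsub>obj P a\<^esub>}"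
      using retract_of_free_projective(2)[OF mP approximationD(3)[OF appr]]
      unfolding fg_mod_zero_iff[OF mP] finitely_generated_iff[OF mP] .
    then have "fg_mod R (obj P a) K {\<zero>\<^bsub>obj P a\<^esub>}"
      using submoduleD(1,2)[OF K] by (intro fg_mod_submodule[OF noeth mP K submodule_zero[OF mP]]) auto
    then obtain k g where g: "g \<in> left_module_hom R (free_module R k) (obj P a)" "g ` carrier (free_module R k) = K"
      unfolding fg_mod_zero_iff[OF mP] by blast
    have "g \<in> left_module_hom R (free_module R k) ?Q" by (rule hom_codomain_submodule[OF g(1)]) (simp add: g(2))
    then show ?thesis by (intro exI[of _ k] bexI[of _ g]) (simp_all add: g(2))
  qed
  ultimately have ret: "retract_of_free R ?Q" using flat_fg_retract[OF Q] by blast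
  have am: "a - 1 \<le> m" using \<open>a + 1 \<le> m\<close> by simp
  have into: "?\<alpha> x \<in> ?W" if "x \<in> carrier ?Q" for x using that KW by simp
  have onto: "\<exists>y\<in>carrier ?Q. \<exists>e\<in>carrier (obj C (a - 1 - 1)). x = fst (?\<alpha> y) \<and>
       c = snd (?\<alpha> y) \<oplus>\<^bsub>obj C (a - 1)\<^esub> diff C (a - 1 - 1) e" if xc: "(x, c) \<in> ?W" for x c
  proof -
    have c: "c = \<zero>\<^bsub>obj C (a - 1)\<^esub>" using C0 xc by (auto simp: cone_cocycles_def)
    then have x: "x \<in> carrier ?Q" using xc KW by simp
    show ?thesis
      using c hom_zero[OF mC mC cochain_complexD(3)[OF C, of "a - 1"]]
      by (intro bexI[OF _ x] bexI[OF _ C2.M.zero_closed]) simp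
  qed
  obtain P' f' where appr': "approximation R C m (a - 1) P' f'" and objs: "obj P' (a - 1) = ?Q" "obj P' a = obj P a"
    and d': "\<And>x. diff P' (a - 1) x = fst (?\<alpha> x)" and f'': "\<And>x. f' (a - 1) x = snd (?\<alpha> x)"
    by (rule approximation_extend[OF C appr am Q ret \<alpha> into onto]) (assumption | rule that)+
  note P' = approximationD(1)[OF appr'] and f' = approximationD(2)[OF appr']
  note mP' = cochain_complexD(1)[OF P']
  have exact: "\<exists>y \<in> carrier (obj P' i). \<exists>e \<in> carrier (obj C (i - 1)).
          x = diff P' i y \<and> c = f' i y \<oplus>\<^bsub>obj C i\<^esub> diff C (i - 1) e"
    if xc: "(x, c) \<in> cone_cocycles P' C f' (i + 1)" for i x c
  proof (cases "i \<ge> a - 1")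
    case True
    then show ?thesis using approximationD(5)[OF appr' _ xc] by blast
  next
    case False
    interpret Ci: left_module R "obj C i" by (rule mC)
    interpret Ci1: left_module R "obj C (i - 1)" by (rule mC)
    interpret Pi: left_module R "obj P' i" by (rule mP')
    have c: "c = \<zero>\<^bsub>obj C i\<^esub>" using xc bounded[of i] False by (auto simp: cone_cocycles_def)
    have x: "x = \<zero>\<^bsub>obj P' (i + 1)\<^esub>"
    proof (cases "i + 1 = a - 1")
      case True
      have "diff P' (i + 1) x = \<zero>\<^bsub>obj P' (i + 1 + 1)\<^esub>" using xc by (simp add: cone_cocycles_def)
      then have "x = \<zero>\<^bsub>obj P a\<^esub>" unfolding True d' using objs by simp
      then show ?thesis unfolding True objs by simp
    next
      case False
      then have "i + 1 < a - 1" using \<open>\<not> a - 1 \<le> i\<close> by simp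
      then show ?thesis using xc approximationD(4)[OF appr', of "i + 1"] by (auto simp: cone_cocycles_def)
    qed
    show ?thesis
    proof (intro bexI[OF _ Pi.M.zero_closed] bexI[OF _ Ci1.M.zero_closed])
      show "x = diff P' i \<zero>\<^bsub>obj P' i\<^esub> \<and> c = f' i \<zero>\<^bsub>obj P' i\<^esub> \<oplus>\<^bsub>obj C i\<^esub> diff C (i - 1) \<zero>\<^bsub>obj C (i - 1)\<^esub>"
        using x c hom_zero[OF mP' mP' cochain_complexD(2)[OF P']] hom_zero[OF mP' mC chain_mapD(1)[OF f']]
          hom_zero[OF mC mC cochain_complexD(3)[OF C, of i]] by simp
    qed
  qed
  have "quasi_isomorphism R P' C f'"
  proof (rule quasi_isomorphismI[OF P' C f'])
    fix n z assume z: "z \<in> cocycles P' n" "f' n z \<in> coboundaries C n"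
    then obtain c where "c \<in> carrier (obj C (n - 1))" "f' n z = diff C (n - 1) c" by (auto simp: coboundaries_def)
    then have "(z, c) \<in> cone_cocycles P' C f' (n - 1 + 1)" using z(1) by (auto simp: cone_cocycles_def cocycles_def)
    from exact[OF this] show "z \<in> coboundaries P' n" by (auto simp: coboundaries_def)
  next
    fix n w assume w: "w \<in> cocycles C n"
    interpret Cn: left_module R "obj C n" by (rule mC)
    interpret Pn1: left_module R "obj P' (n + 1)" by (rule mP')
    have "(\<zero>\<^bsub>obj P' (n + 1)\<^esub>, w) \<in> cone_cocycles P' C f' (n + 1)"
      using w hom_zero[OF mP' mC chain_mapD(1)[OF f']] hom_zero[OF mP' mP' cochain_complexD(2)[OF P']]
      by (auto simp: cone_cocycles_def cocycles_def)
    from exact[OF this] obtain y e where y: "y \<in> carrier (obj P' n)" "e \<in> carrier (obj C (n - 1))"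
      "\<zero>\<^bsub>obj P' (n + 1)\<^esub> = diff P' n y" "w = f' n y \<oplus>\<^bsub>obj C n\<^esub> diff C (n - 1) e" by blast
    have c: "f' n y \<in> carrier (obj C n)" "diff C (n - 1) e \<in> carrier (obj C n)"
      using hom_closed[OF chain_mapD(1)[OF f'] y(1)] hom_closed[OF cochain_complexD(3)[OF C] y(2)] by auto
    have "w = diff C (n - 1) e \<oplus>\<^bsub>obj C n\<^esub> f' n y" using y(4) c by (simp add: Cn.M.a_comm)
    moreover have "y \<in> cocycles P' n" using y(1,3) by (simp add: cocycles_def)
    moreover have "diff C (n - 1) e \<in> coboundaries C n" using y(2) by (simp add: coboundaries_def)
    ultimately show "\<exists>z\<in>cocycles P' n. \<exists>b\<in>coboundaries C n. w = b \<oplus>\<^bsub>obj C n\<^esub> f' n z" by blast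
  qed
  moreover have "strictly_perfect R P'"
    unfolding strictly_perfect_def
  proof (intro conjI allI P')
    fix n
    show "finitely_generated R (obj P' n)" "projective R (obj P' n)"
      using retract_of_free_projective[OF mP' approximationD(3)[OF appr']] by auto
    have "{n. carrier (obj P' n) \<noteq> {\<zero>\<^bsub>obj P' n\<^esub>}} \<subseteq> {a - 1..m}"
      using approximationD(4)[OF appr'] by force
    then show "finite {n. carrier (obj P' n) \<noteq> {\<zero>\<^bsub>obj P' n\<^esub>}}" by (rule finite_subset) simp
  qed
  ultimately show ?thesis unfolding perfect_def by blast
qed

section \<open>Pseudo-coherent modules\<close>

definition free_cover :: "('a, 'r) ring_scheme \<Rightarrow> nat \<Rightarrow> ((nat \<Rightarrow> 'a) \<Rightarrow> 'm) \<Rightarrow> ('a, 'm) module \<Rightarrow> bool" where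
  "free_cover R k f M \<longleftrightarrow> f \<in> left_module_hom R (free_module R k) M \<and> f ` carrier (free_module R k) = carrier M"

definition relations :: "('a, 'r) ring_scheme \<Rightarrow> nat \<Rightarrow> ((nat \<Rightarrow> 'a) \<Rightarrow> 'm) \<Rightarrow> ('a, 'm) module \<Rightarrow> ('a, nat \<Rightarrow> 'a) module" where
  "relations R k f M = (free_module R k)\<lparr>carrier := {x \<in> carrier (free_module R k). f x = \<zero>\<^bsub>M\<^esub>}\<rparr>"

definition kernel_module :: "('a, 'm) module \<Rightarrow> ('m \<Rightarrow> 'n) \<Rightarrow> ('a, 'n) module \<Rightarrow> ('a, 'm) module" where
  "kernel_module M p N = M\<lparr>carrier := {x \<in> carrier M. p x = \<zero>\<^bsub>N\<^esub>}\<rparr>"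

lemma relations_eq_kernel_module: "relations R k f M = kernel_module (free_module R k) f M"
  by (simp add: relations_def kernel_module_def)

lemma kernel_left_module:
  "left_module R M \<Longrightarrow> left_module R N \<Longrightarrow> p \<in> left_module_hom R M N \<Longrightarrow> left_module R (kernel_module M p N)"
  unfolding kernel_module_def by (rule submodule_left_module[OF _ submodule_kernel])

lemma kernel_module_simps:
  "x \<in> carrier (kernel_module M p N) \<longleftrightarrow> x \<in> carrier M \<and> p x = \<zero>\<^bsub>N\<^esub>"
  "\<zero>\<^bsub>kernel_module M p N\<^esub> = \<zero>\<^bsub>M\<^esub>"
  "x \<oplus>\<^bsub>kernel_module M p N\<^esub> y = x \<oplus>\<^bsub>M\<^esub> y"
  "a \<odot>\<^bsub>kernel_module M p N\<^esub> x = a \<odot>\<^bsub>M\<^esub> x"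
  by (simp_all add: kernel_module_def)

lemma free_coverD:
  assumes "free_cover R k f M"
  shows "f \<in> left_module_hom R (free_module R k) M" "f ` carrier (free_module R k) = carrier M"
    "y \<in> carrier M \<Longrightarrow> \<exists>x\<in>carrier (free_module R k). f x = y"
proof -
  show *: "f \<in> left_module_hom R (free_module R k) M" "f ` carrier (free_module R k) = carrier M"
    using assms by (auto simp: free_cover_def)
  assume "y \<in> carrier M"
  then have "y \<in> f ` carrier (free_module R k)" using *(2) by simp
  then show "\<exists>x\<in>carrier (free_module R k). f x = y" by auto
qed

lemma relations_left_module:
  assumes "left_module R M" "free_cover R k f M"
  shows "left_module R (relations R k f M)"
  unfolding relations_eq_kernel_module
  by (rule kernel_left_module[OF free_left_module assms(1) free_coverD(1)[OF assms(2)]])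
    (use assms(1) in \<open>simp add: left_module_def\<close>)

text \<open>\<open>M\<close> is \<open>m\<close>-pseudo-coherent if it is finitely generated and, for \<open>m > 0\<close>, the relations of
  every finite family of generators form an \<open>(m - 1)\<close>-pseudo-coherent module. Quantifying over all
  families of generators, not just one, lets the families be adapted to a given exact sequence. The
  recursion runs over modules of rows, which is the type of all modules of relations.\<close>

primrec pseudo_coherent_rows :: "('a, 'r) ring_scheme \<Rightarrow> nat \<Rightarrow> ('a, nat \<Rightarrow> 'a) module \<Rightarrow> bool" where
  "pseudo_coherent_rows R 0 M \<longleftrightarrow> (\<exists>k f. free_cover R k f M)"
| "pseudo_coherent_rows R (Suc m) M \<longleftrightarrow> (\<exists>k f. free_cover R k f M) \<and>
     (\<forall>k f. free_cover R k f M \<longrightarrow> pseudo_coherent_rows R m (relations R k f M))"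

definition pseudo_coherent :: "('a, 'r) ring_scheme \<Rightarrow> nat \<Rightarrow> ('a, 'm) module \<Rightarrow> bool" where
  "pseudo_coherent R m M \<longleftrightarrow> (\<exists>k f. free_cover R k f M) \<and>
     (\<forall>j k f. m = Suc j \<longrightarrow> free_cover R k f M \<longrightarrow> pseudo_coherent_rows R j (relations R k f M))"

lemma pseudo_coherent_rows_iff: "pseudo_coherent_rows R m M \<longleftrightarrow> pseudo_coherent R m M"
  by (cases m) (auto simp: pseudo_coherent_def)

lemma pseudo_coherent_0: "pseudo_coherent R 0 M \<longleftrightarrow> (\<exists>k f. free_cover R k f M)"
  by (simp add: pseudo_coherent_def)

lemma pseudo_coherent_Suc: "pseudo_coherent R (Suc m) M \<longleftrightarrow> (\<exists>k f. free_cover R k f M) \<and>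
     (\<forall>k f. free_cover R k f M \<longrightarrow> pseudo_coherent R m (relations R k f M))"
  by (simp add: pseudo_coherent_def[of R "Suc m"] pseudo_coherent_rows_iff)

lemma pseudo_coherent_imp_0: "pseudo_coherent R m M \<Longrightarrow> pseudo_coherent R 0 M"
  by (auto simp: pseudo_coherent_def)

lemma pseudo_coherent_iso:
  assumes h: "h \<in> left_module_hom R M N" "h' \<in> left_module_hom R N M"
    and hh: "\<And>x. x \<in> carrier M \<Longrightarrow> h' (h x) = x" "\<And>y. y \<in> carrier N \<Longrightarrow> h (h' y) = y"
    and mods: "left_module R M" "left_module R N"
    and pc: "pseudo_coherent R m M"
  shows "pseudo_coherent R m N"
proof -
  have cover: "free_cover R k (\<lambda>x. h (f x)) N" if f: "free_cover R k f M" for k f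
  proof -
    have "\<exists>x\<in>carrier (free_module R k). h (f x) = y" if y: "y \<in> carrier N" for y
      using free_coverD(3)[OF f hom_closed[OF h(2) y]] hh(2)[OF y] by metis
    then show ?thesis
      unfolding free_cover_def using hom_compose[OF free_coverD(1)[OF f] h(1)] hom_closed by fast
  qed
  have cover': "free_cover R k (\<lambda>x. h' (f x)) M" if f: "free_cover R k f N" for k f
  proof -
    have "\<exists>x\<in>carrier (free_module R k). h' (f x) = y" if y: "y \<in> carrier M" for y
      using free_coverD(3)[OF f hom_closed[OF h(1) y]] hh(1)[OF y] by metis
    then show ?thesis
      unfolding free_cover_def using hom_compose[OF free_coverD(1)[OF f] h(2)] hom_closed by fast
  qed
  have rel: "relations R k (\<lambda>x. h' (f x)) M = relations R k f N" if f: "free_cover R k f N" for k f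
  proof -
    have "h' (f x) = \<zero>\<^bsub>M\<^esub> \<longleftrightarrow> f x = \<zero>\<^bsub>N\<^esub>" if x: "x \<in> carrier (free_module R k)" for x
      using hh(2)[OF hom_closed[OF free_coverD(1)[OF f] x]] hom_zero[OF mods h(1)] hom_zero[OF mods(2,1) h(2)] by metis
    then have "{x \<in> carrier (free_module R k). h' (f x) = \<zero>\<^bsub>M\<^esub>} = {x \<in> carrier (free_module R k). f x = \<zero>\<^bsub>N\<^esub>}" by auto
    then show ?thesis by (simp add: relations_def)
  qed
  show ?thesis
  proof (cases m)
    case 0
    then show ?thesis using pc cover by (auto simp: pseudo_coherent_0)
  next
    case (Suc j)
    have "pseudo_coherent R j (relations R k f N)" if f: "free_cover R k f N" for k f
      using pc cover'[OF f] unfolding Suc pseudo_coherent_Suc rel[OF f, symmetric] by blast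
    moreover have "\<exists>k f. free_cover R k f N" using pc cover unfolding Suc pseudo_coherent_Suc by blast
    ultimately show ?thesis unfolding Suc pseudo_coherent_Suc by blast
  qed
qed

text \<open>For \<open>p : Y \<rightarrow> Z\<close> onto, generators \<open>g\<close> of the kernel and lifts \<open>f\<close> of generators of \<open>Z\<close> together
  generate \<open>Y\<close>, and their relations map onto the relations of the generators of \<open>Z\<close>, with kernel the
  relations of \<open>g\<close>.\<close>

lemma relations_append:
  assumes Y: "left_module R Y" and Z: "left_module R Z" and p: "p \<in> left_module_hom R Y Z"
    and g: "free_cover R r g (kernel_module Y p Z)"
    and f: "f \<in> left_module_hom R (free_module R k) Y" and pf: "free_cover R k (\<lambda>x. p (f x)) Z"
  defines "F \<equiv> \<lambda>c. g (row_take R r c) \<oplus>\<^bsub>Y\<^esub> f (row_drop r c)"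
  shows "free_cover R (r + k) F Y" (is ?cover)
    and "row_drop r \<in> left_module_hom R (relations R (r + k) F Y) (relations R k (\<lambda>x. p (f x)) Z)" (is ?hom)
    and "row_drop r ` carrier (relations R (r + k) F Y) = carrier (relations R k (\<lambda>x. p (f x)) Z)" (is ?onto)
    and "pseudo_coherent R m (kernel_module (relations R (r + k) F Y) (row_drop r) (relations R k (\<lambda>x. p (f x)) Z)) \<longleftrightarrow>
      pseudo_coherent R m (relations R r g (kernel_module Y p Z))" (is ?iso)
proof -
  interpret Y: left_module R Y by (rule Y)
  note ring = Y.R.ring_axioms
  note fr = free_left_module[OF ring]
  interpret Fr: left_module R "free_module R n" for n by (rule fr)
  have X: "left_module R (kernel_module Y p Z)" by (rule kernel_left_module[OF Y Z p])
  have kY: "{y \<in> carrier Y. p y = \<zero>\<^bsub>Z\<^esub>} \<subseteq> carrier Y" by auto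
  have gY: "g \<in> left_module_hom R (free_module R r) Y"
    by (rule hom_into_submodule[OF free_coverD(1)[OF g, unfolded kernel_module_def] kY])
  have pg: "p (g u) = \<zero>\<^bsub>Z\<^esub>" if "u \<in> carrier (free_module R r)" for u
    using hom_closed[OF free_coverD(1)[OF g] that] by (simp add: kernel_module_simps)
  have g_onto: "\<exists>u \<in> carrier (free_module R r). g u = y" if "y \<in> carrier Y" "p y = \<zero>\<^bsub>Z\<^esub>" for y
    using free_coverD(3)[OF g] that by (simp add: kernel_module_simps)
  have F: "F \<in> left_module_hom R (free_module R (r + k)) Y"
    unfolding F_def by (rule free_hom_append[OF Y gY f])
  note tk = hom_closed[OF row_take_hom[OF ring]] and dr = hom_closed[OF row_drop_hom]
  interpret Z: left_module R Z by (rule Z)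
  have pF: "p (F c) = p (f (row_drop r c))" if c: "c \<in> carrier (free_module R (r + k))" for c
    using hom_add[OF p hom_closed[OF gY tk[OF c]] hom_closed[OF f dr[OF c]]] pg[OF tk[OF c]]
      hom_closed[OF p hom_closed[OF f dr[OF c]]] by (simp add: F_def)
  have lift: "\<exists>c \<in> carrier (free_module R (r + k)). row_drop r c = v \<and> F c = y"
    if v: "v \<in> carrier (free_module R k)" and y: "y \<in> carrier Y" "p y = p (f v)" for v y
  proof -
    have fv: "f v \<in> carrier Y" using hom_closed[OF f v] .
    have "p (y \<ominus>\<^bsub>Y\<^esub> f v) = \<zero>\<^bsub>Z\<^esub>"
      unfolding hom_minus[OF Y Z p y(1) fv] using Z.M.diff_eq_zero_iff hom_closed[OF p y(1)] y(2) by simp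
    then obtain u where u: "u \<in> carrier (free_module R r)" "g u = y \<ominus>\<^bsub>Y\<^esub> f v"
      using g_onto[of "y \<ominus>\<^bsub>Y\<^esub> f v"] y(1) fv by auto
    have "F (row_append r u v) = y"
      unfolding F_def row_append(2,3)[OF u(1) v] u(2)
      using y(1) fv by (simp add: a_minus_def Y.M.a_assoc Y.M.l_neg)
    then show ?thesis using row_append(1,3)[OF u(1) v] by (intro bexI[of _ "row_append r u v"]) auto
  qed
  show ?cover
    unfolding free_cover_def
  proof (intro conjI F equalityI subsetI)
    fix y assume "y \<in> F ` carrier (free_module R (r + k))"
    then show "y \<in> carrier Y" using hom_closed[OF F] by auto
  next
    fix y assume y: "y \<in> carrier Y"
    obtain v where "v \<in> carrier (free_module R k)" "p (f v) = p y" using free_coverD(3)[OF pf hom_closed[OF p y]] by auto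
    then show "y \<in> F ` carrier (free_module R (r + k))" using lift[of v y] y by auto
  qed
  have drel: "row_drop r c \<in> carrier (relations R k (\<lambda>x. p (f x)) Z)" if c: "c \<in> carrier (relations R (r + k) F Y)" for c
  proof -
    have "c \<in> carrier (free_module R (r + k))" "F c = \<zero>\<^bsub>Y\<^esub>" using c by (auto simp: relations_def)
    then show ?thesis using pF[of c] dr[of c] hom_zero[OF Y Z p] by (simp add: relations_def)
  qed
  show h: ?hom
  proof (rule left_module_homI[OF drel])
    fix c d assume "c \<in> carrier (relations R (r + k) F Y)" "d \<in> carrier (relations R (r + k) F Y)"
    then show "row_drop r (c \<oplus>\<^bsub>relations R (r + k) F Y\<^esub> d) =
        row_drop r c \<oplus>\<^bsub>relations R k (\<lambda>x. p (f x)) Z\<^esub> row_drop r d"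
      by (simp add: relations_def row_drop_def free_module_simps)
  next
    fix a c assume "a \<in> carrier R" "c \<in> carrier (relations R (r + k) F Y)"
    then show "row_drop r (a \<odot>\<^bsub>relations R (r + k) F Y\<^esub> c) = a \<odot>\<^bsub>relations R k (\<lambda>x. p (f x)) Z\<^esub> row_drop r c"
      by (simp add: relations_def row_drop_def free_module_simps)
  qed
  show ?onto
  proof (intro equalityI subsetI)
    fix v assume "v \<in> row_drop r ` carrier (relations R (r + k) F Y)"
    then show "v \<in> carrier (relations R k (\<lambda>x. p (f x)) Z)" using drel by auto
  next
    fix v assume "v \<in> carrier (relations R k (\<lambda>x. p (f x)) Z)"
    then have v: "v \<in> carrier (free_module R k)" "p (f v) = \<zero>\<^bsub>Z\<^esub>" by (auto simp: relations_def)
    obtain c where "c \<in> carrier (free_module R (r + k))" "row_drop r c = v" "F c = \<zero>\<^bsub>Y\<^esub>"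
      using lift[OF v(1) Y.M.zero_closed] v(2) hom_zero[OF Y Z p] by auto
    then show "v \<in> row_drop r ` carrier (relations R (r + k) F Y)" by (auto simp: relations_def)
  qed
  let ?N = "kernel_module (relations R (r + k) F Y) (row_drop r) (relations R k (\<lambda>x. p (f x)) Z)"
  let ?G = "relations R r g (kernel_module Y p Z)"
  let ?z = "\<lambda>i::nat. \<zero>\<^bsub>R\<^esub>"
  have z: "?z \<in> carrier (free_module R k)" using Fr.M.zero_closed[of k] by (simp add: free_module_simps)
  have fz: "f ?z = \<zero>\<^bsub>Y\<^esub>" using hom_zero[OF fr Y f] by (simp add: free_module_simps)
  have N: "c \<in> carrier ?N \<longleftrightarrow> c \<in> carrier (free_module R (r + k)) \<and> F c = \<zero>\<^bsub>Y\<^esub> \<and> row_drop r c = ?z" for c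
    by (auto simp: kernel_module_def relations_def free_module_simps)
  have G: "u \<in> carrier ?G \<longleftrightarrow> u \<in> carrier (free_module R r) \<and> g u = \<zero>\<^bsub>Y\<^esub>" for u
    by (simp add: relations_def kernel_module_simps)
  have NG: "row_take R r c \<in> carrier ?G" if "c \<in> carrier ?N" for c
    using that tk[of c] fz hom_closed[OF gY tk[of c]] unfolding N G by (auto simp: F_def)
  have GN: "row_append r u ?z \<in> carrier ?N" if "u \<in> carrier ?G" for u
    using that row_append[OF _ z, of u r] fz unfolding N G by (simp add: F_def)
  have ops: "\<zero>\<^bsub>?N\<^esub> = ?z" "c \<oplus>\<^bsub>?N\<^esub> d = (\<lambda>i. c i \<oplus>\<^bsub>R\<^esub> d i)" "a \<odot>\<^bsub>?N\<^esub> c = (\<lambda>i. a \<otimes>\<^bsub>R\<^esub> c i)"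
    "c \<oplus>\<^bsub>?G\<^esub> d = (\<lambda>i. c i \<oplus>\<^bsub>R\<^esub> d i)" "a \<odot>\<^bsub>?G\<^esub> c = (\<lambda>i. a \<otimes>\<^bsub>R\<^esub> c i)" for a c d
    by (simp_all add: kernel_module_def relations_def free_module_simps)
  have h1: "row_take R r \<in> left_module_hom R ?N ?G"
    by (rule left_module_homI[OF NG]) (auto simp: ops row_take_def fun_eq_iff)
  have h2: "(\<lambda>u. row_append r u ?z) \<in> left_module_hom R ?G ?N"
    by (rule left_module_homI[OF GN]) (auto simp: ops row_append_def fun_eq_iff)
  have i1: "row_append r (row_take R r c) ?z = c" if "c \<in> carrier ?N" for c
    using that row_append_take_drop[of c R r k] unfolding N by simp
  have i2: "row_take R r (row_append r u ?z) = u" if "u \<in> carrier ?G" for u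
    using that row_append(2)[OF _ z] unfolding G by blast
  have mN: "left_module R ?N"
    by (rule kernel_left_module[OF relations_left_module[OF Y \<open>?cover\<close>] relations_left_module[OF Z pf] h])
  note mG = relations_left_module[OF X g]
  show ?iso using pseudo_coherent_iso[OF h1 h2 i1 i2 mN mG] pseudo_coherent_iso[OF h2 h1 i2 i1 mG mN] by blast
qed

lemma free_cover_compose:
  assumes "free_cover R k f Y" "p \<in> left_module_hom R Y Z" "p ` carrier Y = carrier Z"
  shows "free_cover R k (\<lambda>x. p (f x)) Z"
  unfolding free_cover_def
proof
  show "(\<lambda>x. p (f x)) \<in> left_module_hom R (free_module R k) Z" by (rule hom_compose[OF free_coverD(1)[OF assms(1)] assms(2)])
  have "(\<lambda>x. p (f x)) ` carrier (free_module R k) = p ` (f ` carrier (free_module R k))" by (simp add: image_image)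
  then show "(\<lambda>x. p (f x)) ` carrier (free_module R k) = carrier Z"
    using free_coverD(2)[OF assms(1)] assms(3) by simp
qed

lemma pseudo_coherent_kernel_0:
  assumes Y: "left_module R Y" and Z: "left_module R Z" and p: "p \<in> left_module_hom R Y Z" "p ` carrier Y = carrier Z"
    and "pseudo_coherent R 0 Y" "pseudo_coherent R (Suc 0) Z"
  shows "pseudo_coherent R 0 (kernel_module Y p Z)"
proof -
  obtain k f where f: "free_cover R k f Y" using assms(5) by (auto simp: pseudo_coherent_0)
  note pf = free_cover_compose[OF f p]
  obtain q g where g: "free_cover R q g (relations R k (\<lambda>x. p (f x)) Z)"
    using assms(6) pf unfolding pseudo_coherent_Suc pseudo_coherent_0 by meson
  have g': "g \<in> left_module_hom R (free_module R q) (free_module R k)"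
    by (rule hom_into_submodule[OF free_coverD(1)[OF g, unfolded relations_def]]) auto
  note fg = hom_compose[OF g' free_coverD(1)[OF f]]
  have im: "g x \<in> carrier (free_module R k)" "p (f (g x)) = \<zero>\<^bsub>Z\<^esub>" if "x \<in> carrier (free_module R q)" for x
    using hom_closed[OF free_coverD(1)[OF g] that] by (auto simp: relations_def)
  have "free_cover R q (\<lambda>x. f (g x)) (kernel_module Y p Z)"
    unfolding free_cover_def
  proof (intro conjI equalityI subsetI)
    show "(\<lambda>x. f (g x)) \<in> left_module_hom R (free_module R q) (kernel_module Y p Z)"
      unfolding kernel_module_def by (rule hom_codomain_submodule[OF fg]) (use im hom_closed[OF fg] in auto)
    fix y
    show "y \<in> (\<lambda>x. f (g x)) ` carrier (free_module R q) \<Longrightarrow> y \<in> carrier (kernel_module Y p Z)"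
      using im hom_closed[OF fg] by (auto simp: kernel_module_simps)
    assume "y \<in> carrier (kernel_module Y p Z)"
    then have y: "y \<in> carrier Y" "p y = \<zero>\<^bsub>Z\<^esub>" by (auto simp: kernel_module_simps)
    obtain x where x: "x \<in> carrier (free_module R k)" "f x = y" using free_coverD(3)[OF f y(1)] by auto
    then have "x \<in> carrier (relations R k (\<lambda>x. p (f x)) Z)" using y by (simp add: relations_def)
    then obtain u where "u \<in> carrier (free_module R q)" "g u = x" using free_coverD(3)[OF g] by auto
    then show "y \<in> (\<lambda>x. f (g x)) ` carrier (free_module R q)" using x(2) by auto
  qed
  then show ?thesis by (auto simp: pseudo_coherent_0)
qed

text \<open>Relations between generators of the kernel of \<open>p\<close> are the kernel of a surjection between
  modules of relations of \<open>Y\<close> and of \<open>Z\<close>, so the claim for \<open>m + 1\<close> reduces to the claim for \<open>m\<close>. The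
  latter is assumed for modules of rows only: an induction cannot change types, and modules of
  relations are of this type.\<close>

lemma pseudo_coherent_kernel_step:
  fixes Y :: "('a, 'y) module" and Z :: "('a, 'z) module"
  assumes IH: "\<And>(Y' :: ('a, nat \<Rightarrow> 'a) module) (Z' :: ('a, nat \<Rightarrow> 'a) module) p'.
      left_module R Y' \<Longrightarrow> left_module R Z' \<Longrightarrow> p' \<in> left_module_hom R Y' Z' \<Longrightarrow> p' ` carrier Y' = carrier Z' \<Longrightarrow>
      pseudo_coherent R m Y' \<Longrightarrow> pseudo_coherent R (Suc m) Z' \<Longrightarrow> pseudo_coherent R m (kernel_module Y' p' Z')"
    and Y: "left_module R Y" and Z: "left_module R Z" and p: "p \<in> left_module_hom R Y Z" "p ` carrier Y = carrier Z"
    and pY: "pseudo_coherent R (Suc m) Y" and pZ: "pseudo_coherent R (Suc (Suc m)) Z"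
  shows "pseudo_coherent R (Suc m) (kernel_module Y p Z)"
  unfolding pseudo_coherent_Suc
proof (intro conjI allI impI)
  have "pseudo_coherent R (Suc 0) Z"
    using pZ pseudo_coherent_imp_0 unfolding pseudo_coherent_Suc[of R "Suc m"] pseudo_coherent_Suc[of R 0] by blast
  then show "\<exists>k f. free_cover R k f (kernel_module Y p Z)"
    using pseudo_coherent_kernel_0[OF Y Z p pseudo_coherent_imp_0[OF pY]] by (simp add: pseudo_coherent_0)
  fix r g assume g: "free_cover R r g (kernel_module Y p Z)"
  obtain k f where f: "free_cover R k f Y" using pY by (auto simp: pseudo_coherent_Suc)
  note pf = free_cover_compose[OF f p]
  note app = relations_append[OF Y Z p(1) g free_coverD(1)[OF f] pf]
  have "pseudo_coherent R m (relations R (r + k) (\<lambda>c. g (row_take R r c) \<oplus>\<^bsub>Y\<^esub> f (row_drop r c)) Y)"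
    using pY app(1) by (auto simp: pseudo_coherent_Suc)
  moreover have "pseudo_coherent R (Suc m) (relations R k (\<lambda>x. p (f x)) Z)"
    using pZ pf unfolding pseudo_coherent_Suc[of R "Suc m"] by blast
  ultimately show "pseudo_coherent R m (relations R r g (kernel_module Y p Z))"
    using IH[OF relations_left_module[OF Y app(1)] relations_left_module[OF Z pf] app(2,3)] app(4) by blast
qed

lemma pseudo_coherent_kernel:
  fixes Y :: "('a, 'y) module" and Z :: "('a, 'z) module"
  assumes "left_module R Y" "left_module R Z" "p \<in> left_module_hom R Y Z" "p ` carrier Y = carrier Z"
    and "pseudo_coherent R m Y" "pseudo_coherent R (Suc m) Z"
  shows "pseudo_coherent R m (kernel_module Y p Z)"
proof -
  have rows: "left_module R Y' \<Longrightarrow> left_module R Z' \<Longrightarrow> p' \<in> left_module_hom R Y' Z' \<Longrightarrow> p' ` carrier Y' = carrier Z' \<Longrightarrow>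
      pseudo_coherent R n Y' \<Longrightarrow> pseudo_coherent R (Suc n) Z' \<Longrightarrow> pseudo_coherent R n (kernel_module Y' p' Z')"
    for n and Y' Z' :: "('a, nat \<Rightarrow> 'a) module" and p'
  proof (induction n arbitrary: Y' Z' p')
    case 0 then show ?case by (rule pseudo_coherent_kernel_0)
  next
    case (Suc n) show ?case by (rule pseudo_coherent_kernel_step[OF Suc.IH Suc.prems])
  qed
  show ?thesis
  proof (cases m)
    case 0 then show ?thesis using pseudo_coherent_kernel_0 assms by blast
  next
    case (Suc n)
    show ?thesis unfolding Suc
      by (rule pseudo_coherent_kernel_step[OF rows assms(1-4) assms(5,6)[unfolded Suc]])
  qed
qed

lemma pseudo_coherent_quotient_0:
  assumes "p \<in> left_module_hom R Y Z" "p ` carrier Y = carrier Z" "pseudo_coherent R 0 Y"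
  shows "pseudo_coherent R 0 Z"
  using assms(3) free_cover_compose[OF _ assms(1,2)] unfolding pseudo_coherent_0 by blast

text \<open>Given generators of \<open>Z\<close>, their relations are the quotient of the relations of suitable
  generators of \<open>Y\<close> by the relations of generators of the kernel of \<open>p\<close>.\<close>

lemma pseudo_coherent_quotient_step:
  fixes Y :: "('a, 'y) module" and Z :: "('a, 'z) module"
  assumes IH: "\<And>(Y' :: ('a, nat \<Rightarrow> 'a) module) (Z' :: ('a, nat \<Rightarrow> 'a) module) p'.
      left_module R Y' \<Longrightarrow> left_module R Z' \<Longrightarrow> p' \<in> left_module_hom R Y' Z' \<Longrightarrow> p' ` carrier Y' = carrier Z' \<Longrightarrow>
      pseudo_coherent R m Y' \<Longrightarrow> (\<And>j. m = Suc j \<Longrightarrow> pseudo_coherent R j (kernel_module Y' p' Z')) \<Longrightarrow> pseudo_coherent R m Z'"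
    and Y: "left_module R Y" and Z: "left_module R Z" and p: "p \<in> left_module_hom R Y Z" "p ` carrier Y = carrier Z"
    and pY: "pseudo_coherent R (Suc m) Y" and pX: "pseudo_coherent R m (kernel_module Y p Z)"
  shows "pseudo_coherent R (Suc m) Z"
  unfolding pseudo_coherent_Suc
proof (intro conjI allI impI)
  show "\<exists>k f. free_cover R k f Z"
    using pseudo_coherent_quotient_0[OF p pseudo_coherent_imp_0[OF pY]] by (simp add: pseudo_coherent_0)
  fix k f' assume f': "free_cover R k f' Z"
  obtain f where f: "f \<in> left_module_hom R (free_module R k) Y" "\<And>x. x \<in> carrier (free_module R k) \<Longrightarrow> p (f x) = f' x"
    using free_hom_lift[OF Y Z p(1) free_coverD(1)[OF f']] free_coverD(2)[OF f'] p(2) by (metis order_refl)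
  have pf: "free_cover R k (\<lambda>x. p (f x)) Z"
    using f' hom_compose[OF f(1) p(1)] f(2) by (simp add: free_cover_def cong: image_cong)
  have rel: "relations R k (\<lambda>x. p (f x)) Z = relations R k f' Z"
    using f(2) by (simp add: relations_def cong: conj_cong)
  obtain r g where g: "free_cover R r g (kernel_module Y p Z)"
    using pseudo_coherent_imp_0[OF pX] by (auto simp: pseudo_coherent_0)
  note app = relations_append[OF Y Z p(1) g f(1) pf]
  have 1: "pseudo_coherent R m (relations R (r + k) (\<lambda>c. g (row_take R r c) \<oplus>\<^bsub>Y\<^esub> f (row_drop r c)) Y)"
    using pY app(1) by (auto simp: pseudo_coherent_Suc)
  have 2: "pseudo_coherent R j (relations R r g (kernel_module Y p Z))" if "m = Suc j" for j
    using pX g unfolding that pseudo_coherent_Suc by blast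
  show "pseudo_coherent R m (relations R k f' Z)"
    unfolding rel[symmetric]
    by (rule IH[OF relations_left_module[OF Y app(1)] relations_left_module[OF Z pf] app(2,3) 1]) (use 2 app(4) in blast)
qed

lemma pseudo_coherent_quotient:
  fixes Y :: "('a, 'y) module" and Z :: "('a, 'z) module"
  assumes "left_module R Y" "left_module R Z" "p \<in> left_module_hom R Y Z" "p ` carrier Y = carrier Z"
    and "pseudo_coherent R m Y" "\<And>j. m = Suc j \<Longrightarrow> pseudo_coherent R j (kernel_module Y p Z)"
  shows "pseudo_coherent R m Z"
proof -
  have rows: "left_module R Y' \<Longrightarrow> left_module R Z' \<Longrightarrow> p' \<in> left_module_hom R Y' Z' \<Longrightarrow> p' ` carrier Y' = carrier Z' \<Longrightarrow>
      pseudo_coherent R n Y' \<Longrightarrow> (\<And>j. n = Suc j \<Longrightarrow> pseudo_coherent R j (kernel_module Y' p' Z')) \<Longrightarrow> pseudo_coherent R n Z'"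
    for n and Y' Z' :: "('a, nat \<Rightarrow> 'a) module" and p'
  proof (induction n arbitrary: Y' Z' p')
    case 0 then show ?case using pseudo_coherent_quotient_0 by blast
  next
    case (Suc n) show ?case by (rule pseudo_coherent_quotient_step[OF Suc.IH Suc.prems(1-5) Suc.prems(6)[OF refl]])
  qed
  show ?thesis
  proof (cases m)
    case 0 then show ?thesis using pseudo_coherent_quotient_0 assms by blast
  next
    case (Suc n)
    show ?thesis unfolding Suc
      by (rule pseudo_coherent_quotient_step[OF rows assms(1-4) assms(5)[unfolded Suc] assms(6)[OF Suc]])
  qed
qed

text \<open>The cover splits: \<open>x \<mapsto> x - g (i (f x))\<close> projects the free module onto the relations.\<close>

lemma retract_of_free_relations:
  assumes M: "left_module R M" and ret: "retract_of_free R M" and f: "free_cover R k f M"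
  shows "retract_of_free R (relations R k f M)"
proof -
  interpret M: left_module R M by (rule M)
  note fr = free_left_module[OF M.R.ring_axioms]
  interpret F: left_module R "free_module R k" by (rule fr)
  obtain n i r where ir: "i \<in> left_module_hom R M (free_module R n)" "r \<in> left_module_hom R (free_module R n) M"
    "\<And>x. x \<in> carrier M \<Longrightarrow> r (i x) = x" using ret by (auto simp: retract_of_free_def)
  obtain g where g: "g \<in> left_module_hom R (free_module R n) (free_module R k)"
    "\<And>x. x \<in> carrier (free_module R n) \<Longrightarrow> f (g x) = r x"
    by (rule free_hom_lift[OF fr M free_coverD(1)[OF f] ir(2)]) (use free_coverD(2)[OF f] hom_closed[OF ir(2)] in auto)
  let ?s = "\<lambda>x. g (i (f x))"
  have s: "?s \<in> left_module_hom R (free_module R k) (free_module R k)"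
    by (rule hom_compose[OF hom_compose[OF free_coverD(1)[OF f] ir(1)] g(1)])
  let ?\<rho> = "\<lambda>x. x \<ominus>\<^bsub>free_module R k\<^esub> ?s x"
  have \<rho>: "?\<rho> \<in> left_module_hom R (free_module R k) (free_module R k)" by (rule hom_diff[OF fr hom_id s])
  have "f (?\<rho> x) = \<zero>\<^bsub>M\<^esub>" if x: "x \<in> carrier (free_module R k)" for x
  proof -
    have fx: "f x \<in> carrier M" using hom_closed[OF free_coverD(1)[OF f] x] .
    have "f (?\<rho> x) = f x \<ominus>\<^bsub>M\<^esub> f x"
      using hom_minus[OF fr M free_coverD(1)[OF f] x hom_closed[OF s x]] g(2)[OF hom_closed[OF ir(1) fx]] ir(3)[OF fx] by simp
    then show ?thesis using M.M.diff_eq_zero_iff[OF fx fx] by simp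
  qed
  then have \<rho>': "?\<rho> \<in> left_module_hom R (free_module R k) (relations R k f M)"
    unfolding relations_def by (intro hom_codomain_submodule[OF \<rho>]) (use hom_closed[OF \<rho>] in auto)
  have inc: "(\<lambda>x. x) \<in> left_module_hom R (relations R k f M) (free_module R k)"
    unfolding relations_def by (rule hom_from_submodule[OF hom_id]) auto
  have "?\<rho> x = x" if x: "x \<in> carrier (relations R k f M)" for x
  proof -
    have x: "x \<in> carrier (free_module R k)" "f x = \<zero>\<^bsub>M\<^esub>" using x by (auto simp: relations_def)
    have "?s x = \<zero>\<^bsub>free_module R k\<^esub>" using x(2) hom_zero[OF M fr ir(1)] hom_zero[OF fr fr g(1)] by simp
    then show ?thesis using x(1) by (simp add: a_minus_def)
  qed
  then show ?thesis
    unfolding retract_of_free_def by (intro exI[of _ k] bexI[OF _ inc] bexI[OF _ \<rho>']) simp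
qed

lemma retract_of_free_cover:
  assumes M: "left_module R M" and "retract_of_free R M"
  shows "\<exists>k f. free_cover R k f M"
  using retract_of_free_projective(2)[OF assms] unfolding finitely_generated_iff[OF M] free_cover_def by blast

lemma retract_of_free_pseudo_coherent:
  fixes M :: "('a, 'm) module"
  assumes M: "left_module R M" and ret: "retract_of_free R M"
  shows "pseudo_coherent R m M"
proof -
  have rows: "left_module R N \<Longrightarrow> retract_of_free R N \<Longrightarrow> pseudo_coherent R n N" for n and N :: "('a, nat \<Rightarrow> 'a) module"
  proof (induction n arbitrary: N)
    case 0 then show ?case using retract_of_free_cover unfolding pseudo_coherent_0 by blast
  next
    case (Suc n)
    then show ?case
      using retract_of_free_cover retract_of_free_relations relations_left_module unfolding pseudo_coherent_Suc by blast
  qed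
  show ?thesis
  proof (cases m)
    case 0 then show ?thesis using retract_of_free_cover[OF assms] by (simp add: pseudo_coherent_0)
  next
    case (Suc n)
    then show ?thesis
      using retract_of_free_cover[OF assms] retract_of_free_relations[OF assms] relations_left_module[OF M] rows
      unfolding Suc pseudo_coherent_Suc by blast
  qed
qed

section \<open>Left pseudocompact rings\<close>

lemma regular_module_neg: "\<ominus>\<^bsub>regular_module R\<^esub> x = \<ominus>\<^bsub>R\<^esub> x" "x \<ominus>\<^bsub>regular_module R\<^esub> y = x \<ominus>\<^bsub>R\<^esub> y"
  by (simp_all add: a_minus_def a_inv_def m_inv_def regular_module_def)

text \<open>The algebraic content of a presentation of \<open>A\<close> as a limit: \<open>\<pi> i\<close> is the projection to the
  \<open>i\<close>-th discrete quotient.\<close>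

locale limit_presentation =
  fixes A :: "('a, 'r) ring_scheme" and TA :: "'a topology"
    and Idx :: "'i set" and leq :: "'i \<Rightarrow> 'i \<Rightarrow> bool" and D :: "'i \<Rightarrow> ('a, 'd) module"
    and f :: "'i \<Rightarrow> 'i \<Rightarrow> 'd \<Rightarrow> 'd" and \<pi> :: "'i \<Rightarrow> 'a \<Rightarrow> 'd"
  assumes top_ring: "topological_ring A TA"
    and directed: "directed_set Idx leq"
    and modules: "\<And>i. i \<in> Idx \<Longrightarrow> left_module A (D i)"
    and finite_len: "\<And>i. i \<in> Idx \<Longrightarrow> finite_length A (D i)"
    and proj_hom: "\<And>i. i \<in> Idx \<Longrightarrow> \<pi> i \<in> left_module_hom A (regular_module A) (D i)"
    and proj_open: "\<And>i d. i \<in> Idx \<Longrightarrow> openin TA {a \<in> carrier A. \<pi> i a = d}"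
    and proj_base: "\<And>U. openin TA U \<Longrightarrow> \<zero>\<^bsub>A\<^esub> \<in> U \<Longrightarrow> \<exists>i\<in>Idx. {a \<in> carrier A. \<pi> i a = \<zero>\<^bsub>D i\<^esub>} \<subseteq> U"
    and proj_inj: "\<And>a. a \<in> carrier A \<Longrightarrow> (\<And>i. i \<in> Idx \<Longrightarrow> \<pi> i a = \<zero>\<^bsub>D i\<^esub>) \<Longrightarrow> a = \<zero>\<^bsub>A\<^esub>"
    and proj_compat: "\<And>i j a. i \<in> Idx \<Longrightarrow> j \<in> Idx \<Longrightarrow> leq i j \<Longrightarrow> a \<in> carrier A \<Longrightarrow> f i j (\<pi> j a) = \<pi> i a"
    and proj_surj: "\<And>d. (\<And>i. i \<in> Idx \<Longrightarrow> d i \<in> carrier (D i)) \<Longrightarrow>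
      (\<And>i j. i \<in> Idx \<Longrightarrow> j \<in> Idx \<Longrightarrow> leq i j \<Longrightarrow> f i j (d j) = d i) \<Longrightarrow>
      \<exists>a \<in> carrier A. \<forall>i\<in>Idx. \<pi> i a = d i"

lemma directed_finite_bound:
  assumes "directed_set Idx leq" "finite F" "F \<subseteq> Idx"
  shows "\<exists>k\<in>Idx. \<forall>i\<in>F. leq i k"
proof -
  have trans: "\<And>i j k. i \<in> Idx \<Longrightarrow> j \<in> Idx \<Longrightarrow> k \<in> Idx \<Longrightarrow> leq i j \<Longrightarrow> leq j k \<Longrightarrow> leq i k"
    and bound: "\<And>i j. i \<in> Idx \<Longrightarrow> j \<in> Idx \<Longrightarrow> \<exists>k\<in>Idx. leq i k \<and> leq j k" and "Idx \<noteq> {}"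
    using assms(1) unfolding directed_set_def by (metis, metis, metis)
  show ?thesis
    using assms(2,3)
  proof (induction F)
    case empty then show ?case using \<open>Idx \<noteq> {}\<close> by auto
  next
    case (insert i F)
    then obtain k where k: "k \<in> Idx" "\<And>i. i \<in> F \<Longrightarrow> leq i k" by auto
    have i: "i \<in> Idx" "F \<subseteq> Idx" using insert by auto
    obtain l where l: "l \<in> Idx" "leq i l" "leq k l" using bound[OF i(1) k(1)] by auto
    have "leq j l" if "j \<in> F" for j using trans[OF _ k(1) l(1) k(2)[OF that] l(3)] that i(2) by auto
    then show ?case using l by (intro bexI[OF _ l(1)]) auto
  qed
qed

lemma left_pseudocompact_presentation:
  fixes A :: "('a, 'r) ring_scheme" and TA :: "'a topology"
  assumes "left_pseudocompact_ring A TA"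
  obtains Idx :: "'a set set" and leq and D :: "'a set \<Rightarrow> ('a, 'a set) module" and f \<pi>
  where "limit_presentation A TA Idx leq D f \<pi>"
proof -
  have top: "topological_ring A TA" and pc: "pseudocompact_module A TA (regular_module A) TA"
    using assms by (auto simp: left_pseudocompact_ring_def)
  obtain Idx :: "'a set set" and leq and D :: "'a set \<Rightarrow> ('a, 'a set) module" and f \<phi>
    where sys: "inverse_system A Idx leq D f" and fl: "\<forall>i\<in>Idx. finite_length A (D i)"
      and iso: "\<phi> \<in> topological_module_iso A (regular_module A) TA
             (inverse_limit Idx leq D f) (limit_topology_of_discrete Idx leq D f)"
    using pc unfolding pseudocompact_module_def by blast
  let ?L = "inverse_limit Idx leq D f"
  have ring: "ring A" and ts: "topspace TA = carrier A" using top by (auto simp: topological_ring_def)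
  have dir: "directed_set Idx leq" and mods: "\<And>i. i \<in> Idx \<Longrightarrow> left_module A (D i)"
    using sys by (auto simp: inverse_system_def)
  have hom: "\<phi> \<in> left_module_hom A (regular_module A) ?L"
    and bij: "bij_betw \<phi> (carrier A) (carrier ?L)"
    and homeo: "homeomorphic_map TA (limit_topology_of_discrete Idx leq D f) \<phi>"
    using iso by (auto simp: topological_module_iso_def left_module_iso_def regular_module_simps)
  have carL: "carrier ?L = {x \<in> (\<Pi>\<^sub>E i\<in>Idx. carrier (D i)). \<forall>i\<in>Idx. \<forall>j\<in>Idx. leq i j \<longrightarrow> f i j (x j) = x i}"
    by (simp add: inverse_limit_def product_module_simps)
  have opsL: "\<zero>\<^bsub>?L\<^esub> = (\<lambda>i\<in>Idx. \<zero>\<^bsub>D i\<^esub>)" "x \<oplus>\<^bsub>?L\<^esub> y = (\<lambda>i\<in>Idx. x i \<oplus>\<^bsub>D i\<^esub> y i)" "a \<odot>\<^bsub>?L\<^esub> x = (\<lambda>i\<in>Idx. a \<odot>\<^bsub>D i\<^esub> x i)" for a x y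
    by (simp_all add: inverse_limit_def product_module_def)
  define \<pi> where "\<pi> i a = \<phi> a i" for i a
  have \<phi>L: "\<phi> a \<in> carrier ?L" if "a \<in> carrier A" for a using hom_closed[OF hom] that by (simp add: regular_module_simps)
  have proj_hom: "\<pi> i \<in> left_module_hom A (regular_module A) (D i)" if i: "i \<in> Idx" for i
  proof (rule left_module_homI)
    fix x assume "x \<in> carrier (regular_module A)"
    then show "\<pi> i x \<in> carrier (D i)" using \<phi>L[of x] i by (auto simp: \<pi>_def carL regular_module_simps)
  qed (use i in \<open>simp_all add: \<pi>_def hom_add[OF hom] hom_smult[OF hom] opsL\<close>)
  have cont: "continuous_map TA (discrete_topology (carrier (D i))) (\<pi> i)" if i: "i \<in> Idx" for i
  proof -
    have "continuous_map TA (product_topology (\<lambda>i. discrete_topology (carrier (D i))) Idx) \<phi>"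
      using homeomorphic_imp_continuous_map[OF homeo] by (simp add: limit_topology_of_discrete_def continuous_map_in_subtopology)
    then show ?thesis
      using continuous_map_componentwise[of TA "\<lambda>i. discrete_topology (carrier (D i))" Idx \<phi>] i by (simp add: \<pi>_def[abs_def])
  qed
  have proj_open: "openin TA {a \<in> carrier A. \<pi> i a = d}" if i: "i \<in> Idx" for i d
  proof -
    have "openin TA {a \<in> topspace TA. \<pi> i a \<in> carrier (D i) \<inter> {d}}"
      by (rule openin_continuous_map_preimage[OF cont[OF i]]) auto
    moreover have "{a \<in> topspace TA. \<pi> i a \<in> carrier (D i) \<inter> {d}} = {a \<in> carrier A. \<pi> i a = d}"
      using hom_closed[OF proj_hom[OF i]] ts by (auto simp: regular_module_simps)
    ultimately show ?thesis by simp
  qed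
  have regA: "left_module A (regular_module A)" by (rule regular_left_module[OF ring])
  have proj0: "\<pi> i \<zero>\<^bsub>A\<^esub> = \<zero>\<^bsub>D i\<^esub>" if "i \<in> Idx" for i
    using hom_zero[OF regA mods[OF that] proj_hom[OF that]] by (simp add: regular_module_simps)
  have compat: "f i j (\<pi> j a) = \<pi> i a" if "i \<in> Idx" "j \<in> Idx" "leq i j" "a \<in> carrier A" for i j a
    using \<phi>L[OF that(4)] that(1-3) by (auto simp: carL \<pi>_def)
  have fhom: "f i j \<in> left_module_hom A (D j) (D i)" if "i \<in> Idx" "j \<in> Idx" "leq i j" for i j
    using sys that by (auto simp: inverse_system_def)
  have inj: "inj_on \<phi> (carrier A)" and img: "\<phi> ` carrier A = carrier ?L" using bij by (auto simp: bij_betw_def)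
  have base: "\<exists>i\<in>Idx. {a \<in> carrier A. \<pi> i a = \<zero>\<^bsub>D i\<^esub>} \<subseteq> U" if U: "openin TA U" "\<zero>\<^bsub>A\<^esub> \<in> U" for U
  proof -
    have UA: "U \<subseteq> carrier A" using openin_subset[OF U(1)] ts by simp
    have "openin (limit_topology_of_discrete Idx leq D f) (\<phi> ` U)"
      using homeomorphic_map_openness[OF homeo, of U] U(1) UA ts by simp
    then obtain V where V: "openin (product_topology (\<lambda>i. discrete_topology (carrier (D i))) Idx) V" "\<phi> ` U = V \<inter> carrier ?L"
      unfolding limit_topology_of_discrete_def openin_subtopology by blast
    have "\<phi> \<zero>\<^bsub>A\<^esub> \<in> V" using U(2) V(2) by blast
    then obtain W where W: "finite {i \<in> Idx. W i \<noteq> topspace (discrete_topology (carrier (D i)))}"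
      "\<phi> \<zero>\<^bsub>A\<^esub> \<in> Pi\<^sub>E Idx W" "Pi\<^sub>E Idx W \<subseteq> V"
      using V(1) unfolding openin_product_topology_alt by meson
    \<comment> \<open>A basic neighbourhood of zero restricts finitely many coordinates, and by directedness all of
      them are determined by a single one.\<close>
    let ?F = "{i \<in> Idx. W i \<noteq> topspace (discrete_topology (carrier (D i)))}"
    obtain k where k: "k \<in> Idx" "\<forall>i\<in>?F. leq i k" using directed_finite_bound[OF dir W(1)] by auto
    have "a \<in> U" if a: "a \<in> carrier A" "\<pi> k a = \<zero>\<^bsub>D k\<^esub>" for a
    proof -
      have "\<phi> a i \<in> W i" if i: "i \<in> Idx" for i
      proof (cases "i \<in> ?F")
        case True
        then have ik: "leq i k" using k(2) by blast
        have "\<pi> i a = f i k \<zero>\<^bsub>D k\<^esub>" using compat[OF i k(1) ik a(1)] a(2) by simp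
        also have "\<dots> = \<pi> i \<zero>\<^bsub>A\<^esub>" using proj0[OF i] hom_zero[OF mods[OF k(1)] mods[OF i] fhom[OF i k(1) ik]] by simp
        finally show ?thesis using W(2) i by (auto simp: \<pi>_def)
      next
        case False
        then show ?thesis using i \<phi>L[OF a(1)] by (auto simp: carL)
      qed
      moreover have "\<phi> a \<in> extensional Idx" using \<phi>L[OF a(1)] by (auto simp: carL PiE_def)
      ultimately have "\<phi> a \<in> \<phi> ` U" using V(2) W(3) \<phi>L[OF a(1)] by (auto simp: PiE_def)
      then show "a \<in> U" using inj a(1) UA by (auto simp: inj_on_def)
    qed
    then show ?thesis using k(1) by blast
  qed
  have "limit_presentation A TA Idx leq D f \<pi>"
  proof (rule limit_presentation.intro)
    fix a assume a: "a \<in> carrier A" "\<And>i. i \<in> Idx \<Longrightarrow> \<pi> i a = \<zero>\<^bsub>D i\<^esub>"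
    have z: "\<zero>\<^bsub>A\<^esub> \<in> carrier A" using ring by (simp add: ring.ring_simprules)
    have "\<phi> a = \<phi> \<zero>\<^bsub>A\<^esub>"
      by (rule extensionalityI[of _ Idx])
        (use \<phi>L[OF a(1)] \<phi>L[OF z] a(2) proj0 in \<open>auto simp: carL PiE_def \<pi>_def\<close>)
    then show "a = \<zero>\<^bsub>A\<^esub>" using inj a(1) z by (auto simp: inj_on_def)
  next
    fix d assume d: "\<And>i. i \<in> Idx \<Longrightarrow> d i \<in> carrier (D i)"
      "\<And>i j. i \<in> Idx \<Longrightarrow> j \<in> Idx \<Longrightarrow> leq i j \<Longrightarrow> f i j (d j) = d i"
    have "restrict d Idx \<in> carrier ?L" using d by (auto simp: carL)
    then obtain a where "a \<in> carrier A" "\<phi> a = restrict d Idx" unfolding img[symmetric] by auto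
    then have "\<forall>i\<in>Idx. \<pi> i a = d i" by (simp add: \<pi>_def)
    with \<open>a \<in> carrier A\<close> show "\<exists>a\<in>carrier A. \<forall>i\<in>Idx. \<pi> i a = d i" by blast
  next
    show "finite_length A (D i)" if "i \<in> Idx" for i using fl that by simp
  qed (rule top dir mods proj_hom proj_open base compat; assumption)+
  then show thesis by (rule that)
qed

context limit_presentation
begin

lemma ring_A: "ring A" and topspace_A: "topspace TA = carrier A"
  using top_ring by (auto simp: topological_ring_def)

abbreviation ker :: "'i \<Rightarrow> 'a set" where
  "ker i \<equiv> {a \<in> carrier A. \<pi> i a = \<zero>\<^bsub>D i\<^esub>}"

abbreviation left_ideal :: "'a set \<Rightarrow> bool" where
  "left_ideal U \<equiv> submodule U A (regular_module A)"

lemma proj_mult: "i \<in> Idx \<Longrightarrow> a \<in> carrier A \<Longrightarrow> b \<in> carrier A \<Longrightarrow> \<pi> i (a \<otimes>\<^bsub>A\<^esub> b) = a \<odot>\<^bsub>D i\<^esub> \<pi> i b"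
  and proj_closed: "i \<in> Idx \<Longrightarrow> a \<in> carrier A \<Longrightarrow> \<pi> i a \<in> carrier (D i)"
  using hom_smult[OF proj_hom] hom_closed[OF proj_hom] by (auto simp: regular_module_simps)

lemma left_idealD:
  assumes "left_ideal U"
  shows "U \<subseteq> carrier A" "\<zero>\<^bsub>A\<^esub> \<in> U" "x \<in> U \<Longrightarrow> y \<in> U \<Longrightarrow> x \<oplus>\<^bsub>A\<^esub> y \<in> U"
    "a \<in> carrier A \<Longrightarrow> x \<in> U \<Longrightarrow> a \<otimes>\<^bsub>A\<^esub> x \<in> U" "x \<in> U \<Longrightarrow> \<ominus>\<^bsub>A\<^esub> x \<in> U" "x \<in> U \<Longrightarrow> y \<in> U \<Longrightarrow> x \<ominus>\<^bsub>A\<^esub> y \<in> U"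
  using submoduleD[OF assms] by (simp_all add: regular_module_simps regular_module_neg)

lemma left_idealI:
  assumes "U \<subseteq> carrier A" "\<zero>\<^bsub>A\<^esub> \<in> U" "\<And>x y. x \<in> U \<Longrightarrow> y \<in> U \<Longrightarrow> x \<oplus>\<^bsub>A\<^esub> y \<in> U"
    "\<And>a x. a \<in> carrier A \<Longrightarrow> x \<in> U \<Longrightarrow> a \<otimes>\<^bsub>A\<^esub> x \<in> U"
  shows "left_ideal U"
  by (rule left_module.submoduleI[OF regular_left_module[OF ring_A]]) (use assms in \<open>auto simp: regular_module_simps\<close>)

lemma ker_left_ideal:
  assumes "i \<in> Idx"
  shows "left_ideal (ker i)"
  using submodule_kernel[OF regular_left_module[OF ring_A] modules[OF assms] proj_hom[OF assms]]
  by (simp add: regular_module_simps)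

lemma proj_eq_iff:
  assumes "i \<in> Idx" "a \<in> carrier A" "b \<in> carrier A"
  shows "\<pi> i a = \<pi> i b \<longleftrightarrow> a \<ominus>\<^bsub>A\<^esub> b \<in> ker i"
proof -
  interpret R: ring A by (rule ring_A)
  interpret D: left_module A "D i" by (rule modules[OF assms(1)])
  interpret Rg: left_module A "regular_module A" by (rule regular_left_module[OF ring_A])
  have "\<pi> i (a \<ominus>\<^bsub>A\<^esub> b) = \<pi> i a \<ominus>\<^bsub>D i\<^esub> \<pi> i b"
    using hom_minus[OF Rg.left_module_axioms D.left_module_axioms proj_hom[OF assms(1)], of a b] assms(2,3)
    by (simp add: regular_module_simps regular_module_neg)
  then show ?thesis
    using D.M.diff_eq_zero_iff[OF proj_closed[OF assms(1,2)] proj_closed[OF assms(1,3)]] assms by simp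
qed

lemma open_of_ker_subset:
  assumes "i \<in> Idx" "left_ideal U" "ker i \<subseteq> U"
  shows "openin TA U" "closedin TA U"
proof -
  interpret R: ring A by (rule ring_A)
  note U = left_idealD[OF assms(2)]
  have nb: "{b \<in> carrier A. \<pi> i b = \<pi> i a} \<subseteq> U" if a: "a \<in> U" for a
  proof
    fix b assume b: "b \<in> {b \<in> carrier A. \<pi> i b = \<pi> i a}"
    then have "b \<ominus>\<^bsub>A\<^esub> a \<in> U" using proj_eq_iff[OF assms(1), of b a] a U(1) assms(3) by auto
    moreover have "b = (b \<ominus>\<^bsub>A\<^esub> a) \<oplus>\<^bsub>A\<^esub> a" using b a U(1) by (auto simp: a_minus_def R.a_assoc R.l_neg)
    ultimately show "b \<in> U" using U(3) a by metis
  qed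
  show "openin TA U"
    by (subst openin_subopen) (use nb U(1) proj_open[OF assms(1)] in blast)
  have "openin TA (carrier A - U)"
  proof (subst openin_subopen, intro ballI)
    fix a assume a: "a \<in> carrier A - U"
    have "{b \<in> carrier A. \<pi> i b = \<pi> i a} \<subseteq> carrier A - U"
    proof
      fix b assume "b \<in> {b \<in> carrier A. \<pi> i b = \<pi> i a}"
      then show "b \<in> carrier A - U" using nb[of b] a by auto
    qed
    then show "\<exists>T. openin TA T \<and> a \<in> T \<and> T \<subseteq> carrier A - U"
      using a proj_open[OF assms(1)] by (intro exI[of _ "{b \<in> carrier A. \<pi> i b = \<pi> i a}"]) auto
  qed
  then show "closedin TA U" using U(1) by (simp add: closedin_def topspace_A)
qed

lemma Hausdorff_A: "Hausdorff_space TA"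
  unfolding Hausdorff_space_def
proof (intro allI impI)
  fix x y assume "x \<in> topspace TA \<and> y \<in> topspace TA \<and> x \<noteq> y"
  then have xy: "x \<in> carrier A" "y \<in> carrier A" "x \<noteq> y" by (auto simp: topspace_A)
  interpret R: ring A by (rule ring_A)
  have "x \<ominus>\<^bsub>A\<^esub> y \<noteq> \<zero>\<^bsub>A\<^esub>" using R.diff_eq_zero_iff xy by blast
  then obtain i where i: "i \<in> Idx" "\<pi> i x \<noteq> \<pi> i y" using proj_inj[of "x \<ominus>\<^bsub>A\<^esub> y"] proj_eq_iff xy by auto
  show "\<exists>U V. openin TA U \<and> openin TA V \<and> x \<in> U \<and> y \<in> V \<and> disjnt U V"
    by (rule exI[of _ "{a \<in> carrier A. \<pi> i a = \<pi> i x}"], rule exI[of _ "{a \<in> carrier A. \<pi> i a = \<pi> i y}"])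
      (use i xy proj_open in \<open>auto simp: disjnt_def\<close>)
qed

lemma right_mult_continuous:
  assumes "c \<in> carrier A"
  shows "continuous_map TA TA (\<lambda>y. y \<otimes>\<^bsub>A\<^esub> c)"
proof -
  have m: "continuous_map (prod_topology TA TA) TA (\<lambda>(x, y). x \<otimes>\<^bsub>A\<^esub> y)" using top_ring by (simp add: topological_ring_def)
  have "continuous_map TA (prod_topology TA TA) (\<lambda>y. (y, c))"
    using assms by (intro continuous_map_pairedI) (auto simp: topspace_A)
  from continuous_map_compose[OF this m] show ?thesis by (simp add: o_def)
qed

end

text \<open>If \<open>x\<close> is not in \<open>N\<close>, then \<open>{a. a x \<in> N}\<close> is a maximal left ideal, because \<open>N' / N\<close> is simple
  and generated by \<open>x\<close>.\<close>

lemma jacobson_radical_simple: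
  assumes M: "left_module R M" and N: "submodule N R M" and N': "submodule N' R M" and "N \<subset> N'"
    and simple: "\<not> (\<exists>L. submodule L R M \<and> N \<subset> L \<and> L \<subset> N')"
    and c: "c \<in> jacobson_radical R" and x: "x \<in> N'"
  shows "c \<odot>\<^bsub>M\<^esub> x \<in> N"
proof (cases "x \<in> N")
  case True
  then show ?thesis using submoduleD(4)[OF N] c by (auto simp: jacobson_radical_def)
next
  case False
  interpret M: left_module R M by (rule M)
  have xM: "x \<in> carrier M" using x submoduleD(1)[OF N'] by blast
  have Rg: "left_module R (regular_module R)" by (rule regular_left_module[OF M.R.ring_axioms])
  have h: "(\<lambda>a. a \<odot>\<^bsub>M\<^esub> x) \<in> left_module_hom R (regular_module R) M"
    by (rule left_module_homI) (use xM in \<open>auto simp: regular_module_simps M.smult_closed M.smult_l_distr M.smult_assoc1\<close>)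
  let ?J = "{a \<in> carrier (regular_module R). a \<odot>\<^bsub>M\<^esub> x \<in> N}"
  have J: "submodule ?J R (regular_module R)" by (rule submodule_preimage[OF Rg M h N])
  have "maximal_left_ideal R ?J"
    unfolding maximal_left_ideal_def
  proof (intro conjI J allI impI)
    have "\<one>\<^bsub>R\<^esub> \<notin> ?J" using False xM by (simp add: M.smult_one)
    then show "?J \<noteq> carrier R" using M.R.one_closed by metis
    fix L assume L: "submodule L R (regular_module R) \<and> ?J \<subseteq> L"
    show "L = ?J \<or> L = carrier R"
    proof (rule ccontr)
      assume "\<not> (L = ?J \<or> L = carrier R)"
      then obtain a where a: "a \<in> L" "a \<notin> ?J" and "L \<noteq> carrier R" using L by blast
      have aR: "a \<in> carrier R" using a(1) L submoduleD(1) by (fastforce simp: regular_module_simps)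
      have LR: "L \<subseteq> carrier R" using L submoduleD(1)[of L R "regular_module R"] by (auto simp: regular_module_simps)
      have hL: "submodule ((\<lambda>a. a \<odot>\<^bsub>M\<^esub> x) ` L) R M" by (rule submodule_image[OF Rg M h]) (use L in blast)
      let ?N = "{u \<oplus>\<^bsub>M\<^esub> v | u v. u \<in> N \<and> v \<in> (\<lambda>a. a \<odot>\<^bsub>M\<^esub> x) ` L}"
      have N2: "submodule ?N R M" by (rule submodule_sum[OF M N hL])
      have "N \<subseteq> ?N"
      proof
        fix u assume "u \<in> N"
        moreover have "u \<oplus>\<^bsub>M\<^esub> \<zero>\<^bsub>M\<^esub> = u" using \<open>u \<in> N\<close> submoduleD(1)[OF N] by auto
        ultimately show "u \<in> ?N" using submoduleD(2)[OF hL] by force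
      qed
      moreover have "a \<odot>\<^bsub>M\<^esub> x \<in> ?N"
      proof -
        have "\<zero>\<^bsub>M\<^esub> \<oplus>\<^bsub>M\<^esub> a \<odot>\<^bsub>M\<^esub> x = a \<odot>\<^bsub>M\<^esub> x" using aR xM by (simp add: M.smult_closed)
        then show ?thesis using submoduleD(2)[OF N] a(1) by force
      qed
      moreover have "a \<odot>\<^bsub>M\<^esub> x \<notin> N" using a(2) aR by (simp add: regular_module_simps)
      moreover have "?N \<subseteq> N'"
        using \<open>N \<subset> N'\<close> submoduleD(3,4)[OF N'] x LR by blast
      ultimately have "?N = N'" using simple N2 by blast
      then have "x \<in> ?N" using x by simp
      then obtain u b where ub: "u \<in> N" "b \<in> L" "x = u \<oplus>\<^bsub>M\<^esub> b \<odot>\<^bsub>M\<^esub> x" by auto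
      have bR: "b \<in> carrier R" and uM: "u \<in> carrier M" using ub LR submoduleD(1)[OF N] by auto
      have "(\<one>\<^bsub>R\<^esub> \<ominus>\<^bsub>R\<^esub> b) \<odot>\<^bsub>M\<^esub> x = x \<ominus>\<^bsub>M\<^esub> b \<odot>\<^bsub>M\<^esub> x"
        using bR xM by (simp add: a_minus_def M.smult_l_distr M.smult_one M.smult_minus_left)
      also have "\<dots> = (u \<oplus>\<^bsub>M\<^esub> b \<odot>\<^bsub>M\<^esub> x) \<ominus>\<^bsub>M\<^esub> b \<odot>\<^bsub>M\<^esub> x" by (simp only: ub(3)[symmetric])
      also have "\<dots> = u" using uM bR xM by (simp add: a_minus_def M.M.a_assoc M.smult_closed M.M.r_neg)
      finally have "\<one>\<^bsub>R\<^esub> \<ominus>\<^bsub>R\<^esub> b \<in> ?J" using ub(1) bR by (simp add: regular_module_simps)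
      then have "(\<one>\<^bsub>R\<^esub> \<ominus>\<^bsub>R\<^esub> b) \<oplus>\<^bsub>R\<^esub> b \<in> L"
        using L submoduleD(3)[of L R "regular_module R"] ub(2) by (auto simp: regular_module_simps)
      then have "\<one>\<^bsub>R\<^esub> \<in> L" using bR by (simp add: a_minus_def M.R.a_assoc M.R.l_neg)
      then have "carrier R \<subseteq> L"
        using L submoduleD(4)[of L R "regular_module R" _ "\<one>\<^bsub>R\<^esub>"] by (auto simp: regular_module_simps)
      then show False using \<open>L \<noteq> carrier R\<close> LR by blast
    qed
  qed
  then have "c \<in> ?J" using c by (auto simp: jacobson_radical_def)
  then show ?thesis by simp
qed

primrec power_products :: "('a, 'r) ring_scheme \<Rightarrow> 'a set \<Rightarrow> nat \<Rightarrow> 'a set" where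
  "power_products R I 0 = {\<one>\<^bsub>R\<^esub>}"
| "power_products R I (Suc n) = {w \<otimes>\<^bsub>R\<^esub> c | w c. w \<in> power_products R I n \<and> c \<in> I}"

lemma power_products_closed:
  assumes "ring R" "I \<subseteq> carrier R"
  shows "power_products R I n \<subseteq> carrier R"
proof -
  interpret ring R by fact
  show ?thesis using assms(2) by (induction n) auto
qed

text \<open>Each factor from the radical moves an element one step down in a composition series.\<close>

lemma finite_length_power_products:
  assumes M: "left_module R M" and "finite_length R M" and I: "I \<subseteq> jacobson_radical R"
  shows "\<exists>n. \<forall>w\<in>power_products R I n. \<forall>x\<in>carrier M. w \<odot>\<^bsub>M\<^esub> x = \<zero>\<^bsub>M\<^esub>"
proof -
  interpret M: left_module R M by (rule M)
  obtain n N where N: "N 0 = {\<zero>\<^bsub>M\<^esub>}" "N n = carrier M" "\<And>i. i \<le> n \<Longrightarrow> submodule (N i) R M"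
    "\<And>i. i < n \<Longrightarrow> N i \<subset> N (Suc i)" "\<And>i. i < n \<Longrightarrow> \<not> (\<exists>L. submodule L R M \<and> N i \<subset> L \<and> L \<subset> N (Suc i))"
    using assms(2) unfolding finite_length_def by metis
  have IR: "I \<subseteq> carrier R" using I by (auto simp: jacobson_radical_def)
  have "j \<le> n \<Longrightarrow> w \<in> power_products R I j \<Longrightarrow> x \<in> N j \<Longrightarrow> w \<odot>\<^bsub>M\<^esub> x = \<zero>\<^bsub>M\<^esub>" for j w x
  proof (induction j arbitrary: w x)
    case 0
    then show ?case using N(1) by (simp add: M.smult_zero_right)
  next
    case (Suc j)
    then obtain w' c where w: "w = w' \<otimes>\<^bsub>R\<^esub> c" "w' \<in> power_products R I j" "c \<in> I" by auto
    have "c \<odot>\<^bsub>M\<^esub> x \<in> N j"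
      by (rule jacobson_radical_simple[OF M N(3) N(3) N(4) N(5) _ Suc.prems(3)]) (use Suc.prems w(3) I in auto)
    then have "w' \<odot>\<^bsub>M\<^esub> (c \<odot>\<^bsub>M\<^esub> x) = \<zero>\<^bsub>M\<^esub>" using Suc.IH w(2) Suc.prems(1) by simp
    moreover have "x \<in> carrier M" using submoduleD(1)[OF N(3)[OF Suc.prems(1)]] Suc.prems(3) by blast
    ultimately show ?case
      using w power_products_closed[OF M.R.ring_axioms IR, of j] IR by (simp add: M.smult_assoc1 subset_iff)
  qed
  then show ?thesis using N(2) by blast
qed

text \<open>Induction along a composition series \<open>N\<close>: the submodules \<open>X n \<inter> N (j + 1)\<close> become constant
  once \<open>X n \<inter> N j\<close> is constant and the image in the simple module \<open>N (j + 1) / N j\<close> is constant as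
  well.\<close>

lemma finite_length_dcc:
  assumes M: "left_module R M" and "finite_length R M"
    and X: "\<And>n. submodule (X n) R M" "\<And>n. X (Suc n) \<subseteq> X n"
  shows "\<exists>k. \<forall>n\<ge>k. X n = X k"
proof -
  interpret M: left_module R M by (rule M)
  obtain l N where N: "N 0 = {\<zero>\<^bsub>M\<^esub>}" "N l = carrier M" "\<And>i. i \<le> l \<Longrightarrow> submodule (N i) R M"
    "\<And>i. i < l \<Longrightarrow> N i \<subset> N (Suc i)" "\<And>i. i < l \<Longrightarrow> \<not> (\<exists>L. submodule L R M \<and> N i \<subset> L \<and> L \<subset> N (Suc i))"
    using assms(2) unfolding finite_length_def by metis
  have anti: "X n \<subseteq> X m" if "m \<le> n" for m n using that by (induction rule: dec_induct) (use X(2) in auto)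
  have "j \<le> l \<Longrightarrow> \<exists>k. \<forall>n\<ge>k. X n \<inter> N j = X k \<inter> N j" for j
  proof (induction j)
    case 0
    have "X n \<inter> N 0 = {\<zero>\<^bsub>M\<^esub>}" for n using submoduleD(2)[OF X(1)[of n]] N(1) by auto
    then show ?case by simp
  next
    case (Suc j)
    then obtain k where k: "\<And>n. n \<ge> k \<Longrightarrow> X n \<inter> N j = X k \<inter> N j" by auto
    note Nj = N(3)[of j] and Nj' = N(3)[OF Suc.prems]
    show ?case
    \<comment> \<open>Either the image in \<open>N (j + 1) / N j\<close> vanishes from some \<open>m\<close> on, or it is the whole simple
      module for all \<open>n\<close>.\<close>
    proof (cases "\<exists>m. X m \<inter> N (Suc j) \<subseteq> N j")
      case True
      then obtain m where m: "X m \<inter> N (Suc j) \<subseteq> N j" by auto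
      have "X n \<inter> N (Suc j) = X n \<inter> N j" if "n \<ge> m" for n
        using anti[OF that] m N(4)[of j] Suc.prems by auto
      then have "X n \<inter> N (Suc j) = X k \<inter> N j" if "n \<ge> max k m" for n using k[of n] that by simp
      then show ?thesis by (intro exI[of _ "max k m"]) simp
    next
      case False
      have "X k \<inter> N (Suc j) \<subseteq> X n \<inter> N (Suc j)" if n: "n \<ge> k" for n
      proof
        fix y assume y: "y \<in> X k \<inter> N (Suc j)"
        have XN: "submodule (X n \<inter> N (Suc j)) R M" by (rule submodule_Int[OF M X(1) Nj'])
        let ?S = "{u \<oplus>\<^bsub>M\<^esub> v | u v. u \<in> N j \<and> v \<in> X n \<inter> N (Suc j)}"
        have jl: "j \<le> l" "j < l" using Suc.prems by auto
        have S: "submodule ?S R M" by (rule submodule_sum[OF M Nj[OF jl(1)] XN])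
        have "N j \<subseteq> ?S"
        proof
          fix u assume u: "u \<in> N j"
          then have "u \<oplus>\<^bsub>M\<^esub> \<zero>\<^bsub>M\<^esub> = u" using submoduleD(1)[OF Nj[OF jl(1)]] by auto
          then show "u \<in> ?S" using u submoduleD(2)[OF XN] by force
        qed
        moreover obtain z where z: "z \<in> X n \<inter> N (Suc j)" "z \<notin> N j" using False by blast
        moreover have "z \<in> ?S"
        proof -
          have "\<zero>\<^bsub>M\<^esub> \<oplus>\<^bsub>M\<^esub> z = z" using z submoduleD(1)[OF X(1)[of n]] by auto
          then show ?thesis using z submoduleD(2)[OF Nj[OF jl(1)]] by force
        qed
        moreover have "?S \<subseteq> N (Suc j)" using N(4)[OF jl(2)] submoduleD(3)[OF Nj'] by blast
        ultimately have "?S = N (Suc j)" using N(5)[OF jl(2)] S by blast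
        then have "y \<in> ?S" using y by simp
        then obtain u v where uv: "u \<in> N j" "v \<in> X n \<inter> N (Suc j)" "y = u \<oplus>\<^bsub>M\<^esub> v" by auto
        have c: "u \<in> carrier M" "v \<in> carrier M" using uv submoduleD(1)[OF Nj[OF jl(1)]] submoduleD(1)[OF X(1)[of n]] by auto
        have "v \<in> X k" using uv(2) anti[OF n] by blast
        then have "y \<ominus>\<^bsub>M\<^esub> v \<in> X k" using submoduleD(6)[OF X(1)[of k]] y by blast
        moreover have "y \<ominus>\<^bsub>M\<^esub> v = u" using c uv(3) by (simp add: a_minus_def M.M.a_assoc M.M.r_neg)
        ultimately have "u \<in> X n" using uv(1) k[OF n] by blast
        then show "y \<in> X n \<inter> N (Suc j)" using uv submoduleD(3)[OF X(1)[of n]] y by auto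
      qed
      then have "X n \<inter> N (Suc j) = X k \<inter> N (Suc j)" if "n \<ge> k" for n using anti[OF that] that by blast
      then show ?thesis by blast
    qed
  qed
  from this[of l] show ?thesis using N(2) submoduleD(1)[OF X(1)] by (simp add: Int_absorb2)
qed

primrec partial_sum :: "('a, 'r) ring_scheme \<Rightarrow> (nat \<Rightarrow> 'a) \<Rightarrow> nat \<Rightarrow> 'a" where
  "partial_sum R y 0 = \<zero>\<^bsub>R\<^esub>"
| "partial_sum R y (Suc n) = partial_sum R y n \<oplus>\<^bsub>R\<^esub> y n"

context limit_presentation
begin

text \<open>The open left ideals that contain all products of \<open>n\<close> elements of \<open>I\<close>. Their intersection is the
  closure of the left ideal generated by these products.\<close>

definition adic_family :: "'a set \<Rightarrow> nat \<Rightarrow> 'a set set" where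
  "adic_family I n = {U. left_ideal U \<and> (\<exists>i\<in>Idx. ker i \<subseteq> U) \<and> power_products A I n \<subseteq> U}"

definition adic :: "'a set \<Rightarrow> nat \<Rightarrow> 'a set" where
  "adic I n = \<Inter>(adic_family I n)"

lemma adic_family_nonempty:
  assumes "I \<subseteq> carrier A"
  shows "carrier A \<in> adic_family I n"
proof -
  obtain i where "i \<in> Idx" using directed by (auto simp: directed_set_def)
  moreover have "left_ideal (carrier A)"
    using submodule_carrier[OF regular_left_module[OF ring_A]] by (simp add: regular_module_simps)
  ultimately show ?thesis using power_products_closed[OF ring_A assms] by (auto simp: adic_family_def)
qed

lemma adic_left_ideal:
  assumes "I \<subseteq> carrier A"
  shows "left_ideal (adic I n)"
  unfolding adic_def
proof (rule submodule_Inter[OF regular_left_module[OF ring_A]])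
  show "adic_family I n \<noteq> {}" using adic_family_nonempty[OF assms] by blast
qed (simp add: adic_family_def)

lemma adic_closed:
  assumes "I \<subseteq> carrier A"
  shows "closedin TA (adic I n)"
  unfolding adic_def
proof (rule closedin_Inter)
  show "adic_family I n \<noteq> {}" using adic_family_nonempty[OF assms] by blast
  show "closedin TA U" if "U \<in> adic_family I n" for U
    using that open_of_ker_subset(2) by (auto simp: adic_family_def)
qed

lemma adic_0:
  assumes "x \<in> carrier A"
  shows "x \<in> adic I 0"
proof -
  interpret R: ring A by (rule ring_A)
  have "x \<in> U" if "left_ideal U" "\<one>\<^bsub>A\<^esub> \<in> U" for U
    using left_idealD(4)[OF that(1) assms that(2)] assms by simp
  then show ?thesis by (auto simp: adic_def adic_family_def)
qed

lemma power_products_Suc_subset: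
  assumes "ideal I A" "left_ideal U" "power_products A I n \<subseteq> U"
  shows "power_products A I (Suc n) \<subseteq> U"
proof -
  interpret R: ring A by (rule ring_A)
  interpret I: ideal I A by (rule assms(1))
  have IA: "I \<subseteq> carrier A" using I.Icarr by blast
  show ?thesis
  proof (cases n)
    case 0
    then have "\<one>\<^bsub>A\<^esub> \<in> U" using assms(3) by simp
    then have "carrier A \<subseteq> U" using left_idealD(4)[OF assms(2)] by force
    then show ?thesis using power_products_closed[OF ring_A IA] by blast
  next
    case (Suc m)
    have "w \<otimes>\<^bsub>A\<^esub> c' \<otimes>\<^bsub>A\<^esub> c \<in> U" if "w \<in> power_products A I m" "c' \<in> I" "c \<in> I" for w c c'
    proof -
      have "w \<otimes>\<^bsub>A\<^esub> c' \<otimes>\<^bsub>A\<^esub> c = w \<otimes>\<^bsub>A\<^esub> (c' \<otimes>\<^bsub>A\<^esub> c)"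
        using that power_products_closed[OF ring_A IA, of m] IA by (intro R.m_assoc) auto
      moreover have "c' \<otimes>\<^bsub>A\<^esub> c \<in> I" using that IA by (intro I.I_r_closed) auto
      ultimately show ?thesis using assms(3) that(1) Suc by auto
    qed
    then show ?thesis unfolding Suc by auto
  qed
qed

lemma adic_Suc_subset:
  assumes "ideal I A"
  shows "adic I (Suc n) \<subseteq> adic I n"
  using power_products_Suc_subset[OF assms] unfolding adic_def adic_family_def by blast

lemma adic_antimono:
  assumes "ideal I A" "m \<le> n"
  shows "adic I n \<subseteq> adic I m"
  using assms(2) by (induction rule: dec_induct) (use adic_Suc_subset[OF assms(1)] in auto)

text \<open>Right multiplication by \<open>c\<close> is continuous, so it pulls open left ideals that contain the
  products of \<open>n + 1\<close> elements back to open left ideals that contain the products of \<open>n\<close> elements.\<close>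

lemma adic_mult:
  assumes "ideal I A" "x \<in> adic I n" "c \<in> I"
  shows "x \<otimes>\<^bsub>A\<^esub> c \<in> adic I (Suc n)"
proof -
  interpret R: ring A by (rule ring_A)
  interpret I: ideal I A by (rule assms(1))
  have IA: "I \<subseteq> carrier A" and cA: "c \<in> carrier A" using I.Icarr assms(3) by auto
  have "x \<otimes>\<^bsub>A\<^esub> c \<in> U" if U: "U \<in> adic_family I (Suc n)" for U
  proof -
    have UU: "left_ideal U" "power_products A I (Suc n) \<subseteq> U" "openin TA U"
      using U open_of_ker_subset(1) by (auto simp: adic_family_def)
    note UD = left_idealD[OF UU(1)]
    let ?V = "{y \<in> carrier A. y \<otimes>\<^bsub>A\<^esub> c \<in> U}"
    have V: "left_ideal ?V"
      by (rule left_idealI) (use UD cA in \<open>auto simp: R.l_distr R.m_assoc\<close>)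
    have "openin TA ?V"
      using openin_continuous_map_preimage[OF right_mult_continuous[OF cA] UU(3)] by (simp add: topspace_A)
    then obtain j where "j \<in> Idx" "ker j \<subseteq> ?V" using proj_base[of ?V] UD(2) cA by auto
    moreover have "power_products A I n \<subseteq> ?V"
      using UU(2) power_products_closed[OF ring_A IA, of n] assms(3) by auto
    ultimately have "?V \<in> adic_family I n" using V by (auto simp: adic_family_def)
    then show ?thesis using assms(2) by (auto simp: adic_def)
  qed
  then show ?thesis by (auto simp: adic_def)
qed

text \<open>A long product of elements of the radical kills the finite length module \<open>D i\<close>, in particular
  the image of \<open>1\<close>.\<close>

lemma adic_subset_ker:
  assumes "I \<subseteq> jacobson_radical A" "i \<in> Idx"
  shows "\<exists>n. adic I n \<subseteq> ker i"
proof -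
  interpret R: ring A by (rule ring_A)
  obtain n where n: "\<And>w x. w \<in> power_products A I n \<Longrightarrow> x \<in> carrier (D i) \<Longrightarrow> w \<odot>\<^bsub>D i\<^esub> x = \<zero>\<^bsub>D i\<^esub>"
    using finite_length_power_products[OF modules[OF assms(2)] finite_len[OF assms(2)] assms(1)] by blast
  have IA: "I \<subseteq> carrier A" using assms(1) by (auto simp: jacobson_radical_def)
  have "w \<in> ker i" if w: "w \<in> power_products A I n" for w
  proof -
    have wA: "w \<in> carrier A" using power_products_closed[OF ring_A IA] w by blast
    then have "\<pi> i w = w \<odot>\<^bsub>D i\<^esub> \<pi> i \<one>\<^bsub>A\<^esub>" using proj_mult[OF assms(2), of w "\<one>\<^bsub>A\<^esub>"] by simp
    then show ?thesis using n[OF w proj_closed[OF assms(2) R.one_closed]] wA by simp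
  qed
  then have "ker i \<in> adic_family I n" using ker_left_ideal[OF assms(2)] assms(2) by (auto simp: adic_family_def)
  then show ?thesis unfolding adic_def by blast
qed

lemma adic_separated:
  assumes "I \<subseteq> jacobson_radical A" "x \<in> carrier A" "\<And>n. x \<in> adic I n"
  shows "x = \<zero>\<^bsub>A\<^esub>"
  using adic_subset_ker[OF assms(1)] assms(2,3) by (intro proj_inj) blast+

lemma partial_sum_closed: "(\<And>n. y n \<in> carrier A) \<Longrightarrow> partial_sum A y n \<in> carrier A"
  using ring_A by (induction n) (auto simp: ring.ring_simprules)

text \<open>The partial sums become constant in each discrete quotient, and these constants are
  compatible.\<close>

lemma adic_complete:
  assumes I: "ideal I A" "I \<subseteq> jacobson_radical A" and y: "\<And>n. y n \<in> adic I n"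
  shows "\<exists>s \<in> carrier A. \<forall>n. s \<ominus>\<^bsub>A\<^esub> partial_sum A y n \<in> adic I n"
proof -
  interpret R: ring A by (rule ring_A)
  have IA: "I \<subseteq> carrier A" using I(2) by (auto simp: jacobson_radical_def)
  have yA: "y n \<in> carrier A" for n using y left_idealD(1)[OF adic_left_ideal[OF IA]] by blast
  let ?s = "partial_sum A y"
  have sA: "?s n \<in> carrier A" for n by (rule partial_sum_closed[OF yA])
  have tail: "?s m \<ominus>\<^bsub>A\<^esub> ?s n \<in> U" if "left_ideal U" "adic I n \<subseteq> U" "n \<le> m" for U n m
    using that(3)
  proof (induction m rule: dec_induct)
    case base
    then show ?case using left_idealD(2)[OF that(1)] sA[of n] by (simp add: a_minus_def R.r_neg)
  next
    case (step m)
    have "y m \<in> U" using y[of m] adic_antimono[OF I(1) step(1)] that(2) by blast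
    moreover have "?s (Suc m) \<ominus>\<^bsub>A\<^esub> ?s n = (?s m \<ominus>\<^bsub>A\<^esub> ?s n) \<oplus>\<^bsub>A\<^esub> y m"
      using sA[of m] sA[of n] yA[of m] by (simp add: a_minus_def R.a_ac)
    ultimately show ?case using left_idealD(3)[OF that(1) step(3)] by metis
  qed
  obtain N where N: "\<And>i. i \<in> Idx \<Longrightarrow> adic I (N i) \<subseteq> ker i" using adic_subset_ker[OF I(2)] by metis
  have const: "\<pi> i (?s n) = \<pi> i (?s (N i))" if "i \<in> Idx" "N i \<le> n" for i n
    using proj_eq_iff[OF that(1) sA sA] tail[OF ker_left_ideal[OF that(1)] N[OF that(1)] that(2)] by blast
  have "\<exists>s\<in>carrier A. \<forall>i\<in>Idx. \<pi> i s = \<pi> i (?s (N i))"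
  proof (rule proj_surj)
    show "\<pi> i (?s (N i)) \<in> carrier (D i)" if "i \<in> Idx" for i using proj_closed[OF that sA] .
    show "f i j (\<pi> j (?s (N j))) = \<pi> i (?s (N i))" if ij: "i \<in> Idx" "j \<in> Idx" "leq i j" for i j
      using proj_compat[OF ij sA[of "max (N i) (N j)"]] const[OF ij(1), of "max (N i) (N j)"] const[OF ij(2), of "max (N i) (N j)"] by simp
  qed
  then obtain s where s: "s \<in> carrier A" "\<And>i. i \<in> Idx \<Longrightarrow> \<pi> i s = \<pi> i (?s (N i))" by blast
  have "s \<ominus>\<^bsub>A\<^esub> ?s n \<in> U" if U: "U \<in> adic_family I n" for n U
  proof -
    obtain i where i: "i \<in> Idx" "ker i \<subseteq> U" and UL: "left_ideal U" using U by (auto simp: adic_family_def)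
    let ?m = "max n (N i)"
    have "s \<ominus>\<^bsub>A\<^esub> ?s ?m \<in> U" using proj_eq_iff[OF i(1) s(1) sA, of ?m] s(2)[OF i(1)] const[OF i(1), of ?m] i(2) by auto
    moreover have "?s ?m \<ominus>\<^bsub>A\<^esub> ?s n \<in> U" by (rule tail[OF UL]) (use U in \<open>auto simp: adic_def\<close>)
    moreover have "s \<ominus>\<^bsub>A\<^esub> ?s n = (s \<ominus>\<^bsub>A\<^esub> ?s ?m) \<oplus>\<^bsub>A\<^esub> (?s ?m \<ominus>\<^bsub>A\<^esub> ?s n)"
    proof -
      have "(s \<ominus>\<^bsub>A\<^esub> x) \<oplus>\<^bsub>A\<^esub> (x \<ominus>\<^bsub>A\<^esub> z) = s \<ominus>\<^bsub>A\<^esub> z" if "x \<in> carrier A" "z \<in> carrier A" for x z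
        using that s(1) by (simp add: a_minus_def R.a_assoc R.r_neg1)
      then show ?thesis using sA by simp
    qed
    ultimately show ?thesis using left_idealD(3)[OF UL] by metis
  qed
  then show ?thesis using s(1) by (auto simp: adic_def)
qed

text \<open>The quotient by \<open>U\<close> is a subquotient of one of the finite length modules \<open>D i\<close>.\<close>

lemma open_left_ideal_dcc:
  assumes U: "left_ideal U" "openin TA U"
    and X: "\<And>n. left_ideal (X n)" "\<And>n. X (Suc n) \<subseteq> X n" "\<And>n. U \<subseteq> X n"
  shows "\<exists>k. \<forall>n\<ge>k. X n = X k"
proof -
  interpret R: ring A by (rule ring_A)
  obtain i where i: "i \<in> Idx" "ker i \<subseteq> U" using proj_base[OF U(2) left_idealD(2)[OF U(1)]] by blast
  note Rg = regular_left_module[OF ring_A]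
  have "\<exists>k. \<forall>n\<ge>k. \<pi> i ` X n = \<pi> i ` X k"
    by (rule finite_length_dcc[OF modules[OF i(1)] finite_len[OF i(1)] submodule_image[OF Rg modules[OF i(1)] proj_hom[OF i(1)] X(1)]])
      (use X(2) in blast)
  then obtain k where k: "\<And>n. n \<ge> k \<Longrightarrow> \<pi> i ` X n = \<pi> i ` X k" by blast
  have sat: "x \<in> X n" if x: "x \<in> carrier A" "\<pi> i x \<in> \<pi> i ` X n" for x n
  proof -
    obtain x' where x': "x' \<in> X n" "\<pi> i x = \<pi> i x'" using x(2) by auto
    have x'A: "x' \<in> carrier A" using x'(1) left_idealD(1)[OF X(1)] by blast
    have "x \<ominus>\<^bsub>A\<^esub> x' \<in> X n" using proj_eq_iff[OF i(1) x(1) x'A] x'(2) i(2) X(3)[of n] by blast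
    then have "(x \<ominus>\<^bsub>A\<^esub> x') \<oplus>\<^bsub>A\<^esub> x' \<in> X n" using left_idealD(3)[OF X(1)] x'(1) by blast
    then show ?thesis using x(1) x'A by (simp add: a_minus_def R.a_assoc R.l_neg)
  qed
  have "X n = X k" if n: "n \<ge> k" for n
  proof (intro equalityI subsetI)
    fix x assume x: "x \<in> X n"
    then have "\<pi> i x \<in> \<pi> i ` X k" using k[OF n] by blast
    then show "x \<in> X k" using sat x left_idealD(1)[OF X(1)] by blast
  next
    fix x assume x: "x \<in> X k"
    then have "\<pi> i x \<in> \<pi> i ` X n" using k[OF n] by blast
    then show "x \<in> X n" using sat x left_idealD(1)[OF X(1)] by blast
  qed
  then show ?thesis by blast
qed

end

text \<open>If \<open>R / J\<close> satisfies the descending chain condition on left ideals, then so does every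
  finitely generated \<open>R / J\<close>-module. The chain is pulled back to a free module and compared one
  coordinate at a time, by means of the left ideals \<open>L n\<close> of leading coefficients.\<close>

lemma descending_chain_fg_mod:
  assumes M: "left_module R M" and J: "J \<subseteq> carrier R"
    and dcc: "\<And>Y. (\<And>n. submodule (Y n) R (regular_module R)) \<Longrightarrow> (\<And>n. Y (Suc n) \<subseteq> Y n) \<Longrightarrow> (\<And>n. J \<subseteq> Y n) \<Longrightarrow>
      \<exists>k::nat. \<forall>n\<ge>k. Y n = Y k"
    and fg: "fg_mod R M (carrier M) X'" and JM: "\<And>c x. c \<in> J \<Longrightarrow> x \<in> carrier M \<Longrightarrow> c \<odot>\<^bsub>M\<^esub> x \<in> X'"
    and X: "\<And>n. submodule (X n) R M" "\<And>n. X (Suc n) \<subseteq> X n" "\<And>n. X' \<subseteq> X n"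
  shows "\<exists>k::nat. \<forall>n\<ge>k. X n = X k"
proof -
  interpret M: left_module R M by (rule M)
  note fr = free_left_module[OF M.R.ring_axioms]
  obtain k f where f: "f \<in> left_module_hom R (free_module R k) M"
    "\<And>y. y \<in> carrier M \<Longrightarrow> \<exists>x \<in> carrier (free_module R k). \<exists>z\<in>X'. y = f x \<oplus>\<^bsub>M\<^esub> z"
    using fg_modE[OF fg] by metis
  define Y where "Y n = {x \<in> carrier (free_module R k). f x \<in> X n}" for n
  have Y: "submodule (Y n) R (free_module R k)" for n
    unfolding Y_def by (rule submodule_preimage[OF fr M f(1) X(1)])
  have YS: "Y (Suc n) \<subseteq> Y n" for n using X(2) by (auto simp: Y_def)
  have anti: "Y n \<subseteq> Y m" if "m \<le> n" for m n using that by (induction rule: dec_induct) (use YS in auto)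
  have antiX: "X n \<subseteq> X m" if "m \<le> n" for m n using that by (induction rule: dec_induct) (use X(2) in auto)
  have rowR: "x i \<in> carrier R" if "x \<in> Y n" for x n i using that by (simp add: Y_def free_module_simps)
  interpret F: left_module R "free_module R k" by (rule fr)
  \<comment> \<open>For rows supported below \<open>j\<close> the chain is constant from some \<open>N\<close> on.\<close>
  have "j \<le> k \<Longrightarrow> \<exists>N. \<forall>n\<ge>N. \<forall>x\<in>Y N. (\<forall>i\<ge>j. x i = \<zero>\<^bsub>R\<^esub>) \<longrightarrow> x \<in> Y n" for j
  proof (induction j)
    case 0
    have "x \<in> Y n" if "x \<in> Y 0" "\<forall>i\<ge>0. x i = \<zero>\<^bsub>R\<^esub>" for x n
    proof -
      have "x = \<zero>\<^bsub>free_module R k\<^esub>" using that(2) by (auto simp: free_module_simps)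
      then show ?thesis using submoduleD(2)[OF Y] by simp
    qed
    then show ?case by blast
  next
    case (Suc j)
    then obtain N where N: "\<And>n x. n \<ge> N \<Longrightarrow> x \<in> Y N \<Longrightarrow> (\<forall>i\<ge>j. x i = \<zero>\<^bsub>R\<^esub>) \<Longrightarrow> x \<in> Y n" by auto
    have jk: "j < k" using Suc.prems by simp
    define L where "L n = {x j | x. x \<in> Y n \<and> (\<forall>i\<ge>Suc j. x i = \<zero>\<^bsub>R\<^esub>)}" for n
    have "\<exists>k::nat. \<forall>n\<ge>k. L n = L k"
    proof (rule dcc)
      fix n
      show "submodule (L n) R (regular_module R)"
      proof (rule left_module.submoduleI[OF regular_left_module[OF M.R.ring_axioms]])
        show "L n \<subseteq> carrier (regular_module R)" using rowR by (auto simp: L_def regular_module_simps)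
        show "\<zero>\<^bsub>regular_module R\<^esub> \<in> L n"
          using submoduleD(2)[OF Y[of n]] by (auto simp: L_def regular_module_simps free_module_simps intro!: exI[of _ "\<lambda>i. \<zero>\<^bsub>R\<^esub>"])
      next
        fix a b assume "a \<in> L n" "b \<in> L n"
        then obtain x y where "x \<in> Y n" "\<forall>i\<ge>Suc j. x i = \<zero>\<^bsub>R\<^esub>" "a = x j" "y \<in> Y n" "\<forall>i\<ge>Suc j. y i = \<zero>\<^bsub>R\<^esub>" "b = y j"
          by (auto simp: L_def)
        then show "a \<oplus>\<^bsub>regular_module R\<^esub> b \<in> L n"
          using submoduleD(3)[OF Y[of n], of x y]
          by (auto simp: L_def regular_module_simps free_module_simps intro!: exI[of _ "\<lambda>i. x i \<oplus>\<^bsub>R\<^esub> y i"])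
      next
        fix c a assume "c \<in> carrier R" "a \<in> L n"
        then obtain x where "x \<in> Y n" "\<forall>i\<ge>Suc j. x i = \<zero>\<^bsub>R\<^esub>" "a = x j" by (auto simp: L_def)
        then show "c \<odot>\<^bsub>regular_module R\<^esub> a \<in> L n"
          using submoduleD(4)[OF Y[of n] \<open>c \<in> carrier R\<close>, of x] \<open>c \<in> carrier R\<close>
          by (auto simp: L_def regular_module_simps free_module_simps intro!: exI[of _ "\<lambda>i. c \<otimes>\<^bsub>R\<^esub> x i"])
      qed
      show "L (Suc n) \<subseteq> L n" using YS by (auto simp: L_def)
      show "J \<subseteq> L n"
      proof
        fix c assume c: "c \<in> J"
        then have cR: "c \<in> carrier R" using J by blast
        let ?x = "c \<odot>\<^bsub>free_module R k\<^esub> unit_row R j"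
        have e: "unit_row R j \<in> carrier (free_module R k)" by (rule unit_row_in_free[OF M.R.ring_axioms jk])
        have "f ?x \<in> X n" using hom_smult[OF f(1) cR e] JM[OF c hom_closed[OF f(1) e]] X(3) by auto
        then have 1: "?x \<in> Y n" using F.smult_closed[OF cR e] by (simp add: Y_def)
        have 2: "c = ?x j" "\<forall>i\<ge>Suc j. ?x i = \<zero>\<^bsub>R\<^esub>" using cR by (auto simp: free_module_simps unit_row_def)
        show "c \<in> L n" unfolding L_def by (intro CollectI exI[of _ ?x] conjI 1 2)
      qed
    qed
    then obtain N' where N': "\<And>n. n \<ge> N' \<Longrightarrow> L n = L N'" by blast
    let ?N = "max N N'"
    have "x \<in> Y n" if n: "n \<ge> ?N" and x: "x \<in> Y ?N" "\<forall>i\<ge>Suc j. x i = \<zero>\<^bsub>R\<^esub>" for n x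
    proof -
      have "x j \<in> L ?N" using x by (auto simp: L_def)
      then have "x j \<in> L n" using N'[of ?N] N'[of n] n by simp
      then obtain y where y: "y \<in> Y n" "\<forall>i\<ge>Suc j. y i = \<zero>\<^bsub>R\<^esub>" "y j = x j" by (auto simp: L_def)
      have xF: "x \<in> carrier (free_module R k)" "y \<in> carrier (free_module R k)" using x(1) y(1) by (auto simp: Y_def)
      let ?w = "x \<ominus>\<^bsub>free_module R k\<^esub> y"
      have "y \<in> Y ?N" using y(1) anti[OF n] by blast
      then have w: "?w \<in> Y ?N" using submoduleD(6)[OF Y x(1)] by blast
      have wx: "?w \<oplus>\<^bsub>free_module R k\<^esub> y = x" using xF by (simp add: a_minus_def F.M.a_assoc F.M.l_neg)
      have "?w i = \<zero>\<^bsub>R\<^esub>" if "i \<ge> j" for i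
      proof -
        have "?w i \<oplus>\<^bsub>R\<^esub> y i = x i" using wx by (simp add: free_module_simps fun_eq_iff)
        moreover have "x i = y i" using that x(2) y(2,3) by (cases "i = j") auto
        ultimately show ?thesis using rowR[OF w, of i] rowR[OF y(1), of i] M.R.add.r_cancel_one' by metis
      qed
      then have "?w \<in> Y n" using N[of n ?w] w anti[of N ?N] n by auto
      then show ?thesis using submoduleD(3)[OF Y _ y(1)] wx by metis
    qed
    then show ?case by blast
  qed
  from this[OF order_refl] obtain N where N0: "\<forall>n\<ge>N. \<forall>x\<in>Y N. (\<forall>i\<ge>k. x i = \<zero>\<^bsub>R\<^esub>) \<longrightarrow> x \<in> Y n" by blast
  have N: "x \<in> Y n" if "n \<ge> N" "x \<in> Y N" for n x
  proof -
    have "\<forall>i\<ge>k. x i = \<zero>\<^bsub>R\<^esub>" using that(2) by (simp add: Y_def free_module_simps)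
    then show ?thesis using N0 that by blast
  qed
  have "X N \<subseteq> X n" if n: "n \<ge> N" for n
  proof
    fix x assume x: "x \<in> X N"
    then have xM: "x \<in> carrier M" using submoduleD(1)[OF X(1)] by blast
    obtain u z where u: "u \<in> carrier (free_module R k)" "z \<in> X'" "x = f u \<oplus>\<^bsub>M\<^esub> z" using f(2)[OF xM] by blast
    have c: "z \<in> carrier M" "f u \<in> carrier M" using u X(3) submoduleD(1)[OF X(1)] hom_closed[OF f(1)] by blast+
    have "x \<ominus>\<^bsub>M\<^esub> z \<in> X N" using submoduleD(6)[OF X(1) x] u(2) X(3) by blast
    moreover have "x \<ominus>\<^bsub>M\<^esub> z = f u" using c by (simp add: u(3) a_minus_def M.M.a_assoc M.M.r_neg)
    ultimately have "u \<in> Y N" using u(1) by (simp add: Y_def)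
    then have "f u \<in> X n" using N[OF n] by (simp add: Y_def)
    then show "x \<in> X n" using submoduleD(3)[OF X(1)] u(2,3) X(3) by blast
  qed
  then show ?thesis using antiX by (intro exI[of _ N]) blast
qed

section \<open>Restriction of scalars\<close>

lemma restrict_scalars:
  assumes "ring A" "carrier A \<subseteq> carrier B" "(\<lambda>a. a) \<in> ring_hom A B" "left_module B M"
  shows "left_module A M"
proof -
  interpret M: left_module B M by fact
  show ?thesis
    using assms M.M.abelian_group_axioms
    by (auto simp: left_module_def left_module_axioms_def ring_hom_def M.smult_closed M.smult_l_distr
        M.smult_r_distr M.smult_assoc1 M.smult_one subset_iff)
qed

lemma restrict_scalars_hom: "carrier A \<subseteq> carrier B \<Longrightarrow> left_module_hom B M N \<subseteq> left_module_hom A M N"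
  by (auto simp: left_module_hom_def)

lemma restrict_scalars_submodule: "carrier A \<subseteq> carrier B \<Longrightarrow> submodule N B M \<Longrightarrow> submodule N A M"
  by (auto simp: submodule_def submodule_axioms_def)

section \<open>Coefficients of skew power series\<close>

locale skew_series =
  fixes A :: "('a, 'r) ring_scheme" and TA :: "'a topology" and \<sigma> \<delta> :: "'a \<Rightarrow> 'a"
    and B :: "('a, 's) ring_scheme" and TB :: "'a topology" and t :: 'a and \<phi> :: "(nat \<Rightarrow> 'a) \<Rightarrow> 'a"
  assumes sps: "skew_power_series_ring A TA \<sigma> \<delta> B TB t"
    and haus_A: "Hausdorff_space TA"
    and \<phi>_iso: "\<phi> \<in> topological_module_iso A (product_module (UNIV :: nat set) (\<lambda>_. regular_module A))
               (product_topology (\<lambda>_. TA) UNIV) (regular_module B) TB"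
    and \<phi>_unit: "\<And>n. \<phi> (\<lambda>m. if m = n then \<one>\<^bsub>A\<^esub> else \<zero>\<^bsub>A\<^esub>) = t [^]\<^bsub>B\<^esub> n"
begin

lemma top_B: "topological_ring B TB" and top_A: "topological_ring A TA"
  and t_closed: "t \<in> carrier B" and A_sub: "carrier A \<subseteq> carrier B" and incl: "(\<lambda>a. a) \<in> ring_hom A B"
  and t_comm: "a \<in> carrier A \<Longrightarrow> t \<otimes>\<^bsub>B\<^esub> a = \<sigma> a \<otimes>\<^bsub>B\<^esub> t \<oplus>\<^bsub>B\<^esub> \<delta> a"
  using sps by (auto simp: skew_power_series_ring_def left_pseudocompact_ring_def pseudocompact_ring_def)

lemma ring_A: "ring A" and ring_B: "ring B" and topspace_A: "topspace TA = carrier A" and topspace_B: "topspace TB = carrier B"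
  using top_A top_B by (auto simp: topological_ring_def)

sublocale A: ring A by (rule ring_A)
sublocale B: ring B by (rule ring_B)

lemma A_ops: "a \<in> carrier A \<Longrightarrow> b \<in> carrier A \<Longrightarrow> a \<otimes>\<^bsub>A\<^esub> b = a \<otimes>\<^bsub>B\<^esub> b"
  "a \<in> carrier A \<Longrightarrow> b \<in> carrier A \<Longrightarrow> a \<oplus>\<^bsub>A\<^esub> b = a \<oplus>\<^bsub>B\<^esub> b" "\<one>\<^bsub>A\<^esub> = \<one>\<^bsub>B\<^esub>"
  using incl by (auto simp: ring_hom_def)

lemma A_zero: "\<zero>\<^bsub>A\<^esub> = \<zero>\<^bsub>B\<^esub>" using ring_hom_zero[OF incl ring_A ring_B] by simp

lemma A_B: "a \<in> carrier A \<Longrightarrow> a \<in> carrier B" using A_sub by blast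

lemma \<sigma>_closed: "a \<in> carrier A \<Longrightarrow> \<sigma> a \<in> carrier A"
  and \<sigma>_add: "a \<in> carrier A \<Longrightarrow> b \<in> carrier A \<Longrightarrow> \<sigma> (a \<oplus>\<^bsub>A\<^esub> b) = \<sigma> a \<oplus>\<^bsub>A\<^esub> \<sigma> b"
  using sps by (auto simp: skew_power_series_ring_def continuous_automorphism_def ring_iso_def ring_hom_def)

lemma \<delta>_closed: "a \<in> carrier A \<Longrightarrow> \<delta> a \<in> carrier A"
  and \<delta>_add: "a \<in> carrier A \<Longrightarrow> b \<in> carrier A \<Longrightarrow> \<delta> (a \<oplus>\<^bsub>A\<^esub> b) = \<delta> a \<oplus>\<^bsub>A\<^esub> \<delta> b"
proof -
  have *: "continuous_map TA TA \<delta>" "\<forall>a \<in> carrier A. \<forall>b \<in> carrier A. \<delta> (a \<oplus>\<^bsub>A\<^esub> b) = \<delta> a \<oplus>\<^bsub>A\<^esub> \<delta> b"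
    using sps by (auto simp: skew_power_series_ring_def continuous_skew_derivation_def)
  show "a \<in> carrier A \<Longrightarrow> \<delta> a \<in> carrier A"
    using continuous_map_image_subset_topspace[OF *(1)] topspace_A by auto
  show "a \<in> carrier A \<Longrightarrow> b \<in> carrier A \<Longrightarrow> \<delta> (a \<oplus>\<^bsub>A\<^esub> b) = \<delta> a \<oplus>\<^bsub>A\<^esub> \<delta> b" using *(2) by blast
qed

lemma additive_zero:
  assumes "\<And>a. a \<in> carrier A \<Longrightarrow> f a \<in> carrier A" "\<And>a b. a \<in> carrier A \<Longrightarrow> b \<in> carrier A \<Longrightarrow> f (a \<oplus>\<^bsub>A\<^esub> b) = f a \<oplus>\<^bsub>A\<^esub> f b"
  shows "f \<zero>\<^bsub>A\<^esub> = \<zero>\<^bsub>A\<^esub>"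
  using assms(1)[OF A.zero_closed] assms(2)[OF A.zero_closed A.zero_closed] A.add.l_cancel_one' by simp

lemma \<sigma>_zero: "\<sigma> \<zero>\<^bsub>A\<^esub> = \<zero>\<^bsub>A\<^esub>" by (rule additive_zero[OF \<sigma>_closed \<sigma>_add])
lemma \<delta>_zero: "\<delta> \<zero>\<^bsub>A\<^esub> = \<zero>\<^bsub>A\<^esub>" by (rule additive_zero[OF \<delta>_closed \<delta>_add])

lemma left_mult_continuous: "b \<in> carrier B \<Longrightarrow> continuous_map TB TB (\<lambda>y. b \<otimes>\<^bsub>B\<^esub> y)"
  and right_mult_continuous: "b \<in> carrier B \<Longrightarrow> continuous_map TB TB (\<lambda>y. y \<otimes>\<^bsub>B\<^esub> b)"
proof -
  assume b: "b \<in> carrier B"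
  have m: "continuous_map (prod_topology TB TB) TB (\<lambda>(x, y). x \<otimes>\<^bsub>B\<^esub> y)" using top_B by (simp add: topological_ring_def)
  have "continuous_map TB (prod_topology TB TB) (\<lambda>y. (b, y))" "continuous_map TB (prod_topology TB TB) (\<lambda>y. (y, b))"
    using b by (auto intro!: continuous_map_pairedI simp: topspace_B)
  from continuous_map_compose[OF this(1) m] continuous_map_compose[OF this(2) m]
  show "continuous_map TB TB (\<lambda>y. b \<otimes>\<^bsub>B\<^esub> y)" "continuous_map TB TB (\<lambda>y. y \<otimes>\<^bsub>B\<^esub> b)" by (simp_all add: o_def)
qed

definition seqs :: "(nat \<Rightarrow> 'a) set" where "seqs = {x. \<forall>n. x n \<in> carrier A}"

definition coef :: "'a \<Rightarrow> nat \<Rightarrow> 'a" where "coef b = inv_into seqs \<phi> b"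

lemma product_seqs:
  "carrier (product_module (UNIV :: nat set) (\<lambda>_. regular_module A)) = seqs"
  by (auto simp: product_module_simps regular_module_simps seqs_def)

lemma \<phi>_bij: "bij_betw \<phi> seqs (carrier B)"
  and \<phi>_hom: "\<phi> \<in> left_module_hom A (product_module (UNIV :: nat set) (\<lambda>_. regular_module A)) (regular_module B)"
  and \<phi>_homeo: "homeomorphic_map (product_topology (\<lambda>_. TA) UNIV) TB \<phi>"
  using \<phi>_iso unfolding topological_module_iso_def left_module_iso_def product_seqs by (auto simp: regular_module_simps)

lemma \<phi>_closed: "x \<in> seqs \<Longrightarrow> \<phi> x \<in> carrier B"
  and coef_closed: "b \<in> carrier B \<Longrightarrow> coef b n \<in> carrier A"
  and coef_seqs: "b \<in> carrier B \<Longrightarrow> coef b \<in> seqs"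
  and \<phi>_coef: "b \<in> carrier B \<Longrightarrow> \<phi> (coef b) = b"
  and coef_\<phi>: "x \<in> seqs \<Longrightarrow> coef (\<phi> x) = x"
proof -
  note b = \<phi>_bij[unfolded bij_betw_def]
  show "x \<in> seqs \<Longrightarrow> \<phi> x \<in> carrier B" using b by auto
  show s: "b \<in> carrier B \<Longrightarrow> coef b \<in> seqs" using b inv_into_into[of b \<phi> seqs] by (auto simp: coef_def)
  then show "b \<in> carrier B \<Longrightarrow> coef b n \<in> carrier A" by (auto simp: seqs_def)
  show "b \<in> carrier B \<Longrightarrow> \<phi> (coef b) = b" using b f_inv_into_f[of b \<phi> seqs] by (auto simp: coef_def)
  show "x \<in> seqs \<Longrightarrow> coef (\<phi> x) = x" using b inv_into_f_f[of \<phi> seqs x] by (auto simp: coef_def)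
qed

lemma \<phi>_add: "x \<in> seqs \<Longrightarrow> y \<in> seqs \<Longrightarrow> \<phi> (\<lambda>n. x n \<oplus>\<^bsub>A\<^esub> y n) = \<phi> x \<oplus>\<^bsub>B\<^esub> \<phi> y"
  using hom_add[OF \<phi>_hom, of x y] unfolding product_seqs by (simp add: product_module_simps(3) regular_module_simps restrict_def)

lemma \<phi>_smult: "a \<in> carrier A \<Longrightarrow> x \<in> seqs \<Longrightarrow> \<phi> (\<lambda>n. a \<otimes>\<^bsub>A\<^esub> x n) = a \<otimes>\<^bsub>B\<^esub> \<phi> x"
  using hom_smult[OF \<phi>_hom, of a x] unfolding product_seqs by (simp add: product_module_simps(4) regular_module_simps restrict_def)

lemma seqs_add: "x \<in> seqs \<Longrightarrow> y \<in> seqs \<Longrightarrow> (\<lambda>n. x n \<oplus>\<^bsub>A\<^esub> y n) \<in> seqs"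
  and seqs_smult: "a \<in> carrier A \<Longrightarrow> x \<in> seqs \<Longrightarrow> (\<lambda>n. a \<otimes>\<^bsub>A\<^esub> x n) \<in> seqs"
  and seqs_zero: "(\<lambda>n. \<zero>\<^bsub>A\<^esub>) \<in> seqs"
  by (auto simp: seqs_def)

lemma coef_add: "b \<in> carrier B \<Longrightarrow> c \<in> carrier B \<Longrightarrow> coef (b \<oplus>\<^bsub>B\<^esub> c) n = coef b n \<oplus>\<^bsub>A\<^esub> coef c n"
  using coef_\<phi>[OF seqs_add[OF coef_seqs coef_seqs], of b c] by (simp add: \<phi>_add coef_seqs \<phi>_coef)

lemma coef_smult: "a \<in> carrier A \<Longrightarrow> b \<in> carrier B \<Longrightarrow> coef (a \<otimes>\<^bsub>B\<^esub> b) n = a \<otimes>\<^bsub>A\<^esub> coef b n"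
  using coef_\<phi>[OF seqs_smult[OF _ coef_seqs], of a b] by (simp add: \<phi>_smult coef_seqs \<phi>_coef)

lemma \<phi>_zero: "\<phi> (\<lambda>n. \<zero>\<^bsub>A\<^esub>) = \<zero>\<^bsub>B\<^esub>"
proof -
  have "\<phi> (\<lambda>n. \<zero>\<^bsub>A\<^esub>) \<oplus>\<^bsub>B\<^esub> \<phi> (\<lambda>n. \<zero>\<^bsub>A\<^esub>) = \<phi> (\<lambda>n. \<zero>\<^bsub>A\<^esub>)" using \<phi>_add[OF seqs_zero seqs_zero] by simp
  then show ?thesis using \<phi>_closed[OF seqs_zero] B.add.l_cancel_one' by metis
qed

lemma coef_zero: "coef \<zero>\<^bsub>B\<^esub> n = \<zero>\<^bsub>A\<^esub>" using coef_\<phi>[OF seqs_zero] by (simp add: \<phi>_zero)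

lemma coef_neg: assumes "b \<in> carrier B" shows "coef (\<ominus>\<^bsub>B\<^esub> b) n = \<ominus>\<^bsub>A\<^esub> coef b n"
proof -
  have "coef (\<ominus>\<^bsub>B\<^esub> b) n \<oplus>\<^bsub>A\<^esub> coef b n = \<zero>\<^bsub>A\<^esub>" using coef_add[of "\<ominus>\<^bsub>B\<^esub> b" b n] assms B.l_neg coef_zero by simp
  then show ?thesis using A.minus_equality coef_closed assms by (metis B.a_inv_closed)
qed

lemma coef_minus: "b \<in> carrier B \<Longrightarrow> c \<in> carrier B \<Longrightarrow> coef (b \<ominus>\<^bsub>B\<^esub> c) n = coef b n \<ominus>\<^bsub>A\<^esub> coef c n"
  by (simp add: a_minus_def coef_add coef_neg)

lemma coef_eqI: "b \<in> carrier B \<Longrightarrow> c \<in> carrier B \<Longrightarrow> (\<And>n. coef b n = coef c n) \<Longrightarrow> b = c"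
  using \<phi>_coef by (metis ext)

subsection \<open>Convergence\<close>

lemma haus_B: "Hausdorff_space TB"
proof -
  have "(product_topology (\<lambda>_::nat. TA) UNIV) homeomorphic_space TB"
    using \<phi>_homeo by (rule homeomorphic_map_imp_homeomorphic_space)
  moreover have "Hausdorff_space (product_topology (\<lambda>_::nat. TA) UNIV)"
    using haus_A by (simp add: Hausdorff_space_product_topology)
  ultimately show ?thesis using homeomorphic_Hausdorff_space by blast
qed

lemma \<phi>_limit:
  assumes "\<And>N. g N \<in> seqs" "x \<in> seqs" "\<And>k N. k < N \<Longrightarrow> g N k = x k"
  shows "limitin TB (\<lambda>N. \<phi> (g N)) (\<phi> x) sequentially"
proof -
  have "limitin TA (\<lambda>N. g N k) (x k) sequentially" for k
    by (rule limitin_eventually)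
      (use assms in \<open>auto simp: topspace_A seqs_def eventually_sequentially intro!: exI[of _ "Suc k"]\<close>)
  then have "limitin (product_topology (\<lambda>_. TA) UNIV) g x sequentially"
    using assms(1) by (simp add: limitin_componentwise topspace_A seqs_def PiE_UNIV_domain Pi_iff)
  from continuous_map_limit[OF homeomorphic_imp_continuous_map[OF \<phi>_homeo] this]
  show ?thesis by (simp add: o_def)
qed

lemma limit_unique: "limitin TB f x sequentially \<Longrightarrow> limitin TB f y sequentially \<Longrightarrow> x = y"
  by (rule limitin_Hausdorff_unique[OF _ _ _ haus_B]) auto

definition trunc :: "nat \<Rightarrow> (nat \<Rightarrow> 'a) \<Rightarrow> nat \<Rightarrow> 'a" where
  "trunc N x = (\<lambda>k. if k < N then x k else \<zero>\<^bsub>A\<^esub>)"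

definition monomial :: "'a \<Rightarrow> nat \<Rightarrow> nat \<Rightarrow> 'a" where
  "monomial a n = (\<lambda>k. if k = n then a else \<zero>\<^bsub>A\<^esub>)"

lemma trunc_seqs: "x \<in> seqs \<Longrightarrow> trunc N x \<in> seqs"
  and monomial_seqs: "a \<in> carrier A \<Longrightarrow> monomial a n \<in> seqs"
  by (auto simp: seqs_def trunc_def monomial_def)

lemma trunc_0: "trunc 0 x = (\<lambda>n. \<zero>\<^bsub>A\<^esub>)"
  and trunc_Suc: "x \<in> seqs \<Longrightarrow> trunc (Suc N) x = (\<lambda>k. trunc N x k \<oplus>\<^bsub>A\<^esub> monomial (x N) N k)"
  by (auto simp: trunc_def monomial_def seqs_def fun_eq_iff less_Suc_eq)

lemma \<phi>_monomial: assumes "a \<in> carrier A" shows "\<phi> (monomial a n) = a \<otimes>\<^bsub>B\<^esub> t [^]\<^bsub>B\<^esub> n"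
proof -
  have "(\<lambda>m. if m = n then \<one>\<^bsub>A\<^esub> else \<zero>\<^bsub>A\<^esub>) \<in> seqs" by (auto simp: seqs_def)
  from \<phi>_smult[OF assms this] have "\<phi> (\<lambda>k. a \<otimes>\<^bsub>A\<^esub> (if k = n then \<one>\<^bsub>A\<^esub> else \<zero>\<^bsub>A\<^esub>)) = a \<otimes>\<^bsub>B\<^esub> t [^]\<^bsub>B\<^esub> n" by (simp add: \<phi>_unit)
  moreover have "(\<lambda>k. a \<otimes>\<^bsub>A\<^esub> (if k = n then \<one>\<^bsub>A\<^esub> else \<zero>\<^bsub>A\<^esub>)) = monomial a n" using assms by (auto simp: monomial_def)
  ultimately show ?thesis by simp
qed

lemma t_pow_closed: "t [^]\<^bsub>B\<^esub> (n::nat) \<in> carrier B" using t_closed by simp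

lemma \<phi>_trunc_limit: "x \<in> seqs \<Longrightarrow> limitin TB (\<lambda>N. \<phi> (trunc N x)) (\<phi> x) sequentially"
  by (rule \<phi>_limit) (auto simp: trunc_seqs, simp add: trunc_def)

lemma \<phi>_trunc_Suc:
  assumes "x \<in> seqs"
  shows "\<phi> (trunc (Suc N) x) = \<phi> (trunc N x) \<oplus>\<^bsub>B\<^esub> x N \<otimes>\<^bsub>B\<^esub> t [^]\<^bsub>B\<^esub> N"
proof -
  have a: "x N \<in> carrier A" using assms by (simp add: seqs_def)
  show ?thesis
    unfolding trunc_Suc[OF assms] using \<phi>_add[OF trunc_seqs[OF assms] monomial_seqs[OF a]] \<phi>_monomial[OF a] by simp
qed

text \<open>Passing to the limit of the partial sums; this reduces membership of a product to that of the
  terms.\<close>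

lemma series_mult_in_closed:
  assumes C: "closedin TB C" "\<zero>\<^bsub>B\<^esub> \<in> C" "\<And>u v. u \<in> C \<Longrightarrow> v \<in> C \<Longrightarrow> u \<oplus>\<^bsub>B\<^esub> v \<in> C"
    and x: "x \<in> carrier B" and y: "y \<in> carrier B" and terms: "\<And>n. coef x n \<otimes>\<^bsub>B\<^esub> (t [^]\<^bsub>B\<^esub> n \<otimes>\<^bsub>B\<^esub> y) \<in> C"
  shows "x \<otimes>\<^bsub>B\<^esub> y \<in> C"
proof -
  let ?x = "coef x"
  have xs: "?x \<in> seqs" by (rule coef_seqs[OF x])
  have "\<phi> (trunc N ?x) \<otimes>\<^bsub>B\<^esub> y \<in> C" for N
  proof (induction N)
    case 0 then show ?case using C(2) y by (simp add: trunc_0 \<phi>_zero)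
  next
    case (Suc N)
    have a: "?x N \<in> carrier A" using coef_closed[OF x] .
    have c: "\<phi> (trunc N ?x) \<in> carrier B" "?x N \<in> carrier B" "?x N \<otimes>\<^bsub>B\<^esub> t [^]\<^bsub>B\<^esub> N \<in> carrier B"
      using \<phi>_closed[OF trunc_seqs[OF xs]] A_B[OF a] t_pow_closed by auto
    have "\<phi> (trunc (Suc N) ?x) \<otimes>\<^bsub>B\<^esub> y = \<phi> (trunc N ?x) \<otimes>\<^bsub>B\<^esub> y \<oplus>\<^bsub>B\<^esub> ?x N \<otimes>\<^bsub>B\<^esub> (t [^]\<^bsub>B\<^esub> N \<otimes>\<^bsub>B\<^esub> y)"
      using c y t_pow_closed[of N] by (simp add: \<phi>_trunc_Suc[OF xs] B.l_distr B.m_assoc)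
    then show ?case using C(3)[OF Suc terms[of N]] by simp
  qed
  moreover have "limitin TB (\<lambda>N. \<phi> (trunc N ?x) \<otimes>\<^bsub>B\<^esub> y) (\<phi> ?x \<otimes>\<^bsub>B\<^esub> y) sequentially"
    using continuous_map_limit[OF right_mult_continuous[OF y] \<phi>_trunc_limit[OF xs]] by (simp add: o_def)
  ultimately have "\<phi> ?x \<otimes>\<^bsub>B\<^esub> y \<in> C"
    by (intro limitin_closedin[OF _ C(1)]) auto
  then show ?thesis by (simp add: \<phi>_coef[OF x])
qed

text \<open>For computing the coefficients of \<open>b t\<close> and \<open>t b\<close>: it suffices to treat monomials \<open>a t\<^sup>n\<close>, as
  partial sums are finite sums of these and converge.\<close>

lemma continuous_additive_eq:
  assumes F: "continuous_map TB TB F" "\<And>u v. u \<in> carrier B \<Longrightarrow> v \<in> carrier B \<Longrightarrow> F (u \<oplus>\<^bsub>B\<^esub> v) = F u \<oplus>\<^bsub>B\<^esub> F v"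
    "F \<zero>\<^bsub>B\<^esub> = \<zero>\<^bsub>B\<^esub>"
    and G: "\<And>x. x \<in> seqs \<Longrightarrow> G x \<in> seqs" "\<And>x y k. x \<in> seqs \<Longrightarrow> y \<in> seqs \<Longrightarrow> G (\<lambda>n. x n \<oplus>\<^bsub>A\<^esub> y n) k = G x k \<oplus>\<^bsub>A\<^esub> G y k"
    "\<And>k. G (\<lambda>n. \<zero>\<^bsub>A\<^esub>) k = \<zero>\<^bsub>A\<^esub>" "\<And>x k N. x \<in> seqs \<Longrightarrow> k < N \<Longrightarrow> G (trunc N x) k = G x k"
    and mono: "\<And>a n. a \<in> carrier A \<Longrightarrow> F (a \<otimes>\<^bsub>B\<^esub> t [^]\<^bsub>B\<^esub> n) = \<phi> (G (monomial a n))"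
    and x: "x \<in> seqs"
  shows "F (\<phi> x) = \<phi> (G x)"
proof -
  have fin: "F (\<phi> (trunc N x)) = \<phi> (G (trunc N x))" for N
  proof (induction N)
    case 0
    have "G (\<lambda>n. \<zero>\<^bsub>A\<^esub>) = (\<lambda>n. \<zero>\<^bsub>A\<^esub>)" using G(3) by auto
    then show ?case by (simp add: trunc_0 \<phi>_zero F(3))
  next
    case (Suc N)
    have a: "x N \<in> carrier A" using x by (simp add: seqs_def)
    note s = trunc_seqs[OF x, of N] monomial_seqs[OF a, of N]
    have "F (\<phi> (trunc (Suc N) x)) = F (\<phi> (trunc N x)) \<oplus>\<^bsub>B\<^esub> F (\<phi> (monomial (x N) N))"
      unfolding trunc_Suc[OF x] \<phi>_add[OF s] using F(2) \<phi>_closed s by simp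
    also have "\<dots> = \<phi> (G (trunc N x)) \<oplus>\<^bsub>B\<^esub> \<phi> (G (monomial (x N) N))" by (simp add: Suc \<phi>_monomial[OF a] mono[OF a])
    also have "\<dots> = \<phi> (\<lambda>k. G (trunc N x) k \<oplus>\<^bsub>A\<^esub> G (monomial (x N) N) k)" by (rule \<phi>_add[OF G(1)[OF s(1)] G(1)[OF s(2)], symmetric])
    also have "(\<lambda>k. G (trunc N x) k \<oplus>\<^bsub>A\<^esub> G (monomial (x N) N) k) = G (trunc (Suc N) x)"
      unfolding trunc_Suc[OF x] using G(2)[OF s] by auto
    finally show ?case .
  qed
  have "limitin TB (\<lambda>N. F (\<phi> (trunc N x))) (F (\<phi> x)) sequentially"
    using continuous_map_limit[OF F(1) \<phi>_trunc_limit[OF x]] by (simp add: o_def)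
  moreover have "limitin TB (\<lambda>N. \<phi> (G (trunc N x))) (\<phi> (G x)) sequentially"
    by (rule \<phi>_limit[OF G(1)[OF trunc_seqs[OF x]] G(1)[OF x]]) (rule G(4)[OF x])
  ultimately show ?thesis using limit_unique fin by simp
qed

lemma coef_mult_t: assumes "b \<in> carrier B" shows "coef (b \<otimes>\<^bsub>B\<^esub> t) n = (if n = 0 then \<zero>\<^bsub>A\<^esub> else coef b (n - 1))"
proof -
  let ?G = "\<lambda>(x :: nat \<Rightarrow> 'a) n. if n = 0 then \<zero>\<^bsub>A\<^esub> else x (n - 1)"
  have "\<phi> (coef b) \<otimes>\<^bsub>B\<^esub> t = \<phi> (?G (coef b))"
  proof (rule continuous_additive_eq[where F = "\<lambda>y. y \<otimes>\<^bsub>B\<^esub> t" and G = ?G])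
    show "continuous_map TB TB (\<lambda>y. y \<otimes>\<^bsub>B\<^esub> t)" by (rule right_mult_continuous[OF t_closed])
    fix a n assume a: "a \<in> carrier A"
    have "?G (monomial a n) = monomial a (Suc n)" by (auto simp: monomial_def fun_eq_iff)
    then show "a \<otimes>\<^bsub>B\<^esub> t [^]\<^bsub>B\<^esub> n \<otimes>\<^bsub>B\<^esub> t = \<phi> (?G (monomial a n))"
      using \<phi>_monomial[OF a, of "Suc n"] A_B[OF a] t_closed by (simp add: B.m_assoc)
  qed (use t_closed in \<open>auto simp: B.l_distr seqs_def trunc_def coef_closed assms\<close>)
  moreover have "?G (coef b) \<in> seqs" using coef_closed[OF assms] by (auto simp: seqs_def)
  ultimately show ?thesis using coef_\<phi> \<phi>_coef[OF assms] by simp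
qed

lemma coef_t_mult: assumes "b \<in> carrier B"
  shows "coef (t \<otimes>\<^bsub>B\<^esub> b) n = (if n = 0 then \<zero>\<^bsub>A\<^esub> else \<sigma> (coef b (n - 1))) \<oplus>\<^bsub>A\<^esub> \<delta> (coef b n)"
proof -
  let ?G = "\<lambda>x n. (if n = 0 then \<zero>\<^bsub>A\<^esub> else \<sigma> (x (n - 1))) \<oplus>\<^bsub>A\<^esub> \<delta> (x n)"
  have "t \<otimes>\<^bsub>B\<^esub> \<phi> (coef b) = \<phi> (?G (coef b))"
  proof (rule continuous_additive_eq[where F = "\<lambda>y. t \<otimes>\<^bsub>B\<^esub> y" and G = ?G])
    show "continuous_map TB TB (\<lambda>y. t \<otimes>\<^bsub>B\<^esub> y)" by (rule left_mult_continuous[OF t_closed])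
    fix a n assume a: "a \<in> carrier A"
    have "?G (monomial a n) = (\<lambda>k. monomial (\<sigma> a) (Suc n) k \<oplus>\<^bsub>A\<^esub> monomial (\<delta> a) n k)"
      using \<sigma>_closed[OF a] \<delta>_closed[OF a] by (auto simp: monomial_def fun_eq_iff \<sigma>_zero \<delta>_zero)
    then have "\<phi> (?G (monomial a n)) = \<sigma> a \<otimes>\<^bsub>B\<^esub> t [^]\<^bsub>B\<^esub> (Suc n) \<oplus>\<^bsub>B\<^esub> \<delta> a \<otimes>\<^bsub>B\<^esub> t [^]\<^bsub>B\<^esub> n"
      using \<phi>_add[OF monomial_seqs monomial_seqs] \<phi>_monomial \<sigma>_closed[OF a] \<delta>_closed[OF a] by simp
    also have "\<dots> = (\<sigma> a \<otimes>\<^bsub>B\<^esub> t \<oplus>\<^bsub>B\<^esub> \<delta> a) \<otimes>\<^bsub>B\<^esub> t [^]\<^bsub>B\<^esub> n"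
      using A_B[OF \<sigma>_closed[OF a]] A_B[OF \<delta>_closed[OF a]] t_closed B.nat_pow_Suc2[OF t_closed, of n]
      by (simp add: B.l_distr B.m_assoc del: B.nat_pow_Suc)
    also have "\<dots> = t \<otimes>\<^bsub>B\<^esub> (a \<otimes>\<^bsub>B\<^esub> t [^]\<^bsub>B\<^esub> n)"
      using t_comm[OF a] A_B[OF a] t_closed by (simp flip: B.m_assoc)
    finally show "t \<otimes>\<^bsub>B\<^esub> (a \<otimes>\<^bsub>B\<^esub> t [^]\<^bsub>B\<^esub> n) = \<phi> (?G (monomial a n))" by simp
  next
    fix x y k assume xy: "x \<in> seqs" "y \<in> seqs"
    then show "?G (\<lambda>n. x n \<oplus>\<^bsub>A\<^esub> y n) k = ?G x k \<oplus>\<^bsub>A\<^esub> ?G y k"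
      by (auto simp: seqs_def \<sigma>_add \<delta>_add \<sigma>_closed \<delta>_closed A.a_ac)
  qed (use t_closed in \<open>auto simp: B.r_distr seqs_def trunc_def coef_closed assms \<sigma>_closed \<delta>_closed \<sigma>_zero \<delta>_zero\<close>)
  moreover have "?G (coef b) \<in> seqs" using coef_closed[OF assms] by (auto simp: seqs_def \<sigma>_closed \<delta>_closed)
  ultimately show ?thesis using coef_\<phi> \<phi>_coef[OF assms] by simp
qed

lemma coef_mult_t_pow: "b \<in> carrier B \<Longrightarrow> coef (b \<otimes>\<^bsub>B\<^esub> t [^]\<^bsub>B\<^esub> m) n = (if n < m then \<zero>\<^bsub>A\<^esub> else coef b (n - m))"
proof (induction m arbitrary: n)
  case (Suc m)
  have "b \<otimes>\<^bsub>B\<^esub> t [^]\<^bsub>B\<^esub> Suc m = (b \<otimes>\<^bsub>B\<^esub> t [^]\<^bsub>B\<^esub> m) \<otimes>\<^bsub>B\<^esub> t" using Suc.prems t_closed by (simp add: B.m_assoc)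
  then show ?case using coef_mult_t[of "b \<otimes>\<^bsub>B\<^esub> t [^]\<^bsub>B\<^esub> m" n] Suc t_closed by auto
qed simp

text \<open>The quotient of \<open>b\<close> on division by \<open>t\<^sup>m\<close>; the remainder is the part of \<open>b\<close> of degree less than
  \<open>m\<close>.\<close>

definition tail :: "nat \<Rightarrow> 'a \<Rightarrow> 'a" where "tail m b = \<phi> (\<lambda>n. coef b (n + m))"

lemma tail_closed: "b \<in> carrier B \<Longrightarrow> tail m b \<in> carrier B"
  and coef_tail: "b \<in> carrier B \<Longrightarrow> coef (tail m b) n = coef b (n + m)"
proof -
  assume "b \<in> carrier B"
  then have "(\<lambda>n. coef b (n + m)) \<in> seqs" using coef_closed by (auto simp: seqs_def)
  then show "tail m b \<in> carrier B" "coef (tail m b) n = coef b (n + m)" using \<phi>_closed coef_\<phi> by (auto simp: tail_def)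
qed

lemma tail_add: "b \<in> carrier B \<Longrightarrow> c \<in> carrier B \<Longrightarrow> tail m (b \<oplus>\<^bsub>B\<^esub> c) = tail m b \<oplus>\<^bsub>B\<^esub> tail m c"
  by (rule coef_eqI) (auto simp: tail_closed coef_tail coef_add)

lemma tail_minus: "b \<in> carrier B \<Longrightarrow> c \<in> carrier B \<Longrightarrow> tail m (b \<ominus>\<^bsub>B\<^esub> c) = tail m b \<ominus>\<^bsub>B\<^esub> tail m c"
  by (rule coef_eqI) (auto simp: tail_closed coef_tail coef_minus)

lemma tail_mult_t_pow: "b \<in> carrier B \<Longrightarrow> tail m (b \<otimes>\<^bsub>B\<^esub> t [^]\<^bsub>B\<^esub> m) = b"
  by (rule coef_eqI) (auto simp: tail_closed coef_tail coef_mult_t_pow t_closed)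

definition with_coefs_in :: "'a set \<Rightarrow> 'a set" where
  "with_coefs_in F = {b \<in> carrier B. \<forall>n. coef b n \<in> F}"

lemma with_coefs_in_closed:
  assumes "closedin TA F" "F \<subseteq> carrier A"
  shows "closedin TB (with_coefs_in F)"
proof -
  have "with_coefs_in F = \<phi> ` (Pi\<^sub>E UNIV (\<lambda>_::nat. F))"
  proof (intro equalityI subsetI)
    fix b assume "b \<in> with_coefs_in F"
    then have "coef b \<in> Pi\<^sub>E UNIV (\<lambda>_::nat. F)" "b = \<phi> (coef b)" using \<phi>_coef by (auto simp: with_coefs_in_def)
    then show "b \<in> \<phi> ` (Pi\<^sub>E UNIV (\<lambda>_::nat. F))" by blast
  next
    fix b assume "b \<in> \<phi> ` (Pi\<^sub>E UNIV (\<lambda>_::nat. F))"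
    then obtain x where x: "x \<in> Pi\<^sub>E UNIV (\<lambda>_::nat. F)" "b = \<phi> x" by auto
    then have xs: "x \<in> seqs" using assms(2) by (auto simp: seqs_def)
    then show "b \<in> with_coefs_in F" using x coef_\<phi>[OF xs] \<phi>_closed[OF xs] by (auto simp: with_coefs_in_def)
  qed
  moreover have "closedin (product_topology (\<lambda>_. TA) UNIV) (Pi\<^sub>E UNIV (\<lambda>_::nat. F))"
    using assms(1) by (simp add: closedin_product_topology)
  ultimately show ?thesis using homeomorphic_map_closedness_eq[OF \<phi>_homeo] by simp
qed

lemma with_coefs_in_add:
  assumes "submodule F A (regular_module A)"
  shows "\<zero>\<^bsub>B\<^esub> \<in> with_coefs_in F"
    "u \<in> with_coefs_in F \<Longrightarrow> v \<in> with_coefs_in F \<Longrightarrow> u \<oplus>\<^bsub>B\<^esub> v \<in> with_coefs_in F"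
    "u \<in> with_coefs_in F \<Longrightarrow> v \<in> with_coefs_in F \<Longrightarrow> u \<ominus>\<^bsub>B\<^esub> v \<in> with_coefs_in F"
    "u \<in> with_coefs_in F \<Longrightarrow> \<ominus>\<^bsub>B\<^esub> u \<in> with_coefs_in F"
    "a \<in> carrier A \<Longrightarrow> u \<in> with_coefs_in F \<Longrightarrow> a \<otimes>\<^bsub>B\<^esub> u \<in> with_coefs_in F"
  using submoduleD[OF assms] A_B
  by (auto simp: with_coefs_in_def regular_module_simps regular_module_neg coef_zero coef_add coef_minus coef_neg coef_smult)

lemma with_coefs_in_mult:
  assumes F: "closedin TA F" "submodule F A (regular_module A)"
    and x: "x \<in> carrier B" and y: "y \<in> carrier B"
    and terms: "\<And>n k. coef x n \<otimes>\<^bsub>A\<^esub> coef (t [^]\<^bsub>B\<^esub> n \<otimes>\<^bsub>B\<^esub> y) k \<in> F"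
  shows "x \<otimes>\<^bsub>B\<^esub> y \<in> with_coefs_in F"
proof (rule series_mult_in_closed[OF with_coefs_in_closed with_coefs_in_add(1,2)[OF F(2)] x y])
  show "F \<subseteq> carrier A" using submoduleD(1)[OF F(2)] by (simp add: regular_module_simps)
  fix n :: nat
  have "t [^]\<^bsub>B\<^esub> n \<otimes>\<^bsub>B\<^esub> y \<in> carrier B" using y t_closed by simp
  then show "coef x n \<otimes>\<^bsub>B\<^esub> (t [^]\<^bsub>B\<^esub> n \<otimes>\<^bsub>B\<^esub> y) \<in> with_coefs_in F"
    using terms[of n] coef_closed[OF x] A_B by (auto simp: with_coefs_in_def coef_smult)
qed (use F in auto)

end

section \<open>Weierstrass division modulo an ideal of coefficients\<close>

text \<open>The exponent \<open>r\<close> measures the nilpotence of \<open>\<delta>\<close> modulo \<open>I\<close>, and the chain condition says that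
  \<open>A / I\<close> is left artinian. The filtration \<open>E\<close> stands for the closed powers of \<open>I\<close>: right
  multiplication by \<open>I\<close> raises it, and it makes \<open>A\<close> separated and complete, so that series whose
  terms lie ever deeper in \<open>E\<close> can be summed.\<close>

locale skew_series_ideal = skew_series +
  fixes I :: "'a set" and r :: nat and E :: "nat \<Rightarrow> 'a set"
  assumes I: "ideal I A" and I_closed: "closedin TA I" and \<sigma>_I: "\<sigma> ` I \<subseteq> I" and \<delta>_I: "\<delta> ` I \<subseteq> I"
    and r_pos: "0 < r" and \<delta>_nilpotent: "(\<delta> ^^ r) ` carrier A \<subseteq> I"
    and dcc: "\<And>Y :: nat \<Rightarrow> 'a set. (\<And>n. submodule (Y n) A (regular_module A)) \<Longrightarrow> (\<And>n. Y (Suc n) \<subseteq> Y n) \<Longrightarrow>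
      (\<And>n. I \<subseteq> Y n) \<Longrightarrow> \<exists>k. \<forall>n\<ge>k. Y n = Y k"
    and E_ideal: "\<And>n. submodule (E n) A (regular_module A)" and E_closed: "\<And>n. closedin TA (E n)"
    and E_0: "carrier A \<subseteq> E 0" and E_Suc: "\<And>n. E (Suc n) \<subseteq> E n"
    and E_mult: "\<And>x c n. x \<in> E n \<Longrightarrow> c \<in> I \<Longrightarrow> x \<otimes>\<^bsub>A\<^esub> c \<in> E (Suc n)"
    and E_separated: "\<And>x. x \<in> carrier A \<Longrightarrow> (\<And>n. x \<in> E n) \<Longrightarrow> x = \<zero>\<^bsub>A\<^esub>"
    and E_complete: "\<And>y. (\<And>n. y n \<in> E n) \<Longrightarrow> \<exists>s \<in> carrier A. \<forall>n. s \<ominus>\<^bsub>A\<^esub> partial_sum A y n \<in> E n"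
begin

interpretation Id: ideal I A by (rule I)

abbreviation J :: "'a set" where "J \<equiv> with_coefs_in I"
abbreviation JE :: "nat \<Rightarrow> 'a set" where "JE n \<equiv> with_coefs_in (E n)"

lemma I_A: "c \<in> I \<Longrightarrow> c \<in> carrier A" by (rule Id.Icarr)

lemma I_submodule: "submodule I A (regular_module A)"
  by (rule left_module.submoduleI[OF regular_left_module[OF ring_A]])
    (use I_A in \<open>auto simp: regular_module_simps Id.I_l_closed\<close>)

lemmas J_add = with_coefs_in_add[OF I_submodule]
lemmas JE_add = with_coefs_in_add[OF E_ideal]

lemma J_B: "y \<in> J \<Longrightarrow> y \<in> carrier B" by (simp add: with_coefs_in_def)
lemma JE_B: "y \<in> JE n \<Longrightarrow> y \<in> carrier B" by (simp add: with_coefs_in_def)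

lemma J_t_pow:
  fixes n :: nat
  assumes "y \<in> J"
  shows "t [^]\<^bsub>B\<^esub> n \<otimes>\<^bsub>B\<^esub> y \<in> J"
proof (induction n)
  case 0 then show ?case using assms J_B by simp
next
  case (Suc n)
  let ?z = "t [^]\<^bsub>B\<^esub> n \<otimes>\<^bsub>B\<^esub> y"
  have z: "?z \<in> carrier B" "\<And>k. coef ?z k \<in> I" using Suc by (auto simp: with_coefs_in_def)
  have "coef (t \<otimes>\<^bsub>B\<^esub> ?z) k \<in> I" for k
    unfolding coef_t_mult[OF z(1)] using z(2) \<sigma>_I \<delta>_I by (auto intro!: Id.a_closed)
  moreover have "t [^]\<^bsub>B\<^esub> Suc n \<otimes>\<^bsub>B\<^esub> y = t \<otimes>\<^bsub>B\<^esub> ?z"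
    using B.nat_pow_Suc2[OF t_closed, of n] t_closed J_B[OF assms] by (simp add: B.m_assoc del: B.nat_pow_Suc)
  ultimately show ?case using z(1) t_closed by (simp add: with_coefs_in_def del: B.nat_pow_Suc)
qed

lemma J_left: assumes b: "b \<in> carrier B" and y: "y \<in> J" shows "b \<otimes>\<^bsub>B\<^esub> y \<in> J"
  by (rule with_coefs_in_mult[OF I_closed I_submodule b J_B[OF y]], rule Id.I_l_closed)
    (use J_t_pow[OF y] coef_closed[OF b] in \<open>auto simp: with_coefs_in_def\<close>)

lemma J_right: assumes y: "y \<in> J" and b: "b \<in> carrier B" shows "y \<otimes>\<^bsub>B\<^esub> b \<in> J"
  by (rule with_coefs_in_mult[OF I_closed I_submodule J_B[OF y] b], rule Id.I_r_closed)
    (use y b t_closed coef_closed in \<open>auto simp: with_coefs_in_def\<close>)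

lemma JE_mult: assumes x: "x \<in> JE n" and y: "y \<in> J" shows "x \<otimes>\<^bsub>B\<^esub> y \<in> JE (Suc n)"
  by (rule with_coefs_in_mult[OF E_closed E_ideal JE_B[OF x] J_B[OF y]], rule E_mult)
    (use x J_t_pow[OF y] in \<open>auto simp: with_coefs_in_def\<close>)

lemma JE_0: "x \<in> carrier B \<Longrightarrow> x \<in> JE 0"
  using E_0 coef_closed by (auto simp: with_coefs_in_def)

lemma JE_Suc: "x \<in> JE (Suc n) \<Longrightarrow> x \<in> JE n"
  using E_Suc by (auto simp: with_coefs_in_def)

lemma JE_separated: "(\<And>n. x \<in> JE n) \<Longrightarrow> x = \<zero>\<^bsub>B\<^esub>"
proof -
  assume x: "\<And>n. x \<in> JE n"
  then have xB: "x \<in> carrier B" using JE_B by blast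
  have "coef x k = \<zero>\<^bsub>A\<^esub>" for k
    by (rule E_separated) (use x coef_closed[OF xB] in \<open>auto simp: with_coefs_in_def\<close>)
  then show ?thesis using coef_eqI[OF xB B.zero_closed] coef_zero by simp
qed

lemma JE_tail: "x \<in> JE n \<Longrightarrow> tail m x \<in> JE n"
  by (auto simp: with_coefs_in_def tail_closed coef_tail)

lemma partial_sum_B: "(\<And>n. y n \<in> carrier B) \<Longrightarrow> partial_sum B y n \<in> carrier B"
  by (induction n) auto

lemma coef_partial_sum: "(\<And>n. y n \<in> carrier B) \<Longrightarrow> coef (partial_sum B y n) k = partial_sum A (\<lambda>m. coef (y m) k) n"
  by (induction n) (auto simp: coef_zero coef_add partial_sum_B)

text \<open>If \<open>x s = 0\<close>, then \<open>x = - tail n (x (s - t\<^sup>n))\<close>. The right-hand side lies one step deeper in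
  the filtration than \<open>x\<close>.\<close>

lemma weierstrass_injective:
  fixes n :: nat
  assumes s: "s \<in> carrier B" "s \<ominus>\<^bsub>B\<^esub> t [^]\<^bsub>B\<^esub> n \<in> J" and x: "x \<in> carrier B" "x \<otimes>\<^bsub>B\<^esub> s = \<zero>\<^bsub>B\<^esub>"
  shows "x = \<zero>\<^bsub>B\<^esub>"
proof -
  let ?j = "s \<ominus>\<^bsub>B\<^esub> t [^]\<^bsub>B\<^esub> n"
  note c = t_pow_closed[of n] J_B[OF s(2)]
  have "x \<otimes>\<^bsub>B\<^esub> t [^]\<^bsub>B\<^esub> n \<oplus>\<^bsub>B\<^esub> x \<otimes>\<^bsub>B\<^esub> ?j = x \<otimes>\<^bsub>B\<^esub> (t [^]\<^bsub>B\<^esub> n \<oplus>\<^bsub>B\<^esub> ?j)" using x(1) c by (simp only: B.r_distr)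
  also have "t [^]\<^bsub>B\<^esub> n \<oplus>\<^bsub>B\<^esub> ?j = s" by (rule B.add_diff_cancel[OF s(1) c(1)])
  finally have "tail n (x \<otimes>\<^bsub>B\<^esub> t [^]\<^bsub>B\<^esub> n \<oplus>\<^bsub>B\<^esub> x \<otimes>\<^bsub>B\<^esub> ?j) = tail n \<zero>\<^bsub>B\<^esub>" using x(2) by simp
  moreover have "tail n \<zero>\<^bsub>B\<^esub> = \<zero>\<^bsub>B\<^esub>" by (simp add: tail_def coef_zero \<phi>_zero)
  ultimately have xT: "x \<oplus>\<^bsub>B\<^esub> tail n (x \<otimes>\<^bsub>B\<^esub> ?j) = \<zero>\<^bsub>B\<^esub>" using x(1) c by (simp add: tail_add tail_mult_t_pow)
  then have x': "x = \<ominus>\<^bsub>B\<^esub> tail n (x \<otimes>\<^bsub>B\<^esub> ?j)"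
    using B.minus_equality[OF xT] x(1) c tail_closed by (simp add: B.minus_equality)
  have "x \<in> JE m" for m
  proof (induction m)
    case 0 show ?case by (rule JE_0[OF x(1)])
  next
    case (Suc m)
    show ?case by (subst x', rule JE_add(4), rule JE_tail, rule JE_mult[OF Suc s(2)])
  qed
  then show ?thesis by (rule JE_separated)
qed

text \<open>The quotient \<open>q\<close> has to solve \<open>q + T q = tail n b\<close>, where \<open>T x = tail n (x (s - t\<^sup>n))\<close>. As \<open>T\<close>
  raises the filtration, the alternating series of the \<open>T\<^sup>m (tail n b)\<close> converges to a solution.\<close>

lemma weierstrass_division:
  fixes n :: nat
  assumes s: "s \<in> carrier B" "s \<ominus>\<^bsub>B\<^esub> t [^]\<^bsub>B\<^esub> n \<in> J" and b: "b \<in> carrier B"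
  shows "\<exists>q \<in> carrier B. \<forall>k\<ge>n. coef (b \<ominus>\<^bsub>B\<^esub> q \<otimes>\<^bsub>B\<^esub> s) k = \<zero>\<^bsub>A\<^esub>"
proof -
  let ?j = "s \<ominus>\<^bsub>B\<^esub> t [^]\<^bsub>B\<^esub> n"
  note jB = J_B[OF s(2)]
  define T where "T x = tail n (x \<otimes>\<^bsub>B\<^esub> ?j)" for x
  have TB: "T x \<in> carrier B" if "x \<in> carrier B" for x using that jB by (simp add: T_def tail_closed)
  have T_add: "T (x \<oplus>\<^bsub>B\<^esub> y) = T x \<oplus>\<^bsub>B\<^esub> T y" if "x \<in> carrier B" "y \<in> carrier B" for x y
    using that jB by (simp add: T_def B.l_distr tail_add)
  have TJ: "T x \<in> JE (Suc m)" if "x \<in> JE m" for x m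
    unfolding T_def by (rule JE_tail[OF JE_mult[OF that s(2)]])
  let ?x = "tail n b"
  have xB: "?x \<in> carrier B" by (rule tail_closed[OF b])
  define y where "y = rec_nat ?x (\<lambda>_ z. \<ominus>\<^bsub>B\<^esub> T z)"
  have y0: "y 0 = ?x" and ySuc: "\<And>m. y (Suc m) = \<ominus>\<^bsub>B\<^esub> T (y m)" by (simp_all add: y_def)
  have yJ: "y m \<in> JE m" for m
    by (induction m) (simp_all add: y0 ySuc JE_0[OF xB] JE_add(4) TJ)
  have yB: "y m \<in> carrier B" for m using JE_B[OF yJ] .
  have "\<forall>k. \<exists>c \<in> carrier A. \<forall>m. c \<ominus>\<^bsub>A\<^esub> partial_sum A (\<lambda>m. coef (y m) k) m \<in> E m"
    using E_complete[of "\<lambda>m. coef (y m) k" for k] yJ by (auto simp: with_coefs_in_def)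
  \<comment> \<open>The series is summed in each coefficient.\<close>
  then obtain c where c: "\<And>k. c k \<in> carrier A" "\<And>k m. c k \<ominus>\<^bsub>A\<^esub> partial_sum A (\<lambda>m. coef (y m) k) m \<in> E m" by metis
  have cs: "c \<in> seqs" using c(1) by (simp add: seqs_def)
  let ?q = "\<phi> c" and ?s = "partial_sum B y"
  have qB: "?q \<in> carrier B" by (rule \<phi>_closed[OF cs])
  have sB: "?s m \<in> carrier B" for m by (rule partial_sum_B[OF yB])
  have qs: "?q \<ominus>\<^bsub>B\<^esub> ?s m \<in> JE m" for m
    using c(2) qB sB by (simp add: with_coefs_in_def coef_minus coef_\<phi>[OF cs] coef_partial_sum[OF yB])
  \<comment> \<open>The sum telescopes.\<close>
  have sT: "(?s m \<oplus>\<^bsub>B\<^esub> T (?s m)) \<oplus>\<^bsub>B\<^esub> y m = ?x" for m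
  proof (induction m)
    case 0
    have "T \<zero>\<^bsub>B\<^esub> = \<zero>\<^bsub>B\<^esub>" using jB by (simp add: T_def) (simp add: tail_def coef_zero \<phi>_zero)
    then show ?case using xB by (simp add: y0)
  next
    case (Suc m)
    have "(?s (Suc m) \<oplus>\<^bsub>B\<^esub> T (?s (Suc m))) \<oplus>\<^bsub>B\<^esub> y (Suc m) =
        ((?s m \<oplus>\<^bsub>B\<^esub> T (?s m)) \<oplus>\<^bsub>B\<^esub> y m) \<oplus>\<^bsub>B\<^esub> (T (y m) \<oplus>\<^bsub>B\<^esub> (\<ominus>\<^bsub>B\<^esub> T (y m)))"
      using sB[of m] yB[of m] TB[OF sB[of m]] TB[OF yB[of m]] by (simp add: T_add ySuc B.a_ac del: B.r_neg)
    also have "\<dots> = ?x" using Suc xB TB[OF yB[of m]] by (simp add: B.r_neg)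
    finally show ?case .
  qed
  let ?d = "(?q \<oplus>\<^bsub>B\<^esub> T ?q) \<ominus>\<^bsub>B\<^esub> ?x"
  have "?d \<in> JE m" for m
  proof -
    let ?e = "?q \<ominus>\<^bsub>B\<^esub> ?s m"
    have eB: "?e \<in> carrier B" using qB sB by simp
    have q: "?q = ?s m \<oplus>\<^bsub>B\<^esub> ?e" using B.add_diff_cancel[OF qB sB] by simp
    have "?q \<oplus>\<^bsub>B\<^esub> T ?q = (?s m \<oplus>\<^bsub>B\<^esub> T (?s m)) \<oplus>\<^bsub>B\<^esub> (?e \<oplus>\<^bsub>B\<^esub> T ?e)"
      by (subst (1 2) q) (use sB[of m] eB TB in \<open>simp add: T_add B.a_ac\<close>)
    moreover have "?x = (?s m \<oplus>\<^bsub>B\<^esub> T (?s m)) \<oplus>\<^bsub>B\<^esub> y m" using sT[of m] by simp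
    ultimately have "?d = ((?s m \<oplus>\<^bsub>B\<^esub> T (?s m)) \<oplus>\<^bsub>B\<^esub> (?e \<oplus>\<^bsub>B\<^esub> T ?e)) \<ominus>\<^bsub>B\<^esub> ((?s m \<oplus>\<^bsub>B\<^esub> T (?s m)) \<oplus>\<^bsub>B\<^esub> y m)" by simp
    also have "\<dots> = (?e \<oplus>\<^bsub>B\<^esub> T ?e) \<ominus>\<^bsub>B\<^esub> y m"
    proof -
      have "(u \<oplus>\<^bsub>B\<^esub> v) \<ominus>\<^bsub>B\<^esub> (u \<oplus>\<^bsub>B\<^esub> w) = v \<ominus>\<^bsub>B\<^esub> w" if "u \<in> carrier B" "v \<in> carrier B" "w \<in> carrier B" for u v w
      proof -
        have "(u \<oplus>\<^bsub>B\<^esub> v) \<ominus>\<^bsub>B\<^esub> (u \<oplus>\<^bsub>B\<^esub> w) = (u \<oplus>\<^bsub>B\<^esub> (\<ominus>\<^bsub>B\<^esub> u)) \<oplus>\<^bsub>B\<^esub> (v \<ominus>\<^bsub>B\<^esub> w)"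
          using that by (simp add: a_minus_def B.minus_add B.a_ac del: B.r_neg)
        then show ?thesis using that by (simp add: B.r_neg)
      qed
      then show ?thesis using sB[of m] TB[OF sB[of m]] eB TB[OF eB] yB[of m] by simp
    qed
    finally have d: "?d = (?e \<oplus>\<^bsub>B\<^esub> T ?e) \<ominus>\<^bsub>B\<^esub> y m" .
    show ?thesis unfolding d using JE_add(2,3) qs[of m] JE_Suc[OF TJ[OF qs[of m]]] yJ[of m] by blast
  qed
  then have d0: "?d = \<zero>\<^bsub>B\<^esub>" by (rule JE_separated)
  have qT: "?q \<oplus>\<^bsub>B\<^esub> T ?q = ?x" using B.diff_eq_zero_iff[of "?q \<oplus>\<^bsub>B\<^esub> T ?q" ?x] d0 qB TB[OF qB] xB by simp
  have "?q \<otimes>\<^bsub>B\<^esub> s = ?q \<otimes>\<^bsub>B\<^esub> (t [^]\<^bsub>B\<^esub> n \<oplus>\<^bsub>B\<^esub> ?j)" using B.add_diff_cancel[OF s(1) t_pow_closed[of n]] by simp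
  also have "\<dots> = ?q \<otimes>\<^bsub>B\<^esub> t [^]\<^bsub>B\<^esub> n \<oplus>\<^bsub>B\<^esub> ?q \<otimes>\<^bsub>B\<^esub> ?j" by (rule B.r_distr[OF t_pow_closed jB qB])
  finally have "tail n (?q \<otimes>\<^bsub>B\<^esub> s) = ?q \<oplus>\<^bsub>B\<^esub> T ?q"
    using qB jB t_pow_closed[of n] by (simp add: tail_add tail_mult_t_pow T_def)
  then have "tail n (b \<ominus>\<^bsub>B\<^esub> ?q \<otimes>\<^bsub>B\<^esub> s) = ?x \<ominus>\<^bsub>B\<^esub> ?x" using tail_minus[OF b] qB s(1) qT by simp
  also have "\<dots> = \<zero>\<^bsub>B\<^esub>" using xB B.diff_eq_zero_iff by blast
  finally have tz: "tail n (b \<ominus>\<^bsub>B\<^esub> ?q \<otimes>\<^bsub>B\<^esub> s) = \<zero>\<^bsub>B\<^esub>" .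
  have "coef (b \<ominus>\<^bsub>B\<^esub> ?q \<otimes>\<^bsub>B\<^esub> s) k = \<zero>\<^bsub>A\<^esub>" if "k \<ge> n" for k
    using coef_tail[of "b \<ominus>\<^bsub>B\<^esub> ?q \<otimes>\<^bsub>B\<^esub> s" n "k - n"] tz b qB s(1) that by (simp add: coef_zero)
  then show ?thesis using qB by blast
qed

lemma regular_B_left_module: "left_module B (regular_module B)" "left_module A (regular_module B)"
  using regular_left_module[OF ring_B] restrict_scalars[OF ring_A A_sub incl] by blast+

lemma weierstrass_quotient_fg:
  fixes n :: nat
  assumes s: "s \<in> carrier B" "s \<ominus>\<^bsub>B\<^esub> t [^]\<^bsub>B\<^esub> n \<in> J"
  shows "fg_mod A (regular_module B) (carrier B) ((\<lambda>q. q \<otimes>\<^bsub>B\<^esub> s) ` carrier B)"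
proof -
  interpret Bm: left_module A "regular_module B" by (rule regular_B_left_module(2))
  let ?f = "\<lambda>x. lincomb (regular_module B) (\<lambda>i. t [^]\<^bsub>B\<^esub> i) x n"
  have f: "?f \<in> left_module_hom A (free_module A n) (regular_module B)"
    by (rule Bm.lincomb_hom) (simp add: regular_module_simps t_closed)
  have fx: "lincomb (regular_module B) (\<lambda>i. t [^]\<^bsub>B\<^esub> i) x m = \<phi> (trunc m x)" if "x \<in> seqs" for x m
    by (induction m) (simp_all add: regular_module_simps trunc_0 \<phi>_zero \<phi>_trunc_Suc[OF that])
  show ?thesis
  proof (rule fg_modI[OF f])
    show "?f x \<in> carrier B" if "x \<in> carrier (free_module A n)" for x
      using hom_closed[OF f that] by (simp add: regular_module_simps)
    fix b assume b: "b \<in> carrier B"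
    obtain q where q: "q \<in> carrier B" "\<And>k. k \<ge> n \<Longrightarrow> coef (b \<ominus>\<^bsub>B\<^esub> q \<otimes>\<^bsub>B\<^esub> s) k = \<zero>\<^bsub>A\<^esub>"
      using weierstrass_division[OF s b] by blast
    let ?d = "b \<ominus>\<^bsub>B\<^esub> q \<otimes>\<^bsub>B\<^esub> s"
    have dB: "?d \<in> carrier B" using b q s by simp
    have x: "coef ?d \<in> carrier (free_module A n)" using coef_closed[OF dB] q(2) by (simp add: free_module_simps)
    have "trunc n (coef ?d) = coef ?d" using q(2) by (auto simp: trunc_def fun_eq_iff)
    then have "?f (coef ?d) = ?d" using fx[OF coef_seqs[OF dB], of n] \<phi>_coef[OF dB] by simp
    moreover have "b = ?d \<oplus>\<^bsub>B\<^esub> q \<otimes>\<^bsub>B\<^esub> s"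
      using b q(1) s(1) B.add_diff_cancel[of b "q \<otimes>\<^bsub>B\<^esub> s"] by (simp add: B.a_comm)
    ultimately show "\<exists>x\<in>carrier (free_module A n). \<exists>z\<in>(\<lambda>q. q \<otimes>\<^bsub>B\<^esub> s) ` carrier B. b = ?f x \<oplus>\<^bsub>regular_module B\<^esub> z"
      using x q(1) by (intro bexI[OF _ x] bexI[of _ "q \<otimes>\<^bsub>B\<^esub> s"]) (simp_all add: regular_module_simps)
  qed
qed

subsection \<open>Cofinite left ideals contain a distinguished element\<close>

text \<open>Modulo \<open>J\<close>, the elements of \<open>low_in m\<close> are the multiples \<open>b t\<^sup>m\<close>.\<close>

definition low_in :: "nat \<Rightarrow> 'a set" where
  "low_in m = {b \<in> carrier B. \<forall>i<m. coef b i \<in> I}"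

lemma low_in_add: "b \<in> low_in m \<Longrightarrow> c \<in> low_in m \<Longrightarrow> b \<oplus>\<^bsub>B\<^esub> c \<in> low_in m"
  and low_in_minus: "b \<in> low_in m \<Longrightarrow> c \<in> low_in m \<Longrightarrow> b \<ominus>\<^bsub>B\<^esub> c \<in> low_in m"
  and J_low_in: "y \<in> J \<Longrightarrow> y \<in> low_in m"
  and mult_t_pow_low_in: "b \<in> carrier B \<Longrightarrow> b \<otimes>\<^bsub>B\<^esub> t [^]\<^bsub>B\<^esub> m \<in> low_in m"
  and low_in_0: "b \<in> carrier B \<Longrightarrow> b \<in> low_in 0"
  using submoduleD(6)[OF I_submodule]
  by (auto simp: low_in_def coef_add coef_minus with_coefs_in_def coef_mult_t_pow t_closed regular_module_neg)

lemma low_in_antimono: "m \<le> m' \<Longrightarrow> b \<in> low_in m' \<Longrightarrow> b \<in> low_in m" by (auto simp: low_in_def)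

lemma low_in_decompose:
  assumes "b \<in> low_in m"
  obtains x y where "x \<in> carrier B" "y \<in> J" "b = x \<otimes>\<^bsub>B\<^esub> t [^]\<^bsub>B\<^esub> m \<oplus>\<^bsub>B\<^esub> y"
proof -
  have b: "b \<in> carrier B" "\<And>i. i < m \<Longrightarrow> coef b i \<in> I" using assms by (auto simp: low_in_def)
  let ?x = "tail m b"
  have x: "?x \<in> carrier B" "?x \<otimes>\<^bsub>B\<^esub> t [^]\<^bsub>B\<^esub> m \<in> carrier B" using tail_closed[OF b(1)] t_pow_closed[of m] by auto
  have "coef (b \<ominus>\<^bsub>B\<^esub> ?x \<otimes>\<^bsub>B\<^esub> t [^]\<^bsub>B\<^esub> m) k \<in> I" for k
  proof -
    have bk: "coef b k \<in> carrier A" by (rule coef_closed[OF b(1)])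
    have "coef (b \<ominus>\<^bsub>B\<^esub> ?x \<otimes>\<^bsub>B\<^esub> t [^]\<^bsub>B\<^esub> m) k = coef b k \<ominus>\<^bsub>A\<^esub> (if k < m then \<zero>\<^bsub>A\<^esub> else coef b k)"
      using b(1) x by (simp add: coef_minus coef_mult_t_pow coef_tail)
    also have "\<dots> = (if k < m then coef b k else \<zero>\<^bsub>A\<^esub>)" using bk by (simp add: a_minus_def A.r_neg)
    finally have "coef (b \<ominus>\<^bsub>B\<^esub> ?x \<otimes>\<^bsub>B\<^esub> t [^]\<^bsub>B\<^esub> m) k = (if k < m then coef b k else \<zero>\<^bsub>A\<^esub>)" .
    then show ?thesis using b(2) by simp
  qed
  then have "b \<ominus>\<^bsub>B\<^esub> ?x \<otimes>\<^bsub>B\<^esub> t [^]\<^bsub>B\<^esub> m \<in> J" using b(1) x by (simp add: with_coefs_in_def)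
  moreover have "b = ?x \<otimes>\<^bsub>B\<^esub> t [^]\<^bsub>B\<^esub> m \<oplus>\<^bsub>B\<^esub> (b \<ominus>\<^bsub>B\<^esub> ?x \<otimes>\<^bsub>B\<^esub> t [^]\<^bsub>B\<^esub> m)" using B.add_diff_cancel[OF b(1) x(2)] by simp
  ultimately show thesis using that x(1) by blast
qed

lemma low_in_left: assumes "b \<in> carrier B" "c \<in> low_in m" shows "b \<otimes>\<^bsub>B\<^esub> c \<in> low_in m"
proof -
  obtain x y where xy: "x \<in> carrier B" "y \<in> J" "c = x \<otimes>\<^bsub>B\<^esub> t [^]\<^bsub>B\<^esub> m \<oplus>\<^bsub>B\<^esub> y" using low_in_decompose[OF assms(2)] .
  have "b \<otimes>\<^bsub>B\<^esub> c = (b \<otimes>\<^bsub>B\<^esub> x) \<otimes>\<^bsub>B\<^esub> t [^]\<^bsub>B\<^esub> m \<oplus>\<^bsub>B\<^esub> b \<otimes>\<^bsub>B\<^esub> y"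
    using xy(1,3) J_B[OF xy(2)] assms(1) t_pow_closed[of m] by (simp add: B.r_distr B.m_assoc)
  then show ?thesis
    using low_in_add[OF mult_t_pow_low_in J_low_in[OF J_left[OF assms(1) xy(2)]]] xy(1) assms(1) by simp
qed

text \<open>The constant term of \<open>t\<^sup>n b\<close> is \<open>\<delta>\<^sup>n\<close> of the constant term of \<open>b\<close>.\<close>

lemma t_pow_mult_low_in_1: assumes "b \<in> carrier B" shows "t [^]\<^bsub>B\<^esub> r \<otimes>\<^bsub>B\<^esub> b \<in> low_in 1"
proof -
  have "coef (t [^]\<^bsub>B\<^esub> n \<otimes>\<^bsub>B\<^esub> b) 0 = (\<delta> ^^ n) (coef b 0) \<and> (\<delta> ^^ n) (coef b 0) \<in> carrier A" for n :: nat
  proof (induction n)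
    case 0 then show ?case using assms coef_closed by simp
  next
    case (Suc n)
    have "t [^]\<^bsub>B\<^esub> Suc n \<otimes>\<^bsub>B\<^esub> b = t \<otimes>\<^bsub>B\<^esub> (t [^]\<^bsub>B\<^esub> n \<otimes>\<^bsub>B\<^esub> b)"
      using B.nat_pow_Suc2[OF t_closed, of n] t_closed assms by (simp add: B.m_assoc del: B.nat_pow_Suc)
    then show ?case
      using coef_t_mult[of "t [^]\<^bsub>B\<^esub> n \<otimes>\<^bsub>B\<^esub> b" 0] Suc assms t_closed \<delta>_closed by (simp del: B.nat_pow_Suc)
  qed
  from this[of r] have "coef (t [^]\<^bsub>B\<^esub> r \<otimes>\<^bsub>B\<^esub> b) 0 \<in> I" using \<delta>_nilpotent coef_closed[OF assms, of 0] by auto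
  then show ?thesis using assms t_pow_closed[of r] by (simp add: low_in_def)
qed

lemma t_pow_mult_low_in: assumes "b \<in> low_in m" shows "t [^]\<^bsub>B\<^esub> r \<otimes>\<^bsub>B\<^esub> b \<in> low_in (Suc m)"
proof -
  obtain x y where xy: "x \<in> carrier B" "y \<in> J" "b = x \<otimes>\<^bsub>B\<^esub> t [^]\<^bsub>B\<^esub> m \<oplus>\<^bsub>B\<^esub> y" using low_in_decompose[OF assms] .
  obtain x' y' where xy': "x' \<in> carrier B" "y' \<in> J" "t [^]\<^bsub>B\<^esub> r \<otimes>\<^bsub>B\<^esub> x = x' \<otimes>\<^bsub>B\<^esub> t [^]\<^bsub>B\<^esub> (1::nat) \<oplus>\<^bsub>B\<^esub> y'"
    using low_in_decompose[OF t_pow_mult_low_in_1[OF xy(1)]] .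
  note c = xy(1) xy'(1) J_B[OF xy(2)] J_B[OF xy'(2)] t_pow_closed[of m] t_pow_closed[of r] t_closed
  have "t [^]\<^bsub>B\<^esub> r \<otimes>\<^bsub>B\<^esub> b = (t [^]\<^bsub>B\<^esub> r \<otimes>\<^bsub>B\<^esub> x) \<otimes>\<^bsub>B\<^esub> t [^]\<^bsub>B\<^esub> m \<oplus>\<^bsub>B\<^esub> t [^]\<^bsub>B\<^esub> r \<otimes>\<^bsub>B\<^esub> y"
    using xy(3) c by (simp add: B.r_distr B.m_assoc)
  also have "(t [^]\<^bsub>B\<^esub> r \<otimes>\<^bsub>B\<^esub> x) \<otimes>\<^bsub>B\<^esub> t [^]\<^bsub>B\<^esub> m = x' \<otimes>\<^bsub>B\<^esub> t [^]\<^bsub>B\<^esub> (Suc m) \<oplus>\<^bsub>B\<^esub> y' \<otimes>\<^bsub>B\<^esub> t [^]\<^bsub>B\<^esub> m"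
    unfolding xy'(3) using c B.nat_pow_Suc2[OF t_closed, of m] by (simp add: B.l_distr B.m_assoc)
  finally have eq: "t [^]\<^bsub>B\<^esub> r \<otimes>\<^bsub>B\<^esub> b = x' \<otimes>\<^bsub>B\<^esub> t [^]\<^bsub>B\<^esub> (Suc m) \<oplus>\<^bsub>B\<^esub> y' \<otimes>\<^bsub>B\<^esub> t [^]\<^bsub>B\<^esub> m \<oplus>\<^bsub>B\<^esub> t [^]\<^bsub>B\<^esub> r \<otimes>\<^bsub>B\<^esub> y" .
  show ?thesis
    unfolding eq
    by (intro low_in_add mult_t_pow_low_in[OF xy'(1)] J_low_in J_right[OF xy'(2)] J_left[OF _ xy(2)] t_pow_closed)
qed

lemma t_pow_times_low_in: assumes "b \<in> carrier B" shows "t [^]\<^bsub>B\<^esub> (r * m) \<otimes>\<^bsub>B\<^esub> b \<in> low_in m"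
proof (induction m)
  case 0 then show ?case using low_in_0 assms by simp
next
  case (Suc m)
  have "t [^]\<^bsub>B\<^esub> (r * Suc m) \<otimes>\<^bsub>B\<^esub> b = t [^]\<^bsub>B\<^esub> r \<otimes>\<^bsub>B\<^esub> (t [^]\<^bsub>B\<^esub> (r * m) \<otimes>\<^bsub>B\<^esub> b)"
    using B.nat_pow_mult[OF t_closed, of r "r * m"] assms t_closed by (simp flip: B.m_assoc)
  then show ?case using t_pow_mult_low_in[OF Suc] by simp
qed

text \<open>The subsets \<open>low_in m\<close> are left ideals only; commuting \<open>t\<^sup>r\<^sup>m\<close> past \<open>b\<close> still leaves \<open>m\<close>
  powers of \<open>t\<close>.\<close>

lemma low_in_right: assumes "c \<in> low_in (r * m)" "b \<in> carrier B" shows "c \<otimes>\<^bsub>B\<^esub> b \<in> low_in m"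
proof -
  obtain x y where xy: "x \<in> carrier B" "y \<in> J" "c = x \<otimes>\<^bsub>B\<^esub> t [^]\<^bsub>B\<^esub> (r * m) \<oplus>\<^bsub>B\<^esub> y" using low_in_decompose[OF assms(1)] .
  have "c \<otimes>\<^bsub>B\<^esub> b = x \<otimes>\<^bsub>B\<^esub> (t [^]\<^bsub>B\<^esub> (r * m) \<otimes>\<^bsub>B\<^esub> b) \<oplus>\<^bsub>B\<^esub> y \<otimes>\<^bsub>B\<^esub> b"
    using xy(1,3) J_B[OF xy(2)] assms(2) t_pow_closed[of "r * m"] by (simp add: B.l_distr B.m_assoc)
  then show ?thesis
    using low_in_add[OF low_in_left[OF xy(1) t_pow_times_low_in[OF assms(2)]] J_low_in[OF J_right[OF xy(2) assms(2)]]] by simp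
qed

text \<open>The inverse is the geometric series in \<open>u = c t\<^sup>r\<close>. It converges modulo \<open>J\<close>, since left
  multiplication by \<open>t\<^sup>r\<close> raises the order in \<open>t\<close>.\<close>

lemma one_minus_left_invertible:
  assumes c: "c \<in> carrier B"
  defines "u \<equiv> c \<otimes>\<^bsub>B\<^esub> t [^]\<^bsub>B\<^esub> r"
  shows "\<exists>v \<in> carrier B. v \<otimes>\<^bsub>B\<^esub> (\<one>\<^bsub>B\<^esub> \<ominus>\<^bsub>B\<^esub> u) \<ominus>\<^bsub>B\<^esub> \<one>\<^bsub>B\<^esub> \<in> J"
proof -
  have uB: "u \<in> carrier B" using c t_pow_closed[of r] by (simp add: u_def)
  have u_low: "u [^]\<^bsub>B\<^esub> m \<in> low_in m" for m :: nat
  proof (induction m)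
    case 0 then show ?case using low_in_0 by simp
  next
    case (Suc m)
    have "u [^]\<^bsub>B\<^esub> Suc m = c \<otimes>\<^bsub>B\<^esub> (t [^]\<^bsub>B\<^esub> r \<otimes>\<^bsub>B\<^esub> u [^]\<^bsub>B\<^esub> m)"
      using B.nat_pow_Suc2[OF uB, of m] c t_pow_closed[of r] uB by (simp add: u_def B.m_assoc)
    then show ?case using low_in_left[OF c t_pow_mult_low_in[OF Suc]] by simp
  qed
  let ?s = "partial_sum B (\<lambda>m. u [^]\<^bsub>B\<^esub> m)"
  have sB: "?s m \<in> carrier B" for m by (rule partial_sum_B) (simp add: uB)
  have diff: "?s n \<ominus>\<^bsub>B\<^esub> ?s m \<in> low_in m" if "m \<le> n" for m n
    using that
  proof (induction n rule: dec_induct)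
    case base
    then show ?case using sB[of m] B.diff_eq_zero_iff[of "?s m" "?s m"] J_low_in[OF J_add(1)] by simp
  next
    case (step n)
    have "?s (Suc n) \<ominus>\<^bsub>B\<^esub> ?s m = (?s n \<ominus>\<^bsub>B\<^esub> ?s m) \<oplus>\<^bsub>B\<^esub> u [^]\<^bsub>B\<^esub> n"
      using sB[of n] sB[of m] uB by (simp add: a_minus_def B.a_ac)
    then show ?case using low_in_add[OF step(3) low_in_antimono[OF step(1) u_low]] by simp
  qed
  \<comment> \<open>Modulo \<open>I\<close>, the \<open>k\<close>-th coefficient of the partial sums is constant from the sum of \<open>k + 1\<close>
    terms on.\<close>
  let ?x = "\<lambda>k. coef (?s (Suc k)) k"
  have xs: "?x \<in> seqs" unfolding seqs_def by (intro CollectI allI coef_closed sB)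
  let ?v = "\<phi> ?x"
  have vB: "?v \<in> carrier B" by (rule \<phi>_closed[OF xs])
  have v_low: "?v \<ominus>\<^bsub>B\<^esub> ?s m \<in> low_in m" for m
  proof -
    have "coef (?v \<ominus>\<^bsub>B\<^esub> ?s m) k \<in> I" if k: "k < m" for k
    proof -
      have "coef (?s m \<ominus>\<^bsub>B\<^esub> ?s (Suc k)) k \<in> I" using diff[of "Suc k" m] k by (simp add: low_in_def)
      then have "\<ominus>\<^bsub>A\<^esub> (coef (?s m) k \<ominus>\<^bsub>A\<^esub> coef (?s (Suc k)) k) \<in> I"
        using sB coef_minus submoduleD(5)[OF I_submodule] by (metis regular_module_neg(1))
      moreover have "\<ominus>\<^bsub>A\<^esub> (coef (?s m) k \<ominus>\<^bsub>A\<^esub> coef (?s (Suc k)) k) = coef (?s (Suc k)) k \<ominus>\<^bsub>A\<^esub> coef (?s m) k"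
      proof -
        have "\<ominus>\<^bsub>A\<^esub> (p \<ominus>\<^bsub>A\<^esub> q) = q \<ominus>\<^bsub>A\<^esub> p" if "p \<in> carrier A" "q \<in> carrier A" for p q
          using that by (simp add: a_minus_def A.minus_add A.a_comm)
        then show ?thesis using coef_closed[OF sB] by blast
      qed
      ultimately show ?thesis using coef_minus[OF vB sB] coef_\<phi>[OF xs] by simp
    qed
    then show ?thesis using vB sB by (simp add: low_in_def)
  qed
  have geo: "?s m \<otimes>\<^bsub>B\<^esub> (\<one>\<^bsub>B\<^esub> \<ominus>\<^bsub>B\<^esub> u) \<oplus>\<^bsub>B\<^esub> u [^]\<^bsub>B\<^esub> m = \<one>\<^bsub>B\<^esub>" for m
  proof (induction m)
    case 0 then show ?case using uB by simp
  next
    case (Suc m)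
    have p: "u [^]\<^bsub>B\<^esub> m \<in> carrier B" "?s m \<otimes>\<^bsub>B\<^esub> (\<one>\<^bsub>B\<^esub> \<ominus>\<^bsub>B\<^esub> u) \<in> carrier B" using uB sB[of m] by auto
    have "u [^]\<^bsub>B\<^esub> m \<otimes>\<^bsub>B\<^esub> (\<one>\<^bsub>B\<^esub> \<ominus>\<^bsub>B\<^esub> u) = u [^]\<^bsub>B\<^esub> m \<ominus>\<^bsub>B\<^esub> u [^]\<^bsub>B\<^esub> Suc m"
      using uB p by (simp add: a_minus_def B.r_distr B.r_minus)
    then have "?s (Suc m) \<otimes>\<^bsub>B\<^esub> (\<one>\<^bsub>B\<^esub> \<ominus>\<^bsub>B\<^esub> u) \<oplus>\<^bsub>B\<^esub> u [^]\<^bsub>B\<^esub> Suc m =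
        ?s m \<otimes>\<^bsub>B\<^esub> (\<one>\<^bsub>B\<^esub> \<ominus>\<^bsub>B\<^esub> u) \<oplus>\<^bsub>B\<^esub> (u [^]\<^bsub>B\<^esub> m \<ominus>\<^bsub>B\<^esub> u [^]\<^bsub>B\<^esub> Suc m) \<oplus>\<^bsub>B\<^esub> u [^]\<^bsub>B\<^esub> Suc m"
      using sB[of m] p uB by (simp add: B.l_distr del: B.nat_pow_Suc)
    also have "\<dots> = ?s m \<otimes>\<^bsub>B\<^esub> (\<one>\<^bsub>B\<^esub> \<ominus>\<^bsub>B\<^esub> u) \<oplus>\<^bsub>B\<^esub> u [^]\<^bsub>B\<^esub> m"
      using p uB B.nat_pow_closed[OF uB, of "Suc m"] by (simp add: a_minus_def B.a_assoc B.l_neg del: B.nat_pow_Suc)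
    finally show ?case using Suc by simp
  qed
  let ?w = "?v \<otimes>\<^bsub>B\<^esub> (\<one>\<^bsub>B\<^esub> \<ominus>\<^bsub>B\<^esub> u) \<ominus>\<^bsub>B\<^esub> \<one>\<^bsub>B\<^esub>"
  have wB: "?w \<in> carrier B" using vB uB by simp
  have "?w \<in> low_in m" for m
  proof -
    \<comment> \<open>Right multiplication by \<open>1 - u\<close> may lower the order in \<open>t\<close> by the factor \<open>r\<close>.\<close>
    let ?N = "r * m" and ?o = "\<one>\<^bsub>B\<^esub> \<ominus>\<^bsub>B\<^esub> u"
    have oB: "?o \<in> carrier B" using uB by simp
    have p: "u [^]\<^bsub>B\<^esub> ?N \<in> carrier B" "?s ?N \<otimes>\<^bsub>B\<^esub> ?o \<in> carrier B" "?v \<otimes>\<^bsub>B\<^esub> ?o \<in> carrier B" using uB sB[of ?N] oB vB by auto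
    have "?w = ?v \<otimes>\<^bsub>B\<^esub> ?o \<ominus>\<^bsub>B\<^esub> (?s ?N \<otimes>\<^bsub>B\<^esub> ?o \<oplus>\<^bsub>B\<^esub> u [^]\<^bsub>B\<^esub> ?N)" by (simp only: geo)
    also have "\<dots> = (?v \<otimes>\<^bsub>B\<^esub> ?o \<ominus>\<^bsub>B\<^esub> ?s ?N \<otimes>\<^bsub>B\<^esub> ?o) \<ominus>\<^bsub>B\<^esub> u [^]\<^bsub>B\<^esub> ?N"
      using p by (simp add: a_minus_def B.minus_add B.a_assoc)
    also have "?v \<otimes>\<^bsub>B\<^esub> ?o \<ominus>\<^bsub>B\<^esub> ?s ?N \<otimes>\<^bsub>B\<^esub> ?o = (?v \<ominus>\<^bsub>B\<^esub> ?s ?N) \<otimes>\<^bsub>B\<^esub> ?o"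
      using vB sB[of ?N] oB by (simp add: a_minus_def B.l_distr B.l_minus)
    finally have w: "?w = (?v \<ominus>\<^bsub>B\<^esub> ?s ?N) \<otimes>\<^bsub>B\<^esub> ?o \<ominus>\<^bsub>B\<^esub> u [^]\<^bsub>B\<^esub> ?N" .
    have "m \<le> ?N" using r_pos by simp
    then show ?thesis unfolding w
      by (intro low_in_minus low_in_right[OF v_low oB] low_in_antimono[OF _ u_low])
  qed
  then have "coef ?w k \<in> I" for k by (auto simp: low_in_def dest: spec[of _ "Suc k"])
  then have "?w \<in> J" using wB by (simp add: with_coefs_in_def)
  then show ?thesis using vB by blast
qed

definition distinguished :: "'a set" where
  "distinguished = {s \<in> carrier B. \<exists>n::nat. s \<ominus>\<^bsub>B\<^esub> t [^]\<^bsub>B\<^esub> n \<in> J}"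

lemma J_submodule: "submodule J B (regular_module B)"
  by (rule left_module.submoduleI[OF regular_B_left_module(1)])
    (use J_add J_left in \<open>auto simp: regular_module_simps J_B\<close>)

text \<open>The left ideals \<open>B t\<^sup>n + L + J\<close> form a descending chain with \<open>A / I\<close>-modules as quotients, so
  \<open>t\<^sup>k \<equiv> c t\<^sup>k\<^sup>+\<^sup>r\<close> modulo \<open>L + J\<close> for some \<open>k\<close> and \<open>c\<close>. Hence \<open>(1 - c t\<^sup>r) t\<^sup>k\<close> lies in \<open>L + J\<close>,
  and \<open>1 - c t\<^sup>r\<close> is left invertible modulo \<open>J\<close>.\<close>

theorem cofinite_left_ideal_distinguished:
  assumes L: "submodule L B (regular_module B)" and fg: "fg_mod A (regular_module B) (carrier B) L"
  shows "\<exists>s \<in> L. s \<in> distinguished"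
proof -
  note rB = regular_B_left_module
  let ?L = "{u \<oplus>\<^bsub>regular_module B\<^esub> v | u v. u \<in> L \<and> v \<in> J}"
  have L': "submodule ?L B (regular_module B)" by (rule submodule_sum[OF rB(1) L J_submodule])
  note LD = submoduleD[OF L] and LD' = submoduleD[OF L']
  have LB: "l \<in> carrier B" if "l \<in> L" for l using LD(1) that by (auto simp: regular_module_simps)
  have LB': "l \<in> carrier B" if "l \<in> ?L" for l using LD'(1) that by (auto simp: regular_module_simps)
  have LL: "L \<subseteq> ?L"
  proof
    fix l assume l: "l \<in> L"
    then have "l = l \<oplus>\<^bsub>regular_module B\<^esub> \<zero>\<^bsub>B\<^esub>" using LB by (simp add: regular_module_simps)
    then show "l \<in> ?L" using l J_add(1) by blast
  qed
  have JL: "J \<subseteq> ?L"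
  proof
    fix y assume y: "y \<in> J"
    then have "y = \<zero>\<^bsub>B\<^esub> \<oplus>\<^bsub>regular_module B\<^esub> y" using J_B by (simp add: regular_module_simps)
    then show "y \<in> ?L" using y LD(2) by (auto simp: regular_module_simps)
  qed
  define P where "P n = (\<lambda>x. x \<otimes>\<^bsub>B\<^esub> t [^]\<^bsub>B\<^esub> n) ` carrier B" for n :: nat
  define X where "X n = {u \<oplus>\<^bsub>regular_module B\<^esub> v | u v. u \<in> P n \<and> v \<in> ?L}" for n
  have hP: "(\<lambda>x. x \<otimes>\<^bsub>B\<^esub> t [^]\<^bsub>B\<^esub> n) \<in> left_module_hom B (regular_module B) (regular_module B)" for n :: nat
    by (rule left_module_homI) (use t_closed in \<open>auto simp: regular_module_simps B.l_distr B.m_assoc\<close>)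
  have P: "submodule (P n) B (regular_module B)" for n
    using submodule_image[OF rB(1) rB(1) hP submodule_carrier[OF rB(1)]] by (simp add: P_def regular_module_simps)
  have PB: "p \<in> carrier B" if "p \<in> P n" for p n using submoduleD(1)[OF P] that by (auto simp: regular_module_simps)
  have X: "submodule (X n) A (regular_module B)" for n
    unfolding X_def by (rule restrict_scalars_submodule[OF A_sub submodule_sum[OF rB(1) P L']])
  \<comment> \<open>\<open>B / (L + J)\<close> is a finitely generated module over \<open>A / I\<close>.\<close>
  have "\<exists>k. \<forall>n\<ge>k. X n = X k"
  proof (rule descending_chain_fg_mod[OF rB(2) _ dcc])
    show "I \<subseteq> carrier A" using I_A by blast
    show "fg_mod A (regular_module B) (carrier (regular_module B)) ?L"
      using fg_mod_mono[OF fg LL] by (simp add: regular_module_simps)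
    show "c \<odot>\<^bsub>regular_module B\<^esub> x \<in> ?L" if c: "c \<in> I" and x: "x \<in> carrier (regular_module B)" for c x
    proof -
      have "c \<otimes>\<^bsub>B\<^esub> x \<in> J"
        using c x coef_closed[of x] I_A[OF c] A_B
        by (auto simp: with_coefs_in_def regular_module_simps coef_smult Id.I_r_closed)
      then show ?thesis using JL by (auto simp: regular_module_simps(4))
    qed
    show "submodule (X n) A (regular_module B)" for n by (rule X)
    show "X (Suc n) \<subseteq> X n" for n
    proof -
      have "P (Suc n) \<subseteq> P n"
      proof
        fix p assume "p \<in> P (Suc n)"
        then obtain x where x: "x \<in> carrier B" "p = x \<otimes>\<^bsub>B\<^esub> t [^]\<^bsub>B\<^esub> Suc n" by (auto simp: P_def)
        then have "p = (x \<otimes>\<^bsub>B\<^esub> t) \<otimes>\<^bsub>B\<^esub> t [^]\<^bsub>B\<^esub> n"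
          using t_closed B.nat_pow_Suc2[OF t_closed, of n] by (simp add: B.m_assoc del: B.nat_pow_Suc)
        then show "p \<in> P n" unfolding P_def by (rule image_eqI) (use x t_closed in simp)
      qed
      then show ?thesis unfolding X_def by blast
    qed
    show "?L \<subseteq> X n" for n
    proof
      fix l assume l: "l \<in> ?L"
      then have "l = \<zero>\<^bsub>regular_module B\<^esub> \<oplus>\<^bsub>regular_module B\<^esub> l" using LB'[OF l] by (simp add: regular_module_simps)
      then show "l \<in> X n" unfolding X_def using l submoduleD(2)[OF P[of n]] by blast
    qed
  qed
  then obtain k where k: "X (k + r) = X k" by (meson le_add1)
  have XI: "u \<oplus>\<^bsub>regular_module B\<^esub> v \<in> X k" if "u \<in> P k" "v \<in> ?L" for u v
    unfolding X_def by (rule CollectI, rule exI, rule exI, rule conjI[OF refl conjI[OF that]])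
  have "\<one>\<^bsub>B\<^esub> \<otimes>\<^bsub>B\<^esub> t [^]\<^bsub>B\<^esub> k \<in> P k" unfolding P_def by (rule imageI) simp
  from XI[OF this LD'(2)] have "t [^]\<^bsub>B\<^esub> k \<in> X (k + r)"
    unfolding k using t_pow_closed[of k] by (simp add: regular_module_simps)
  then obtain c l where c: "c \<in> carrier B" "l \<in> ?L" "t [^]\<^bsub>B\<^esub> k = c \<otimes>\<^bsub>B\<^esub> t [^]\<^bsub>B\<^esub> (k + r) \<oplus>\<^bsub>B\<^esub> l"
    unfolding X_def P_def by (auto simp: regular_module_simps(3))
  let ?u = "c \<otimes>\<^bsub>B\<^esub> t [^]\<^bsub>B\<^esub> r"
  have uB: "?u \<in> carrier B" using c(1) t_pow_closed[of r] by simp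
  note lB = LB'[OF c(2)]
  have "c \<otimes>\<^bsub>B\<^esub> t [^]\<^bsub>B\<^esub> (k + r) = ?u \<otimes>\<^bsub>B\<^esub> t [^]\<^bsub>B\<^esub> k"
    using c(1) B.nat_pow_mult[OF t_closed, of r k] t_closed by (simp add: B.m_assoc add.commute)
  then have tk: "t [^]\<^bsub>B\<^esub> k = ?u \<otimes>\<^bsub>B\<^esub> t [^]\<^bsub>B\<^esub> k \<oplus>\<^bsub>B\<^esub> l" using c(3) by simp
  have "(\<one>\<^bsub>B\<^esub> \<ominus>\<^bsub>B\<^esub> ?u) \<otimes>\<^bsub>B\<^esub> t [^]\<^bsub>B\<^esub> k = t [^]\<^bsub>B\<^esub> k \<ominus>\<^bsub>B\<^esub> ?u \<otimes>\<^bsub>B\<^esub> t [^]\<^bsub>B\<^esub> k"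
    using uB t_pow_closed[of k] by (simp add: a_minus_def B.l_distr B.l_minus)
  also have "\<dots> = (?u \<otimes>\<^bsub>B\<^esub> t [^]\<^bsub>B\<^esub> k \<oplus>\<^bsub>B\<^esub> l) \<ominus>\<^bsub>B\<^esub> ?u \<otimes>\<^bsub>B\<^esub> t [^]\<^bsub>B\<^esub> k" by (simp only: tk[symmetric])
  also have "\<dots> = l"
  proof -
    have "(p \<oplus>\<^bsub>B\<^esub> q) \<ominus>\<^bsub>B\<^esub> p = q" if "p \<in> carrier B" "q \<in> carrier B" for p q
      using that by (simp add: a_minus_def B.a_comm[of p q] B.a_assoc B.r_neg)
    then show ?thesis using uB t_pow_closed[of k] lB by simp
  qed
  finally have l: "(\<one>\<^bsub>B\<^esub> \<ominus>\<^bsub>B\<^esub> ?u) \<otimes>\<^bsub>B\<^esub> t [^]\<^bsub>B\<^esub> k = l" .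
  obtain v where v: "v \<in> carrier B" "v \<otimes>\<^bsub>B\<^esub> (\<one>\<^bsub>B\<^esub> \<ominus>\<^bsub>B\<^esub> ?u) \<ominus>\<^bsub>B\<^esub> \<one>\<^bsub>B\<^esub> \<in> J"
    using one_minus_left_invertible[OF c(1)] by blast
  let ?w = "v \<otimes>\<^bsub>B\<^esub> (\<one>\<^bsub>B\<^esub> \<ominus>\<^bsub>B\<^esub> ?u) \<ominus>\<^bsub>B\<^esub> \<one>\<^bsub>B\<^esub>"
  have oB: "\<one>\<^bsub>B\<^esub> \<ominus>\<^bsub>B\<^esub> ?u \<in> carrier B" "v \<otimes>\<^bsub>B\<^esub> (\<one>\<^bsub>B\<^esub> \<ominus>\<^bsub>B\<^esub> ?u) \<in> carrier B" using uB v(1) by auto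
  have "v \<otimes>\<^bsub>B\<^esub> l = (v \<otimes>\<^bsub>B\<^esub> (\<one>\<^bsub>B\<^esub> \<ominus>\<^bsub>B\<^esub> ?u)) \<otimes>\<^bsub>B\<^esub> t [^]\<^bsub>B\<^esub> k"
    unfolding l[symmetric] using v(1) oB(1) t_pow_closed[of k] by (simp add: B.m_assoc)
  also have "\<dots> = (\<one>\<^bsub>B\<^esub> \<oplus>\<^bsub>B\<^esub> ?w) \<otimes>\<^bsub>B\<^esub> t [^]\<^bsub>B\<^esub> k" by (simp only: B.add_diff_cancel[OF oB(2) B.one_closed])
  also have "\<dots> = t [^]\<^bsub>B\<^esub> k \<oplus>\<^bsub>B\<^esub> ?w \<otimes>\<^bsub>B\<^esub> t [^]\<^bsub>B\<^esub> k"
    using J_B[OF v(2)] t_pow_closed[of k] B.l_distr[OF B.one_closed J_B[OF v(2)] t_pow_closed[of k]] by simp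
  finally have vl: "v \<otimes>\<^bsub>B\<^esub> l = t [^]\<^bsub>B\<^esub> k \<oplus>\<^bsub>B\<^esub> ?w \<otimes>\<^bsub>B\<^esub> t [^]\<^bsub>B\<^esub> k" .
  have "v \<otimes>\<^bsub>B\<^esub> l \<in> ?L" using LD'(4)[OF v(1) c(2)] by (simp only: regular_module_simps(4))
  then obtain s y where s: "s \<in> L" "y \<in> J" "v \<otimes>\<^bsub>B\<^esub> l = s \<oplus>\<^bsub>B\<^esub> y" by (auto simp: regular_module_simps(3))
  let ?z = "?w \<otimes>\<^bsub>B\<^esub> t [^]\<^bsub>B\<^esub> k"
  have zJ: "?z \<in> J" by (rule J_right[OF v(2) t_pow_closed])
  have "s \<ominus>\<^bsub>B\<^esub> t [^]\<^bsub>B\<^esub> k = ?z \<ominus>\<^bsub>B\<^esub> y"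
  proof -
    have "s \<oplus>\<^bsub>B\<^esub> y = t [^]\<^bsub>B\<^esub> k \<oplus>\<^bsub>B\<^esub> ?z" using s(3) vl by simp
    moreover have "p \<ominus>\<^bsub>B\<^esub> m = n \<ominus>\<^bsub>B\<^esub> q"
      if "p \<oplus>\<^bsub>B\<^esub> q = m \<oplus>\<^bsub>B\<^esub> n" "p \<in> carrier B" "q \<in> carrier B" "m \<in> carrier B" "n \<in> carrier B" for p q m n
    proof -
      have "p = (m \<oplus>\<^bsub>B\<^esub> n) \<ominus>\<^bsub>B\<^esub> q" using that B.add.inv_solve_right[of p "m \<oplus>\<^bsub>B\<^esub> n" q] by (simp add: a_minus_def)
      then have "p \<ominus>\<^bsub>B\<^esub> m = (m \<oplus>\<^bsub>B\<^esub> (\<ominus>\<^bsub>B\<^esub> m)) \<oplus>\<^bsub>B\<^esub> (n \<ominus>\<^bsub>B\<^esub> q)"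
        using that(3-5) by (simp add: a_minus_def B.a_ac del: B.r_neg)
      then show ?thesis using that(3-5) by (simp add: B.r_neg)
    qed
    ultimately show ?thesis using LB[OF s(1)] J_B[OF s(2)] J_B[OF zJ] t_pow_closed[of k] by blast
  qed
  then have "s \<ominus>\<^bsub>B\<^esub> t [^]\<^bsub>B\<^esub> k \<in> J" using J_add(3)[OF zJ s(2)] by simp
  then show ?thesis using s(1) LB[OF s(1)] unfolding distinguished_def by blast
qed

lemma distinguished_mult:
  assumes "s \<in> distinguished" "s' \<in> distinguished"
  shows "s \<otimes>\<^bsub>B\<^esub> s' \<in> distinguished"
proof -
  obtain m n :: nat where s: "s \<in> carrier B" "s \<ominus>\<^bsub>B\<^esub> t [^]\<^bsub>B\<^esub> m \<in> J" "s' \<in> carrier B" "s' \<ominus>\<^bsub>B\<^esub> t [^]\<^bsub>B\<^esub> n \<in> J"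
    using assms by (auto simp: distinguished_def)
  let ?j = "s \<ominus>\<^bsub>B\<^esub> t [^]\<^bsub>B\<^esub> m" and ?j' = "s' \<ominus>\<^bsub>B\<^esub> t [^]\<^bsub>B\<^esub> n"
  note c = s(1,3) t_pow_closed[of m] t_pow_closed[of n]
  have tmn: "t [^]\<^bsub>B\<^esub> (m + n) = t [^]\<^bsub>B\<^esub> m \<otimes>\<^bsub>B\<^esub> t [^]\<^bsub>B\<^esub> n" by (rule B.nat_pow_mult[OF t_closed, symmetric])
  have "s \<otimes>\<^bsub>B\<^esub> s' \<ominus>\<^bsub>B\<^esub> t [^]\<^bsub>B\<^esub> (m + n) = (s \<otimes>\<^bsub>B\<^esub> s' \<ominus>\<^bsub>B\<^esub> s \<otimes>\<^bsub>B\<^esub> t [^]\<^bsub>B\<^esub> n) \<oplus>\<^bsub>B\<^esub> (s \<otimes>\<^bsub>B\<^esub> t [^]\<^bsub>B\<^esub> n \<ominus>\<^bsub>B\<^esub> t [^]\<^bsub>B\<^esub> m \<otimes>\<^bsub>B\<^esub> t [^]\<^bsub>B\<^esub> n)"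
    unfolding tmn using c by (simp add: a_minus_def B.a_assoc B.r_neg1)
  also have "\<dots> = s \<otimes>\<^bsub>B\<^esub> ?j' \<oplus>\<^bsub>B\<^esub> ?j \<otimes>\<^bsub>B\<^esub> t [^]\<^bsub>B\<^esub> n"
    using c by (simp add: a_minus_def B.l_distr B.r_distr B.l_minus B.r_minus)
  finally have "s \<otimes>\<^bsub>B\<^esub> s' \<ominus>\<^bsub>B\<^esub> t [^]\<^bsub>B\<^esub> (m + n) \<in> J"
    using J_add(2)[OF J_left[OF s(1,4)] J_right[OF s(2) t_pow_closed[of n]]] by simp
  then show ?thesis using s(1,3) by (auto simp: distinguished_def)
qed

end

section \<open>Modules over the skew power series ring that are finitely generated over \<open>A\<close>\<close>

lemma fg_mod_self:
  assumes "left_module R M" "submodule X R M"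
  shows "fg_mod R M X X"
proof -
  interpret M: left_module R M by fact
  have "(\<lambda>_. \<zero>\<^bsub>M\<^esub>) \<in> left_module_hom R (free_module R 0) M"
    by (rule left_module_homI) (auto simp: M.smult_zero_right)
  then show ?thesis
  proof (rule fg_modI)
    show "\<zero>\<^bsub>M\<^esub> \<in> X" by (rule submoduleD(2)[OF assms(2)])
    fix y assume y: "y \<in> X"
    then have "y = \<zero>\<^bsub>M\<^esub> \<oplus>\<^bsub>M\<^esub> y" using submoduleD(1)[OF assms(2)] by auto
    then show "\<exists>x\<in>carrier (free_module R 0). \<exists>z\<in>X. y = \<zero>\<^bsub>M\<^esub> \<oplus>\<^bsub>M\<^esub> z"
      using y left_module.axioms(2)[OF free_left_module[OF M.R.ring_axioms, of 0]]
      by (metis abelian_group.axioms(1) abelian_monoid.zero_closed)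
  qed
qed

lemma pseudo_coherent_iso_bij:
  assumes h: "h \<in> left_module_hom R M N" and bij: "bij_betw h (carrier M) (carrier N)"
    and mods: "left_module R M" "left_module R N" and pc: "pseudo_coherent R m N"
  shows "pseudo_coherent R m M"
proof -
  interpret M: left_module R M by (rule mods)
  let ?g = "inv_into (carrier M) h"
  have inj: "inj_on h (carrier M)" and im: "h ` carrier M = carrier N" using bij by (auto simp: bij_betw_def)
  have gM: "?g y \<in> carrier M" and hg: "h (?g y) = y" if "y \<in> carrier N" for y
    using inv_into_into[of y h "carrier M"] f_inv_into_f[of y h "carrier M"] that im by auto
  have gh: "?g (h x) = x" if "x \<in> carrier M" for x using inv_into_f_f[OF inj that] .
  have "?g \<in> left_module_hom R N M"
  proof (rule left_module_homI)
    fix x y assume xy: "x \<in> carrier N" "y \<in> carrier N"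
    have "?g (x \<oplus>\<^bsub>N\<^esub> y) = ?g (h (?g x \<oplus>\<^bsub>M\<^esub> ?g y))" using xy gM hg by (simp add: hom_add[OF h])
    then show "?g (x \<oplus>\<^bsub>N\<^esub> y) = ?g x \<oplus>\<^bsub>M\<^esub> ?g y" using gh gM xy by simp
  next
    fix a x assume ax: "a \<in> carrier R" "x \<in> carrier N"
    have "?g (a \<odot>\<^bsub>N\<^esub> x) = ?g (h (a \<odot>\<^bsub>M\<^esub> ?g x))" using ax gM hg by (simp add: hom_smult[OF h])
    then show "?g (a \<odot>\<^bsub>N\<^esub> x) = a \<odot>\<^bsub>M\<^esub> ?g x" using gh gM ax by (simp add: M.smult_closed)
  qed (rule gM)
  then show ?thesis using pseudo_coherent_iso[OF _ h hg gh mods(2,1) pc] by blast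
qed

lemma retract_of_free_zero:
  assumes M: "left_module R M" and "carrier M = {\<zero>\<^bsub>M\<^esub>}"
  shows "retract_of_free R M"
proof -
  interpret M: left_module R M by fact
  have 1: "(\<lambda>_. \<zero>\<^bsub>free_module R 0\<^esub>) \<in> left_module_hom R M (free_module R 0)"
    by (rule left_module_homI) (auto simp: free_module_simps)
  have 2: "(\<lambda>_. \<zero>\<^bsub>M\<^esub>) \<in> left_module_hom R (free_module R 0) M"
    by (rule left_module_homI) (auto simp: M.smult_zero_right)
  show ?thesis
    unfolding retract_of_free_def by (intro exI[of _ 0] bexI[OF _ 1] bexI[OF _ 2]) (use assms(2) in auto)
qed

lemma retract_of_free_regular:
  assumes "ring R"
  shows "retract_of_free R (regular_module R)"
proof -
  interpret R: ring R by fact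
  have 1: "(\<lambda>x i. if i = 0 then x else \<zero>\<^bsub>R\<^esub>) \<in> left_module_hom R (regular_module R) (free_module R 1)"
    by (rule left_module_homI) (auto simp: free_module_simps regular_module_simps fun_eq_iff)
  have 2: "(\<lambda>x. x 0) \<in> left_module_hom R (free_module R 1) (regular_module R)"
    by (rule left_module_homI) (auto simp: free_module_simps regular_module_simps)
  show ?thesis
    unfolding retract_of_free_def by (intro exI[of _ 1] bexI[OF _ 1] bexI[OF _ 2]) auto
qed

locale skew_series_noetherian = skew_series_ideal +
  assumes noeth_left: "noetherian_module A (regular_module A)"
    and noeth_right: "noetherian_module (opposite_ring A) (regular_module (opposite_ring A))"
begin

lemmas restrict = restrict_scalars[OF ring_A A_sub incl]

lemma restrict_hom: "h \<in> left_module_hom B M N \<Longrightarrow> h \<in> left_module_hom A M N"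
  using restrict_scalars_hom[OF A_sub] by blast

lemmas restrict_submodule = restrict_scalars_submodule[OF A_sub]

text \<open>As an \<open>A\<close>-module, \<open>B\<^sup>k\<close> is a product of copies of \<open>A\<close>, indexed by the pairs of an exponent and
  a coordinate.\<close>

lemma flat_over_A:
  assumes M: "left_module B M" and ret: "retract_of_free B M"
  shows "flat_module A M"
proof -
  obtain k i q where iq: "i \<in> left_module_hom B M (free_module B k)" "q \<in> left_module_hom B (free_module B k) M"
    "\<And>x. x \<in> carrier M \<Longrightarrow> q (i x) = x" using ret by (auto simp: retract_of_free_def)
  let ?P = "product_module (UNIV :: (nat \<times> nat) set) (\<lambda>_. regular_module A)"
  let ?l = "\<lambda>m p. coef (i m (snd p)) (fst p)"
  let ?r = "\<lambda>z j. if j < k then \<phi> (\<lambda>n. z (n, j)) else \<zero>\<^bsub>B\<^esub>"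
  have iB: "i m j \<in> carrier B" if "m \<in> carrier M" for m j
    using hom_closed[OF iq(1) that] by (simp add: free_module_simps)
  have col: "(\<lambda>n. z (n, j)) \<in> seqs" if "z \<in> carrier ?P" for z j
    using that by (auto simp: product_module_simps regular_module_simps seqs_def)
  have l: "?l \<in> left_module_hom A M ?P"
    by (rule left_module_homI)
      (auto simp: product_module_simps regular_module_simps coef_closed iB hom_add[OF iq(1)] hom_smult[OF iq(1)] A_B
        free_module_simps coef_add coef_smult restrict_def)
  have r: "?r \<in> left_module_hom A ?P (free_module B k)"
  proof (rule left_module_homI)
    fix z assume z: "z \<in> carrier ?P"
    show "?r z \<in> carrier (free_module B k)" using \<phi>_closed[OF col[OF z]] by (simp add: free_module_simps)
    fix w assume w: "w \<in> carrier ?P"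
    show "?r (z \<oplus>\<^bsub>?P\<^esub> w) = ?r z \<oplus>\<^bsub>free_module B k\<^esub> ?r w"
      using \<phi>_add[OF col[OF z] col[OF w]]
      by (auto simp: product_module_simps(3) regular_module_simps free_module_simps fun_eq_iff)
  next
    fix a z assume "a \<in> carrier A" and z: "z \<in> carrier ?P"
    then show "?r (a \<odot>\<^bsub>?P\<^esub> z) = a \<odot>\<^bsub>free_module B k\<^esub> ?r z"
      using \<phi>_smult[OF _ col[OF z]] A_B
      by (auto simp: product_module_simps(4) regular_module_simps free_module_simps fun_eq_iff)
  qed
  have rl: "?r (?l m) = i m" if m: "m \<in> carrier M" for m
    using \<phi>_coef[OF iB[OF m]] hom_closed[OF iq(1) m] by (auto simp: fun_eq_iff free_module_simps)
  show ?thesis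
    by (rule flat_retract_of_product[OF restrict[OF M] noeth_right l hom_compose[OF r restrict_hom[OF iq(2)]]])
      (simp add: rl iq(3))
qed

text \<open>The map \<open>b \<mapsto> b z\<close> embeds the quotient of \<open>B\<close> by \<open>{b. b z \<in> X}\<close> into \<open>Y / X\<close>, so this left
  ideal contains a distinguished element.\<close>

lemma torsion_of_fg:
  assumes M: "left_module B M" and X: "submodule X B M" and fg: "fg_mod A M Y X"
    and z: "z \<in> carrier M" and Y: "\<And>b. b \<in> carrier B \<Longrightarrow> b \<odot>\<^bsub>M\<^esub> z \<in> Y"
  shows "\<exists>s \<in> distinguished. s \<odot>\<^bsub>M\<^esub> z \<in> X"
proof -
  interpret M: left_module B M by (rule M)
  note rB = regular_B_left_module
  have h: "(\<lambda>b. b \<odot>\<^bsub>M\<^esub> z) \<in> left_module_hom B (regular_module B) M"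
    by (rule left_module_homI) (use z in \<open>auto simp: regular_module_simps M.smult_closed M.smult_l_distr M.smult_assoc1\<close>)
  let ?L = "{b \<in> carrier (regular_module B). b \<odot>\<^bsub>M\<^esub> z \<in> X}"
  have L: "submodule ?L B (regular_module B)" by (rule submodule_preimage[OF rB(1) M h X])
  have "fg_mod A (regular_module B) (carrier (regular_module B)) ?L"
    by (rule fg_mod_embed[OF noeth_left rB(2) restrict[OF M] restrict_hom[OF h] submodule_carrier[OF rB(2)]
          restrict_submodule[OF X] fg]) (use Y in \<open>auto simp: regular_module_simps\<close>)
  then have "\<exists>s \<in> ?L. s \<in> distinguished"
    by (intro cofinite_left_ideal_distinguished[OF L]) (simp add: regular_module_simps)
  then show ?thesis by auto
qed

subsection \<open>The set \<open>S\<close>\<close>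

abbreviation S :: "'a set" where "S \<equiv> perfect_mult_set A B"
abbreviation annihilated :: "'a \<Rightarrow> 'a set" where "annihilated b \<equiv> {x \<in> carrier B. x \<otimes>\<^bsub>B\<^esub> b = \<zero>\<^bsub>B\<^esub>}"
abbreviation multiples :: "'a \<Rightarrow> 'a set" where "multiples b \<equiv> (\<lambda>x. x \<otimes>\<^bsub>B\<^esub> b) ` carrier B"

lemma right_mult_hom: "b \<in> carrier B \<Longrightarrow> (\<lambda>x. x \<otimes>\<^bsub>B\<^esub> b) \<in> left_module_hom B (regular_module B) (regular_module B)"
  by (rule left_module_homI) (auto simp: regular_module_simps B.l_distr B.m_assoc)

lemma annihilated_submodule: "b \<in> carrier B \<Longrightarrow> submodule (annihilated b) B (regular_module B)"
  using submodule_kernel[OF regular_B_left_module(1) regular_B_left_module(1) right_mult_hom] by (simp add: regular_module_simps)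

lemma multiples_submodule: "b \<in> carrier B \<Longrightarrow> submodule (multiples b) B (regular_module B)"
  using submodule_image[OF regular_B_left_module(1) regular_B_left_module(1) right_mult_hom submodule_carrier[OF regular_B_left_module(1)]]
  by (simp add: regular_module_simps)

text \<open>The terms of the complex are flat over \<open>A\<close>, so perfectness is a matter of its two cohomology
  modules.\<close>

lemma mem_S_iff:
  assumes b: "b \<in> carrier B"
  shows "b \<in> S \<longleftrightarrow> fg_mod A (regular_module B) (annihilated b) {\<zero>\<^bsub>B\<^esub>} \<and>
    fg_mod A (regular_module B) (carrier B) (multiples b)"
proof -
  let ?C = "right_mult_complex B b"
  note rB = regular_B_left_module
  let ?Z = "(regular_module B)\<lparr>carrier := {\<zero>\<^bsub>B\<^esub>}\<rparr>"
  have sz: "submodule {\<zero>\<^bsub>B\<^esub>} A (regular_module B)" using submodule_zero[OF rB(2)] by (simp add: regular_module_simps)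
  have Z: "left_module A ?Z" by (rule submodule_left_module[OF rB(2) sz])
  have ob: "obj ?C n = (if n = 0 \<or> n = 1 then regular_module B else ?Z)" for n by (simp add: right_mult_complex_def)
  have df: "diff ?C n x = (if n = 0 then x \<otimes>\<^bsub>B\<^esub> b else \<zero>\<^bsub>B\<^esub>)" for n x by (simp add: right_mult_complex_def)
  have ob_zero: "\<zero>\<^bsub>obj ?C n\<^esub> = \<zero>\<^bsub>B\<^esub>" for n by (simp add: ob regular_module_simps)
  interpret rm: left_module A "regular_module B" by (rule rB(2))
  have mods: "left_module A (obj ?C n)" for n using rB(2) Z by (simp add: ob)
  have zero_hom: "(\<lambda>_. \<zero>\<^bsub>B\<^esub>) \<in> left_module_hom A (obj ?C n) (obj ?C m)" for n m
    by (rule left_module_homI) (use A_B in \<open>auto simp: ob regular_module_simps\<close>)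
  have C: "cochain_complex A ?C"
    unfolding cochain_complex_def
  proof (intro conjI allI ballI mods)
    fix n
    show "diff ?C n \<in> left_module_hom A (obj ?C n) (obj ?C (n + 1))"
    proof (cases "n = 0")
      case True
      then show ?thesis using restrict_hom[OF right_mult_hom[OF b]] by (simp add: right_mult_complex_def)
    next
      case False
      then show ?thesis using zero_hom[of n "n + 1"] by (simp add: right_mult_complex_def)
    qed
    fix x assume "x \<in> carrier (obj ?C n)"
    then show "diff ?C (n + 1) (diff ?C n x) = \<zero>\<^bsub>obj ?C (n + 1 + 1)\<^esub>"
      using b by (cases "n + 1 = 0") (auto simp: df ob_zero)
  qed
  have coh: "cocycles ?C 0 = annihilated b" "coboundaries ?C 0 = {\<zero>\<^bsub>B\<^esub>}"
    "cocycles ?C 1 = carrier B" "coboundaries ?C 1 = multiples b"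
    by (auto simp: cocycles_def coboundaries_def ob df ob_zero regular_module_simps)
  have coh': "cocycles ?C n = {\<zero>\<^bsub>B\<^esub>}" "coboundaries ?C n = {\<zero>\<^bsub>B\<^esub>}" if "n \<noteq> 0" "n \<noteq> 1" for n
    using that B.zero_closed by (auto simp: cocycles_def coboundaries_def ob df ob_zero regular_module_simps)
  show ?thesis
  proof
    assume "b \<in> S"
    then have "perfect A ?C" by (simp add: perfect_mult_set_def)
    from perfect_cohomology_fg[OF noeth_left this, of 0] perfect_cohomology_fg[OF noeth_left this, of 1]
    show "fg_mod A (regular_module B) (annihilated b) {\<zero>\<^bsub>B\<^esub>} \<and> fg_mod A (regular_module B) (carrier B) (multiples b)"
      unfolding coh by (simp add: ob)
  next
    assume fg: "fg_mod A (regular_module B) (annihilated b) {\<zero>\<^bsub>B\<^esub>} \<and> fg_mod A (regular_module B) (carrier B) (multiples b)"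
    have "perfect A ?C"
    proof (rule perfectI[OF ring_A noeth_left C, where a = 0 and b = 1])
      fix n
      have "flat_module A (regular_module B)" by (rule flat_over_A[OF rB(1) retract_of_free_regular[OF ring_B]])
      moreover have "flat_module A ?Z" by (rule flat_zero[OF Z]) (simp add: regular_module_simps)
      ultimately show "flat_module A (obj ?C n)" by (simp add: ob)
      consider "n = 0" | "n = 1" | "n \<noteq> 0" "n \<noteq> 1" by blast
      then show "fg_mod A (obj ?C n) (cocycles ?C n) (coboundaries ?C n)"
      proof cases
        case 1 then show ?thesis using fg coh by (simp add: ob)
      next
        case 2 then show ?thesis using fg coh by (simp add: ob)
      next
        case 3
        have "submodule {\<zero>\<^bsub>B\<^esub>} A (obj ?C n)" using submodule_zero[OF mods[of n]] by (simp add: ob_zero)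
        then show ?thesis using fg_mod_self[OF mods[of n]] coh'[OF 3] by simp
      qed
      show "carrier (obj ?C n) = {\<zero>\<^bsub>obj ?C n\<^esub>}" if "n < 0 \<or> 1 < n" using that by (auto simp: ob regular_module_simps)
    qed
    then show "b \<in> S" using b by (simp add: perfect_mult_set_def)
  qed
qed

lemma S_B: "s \<in> S \<Longrightarrow> s \<in> carrier B" by (simp add: perfect_mult_set_def)

lemma distinguished_S: assumes "s \<in> distinguished" shows "s \<in> S"
proof -
  obtain n :: nat where s: "s \<in> carrier B" "s \<ominus>\<^bsub>B\<^esub> t [^]\<^bsub>B\<^esub> n \<in> J" using assms by (auto simp: distinguished_def)
  have "annihilated s = {\<zero>\<^bsub>B\<^esub>}" using weierstrass_injective[OF s] s(1) by auto
  moreover have "fg_mod A (regular_module B) {\<zero>\<^bsub>B\<^esub>} {\<zero>\<^bsub>B\<^esub>}"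
    using fg_mod_self[OF regular_B_left_module(2) submodule_zero[OF regular_B_left_module(2)]] by (simp add: regular_module_simps)
  ultimately show ?thesis using mem_S_iff[OF s(1)] weierstrass_quotient_fg[OF s] by simp
qed

text \<open>The annihilator of \<open>s s'\<close> modulo that of \<open>s\<close> embeds into the annihilator of \<open>s'\<close>, and
  \<open>B s' / B s s'\<close> is a quotient of \<open>B / B s\<close>.\<close>

lemma S_mult: assumes s: "s \<in> S" "s' \<in> S" shows "s \<otimes>\<^bsub>B\<^esub> s' \<in> S"
proof -
  have c: "s \<in> carrier B" "s' \<in> carrier B" "s \<otimes>\<^bsub>B\<^esub> s' \<in> carrier B" using s S_B by auto
  note rB = regular_B_left_module
  note f = s(1)[unfolded mem_S_iff[OF c(1)]] s(2)[unfolded mem_S_iff[OF c(2)]]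
  let ?N = "annihilated (s \<otimes>\<^bsub>B\<^esub> s')"
  note N = restrict_submodule[OF annihilated_submodule[OF c(3)]]
  have sz: "submodule {\<zero>\<^bsub>B\<^esub>} A (regular_module B)" using submodule_zero[OF rB(2)] by (simp add: regular_module_simps)
  have "fg_mod A (regular_module B) ?N {y \<in> ?N. y \<otimes>\<^bsub>B\<^esub> s \<in> {\<zero>\<^bsub>B\<^esub>}}"
    by (rule fg_mod_embed[OF noeth_left rB(2) rB(2) restrict_hom[OF right_mult_hom[OF c(1)]] N sz conjunct1[OF f(2)]])
      (use c in \<open>auto simp: B.m_assoc\<close>)
  moreover have eq: "{y \<in> ?N. y \<otimes>\<^bsub>B\<^esub> s \<in> {\<zero>\<^bsub>B\<^esub>}} = annihilated s"
    using c by (auto simp flip: B.m_assoc)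
  ultimately have 1: "fg_mod A (regular_module B) ?N (annihilated s)" by simp
  have "annihilated s \<subseteq> ?N" using eq by blast
  then have k: "fg_mod A (regular_module B) ?N {\<zero>\<^bsub>B\<^esub>}"
    by (rule fg_mod_trans[OF rB(2) N _ _ 1 conjunct1[OF f(1)]]) (simp add: regular_module_simps)
  have "fg_mod A (regular_module B) (multiples s') ((\<lambda>x. x \<otimes>\<^bsub>B\<^esub> s') ` multiples s)"
    by (rule fg_mod_image[OF restrict_hom[OF right_mult_hom[OF c(2)]] conjunct2[OF f(1)]])
      (use c in \<open>auto simp: regular_module_simps\<close>)
  moreover have "(\<lambda>x. x \<otimes>\<^bsub>B\<^esub> s') ` multiples s = multiples (s \<otimes>\<^bsub>B\<^esub> s')"
    unfolding image_image by (rule image_cong) (use c in \<open>auto simp: B.m_assoc\<close>)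
  ultimately have 2: "fg_mod A (regular_module B) (multiples s') (multiples (s \<otimes>\<^bsub>B\<^esub> s'))" by simp
  have "fg_mod A (regular_module B) (carrier B) (multiples (s \<otimes>\<^bsub>B\<^esub> s'))"
    by (rule fg_mod_trans[OF rB(2) _ _ _ conjunct2[OF f(2)] 2])
      (use c submodule_carrier[OF rB(2)] in \<open>auto simp: regular_module_simps\<close>)
  then show ?thesis using k mem_S_iff[OF c(3)] by simp
qed

text \<open>The Ore condition says that \<open>B / B s\<close> is torsion, and the annihilator condition that the
  annihilator of \<open>s\<close> is torsion. Both modules are finitely generated over \<open>A\<close>.\<close>

theorem S_left_denominator_set: "left_denominator_set B S"
  unfolding left_denominator_set_def
proof (intro conjI ballI impI subsetI)
  note rB = regular_B_left_module
  show "x \<in> carrier B" if "x \<in> S" for x by (rule S_B[OF that])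
  have "\<one>\<^bsub>B\<^esub> \<ominus>\<^bsub>B\<^esub> t [^]\<^bsub>B\<^esub> (0::nat) = \<zero>\<^bsub>B\<^esub>" by (simp add: a_minus_def B.r_neg)
  then have "\<one>\<^bsub>B\<^esub> \<in> distinguished" unfolding distinguished_def using J_add(1) by (metis (mono_tags, lifting) B.one_closed mem_Collect_eq)
  then show "\<one>\<^bsub>B\<^esub> \<in> S" by (rule distinguished_S)
  show "s \<otimes>\<^bsub>B\<^esub> s' \<in> S" if "s \<in> S" "s' \<in> S" for s s' by (rule S_mult[OF that])
  fix s b assume s: "s \<in> S" and b: "b \<in> carrier B"
  note f = s[unfolded mem_S_iff[OF S_B[OF s]]]
  have "\<exists>s'\<in>distinguished. s' \<odot>\<^bsub>regular_module B\<^esub> b \<in> multiples s"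
    by (rule torsion_of_fg[OF rB(1) multiples_submodule[OF S_B[OF s]] conjunct2[OF f]]) (use b in \<open>auto simp: regular_module_simps\<close>)
  then obtain s' x where "s' \<in> distinguished" "x \<in> carrier B" "s' \<otimes>\<^bsub>B\<^esub> b = x \<otimes>\<^bsub>B\<^esub> s" by (auto simp: regular_module_simps(4))
  then show "\<exists>s'\<in>S. \<exists>b'\<in>carrier B. b' \<otimes>\<^bsub>B\<^esub> s = s' \<otimes>\<^bsub>B\<^esub> b" using distinguished_S by (intro bexI[of _ s'] bexI[of _ x]) auto
  assume bs: "b \<otimes>\<^bsub>B\<^esub> s = \<zero>\<^bsub>B\<^esub>"
  have sz: "submodule {\<zero>\<^bsub>B\<^esub>} B (regular_module B)" using submodule_zero[OF rB(1)] by (simp add: regular_module_simps)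
  have "\<exists>s'\<in>distinguished. s' \<odot>\<^bsub>regular_module B\<^esub> b \<in> {\<zero>\<^bsub>B\<^esub>}"
    by (rule torsion_of_fg[OF rB(1) sz conjunct1[OF f]]) (use b bs S_B[OF s] in \<open>auto simp: regular_module_simps B.m_assoc\<close>)
  then show "\<exists>s'\<in>S. s' \<otimes>\<^bsub>B\<^esub> b = \<zero>\<^bsub>B\<^esub>" using distinguished_S by (auto simp: regular_module_simps(4))
qed

subsection \<open>Pseudo-coherence of modules that are finitely generated over \<open>A\<close>\<close>

lemma free_B: "left_module B (free_module B k)" "left_module A (free_module B k)"
  using free_left_module[OF ring_B] restrict by blast+

lemma coordinate_hom: "(\<lambda>x. x i) \<in> left_module_hom B (free_module B k) (regular_module B)"
  by (rule left_module_homI) (auto simp: free_module_simps regular_module_simps)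

text \<open>The quotient is the direct sum of the modules \<open>B / B s\<^sub>i\<close>.\<close>

lemma coordinates_fg:
  assumes s: "\<And>i. i < k \<Longrightarrow> s i \<in> S"
  shows "fg_mod A (free_module B k) (carrier (free_module B k)) {x \<in> carrier (free_module B k). \<forall>i<k. x i \<in> multiples (s i)}"
proof -
  let ?U = "\<lambda>j. {x \<in> carrier (free_module B k). \<forall>i<j. x i \<in> multiples (s i)}"
  have U: "submodule (?U j) A (free_module B k)" if "j \<le> k" for j
    using that
  proof (induction j)
    case 0 then show ?case using submodule_carrier[OF free_B(2)] by simp
  next
    case (Suc j)
    have "submodule {x \<in> carrier (free_module B k). x j \<in> multiples (s j)} A (free_module B k)"
      by (rule restrict_submodule[OF submodule_preimage[OF free_B(1) regular_B_left_module(1) coordinate_hom multiples_submodule[OF S_B[OF s]]]])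
        (use Suc.prems in simp)
    then have "submodule (?U j \<inter> {x \<in> carrier (free_module B k). x j \<in> multiples (s j)}) A (free_module B k)"
      using Suc by (intro submodule_Int[OF free_B(2)]) auto
    moreover have "?U j \<inter> {x \<in> carrier (free_module B k). x j \<in> multiples (s j)} = ?U (Suc j)" by (auto simp: less_Suc_eq)
    ultimately show ?case by simp
  qed
  have "fg_mod A (free_module B k) (carrier (free_module B k)) (?U j)" if "j \<le> k" for j
    using that
  proof (induction j)
    case 0 then show ?case using fg_mod_self[OF free_B(2) submodule_carrier[OF free_B(2)]] by simp
  next
    case (Suc j)
    then have jk: "j < k" by simp
    note sj = s[OF jk]
    have "fg_mod A (free_module B k) (?U j) {y \<in> ?U j. y j \<in> multiples (s j)}"
      by (rule fg_mod_embed[OF noeth_left free_B(2) regular_B_left_module(2) restrict_hom[OF coordinate_hom] U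
            restrict_submodule[OF multiples_submodule[OF S_B[OF sj]]] conjunct2[OF sj[unfolded mem_S_iff[OF S_B[OF sj]]]]])
        (use jk in \<open>auto simp: free_module_simps\<close>)
    moreover have "{y \<in> ?U j. y j \<in> multiples (s j)} = ?U (Suc j)" by (auto simp: less_Suc_eq)
    ultimately have 1: "fg_mod A (free_module B k) (?U j) (?U (Suc j))" by simp
    show ?case
      by (rule fg_mod_trans[OF free_B(2) submodule_carrier[OF free_B(2)] _ _ _ 1]) (use Suc in auto)
  qed
  then show ?thesis by simp
qed

lemma cofinite_distinguished_multiple:
  assumes N: "submodule N B (free_module B k)" and fg: "fg_mod A (free_module B k) (carrier (free_module B k)) N"
  shows "\<exists>s \<in> distinguished. \<forall>i<k. s \<odot>\<^bsub>free_module B k\<^esub> unit_row B i \<in> N"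
proof -
  interpret F: left_module B "free_module B k" by (rule free_B(1))
  have e: "unit_row B i \<in> carrier (free_module B k)" if "i < k" for i by (rule unit_row_in_free[OF ring_B that])
  have one: "\<one>\<^bsub>B\<^esub> \<in> distinguished"
  proof -
    have "\<one>\<^bsub>B\<^esub> \<ominus>\<^bsub>B\<^esub> t [^]\<^bsub>B\<^esub> (0::nat) = \<zero>\<^bsub>B\<^esub>" by (simp add: a_minus_def B.r_neg)
    then show ?thesis unfolding distinguished_def using J_add(1) by (metis (mono_tags, lifting) B.one_closed mem_Collect_eq)
  qed
  have dB: "s \<in> carrier B" if "s \<in> distinguished" for s using that by (simp add: distinguished_def)
  have "j \<le> k \<Longrightarrow> \<exists>s \<in> distinguished. \<forall>i<j. s \<odot>\<^bsub>free_module B k\<^esub> unit_row B i \<in> N" for j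
  proof (induction j)
    case 0 then show ?case using one by auto
  next
    case (Suc j)
    then obtain s where s: "s \<in> distinguished" "\<forall>i<j. s \<odot>\<^bsub>free_module B k\<^esub> unit_row B i \<in> N" by auto
    have jk: "j < k" using Suc.prems by simp
    have z: "s \<odot>\<^bsub>free_module B k\<^esub> unit_row B j \<in> carrier (free_module B k)" by (rule F.smult_closed[OF dB[OF s(1)] e[OF jk]])
    obtain s' where s': "s' \<in> distinguished" "s' \<odot>\<^bsub>free_module B k\<^esub> (s \<odot>\<^bsub>free_module B k\<^esub> unit_row B j) \<in> N"
      using torsion_of_fg[OF free_B(1) N fg z] F.smult_closed[OF _ z] by blast
    have "(s' \<otimes>\<^bsub>B\<^esub> s) \<odot>\<^bsub>free_module B k\<^esub> unit_row B i \<in> N" if "i < Suc j" for i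
    proof -
      have ik: "i < k" using that jk by simp
      have "s' \<odot>\<^bsub>free_module B k\<^esub> (s \<odot>\<^bsub>free_module B k\<^esub> unit_row B i) \<in> N"
        using s(2) s'(2) submoduleD(4)[OF N dB[OF s'(1)]] that by (cases "i = j") auto
      then show ?thesis using F.smult_assoc1[OF dB[OF s'(1)] dB[OF s(1)] e[OF ik]] by simp
    qed
    then show ?case using distinguished_mult[OF s'(1) s(1)] by blast
  qed
  then show ?thesis by blast
qed

text \<open>A distinguished \<open>s\<close> with \<open>B\<^sup>k s \<subseteq> N\<close> exists. As \<open>N / B\<^sup>k s\<close> is generated over \<open>A\<close> by the image
  of some \<open>g : A\<^sup>r \<rightarrow> N\<close>, there is a surjection \<open>B\<^sup>k \<oplus> B\<^sup>r \<rightarrow> N\<close> that is right multiplication by \<open>s\<close>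
  on the first summand. Since this is injective on \<open>B\<^sup>k\<close>, the kernel is isomorphic to its projection
  \<open>N'\<close> to \<open>B\<^sup>r\<close>. Every element of \<open>B\<^sup>r\<close> is congruent modulo \<open>N'\<close> to one of \<open>A\<^sup>r\<close>, so \<open>N'\<close> is of the
  same kind as \<open>N\<close> and induction applies.\<close>

lemma cofinite_rows_pseudo_coherent:
  assumes "submodule N B (free_module B k)" "fg_mod A (free_module B k) (carrier (free_module B k)) N"
  shows "pseudo_coherent B m ((free_module B k)\<lparr>carrier := N\<rparr>)"
  using assms
proof (induction m arbitrary: N k rule: nat_less_induct)
  case (1 m)
  note N = 1(2) and fg = 1(3)
  let ?F = "free_module B k"
  interpret F: left_module B ?F by (rule free_B(1))
  note NM = submodule_left_module[OF free_B(1) N]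
  obtain s where s: "s \<in> distinguished" "\<And>i. i < k \<Longrightarrow> s \<odot>\<^bsub>?F\<^esub> unit_row B i \<in> N"
    using cofinite_distinguished_multiple[OF N fg] by blast
  obtain n :: nat where sn: "s \<in> carrier B" "s \<ominus>\<^bsub>B\<^esub> t [^]\<^bsub>B\<^esub> n \<in> J" using s(1) by (auto simp: distinguished_def)
  let ?u = "\<lambda>x i. x i \<otimes>\<^bsub>B\<^esub> s"
  have u: "?u \<in> left_module_hom B ?F ?F"
    by (rule left_module_homI) (use sn(1) in \<open>auto simp: free_module_simps B.l_distr B.m_assoc\<close>)
  have u_inj: "x = \<zero>\<^bsub>?F\<^esub>" if "x \<in> carrier ?F" "?u x = \<zero>\<^bsub>?F\<^esub>" for x
    using that weierstrass_injective[OF sn] by (auto simp: free_module_simps fun_eq_iff)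
  have uN: "?u x \<in> N" if x: "x \<in> carrier ?F" for x
  proof (rule free_hom_image_subset[OF free_B(1) u N _ x])
    fix i assume i: "i < k"
    have "?u (unit_row B i) = s \<odot>\<^bsub>?F\<^esub> unit_row B i" using sn(1) by (auto simp: unit_row_def free_module_simps)
    then show "?u (unit_row B i) \<in> N" using s(2)[OF i] by simp
  qed
  have uB: "{x \<in> carrier ?F. \<forall>i<k. x i \<in> multiples s} = ?u ` carrier ?F"
  proof (intro equalityI subsetI)
    fix x assume x: "x \<in> {x \<in> carrier ?F. \<forall>i<k. x i \<in> multiples s}"
    then have "\<forall>i. \<exists>w. i < k \<longrightarrow> w \<in> carrier B \<and> x i = w \<otimes>\<^bsub>B\<^esub> s" by auto
    then obtain w where w: "\<And>i. i < k \<Longrightarrow> w i \<in> carrier B \<and> x i = w i \<otimes>\<^bsub>B\<^esub> s" by metis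
    let ?w = "\<lambda>i. if i < k then w i else \<zero>\<^bsub>B\<^esub>"
    have 1: "?w \<in> carrier ?F" using w by (auto simp: free_module_simps)
    have "x = ?u ?w" using w x sn(1) by (auto simp: fun_eq_iff free_module_simps)
    then show "x \<in> ?u ` carrier ?F" by (rule image_eqI[OF _ 1])
  next
    fix x assume "x \<in> ?u ` carrier ?F"
    then obtain w where "w \<in> carrier ?F" "x = ?u w" by auto
    then show "x \<in> {x \<in> carrier ?F. \<forall>i<k. x i \<in> multiples s}"
      using hom_closed[OF u] by (auto simp: free_module_simps)
  qed
  have uS: "submodule (?u ` carrier ?F) A ?F"
    by (rule restrict_submodule[OF submodule_image[OF free_B(1) free_B(1) u submodule_carrier[OF free_B(1)]]])
  have "fg_mod A ?F (carrier ?F) (?u ` carrier ?F)"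
    using coordinates_fg[of k "\<lambda>_. s"] distinguished_S[OF s(1)] unfolding uB by simp
  then have fgN: "fg_mod A ?F N (?u ` carrier ?F)"
    using uN submoduleD(1)[OF N] by (intro fg_mod_submodule[OF noeth_left free_B(2) restrict_submodule[OF N] uS]) auto
  obtain r g where g: "g \<in> left_module_hom A (free_module A r) ?F" "g ` carrier (free_module A r) \<subseteq> N"
    "\<And>y. y \<in> N \<Longrightarrow> \<exists>x \<in> carrier (free_module A r). \<exists>z\<in>?u ` carrier ?F. y = g x \<oplus>\<^bsub>?F\<^esub> z"
    by (rule fg_modE[OF fgN]) (rule that)
  let ?R = "free_module B r"
  have AR: "x \<in> carrier ?R" if "x \<in> carrier (free_module A r)" for x
    using that A_B A_zero by (simp add: free_module_simps)
  have gN: "g (unit_row A i) \<in> N" if "i < r" for i using g(2) unit_row_in_free[OF ring_A that] by blast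
  define G where "G x = lincomb ?F (\<lambda>i. g (unit_row A i)) x r" for x
  have G: "G \<in> left_module_hom B ?R ?F"
    unfolding G_def[abs_def] using gN submoduleD(1)[OF N] by (intro F.lincomb_hom) auto
  have Gg: "G x = g x" if "x \<in> carrier (free_module A r)" for x
    unfolding G_def by (rule free_hom_eq_lincomb[OF free_B(2) g(1) that, symmetric])
  have GN: "G x \<in> N" if "x \<in> carrier ?R" for x
    unfolding G_def by (rule F.lincomb_in_submodule[OF N gN]) (use that in \<open>auto simp: free_module_simps\<close>)
  let ?P = "free_module B (k + r)"
  let ?p = "\<lambda>c. ?u (row_take B k c) \<oplus>\<^bsub>?F\<^esub> G (row_drop k c)"
  have p: "?p \<in> left_module_hom B ?P ?F" by (rule free_hom_append[OF free_B(1) u G])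
  note tk = hom_closed[OF row_take_hom[OF ring_B]] and dr = hom_closed[OF row_drop_hom]
  have pN: "?p c \<in> N" if "c \<in> carrier ?P" for c
    using submoduleD(3)[OF N uN[OF tk[OF that]] GN[OF dr[OF that]]] .
  have p': "?p \<in> left_module_hom B ?P (?F\<lparr>carrier := N\<rparr>)" by (rule hom_codomain_submodule[OF p]) (use pN in blast)
  have p_onto: "?p ` carrier ?P = N"
  proof
    show "?p ` carrier ?P \<subseteq> N" using pN by blast
    show "N \<subseteq> ?p ` carrier ?P"
    proof
      fix y assume y: "y \<in> N"
      obtain x w where xw: "x \<in> carrier (free_module A r)" "w \<in> carrier ?F" "y = g x \<oplus>\<^bsub>?F\<^esub> ?u w" using g(3)[OF y] by blast
      note a = row_append[OF xw(2) AR[OF xw(1)]]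
      have "?p (row_append k w x) = ?u w \<oplus>\<^bsub>?F\<^esub> g x" unfolding a(2,3) Gg[OF xw(1)] ..
      also have "\<dots> = y" unfolding xw(3) by (rule F.M.a_comm[OF hom_closed[OF u xw(2)] hom_closed[OF g(1) xw(1)]])
      finally show "y \<in> ?p ` carrier ?P" by (intro image_eqI[OF _ a(1)]) simp
    qed
  qed
  let ?N' = "{y \<in> carrier ?R. G y \<in> ?u ` carrier ?F}"
  have N': "submodule ?N' B ?R"
    by (rule submodule_preimage[OF free_B(1) free_B(1) G submodule_image[OF free_B(1) free_B(1) u submodule_carrier[OF free_B(1)]]])
  interpret R: left_module B ?R by (rule free_B(1))
  have fg': "fg_mod A ?R (carrier ?R) ?N'"
  proof (rule fg_modI[where f = "\<lambda>x. x" and k = r])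
    show "(\<lambda>x. x) \<in> left_module_hom A (free_module A r) ?R"
      by (rule left_module_homI) (use AR A_ops A_B in \<open>auto simp: free_module_simps\<close>)
    show "x \<in> carrier ?R" if "x \<in> carrier (free_module A r)" for x by (rule AR[OF that])
    fix y assume y: "y \<in> carrier ?R"
    obtain x w where xw: "x \<in> carrier (free_module A r)" "w \<in> carrier ?F" "G y = g x \<oplus>\<^bsub>?F\<^esub> ?u w" using g(3)[OF GN[OF y]] by blast
    have xR: "x \<in> carrier ?R" by (rule AR[OF xw(1)])
    have gx: "g x \<in> carrier ?F" and uw: "?u w \<in> carrier ?F" using hom_closed[OF g(1) xw(1)] hom_closed[OF u xw(2)] by auto
    have "G (y \<ominus>\<^bsub>?R\<^esub> x) = (g x \<oplus>\<^bsub>?F\<^esub> ?u w) \<ominus>\<^bsub>?F\<^esub> g x"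
      unfolding hom_minus[OF free_B(1) free_B(1) G y xR] xw(3) Gg[OF xw(1)] ..
    also have "\<dots> = ?u w" using gx uw by (simp add: a_minus_def F.M.a_comm[of "g x"] F.M.a_assoc F.M.r_neg)
    finally have "y \<ominus>\<^bsub>?R\<^esub> x \<in> ?N'" using y xR xw(2) by auto
    moreover have "y = x \<oplus>\<^bsub>?R\<^esub> (y \<ominus>\<^bsub>?R\<^esub> x)" using R.M.add_diff_cancel[OF y xR] by simp
    ultimately show "\<exists>x\<in>carrier (free_module A r). \<exists>z\<in>?N'. y = x \<oplus>\<^bsub>?R\<^esub> z" using xw(1) by blast
  qed
  let ?K = "kernel_module ?P ?p (?F\<lparr>carrier := N\<rparr>)"
  have K: "left_module B ?K" by (rule kernel_left_module[OF free_B(1) NM p'])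
  have RN: "left_module B (?R\<lparr>carrier := ?N'\<rparr>)" by (rule submodule_left_module[OF free_B(1) N'])
  have Kmem: "c \<in> carrier ?K \<longleftrightarrow> c \<in> carrier ?P \<and> ?u (row_take B k c) \<oplus>\<^bsub>?F\<^esub> G (row_drop k c) = \<zero>\<^bsub>?F\<^esub>" for c
    by (simp add: kernel_module_simps)
  have neg: "G (row_drop k c) = ?u (\<ominus>\<^bsub>?F\<^esub> row_take B k c)" if c: "c \<in> carrier ?K" for c
  proof -
    have c: "c \<in> carrier ?P" "?u (row_take B k c) \<oplus>\<^bsub>?F\<^esub> G (row_drop k c) = \<zero>\<^bsub>?F\<^esub>" using c unfolding Kmem by auto
    have x: "?u (row_take B k c) \<in> carrier ?F" "G (row_drop k c) \<in> carrier ?F"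
      using hom_closed[OF u tk[OF c(1)]] hom_closed[OF G dr[OF c(1)]] by auto
    have "G (row_drop k c) \<oplus>\<^bsub>?F\<^esub> ?u (row_take B k c) = \<zero>\<^bsub>?F\<^esub>" using c(2) x F.M.a_comm by metis
    then have "\<ominus>\<^bsub>?F\<^esub> (?u (row_take B k c)) = G (row_drop k c)" by (rule F.M.minus_equality[OF _ x])
    then show ?thesis using hom_neg[OF free_B(1) free_B(1) u tk[OF c(1)]] by simp
  qed
  have dK: "row_drop k \<in> left_module_hom B ?K (?R\<lparr>carrier := ?N'\<rparr>)"
  proof (rule left_module_homI)
    fix c assume c: "c \<in> carrier ?K"
    then have cP: "c \<in> carrier ?P" unfolding Kmem by auto
    have "G (row_drop k c) \<in> ?u ` carrier ?F"
      unfolding neg[OF c] by (rule imageI[OF F.M.a_inv_closed[OF tk[OF cP]]])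
    then show "row_drop k c \<in> carrier (?R\<lparr>carrier := ?N'\<rparr>)" using dr[OF cP] by simp
  qed (simp_all add: kernel_module_simps row_drop_def free_module_simps)
  have "inj_on (row_drop k) (carrier ?K)"
  proof (rule inj_onI)
    interpret P: left_module B ?P by (rule free_B(1))
    fix c d assume c: "c \<in> carrier ?K" and d: "d \<in> carrier ?K" and eq: "row_drop k c = row_drop k d"
    have cd: "c \<in> carrier ?P" "d \<in> carrier ?P" using c d unfolding Kmem by auto
    have t: "\<ominus>\<^bsub>?F\<^esub> row_take B k c \<in> carrier ?F" "\<ominus>\<^bsub>?F\<^esub> row_take B k d \<in> carrier ?F" using tk cd by auto
    have "?u (\<ominus>\<^bsub>?F\<^esub> row_take B k c \<ominus>\<^bsub>?F\<^esub> \<ominus>\<^bsub>?F\<^esub> row_take B k d) = \<zero>\<^bsub>?F\<^esub>"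
      unfolding hom_minus[OF free_B(1) free_B(1) u t] using neg[OF c] neg[OF d] eq F.M.diff_eq_zero_iff[OF hom_closed[OF u t(1)] hom_closed[OF u t(2)]]
      by simp
    then have "\<ominus>\<^bsub>?F\<^esub> row_take B k c = \<ominus>\<^bsub>?F\<^esub> row_take B k d"
      using u_inj F.M.diff_eq_zero_iff[OF t] t by simp
    then have "row_take B k c = row_take B k d" using F.M.minus_minus tk cd by metis
    then have "row_append k (row_take B k c) (row_drop k c) = row_append k (row_take B k d) (row_drop k d)" unfolding eq by simp
    then show "c = d" unfolding row_append_take_drop[OF cd(1)] row_append_take_drop[OF cd(2)] .
  qed
  moreover have "row_drop k ` carrier ?K = ?N'"
  proof
    show "row_drop k ` carrier ?K \<subseteq> ?N'" using hom_closed[OF dK] by auto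
    show "?N' \<subseteq> row_drop k ` carrier ?K"
    proof
      fix y assume "y \<in> ?N'"
      then obtain w where y: "y \<in> carrier ?R" "w \<in> carrier ?F" "G y = ?u w" by auto
      have nw: "\<ominus>\<^bsub>?F\<^esub> w \<in> carrier ?F" using y(2) by simp
      note a = row_append[OF nw y(1)]
      have "?u (\<ominus>\<^bsub>?F\<^esub> w) \<oplus>\<^bsub>?F\<^esub> G y = \<zero>\<^bsub>?F\<^esub>"
        using hom_neg[OF free_B(1) free_B(1) u y(2)] F.M.l_neg[OF hom_closed[OF u y(2)]] y(3) by simp
      then have "row_append k (\<ominus>\<^bsub>?F\<^esub> w) y \<in> carrier ?K" unfolding Kmem a(2,3) using a(1) by simp
      then show "y \<in> row_drop k ` carrier ?K" using a(3) by (intro image_eqI[of y "row_drop k" "row_append k (\<ominus>\<^bsub>?F\<^esub> w) y"]) auto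
    qed
  qed
  ultimately have bij: "bij_betw (row_drop k) (carrier ?K) (carrier (?R\<lparr>carrier := ?N'\<rparr>))" by (simp add: bij_betw_def)
  have "retract_of_free B ?P" unfolding retract_of_free_def by (intro exI[of _ "k + r"] bexI[OF _ hom_id]) simp
  then have pcP: "pseudo_coherent B m ?P" by (rule retract_of_free_pseudo_coherent[OF free_B(1)])
  show ?case
  proof (rule pseudo_coherent_quotient[OF free_B(1) NM p' _ pcP])
    show "?p ` carrier ?P = carrier (?F\<lparr>carrier := N\<rparr>)" using p_onto by simp
    fix j assume "m = Suc j"
    then have "pseudo_coherent B j (?R\<lparr>carrier := ?N'\<rparr>)" using 1(1) N' fg' by simp
    then show "pseudo_coherent B j ?K" by (rule pseudo_coherent_iso_bij[OF dK bij K RN])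
  qed
qed

text \<open>The preimage of \<open>X\<close> in a free cover of \<open>M\<close> is a submodule as in the previous lemma; \<open>X\<close> is its
  quotient by the relations of \<open>M\<close>.\<close>

lemma cofinite_submodule_pseudo_coherent:
  assumes M: "left_module B M" and pc: "\<And>m. pseudo_coherent B m M" and X: "submodule X B M"
    and fg: "fg_mod A M (carrier M) X"
  shows "pseudo_coherent B m (M\<lparr>carrier := X\<rparr>)"
proof -
  obtain r f where f: "free_cover B r f M" using pc[of 0] by (auto simp: pseudo_coherent_0)
  note fh = free_coverD(1)[OF f]
  let ?F = "free_module B r"
  let ?N = "{x \<in> carrier ?F. f x \<in> X}"
  have N: "submodule ?N B ?F" by (rule submodule_preimage[OF free_B(1) M fh X])
  have "fg_mod A ?F (carrier ?F) ?N"
    by (rule fg_mod_embed[OF noeth_left free_B(2) restrict[OF M] restrict_hom[OF fh] submodule_carrier[OF free_B(2)] restrict_submodule[OF X] fg])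
      (use free_coverD(2)[OF f] in auto)
  then have pcN: "pseudo_coherent B m (?F\<lparr>carrier := ?N\<rparr>)" for m by (rule cofinite_rows_pseudo_coherent[OF N])
  have f': "f \<in> left_module_hom B (?F\<lparr>carrier := ?N\<rparr>) (M\<lparr>carrier := X\<rparr>)"
    by (rule hom_codomain_submodule[OF hom_from_submodule[OF fh]]) auto
  have onto: "f ` carrier (?F\<lparr>carrier := ?N\<rparr>) = carrier (M\<lparr>carrier := X\<rparr>)"
    using free_coverD(3)[OF f] submoduleD(1)[OF X] by force
  have ker: "kernel_module (?F\<lparr>carrier := ?N\<rparr>) f (M\<lparr>carrier := X\<rparr>) = relations B r f M"
  proof -
    have "{x \<in> ?N. f x = \<zero>\<^bsub>M\<^esub>} = {x \<in> carrier ?F. f x = \<zero>\<^bsub>M\<^esub>}" using submoduleD(2)[OF X] by auto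
    then show ?thesis by (simp add: kernel_module_def relations_def)
  qed
  have "pseudo_coherent B j (relations B r f M)" for j
    using pc[of "Suc j"] f unfolding pseudo_coherent_Suc by blast
  then show ?thesis
    using pseudo_coherent_quotient[OF submodule_left_module[OF free_B(1) N] submodule_left_module[OF M X] f' onto pcN] unfolding ker by blast
qed

text \<open>If \<open>s\<^sub>i\<close> takes the \<open>i\<close>-th generator into \<open>X\<close>, then \<open>M / X\<close> is a quotient of the direct sum of
  the modules \<open>B / B s\<^sub>i\<close>.\<close>

lemma torsion_fg:
  assumes M: "left_module B M" and f: "free_cover B k f M" and X: "submodule X B M"
    and tors: "\<And>z. z \<in> carrier M \<Longrightarrow> \<exists>s\<in>S. s \<odot>\<^bsub>M\<^esub> z \<in> X"
  shows "fg_mod A M (carrier M) X"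
proof -
  interpret M: left_module B M by (rule M)
  note fh = free_coverD(1)[OF f]
  have e: "f (unit_row B i) \<in> carrier M" if "i < k" for i using hom_closed[OF fh unit_row_in_free[OF ring_B that]] .
  have "\<forall>i. \<exists>s. i < k \<longrightarrow> s \<in> S \<and> s \<odot>\<^bsub>M\<^esub> f (unit_row B i) \<in> X" using tors[OF e] by blast
  then obtain s where s: "\<And>i. i < k \<Longrightarrow> s i \<in> S" "\<And>i. i < k \<Longrightarrow> s i \<odot>\<^bsub>M\<^esub> f (unit_row B i) \<in> X" by metis
  let ?U = "{x \<in> carrier (free_module B k). \<forall>i<k. x i \<in> multiples (s i)}"
  have "fg_mod A M (f ` carrier (free_module B k)) (f ` ?U)"
    by (rule fg_mod_image[OF restrict_hom[OF fh] coordinates_fg[OF s(1)]]) auto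
  moreover have "f ` ?U \<subseteq> X"
  proof
    fix y assume "y \<in> f ` ?U"
    then obtain x where x: "x \<in> carrier (free_module B k)" "\<And>i. i < k \<Longrightarrow> x i \<in> multiples (s i)" "y = f x" by auto
    have "x i \<odot>\<^bsub>M\<^esub> f (unit_row B i) \<in> X" if i: "i < k" for i
    proof -
      obtain w where w: "w \<in> carrier B" "x i = w \<otimes>\<^bsub>B\<^esub> s i" using x(2)[OF i] by auto
      show ?thesis
        using submoduleD(4)[OF X w(1) s(2)[OF i]] M.smult_assoc1[OF w(1) S_B[OF s(1)[OF i]] e[OF i]] w(2) by simp
    qed
    then have "j \<le> k \<Longrightarrow> lincomb M (\<lambda>i. f (unit_row B i)) x j \<in> X" for j
      using submoduleD(2,3)[OF X] by (induction j) auto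
    then show "y \<in> X" using free_hom_eq_lincomb[OF M fh x(1)] x(3) by simp
  qed
  ultimately have "fg_mod A M (f ` carrier (free_module B k)) X" by (rule fg_mod_mono)
  then show ?thesis using free_coverD(2)[OF f] by simp
qed

subsection \<open>Complexes\<close>

lemma restrict_complex: "cochain_complex B C \<Longrightarrow> cochain_complex A C"
  using restrict restrict_hom unfolding cochain_complex_def by blast

lemma perfect_imp_torsion:
  assumes C: "cochain_complex B C" and "perfect A C"
  shows "torsion_module S (cohomology C n)"
proof -
  have SB: "S \<subseteq> carrier B" using S_B by blast
  note m = cochain_complexD(1)[OF C]
  have "\<exists>s\<in>S. s \<odot>\<^bsub>obj C n\<^esub> z \<in> coboundaries C n" if z: "z \<in> cocycles C n" for z
  proof -
    have "\<exists>s\<in>distinguished. s \<odot>\<^bsub>obj C n\<^esub> z \<in> coboundaries C n"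
      by (rule torsion_of_fg[OF m coboundaries_submodule[OF C] perfect_cohomology_fg[OF noeth_left assms(2)]])
        (use z submoduleD(1,4)[OF cocycles_submodule[OF C]] in blast)+
    then show ?thesis using distinguished_S by blast
  qed
  then show ?thesis unfolding torsion_cohomology_iff[OF C SB] by blast
qed

text \<open>Descending induction on the degree: if the cocycles in degree \<open>n\<close> are pseudo-coherent, then
  torsion makes the cohomology finitely generated over \<open>A\<close>, so the coboundaries are pseudo-coherent,
  and the cocycles in degree \<open>n - 1\<close> are the kernel of a map onto them.\<close>

lemma torsion_imp_cohomology_fg:
  fixes C :: "('a, 'm) cochain"
  assumes SP: "strictly_perfect B C" and tors: "\<And>n. torsion_module S (cohomology C n)"
  shows "fg_mod A (obj C n) (cocycles C n) (coboundaries C n)"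
proof -
  have C: "cochain_complex B C" using SP by (simp add: strictly_perfect_def)
  note m = cochain_complexD(1)[OF C]
  have SB: "S \<subseteq> carrier B" using S_B by blast
  note Z = cocycles_submodule[OF C] and Bd = coboundaries_submodule[OF C]
  let ?Z = "\<lambda>n. (obj C n)\<lparr>carrier := cocycles C n\<rparr>" and ?B = "\<lambda>n. (obj C n)\<lparr>carrier := coboundaries C n\<rparr>"
  note mZ = submodule_left_module[OF m Z] and mB = submodule_left_module[OF m Bd]
  have BZ: "submodule (coboundaries C n) B (?Z n)" for n
    by (rule submodule_of_submodule[OF m Z Bd coboundaries_subset_cocycles[OF C]])
  have fgZ: "fg_mod A (?Z n) (cocycles C n) (coboundaries C n)" if pc: "pseudo_coherent B 0 (?Z n)" for n
  proof -
    obtain k f where f: "free_cover B k f (?Z n)" using pc by (auto simp: pseudo_coherent_0)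
    have "fg_mod A (?Z n) (carrier (?Z n)) (coboundaries C n)"
      by (rule torsion_fg[OF mZ f BZ]) (use tors[of n, unfolded torsion_cohomology_iff[OF C SB]] in auto)
    then show ?thesis by simp
  qed
  have fg: "fg_mod A (obj C n) (cocycles C n) (coboundaries C n)" if pc: "pseudo_coherent B 0 (?Z n)" for n
  proof -
    have "fg_mod A (obj C n) ((\<lambda>x. x) ` cocycles C n) ((\<lambda>x. x) ` coboundaries C n)"
      by (rule fg_mod_image[OF _ fgZ[OF pc]])
        (use submoduleD(1)[OF Z[of n]] coboundaries_subset_cocycles[OF C] in \<open>auto intro: hom_from_submodule[OF hom_id]\<close>)
    then show ?thesis by simp
  qed
  have step: "\<forall>j. pseudo_coherent B j (?Z (n - 1))" if pc: "\<forall>j. pseudo_coherent B j (?Z n)" for n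
  proof
    fix j
    have "fg_mod A (?Z n) (carrier (?Z n)) (coboundaries C n)" using fgZ pc by simp
    then have "pseudo_coherent B i ((?Z n)\<lparr>carrier := coboundaries C n\<rparr>)" for i
      using pc by (intro cofinite_submodule_pseudo_coherent[OF mZ _ BZ]) auto
    then have pcB: "pseudo_coherent B i (?B n)" for i by simp
    have d: "diff C (n - 1) \<in> left_module_hom B (obj C (n - 1)) (?B n)"
      by (rule hom_codomain_submodule[OF cochain_complexD(3)[OF C]]) (simp add: coboundaries_def)
    have "retract_of_free B (obj C (n - 1))"
      using SP by (intro projective_retract_of_free) (auto simp: strictly_perfect_def)
    then have pcC: "pseudo_coherent B j (obj C (n - 1))" by (rule retract_of_free_pseudo_coherent[OF m])
    have "pseudo_coherent B j (kernel_module (obj C (n - 1)) (diff C (n - 1)) (?B n))"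
      by (rule pseudo_coherent_kernel[OF m mB d _ pcC pcB]) (simp add: coboundaries_def)
    moreover have "kernel_module (obj C (n - 1)) (diff C (n - 1)) (?B n) = ?Z (n - 1)"
      by (simp add: kernel_module_def cocycles_def)
    ultimately show "pseudo_coherent B j (?Z (n - 1))" by simp
  qed
  have "finite {n. carrier (obj C n) \<noteq> {\<zero>\<^bsub>obj C n\<^esub>}}" using SP by (simp add: strictly_perfect_def)
  from bdd_above_finite[OF this]
  obtain u where u: "\<And>n. n \<in> {n. carrier (obj C n) \<noteq> {\<zero>\<^bsub>obj C n\<^esub>}} \<Longrightarrow> n \<le> u"
    unfolding bdd_above_def by blast
  have top: "\<forall>j. pseudo_coherent B j (?Z n)" if "n > u" for n
  proof -
    have "carrier (obj C n) = {\<zero>\<^bsub>obj C n\<^esub>}" using u[of n] that by auto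
    then have "cocycles C n = {\<zero>\<^bsub>obj C n\<^esub>}" using submoduleD(1,2)[OF Z[of n]] by auto
    then show ?thesis using retract_of_free_pseudo_coherent[OF mZ retract_of_free_zero[OF mZ]] by simp
  qed
  have "\<forall>j. pseudo_coherent B j (?Z (u + 1 - int i))" for i
  proof (induction i)
    case 0 then show ?case using top[of "u + 1"] by simp
  next
    case (Suc i)
    have "u + 1 - int (Suc i) = u + 1 - int i - 1" by simp
    then show ?case using step[OF Suc] by simp
  qed
  from this[of "nat (u + 1 - n)"] have "\<forall>j. pseudo_coherent B j (?Z n)" if "n \<le> u" using that by simp
  then have "\<forall>j. pseudo_coherent B j (?Z n)" using top[of n] by (cases "n \<le> u") auto
  then show ?thesis using fg by simp
qed

theorem SP_over_eq_torsion:
  "(SP_over A B :: ('a, 'm) cochain set) = {C \<in> SP B. \<forall>n. torsion_module S (cohomology C n)}"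
proof (intro equalityI subsetI)
  fix C :: "('a, 'm) cochain" assume "C \<in> SP_over A B"
  then have C: "C \<in> SP B" "perfect A C" by (auto simp: SP_over_def)
  then have "cochain_complex B C" by (simp add: SP_def strictly_perfect_def)
  then show "C \<in> {C \<in> SP B. \<forall>n. torsion_module S (cohomology C n)}" using C perfect_imp_torsion by blast
next
  fix C :: "('a, 'm) cochain" assume "C \<in> {C \<in> SP B. \<forall>n. torsion_module S (cohomology C n)}"
  then have SPC: "C \<in> SP B" and tors: "\<And>n. torsion_module S (cohomology C n)" by auto
  then have SP: "strictly_perfect B C" by (simp add: SP_def)
  then have C: "cochain_complex B C" and fin: "finite {n. carrier (obj C n) \<noteq> {\<zero>\<^bsub>obj C n\<^esub>}}"
    and proj: "\<And>n. finitely_generated B (obj C n)" "\<And>n. projective B (obj C n)"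
    by (auto simp: strictly_perfect_def)
  obtain u where u: "\<And>n. n \<in> {n. carrier (obj C n) \<noteq> {\<zero>\<^bsub>obj C n\<^esub>}} \<Longrightarrow> n \<le> u"
    using bdd_above_finite[OF fin] unfolding bdd_above_def by blast
  obtain l where l: "\<And>n. n \<in> {n. carrier (obj C n) \<noteq> {\<zero>\<^bsub>obj C n\<^esub>}} \<Longrightarrow> l \<le> n"
    using bdd_below_finite[OF fin] unfolding bdd_below_def by blast
  have "perfect A C"
  proof (rule perfectI[OF ring_A noeth_left restrict_complex[OF C], where a = l and b = u])
    fix n
    show "flat_module A (obj C n)"
      by (rule flat_over_A[OF cochain_complexD(1)[OF C] projective_retract_of_free[OF proj(2,1)]])
    show "fg_mod A (obj C n) (cocycles C n) (coboundaries C n)"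
      by (rule torsion_imp_cohomology_fg[OF SP tors])
    show "carrier (obj C n) = {\<zero>\<^bsub>obj C n\<^esub>}" if "n < l \<or> u < n"
    proof (rule ccontr)
      assume "carrier (obj C n) \<noteq> {\<zero>\<^bsub>obj C n\<^esub>}"
      then have "l \<le> n" "n \<le> u" by (auto intro!: l u CollectI simp del: mem_Collect_eq)
      then show False using that by simp
    qed
  qed
  then show "C \<in> SP_over A B" using SPC by (simp add: SP_over_def)
qed

end

theorem theorem2p18:
  fixes A :: "('a, 'r) ring_scheme" and TA :: "'a topology"
    and \<sigma> \<delta> :: "'a \<Rightarrow> 'a"
    and B :: "('a, 's) ring_scheme" and TB :: "'a topology" and t :: 'a
    and I :: "'a set"
  assumes "pseudocompact_ring A TA" and "two_sided_noetherian A"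
    and "skew_power_series_ring A TA \<sigma> \<delta> B TB t"
    and "ideal I A" and "openin TA I"
    and "\<sigma> ` I \<subseteq> I" and "\<delta> ` I \<subseteq> I"
    and "I \<subseteq> jacobson_radical A"
  defines "S \<equiv> perfect_mult_set A B"
  shows "left_denominator_set B S \<and>
         (SP_over A B :: ('a, 'm) cochain set) =
           {C \<in> SP B. \<forall>n. torsion_module S (cohomology C n)}"
proof -
  obtain Idx :: "'a set set" and leq and D :: "'a set \<Rightarrow> ('a, 'a set) module" and f \<pi>
    where "limit_presentation A TA Idx leq D f \<pi>"
    using left_pseudocompact_presentation assms(1) unfolding pseudocompact_ring_def by metis
  then interpret LP: limit_presentation A TA Idx leq D f \<pi> .
  interpret Id: ideal I A by (rule assms(4))
  have IA: "I \<subseteq> carrier A" using Id.Icarr by blast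
  have Isub: "submodule I A (regular_module A)"
    by (rule LP.left_idealI) (use IA in \<open>auto simp: Id.I_l_closed\<close>)
  obtain i where i: "i \<in> Idx" "LP.ker i \<subseteq> I" using LP.proj_base[OF assms(5) additive_subgroup.zero_closed[OF Id.additive_subgroup_axioms]] by blast
  obtain \<phi> where \<phi>: "\<phi> \<in> topological_module_iso A (product_module (UNIV :: nat set) (\<lambda>_. regular_module A))
               (product_topology (\<lambda>_. TA) UNIV) (regular_module B) TB"
    "\<And>n. \<phi> (\<lambda>m. if m = n then \<one>\<^bsub>A\<^esub> else \<zero>\<^bsub>A\<^esub>) = t [^]\<^bsub>B\<^esub> n"
    using assms(3) unfolding skew_power_series_ring_def by blast
  have "topologically_nilpotent A TA \<delta>" using assms(3) unfolding skew_power_series_ring_def by (elim conjE)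
  then obtain r :: nat where r: "0 < r" "(\<delta> ^^ r) ` carrier A \<subseteq> I"
    using assms(4,5) unfolding topologically_nilpotent_def by blast
  \<comment> \<open>The filtration consists of the closed powers of \<open>I\<close>.\<close>
  interpret skew_series_noetherian A TA \<sigma> \<delta> B TB t \<phi> I r "LP.adic I"
  proof (intro skew_series_noetherian.intro skew_series_ideal.intro skew_series.intro
      skew_series_ideal_axioms.intro skew_series_noetherian_axioms.intro)
    show "closedin TA I" by (rule LP.open_of_ker_subset(2)[OF i(1) Isub i(2)])
    show "\<exists>k. \<forall>n\<ge>k. Y n = Y k" if "\<And>n. submodule (Y n) A (regular_module A)" "\<And>n. Y (Suc n) \<subseteq> Y n" "\<And>n. I \<subseteq> Y n"
      for Y :: "nat \<Rightarrow> 'a set"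
      by (rule LP.open_left_ideal_dcc[where X = Y, OF Isub assms(5) that])
    show "noetherian_module A (regular_module A)" "noetherian_module (opposite_ring A) (regular_module (opposite_ring A))"
      using assms(2) by (auto simp: two_sided_noetherian_def)
    show "carrier A \<subseteq> LP.adic I 0" using LP.adic_0 by blast
    show "\<exists>s\<in>carrier A. \<forall>n. s \<ominus>\<^bsub>A\<^esub> partial_sum A y n \<in> LP.adic I n" if "\<And>n. y n \<in> LP.adic I n" for y
      by (rule LP.adic_complete[where y = y, OF assms(4,8) that])
    show "x = \<zero>\<^bsub>A\<^esub>" if "x \<in> carrier A" "\<And>n. x \<in> LP.adic I n" for x
      by (rule LP.adic_separated[where x = x, OF assms(8) that])
  qed (assumption | rule assms(3,4,6,7) r \<phi> LP.Hausdorff_A LP.adic_left_ideal[OF IA] LP.adic_closed[OF IA]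
      LP.adic_Suc_subset[OF assms(4)] LP.adic_mult[OF assms(4)])+
  show ?thesis unfolding S_def using S_left_denominator_set SP_over_eq_torsion by blast
qed

end
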